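(* Let $k \in \mathbb{Z}_{\geq 0}$ and $G \in S_{2k+2}(\Gamma)$. Then the $h$-th component of $I^{\mathrm{Sh}}(G,\tau)$ is given by \[ I^{\mathrm{Sh}}(G,\tau)_{h} = -\sqrt{N}\sum_{m > 0}\mathbf{t}(G;-m,h)q^{m}. \]
   Context: Let $N\in\mathbb{Q}_{>0}$, $V$ the space of rational trace-zero matrices $X=\left(\begin{smallmatrix} x_2 & x_1\\ x_3 & -x_2\end{smallmatrix}\right)$ with $Q(X)=N\det X$, $(X,Y)=-N\operatorname{tr}(XY)$; $L\subset V$ an even lattice of full rank, $\Gamma\subset\mathrm{SL}_2(\mathbb{Q})$ a congruence subgroup preserving $L$ and acting trivially on $L'/L$, $M=\Gamma\backslash\mathbb{H}$, $q=e^{2\pi i\tau}$. The Shintani lift is $I^{\mathrm{Sh}}(G,\tau)=\int_MG(z)\overline{\Theta(\tau,z,\varphi_{Sh,k})}y^{2k+2}d\mu(z)$ with $\Theta(\tau,z,\varphi_{Sh,k})=\sum_h\sum_{X\in h+L}v^{1/2}y^{-2k-2}Q_X^{k+1}(\bar z)e^{-2\pi vR(X,z)}e^{2\pi iQ(X)\tau}\mathfrak{e}_h$, where $Q_X(z)=N(x_3z^2-2x_2z-x_1)$, $p_z(X)=-\frac{\sqrt N}{y}(x_3|z|^2-2x_2x-x_1)$, $R(X,z)=\tfrac12p_z(X)^2-(X,X)$. For $m<0$, $L_{m,h}=\{X\in L+h:Q(X)=m\}$, and $\mathbf{t}(G;m,h)=\sum_{X\in\Gamma\backslash L_{m,h}}\mathcal{C}(G,X)$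 with the cycle integral $\mathcal{C}(G,X)=\int_{c(X)}G(z)Q_X^k(z)dz$ along the geodesic $c(X)=\Gamma_X\backslash\{z\in\mathbb{H}:z\perp X\}$, oriented so that $\mathcal{C}(G,X)=(-2\sqrt{|m|N}i)^ki\int G|_{2k+2}g(iy)y^kdy$ where $g\in\mathrm{SL}_2(\mathbb{R})$ with $g^{-1}Xg=\sqrt{|m|/N}\,\mathrm{diag}(1,-1)$ and the integral runs over $(0,\infty)$ if $|m|/N$ is a square, over $(1,\varepsilon^2)$ otherwise ($\mathrm{diag}(\varepsilon,\varepsilon^{-1})$ generating the stabilizer of $g^{-1}Xg$ in $g^{-1}\overline\Gamma g$). *)

theory Defs
  imports "HOL-Analysis.Analysis"
begin

section \<open>The quadratic space and lattices\<close>

type_synonym mat2 = "real^2^2"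

text \<open>All matrices are real; rational objects are those with entries in \<open>\<rat>\<close>. A trace-zero matrix
  has the coordinates \<open>x\<^sub>2 = X $ 1 $ 1 = - X $ 2 $ 2\<close>, \<open>x\<^sub>1 = X $ 1 $ 2\<close>, \<open>x\<^sub>3 = X $ 2 $ 1\<close>.\<close>

definition rational_mat :: "mat2 \<Rightarrow> bool" where
  "rational_mat X \<longleftrightarrow> (\<forall>i j. X $ i $ j \<in> \<rat>)"

definition V :: "mat2 set" where
  "V = {X. rational_mat X \<and> trace X = 0}"

definition Q :: "real \<Rightarrow> mat2 \<Rightarrow> real" where
  "Q N X = N * det X"

definition bil :: "real \<Rightarrow> mat2 \<Rightarrow> mat2 \<Rightarrow> real" where
  "bil N X Y = - N * trace (X ** Y)"

text \<open>For vectors of \<open>V\<close>, linear independence over \<open>\<rat>\<close> and over \<open>\<real>\<close> coincide; \<open>V\<close> has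
  dimension 3.\<close>

definition full_lattice :: "mat2 set \<Rightarrow> bool" where
  "full_lattice L \<longleftrightarrow>
     (\<exists>B. B \<subseteq> V \<and> finite B \<and> card B = 3 \<and> independent B \<and>
          L = {\<Sum>b\<in>B. of_int (c b) *\<^sub>R b | c :: mat2 \<Rightarrow> int. True})"

definition even_lattice :: "real \<Rightarrow> mat2 set \<Rightarrow> bool" where
  "even_lattice N L \<longleftrightarrow> full_lattice L \<and> (\<forall>X\<in>L. Q N X \<in> \<int>)"

definition dual_lattice :: "real \<Rightarrow> mat2 set \<Rightarrow> mat2 set" where
  "dual_lattice N L = {X \<in> V. \<forall>Y\<in>L. bil N X Y \<in> \<int>}"

text \<open>An element \<open>h\<close> of \<open>L'/L\<close> is the coset itself (a set of matrices), so that \<open>X \<in> h + L\<close> is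
  written \<open>X \<in> h\<close>. An element of \<open>\<complex>[L'/L]\<close> is a function of \<open>h\<close>, its components in the basis
  \<open>\<ee>\<^sub>h\<close>.\<close>

definition discriminant_group :: "real \<Rightarrow> mat2 set \<Rightarrow> mat2 set set" where
  "discriminant_group N L = (\<lambda>Y. (\<lambda>X. Y + X) ` L) ` dual_lattice N L"

definition lattice_level :: "real \<Rightarrow> real \<Rightarrow> mat2 set \<Rightarrow> mat2 set" where
  "lattice_level N m h = {X \<in> h. Q N X = m}"


section \<open>Groups acting on the upper half-plane and on matrices\<close>

definition upper_half_plane :: "complex set" where
  "upper_half_plane = {z. 0 < Im z}"

definition moebius_act :: "mat2 \<Rightarrow> complex \<Rightarrow> complex" where
  "moebius_act g = moebius (of_real (g $ 1 $ 1)) (of_real (g $ 1 $ 2))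
                           (of_real (g $ 2 $ 1)) (of_real (g $ 2 $ 2))"

definition slash :: "nat \<Rightarrow> (complex \<Rightarrow> complex) \<Rightarrow> mat2 \<Rightarrow> complex \<Rightarrow> complex" where
  "slash w f g z = f (moebius_act g z) / (of_real (g $ 2 $ 1) * z + of_real (g $ 2 $ 2)) ^ w"

definition conj_act :: "mat2 \<Rightarrow> mat2 \<Rightarrow> mat2" where
  "conj_act g X = g ** X ** matrix_inv g"

definition SL2Q :: "mat2 set" where
  "SL2Q = {g. rational_mat g \<and> det g = 1}"

definition SL2Z :: "mat2 set" where
  "SL2Z = {g. (\<forall>i j. g $ i $ j \<in> \<int>) \<and> det g = 1}"

definition principal_congruence :: "nat \<Rightarrow> mat2 set" where
  "principal_congruence n =
     {g \<in> SL2Z. \<forall>i j. \<exists>a::int. g $ i $ j = mat 1 $ i $ j + of_int (int n * a)}"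

text \<open>A congruence subgroup of \<open>SL\<^sub>2(\<rat>)\<close> contains some \<open>\<Gamma>(n)\<close> with finite index; it need not lie
  in \<open>SL\<^sub>2(\<int>)\<close>.\<close>

definition congruence_subgroup :: "mat2 set \<Rightarrow> bool" where
  "congruence_subgroup \<Gamma> \<longleftrightarrow>
     \<Gamma> \<subseteq> SL2Q \<and> mat 1 \<in> \<Gamma> \<and> (\<forall>g\<in>\<Gamma>. \<forall>g'\<in>\<Gamma>. g ** g' \<in> \<Gamma>) \<and> (\<forall>g\<in>\<Gamma>. matrix_inv g \<in> \<Gamma>) \<and>
     (\<exists>n\<ge>1. principal_congruence n \<subseteq> \<Gamma> \<and>
        finite ((\<lambda>g. (\<lambda>d. g ** d) ` principal_congruence n) ` \<Gamma>))"

text \<open>The cusps of a congruence subgroup are the points \<open>\<sigma>\<infinity>\<close> with \<open>\<sigma> \<in> SL\<^sub>2(\<int>)\<close>.\<close>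

definition cusp_forms :: "mat2 set \<Rightarrow> nat \<Rightarrow> (complex \<Rightarrow> complex) set" where
  "cusp_forms \<Gamma> w =
     {f. f holomorphic_on upper_half_plane \<and>
         (\<forall>g\<in>\<Gamma>. \<forall>z\<in>upper_half_plane. slash w f g z = f z) \<and>
         (\<forall>\<sigma>\<in>SL2Z. \<exists>(d::nat) (a :: nat \<Rightarrow> complex). d > 0 \<and> a 0 = 0 \<and>
            (\<forall>z\<in>upper_half_plane.
               (\<lambda>n. a n * exp (2 * of_real pi * \<i> * of_nat n * z / of_nat d)) sums slash w f \<sigma> z))}"


section \<open>Integration over the quotient\<close>

text \<open>\<open>\<Gamma>\<close> acts through its image modulo \<open>\<plusminus>1\<close>, so only \<open>\<gamma> \<noteq> \<plusminus>1\<close> has to move the domain off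
  itself. The integral of a \<open>\<Gamma>\<close>-invariant function does not depend on the domain chosen.\<close>

definition fundamental_domain :: "mat2 set \<Rightarrow> complex set \<Rightarrow> bool" where
  "fundamental_domain \<Gamma> F \<longleftrightarrow>
     F \<subseteq> upper_half_plane \<and> F \<in> sets borel \<and>
     (\<forall>z\<in>upper_half_plane. \<exists>g\<in>\<Gamma>. moebius_act g z \<in> F) \<and>
     (\<forall>g\<in>\<Gamma>. g \<noteq> mat 1 \<and> g \<noteq> - mat 1 \<longrightarrow> negligible (F \<inter> moebius_act g ` F))"

definition quotient_integral :: "mat2 set \<Rightarrow> (complex \<Rightarrow> complex) \<Rightarrow> complex" where
  "quotient_integral \<Gamma> f =
     (LINT z:(SOME F. fundamental_domain \<Gamma> F)|lborel. f z / of_real ((Im z)\<^sup>2))"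


section \<open>The Shintani theta function and lift\<close>

definition QX :: "real \<Rightarrow> mat2 \<Rightarrow> complex \<Rightarrow> complex" where
  "QX N X z = of_real N *
     (of_real (X $ 2 $ 1) * z\<^sup>2 - 2 * of_real (X $ 1 $ 1) * z - of_real (X $ 1 $ 2))"

definition pz :: "real \<Rightarrow> complex \<Rightarrow> mat2 \<Rightarrow> real" where
  "pz N z X = - (sqrt N / Im z) *
     (X $ 2 $ 1 * (cmod z)\<^sup>2 - 2 * (X $ 1 $ 1) * Re z - X $ 1 $ 2)"

definition R :: "real \<Rightarrow> mat2 \<Rightarrow> complex \<Rightarrow> real" where
  "R N X z = (pz N z X)\<^sup>2 / 2 - bil N X X"

definition Theta_Sh ::
    "real \<Rightarrow> nat \<Rightarrow> complex \<Rightarrow> complex \<Rightarrow> mat2 set \<Rightarrow> complex" where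
  "Theta_Sh N k \<tau> z h =
     (\<Sum>\<^sub>\<infinity>X\<in>h. of_real (sqrt (Im \<tau>)) / of_real (Im z ^ (2 * k + 2)) * QX N X (cnj z) ^ (k + 1) *
        exp (of_real (- 2 * pi * Im \<tau> * R N X z)) *
        exp (2 * of_real pi * \<i> * of_real (Q N X) * \<tau>))"

definition Shintani_lift ::
    "real \<Rightarrow> mat2 set \<Rightarrow> nat \<Rightarrow> (complex \<Rightarrow> complex) \<Rightarrow> complex \<Rightarrow> mat2 set \<Rightarrow> complex" where
  "Shintani_lift N \<Gamma> k G \<tau> h =
     quotient_integral \<Gamma>
       (\<lambda>z. G z * cnj (Theta_Sh N k \<tau> z h) * of_real (Im z ^ (2 * k + 2)))"


section \<open>Cycle integrals and traces\<close>

definition diag2 :: "real \<Rightarrow> real \<Rightarrow> mat2" where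
  "diag2 a b = vector [vector [a, 0], vector [0, b]]"

text \<open>The matrices \<open>g \<in> SL\<^sub>2(\<real>)\<close> with \<open>g\<^sup>-\<^sup>1 X g = \<surd>(\<bar>m\<bar>/N) diag(1,-1)\<close>, where \<open>m = Q(X)\<close>.\<close>

definition diagonalizes :: "real \<Rightarrow> mat2 \<Rightarrow> mat2 \<Rightarrow> bool" where
  "diagonalizes N X g \<longleftrightarrow> det g = 1 \<and>
     matrix_inv g ** X ** g = sqrt (\<bar>Q N X\<bar> / N) *\<^sub>R diag2 1 (-1)"

definition geodesic :: "real \<Rightarrow> mat2 \<Rightarrow> complex set" where
  "geodesic N X = {z \<in> upper_half_plane. pz N z X = 0}"

definition geodesic_path :: "mat2 \<Rightarrow> real \<Rightarrow> complex" where
  "geodesic_path g y = moebius_act g (\<i> * of_real y)"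

text \<open>Adjoining \<open>-1\<close> gives the full preimage of the image of \<open>\<Gamma>\<close> in \<open>PSL\<^sub>2(\<real>)\<close>; the generator
  \<open>diag(\<epsilon>, \<epsilon>\<^sup>-\<^sup>1)\<close> is then determined up to sign and inversion, which \<open>\<epsilon> > 1\<close> normalizes.\<close>

definition stabilizer_generator :: "mat2 set \<Rightarrow> mat2 \<Rightarrow> mat2 \<Rightarrow> real \<Rightarrow> bool" where
  "stabilizer_generator \<Gamma> X g \<epsilon> \<longleftrightarrow> \<epsilon> > 1 \<and>
     {d \<in> (\<lambda>\<gamma>. matrix_inv g ** \<gamma> ** g) ` (\<Gamma> \<union> uminus ` \<Gamma>).
        conj_act d (matrix_inv g ** X ** g) = matrix_inv g ** X ** g} =
     {s *\<^sub>R diag2 (\<epsilon> powi n) (\<epsilon> powi (- n)) | s n. s \<in> {1, -1}}"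

text \<open>A parameter interval covering \<open>c(X) = \<Gamma>\<^sub>X \<setminus> {z. z \<bottom> X}\<close> once.\<close>

definition cycle_interval :: "real \<Rightarrow> mat2 set \<Rightarrow> mat2 \<Rightarrow> mat2 \<Rightarrow> real set" where
  "cycle_interval N \<Gamma> X g =
     (if \<exists>r\<in>\<rat>. \<bar>Q N X\<bar> / N = r\<^sup>2 then {0<..}
      else {1<..<(SOME \<epsilon>. stabilizer_generator \<Gamma> X g \<epsilon>)\<^sup>2})"

text \<open>The line integral of \<open>G(z) Q\<^sub>X(z)\<^sup>k dz\<close> along \<open>z = g(iy)\<close> in the direction of increasing \<open>y\<close>.
  It is independent of the choice of \<open>g\<close>. Lemma \<open>geodesic_path_image\<close> and lemma
  \<open>geodesic_integrand\<close> below show that this is the geodesic \<open>z \<bottom> X\<close> and that the orientation is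
  the one of the formula in terms of \<open>G|\<^bsub>2k+2\<^esub>g(iy) y\<^sup>k dy\<close>.\<close>

definition cycle_integral ::
    "real \<Rightarrow> mat2 set \<Rightarrow> nat \<Rightarrow> (complex \<Rightarrow> complex) \<Rightarrow> mat2 \<Rightarrow> complex" where
  "cycle_integral N \<Gamma> k G X =
     (let g = (SOME g. diagonalizes N X g); c = geodesic_path g in
      LINT y:cycle_interval N \<Gamma> X g|lborel.
        G (c y) * QX N X (c y) ^ k * vector_derivative c (at y))"

definition cycle_trace ::
    "real \<Rightarrow> mat2 set \<Rightarrow> nat \<Rightarrow> (complex \<Rightarrow> complex) \<Rightarrow> real \<Rightarrow> mat2 set \<Rightarrow> complex" where
  "cycle_trace N \<Gamma> k G m h =
     (\<Sum>orb \<in> (\<lambda>X. (\<lambda>\<gamma>. conj_act \<gamma> X) ` \<Gamma>) ` lattice_level N m h.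
        cycle_integral N \<Gamma> k G (SOME X. X \<in> orb))"

lemma diagonalizes_entries:
  assumes "diagonalizes N X g"
  defines "s \<equiv> sqrt (\<bar>Q N X\<bar> / N)"
  shows "X $ 1 $ 1 = s * (g $ 1 $ 1 * g $ 2 $ 2 + g $ 1 $ 2 * g $ 2 $ 1)"
    and "X $ 1 $ 2 = - 2 * s * g $ 1 $ 1 * g $ 1 $ 2"
    and "X $ 2 $ 1 = 2 * s * g $ 2 $ 1 * g $ 2 $ 2"
proof -
  have det: "det g = 1" and eq: "matrix_inv g ** X ** g = s *\<^sub>R diag2 1 (-1)"
    using assms by (auto simp: diagonalizes_def)
  from det have "invertible g" by (simp add: invertible_det_nz)
  hence "g ** matrix_inv g = mat 1" 
    unfolding invertible_def matrix_inv_def by (rule someI2_ex) simp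
  hence "X ** g = g ** (s *\<^sub>R diag2 1 (-1))"
    by (metis eq matrix_mul_assoc matrix_mul_lid)
  hence e: "(X ** g) $ i $ j = (g ** (s *\<^sub>R diag2 1 (-1))) $ i $ j" for i j by simp
  have d: "g $ 1 $ 1 * g $ 2 $ 2 - g $ 1 $ 2 * g $ 2 $ 1 = 1"
    using det by (simp add: det_2)
  have e11: "X $ 1 $ 1 * g $ 1 $ 1 + X $ 1 $ 2 * g $ 2 $ 1 = s * g $ 1 $ 1"
    using e[of 1 1] by (simp add: matrix_matrix_mult_def sum_2 diag2_def)
  have e12: "X $ 1 $ 1 * g $ 1 $ 2 + X $ 1 $ 2 * g $ 2 $ 2 = - s * g $ 1 $ 2"
    using e[of 1 2] by (simp add: matrix_matrix_mult_def sum_2 diag2_def)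
  have e21: "X $ 2 $ 1 * g $ 1 $ 1 + X $ 2 $ 2 * g $ 2 $ 1 = s * g $ 2 $ 1"
    using e[of 2 1] by (simp add: matrix_matrix_mult_def sum_2 diag2_def)
  have e22: "X $ 2 $ 1 * g $ 1 $ 2 + X $ 2 $ 2 * g $ 2 $ 2 = - s * g $ 2 $ 2"
    using e[of 2 2] by (simp add: matrix_matrix_mult_def sum_2 diag2_def)
  show "X $ 1 $ 1 = s * (g $ 1 $ 1 * g $ 2 $ 2 + g $ 1 $ 2 * g $ 2 $ 1)"
    using d e11 e12 by algebra
  show "X $ 1 $ 2 = - 2 * s * g $ 1 $ 1 * g $ 1 $ 2"
    using d e11 e12 by algebra
  show "X $ 2 $ 1 = 2 * s * g $ 2 $ 1 * g $ 2 $ 2"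
    using d e21 e22 by algebra
qed

lemma moebius_denom_nz:
  fixes g :: mat2
  assumes "det g = 1" "z \<in> upper_half_plane"
  shows "of_real (g $ 2 $ 1) * z + of_real (g $ 2 $ 2) \<noteq> 0"
proof
  assume "of_real (g $ 2 $ 1) * z + of_real (g $ 2 $ 2) = 0"
  hence "Im (of_real (g $ 2 $ 1) * z + of_real (g $ 2 $ 2)) = 0"
    and re: "Re (of_real (g $ 2 $ 1) * z + of_real (g $ 2 $ 2)) = 0" by simp_all
  hence "g $ 2 $ 1 = 0" using assms(2) by (simp add: upper_half_plane_def)
  with re have "g $ 2 $ 2 = 0" by simp
  with \<open>g $ 2 $ 1 = 0\<close> assms(1) show False by (simp add: det_2)
qed

lemma moebius_upper_half_plane:
  fixes g :: mat2
  assumes "det g = 1" "z \<in> upper_half_plane"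
  shows "moebius_act g z \<in> upper_half_plane"
proof -
  define n where "n = of_real (g $ 1 $ 1) * z + of_real (g $ 1 $ 2)"
  define j where "j = of_real (g $ 2 $ 1) * z + of_real (g $ 2 $ 2)"
  have j: "j \<noteq> 0" unfolding j_def by (rule moebius_denom_nz[OF assms])
  have "Im n * Re j - Re n * Im j = (g $ 1 $ 1 * g $ 2 $ 2 - g $ 1 $ 2 * g $ 2 $ 1) * Im z"
    by (simp add: n_def j_def algebra_simps)
  also have "\<dots> = Im z" using assms(1) by (simp add: det_2)
  finally have "Im n * Re j - Re n * Im j = Im z" .
  moreover have "moebius_act g z = n / j" by (simp add: moebius_act_def moebius_def n_def j_def)
  ultimately have "Im (moebius_act g z) = Im z / ((Re j)\<^sup>2 + (Im j)\<^sup>2)"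
    by (simp add: Im_divide)
  moreover have "(Re j)\<^sup>2 + (Im j)\<^sup>2 > 0" using j by (simp add: complex_neq_0)
  ultimately show ?thesis using assms(2) by (simp add: upper_half_plane_def)
qed

lemma moebius_right_inverse:
  fixes g :: mat2
  assumes "det g = 1" "z \<in> upper_half_plane"
  shows "\<exists>w\<in>upper_half_plane. moebius_act g w = z"
proof -
  define g' :: mat2 where
    "g' = vector [vector [g $ 2 $ 2, - g $ 1 $ 2], vector [- g $ 2 $ 1, g $ 1 $ 1]]"
  have d: "g $ 1 $ 1 * g $ 2 $ 2 - g $ 1 $ 2 * g $ 2 $ 1 = 1"
    using assms(1) by (simp add: det_2)
  have d': "det g' = 1" using d by (simp add: g'_def det_2 algebra_simps)
  define w where "w = moebius_act g' z"
  have w: "w \<in> upper_half_plane"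
    unfolding w_def by (rule moebius_upper_half_plane[OF d' assms(2)])
  have j': "- of_real (g $ 2 $ 1) * z + of_real (g $ 1 $ 1) \<noteq> 0"
    using moebius_denom_nz[OF d' assms(2)] by (simp add: g'_def)
  have j: "of_real (g $ 2 $ 1) * w + of_real (g $ 2 $ 2) \<noteq> 0"
    by (rule moebius_denom_nz[OF assms(1) w])
  have dc: "of_real (g $ 1 $ 1) * of_real (g $ 2 $ 2) - of_real (g $ 1 $ 2) * of_real (g $ 2 $ 1)
              = (1::complex)"
    using d by (simp flip: of_real_mult of_real_diff)
  have "w * (- of_real (g $ 2 $ 1) * z + of_real (g $ 1 $ 1)) =
          of_real (g $ 2 $ 2) * z - of_real (g $ 1 $ 2)"
    using j' by (simp add: w_def moebius_act_def moebius_def g'_def)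
  hence "of_real (g $ 1 $ 1) * w + of_real (g $ 1 $ 2) =
          z * (of_real (g $ 2 $ 1) * w + of_real (g $ 2 $ 2))"
    by (simp add: algebra_simps)
  hence "moebius_act g w = z" using j by (simp add: moebius_act_def moebius_def)
  with w show ?thesis by blast
qed

lemma QX_moebius:
  assumes "diagonalizes N X g" "w \<in> upper_half_plane"
  shows "QX N X (moebius_act g w) = - 2 * of_real (N * sqrt (\<bar>Q N X\<bar> / N)) * w /
           (of_real (g $ 2 $ 1) * w + of_real (g $ 2 $ 2))\<^sup>2"
proof -
  define s where "s = sqrt (\<bar>Q N X\<bar> / N)"
  define a b c d j z where "a = (of_real (g $ 1 $ 1) :: complex)" and "b = (of_real (g $ 1 $ 2) :: complex)"
    and "c = (of_real (g $ 2 $ 1) :: complex)" and "d = (of_real (g $ 2 $ 2) :: complex)"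
    and "j = c * w + d" and "z = moebius_act g w"
  have det: "det g = 1" using assms by (simp add: diagonalizes_def)
  hence "g $ 1 $ 1 * g $ 2 $ 2 - g $ 1 $ 2 * g $ 2 $ 1 = 1" by (simp add: det_2)
  hence dc: "a * d - b * c = 1" unfolding a_def b_def c_def d_def
    by (simp flip: of_real_mult of_real_diff)
  have j: "j \<noteq> 0" unfolding j_def c_def d_def by (rule moebius_denom_nz[OF det assms(2)])
  have zj: "z * j = a * w + b" using j by (simp add: z_def moebius_act_def moebius_def j_def a_def b_def c_def d_def)
  have "QX N X z = 2 * of_real (N * s) * ((c * z - a) * (d * z - b))"
    unfolding QX_def diagonalizes_entries[OF assms(1)] s_def[symmetric]
    by (simp add: a_def b_def c_def d_def algebra_simps power2_eq_square)
  moreover have "(c * z - a) * j = - 1" "(d * z - b) * j = w"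
    using zj dc by (simp_all add: j_def) algebra+
  hence "c * z - a = - 1 / j" "d * z - b = w / j" using j by (simp_all add: field_simps)
  ultimately show ?thesis
    by (simp add: z_def[symmetric] s_def[symmetric] j_def c_def d_def power2_eq_square)
qed

lemma geodesic_integrand:
  assumes "diagonalizes N X g" "N > 0" "y > 0"
  shows "G (geodesic_path g y) * QX N X (geodesic_path g y) ^ k *
             vector_derivative (geodesic_path g) (at y) =
           (- 2 * of_real (sqrt (\<bar>Q N X\<bar> * N)) * \<i>) ^ k * \<i> *
             (slash (2 * k + 2) G g (\<i> * of_real y) * of_real y ^ k)"
proof -
  define w where "w = \<i> * complex_of_real y"
  define j where "j = of_real (g $ 2 $ 1) * w + of_real (g $ 2 $ 2)"
  have w: "w \<in> upper_half_plane" using assms(3) by (simp add: w_def upper_half_plane_def)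
  have det: "det g = 1" using assms by (simp add: diagonalizes_def)
  have j: "j \<noteq> 0" unfolding j_def by (rule moebius_denom_nz[OF det w])
  have d: "of_real (g $ 1 $ 1) * of_real (g $ 2 $ 2) - of_real (g $ 1 $ 2) * of_real (g $ 2 $ 1)
              = (1::complex)"
    using det by (simp add: det_2 flip: of_real_mult of_real_diff)
  have "(moebius_act g has_field_derivative
          (of_real (g $ 1 $ 1) * j - (of_real (g $ 1 $ 1) * w + of_real (g $ 1 $ 2)) * of_real (g $ 2 $ 1))
            / (j * j)) (at w)"
    unfolding moebius_act_def moebius_def using j
    by (auto intro!: derivative_eq_intros simp: j_def)
  also have "of_real (g $ 1 $ 1) * j - (of_real (g $ 1 $ 1) * w + of_real (g $ 1 $ 2)) * of_real (g $ 2 $ 1)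
     = of_real (g $ 1 $ 1) * of_real (g $ 2 $ 2) - of_real (g $ 1 $ 2) * of_real (g $ 2 $ 1)"
    by (simp add: j_def algebra_simps)
  finally have md: "(moebius_act g has_field_derivative 1 / j\<^sup>2) (at w)"
    by (simp add: d power2_eq_square)
  have "((\<lambda>y. \<i> * complex_of_real y) has_vector_derivative \<i>) (at y)"
    by (auto intro!: derivative_eq_intros)
  hence "(moebius_act g \<circ> (\<lambda>y. \<i> * complex_of_real y) has_vector_derivative \<i> * (1 / j\<^sup>2)) (at y)"
    using md by (intro field_vector_diff_chain_at) (auto simp: w_def)
  hence vd: "vector_derivative (geodesic_path g) (at y) = \<i> / j\<^sup>2"
    by (simp add: vector_derivative_at geodesic_path_def[abs_def] o_def)
  have s: "N * sqrt (\<bar>Q N X\<bar> / N) = sqrt (\<bar>Q N X\<bar> * N)"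
    using assms(2) by (simp add: real_sqrt_divide real_sqrt_mult field_simps)
  have "QX N X (geodesic_path g y) ^ k =
          (- 2 * of_real (sqrt (\<bar>Q N X\<bar> * N)) * \<i>) ^ k * of_real y ^ k / (j\<^sup>2) ^ k"
    unfolding geodesic_path_def w_def[symmetric] QX_moebius[OF assms(1) w] s j_def[symmetric]
    by (simp only: w_def power_divide[symmetric] power_mult_distrib[symmetric])
      (simp add: mult.assoc)
  moreover have "j ^ (2 * k + 2) = (j\<^sup>2) ^ k * j\<^sup>2" by (simp add: power_add power_mult power2_eq_square)
  ultimately show ?thesis
    by (simp add: vd slash_def geodesic_path_def w_def[symmetric] j_def[symmetric])
qed

lemma geodesic_path_image:
  assumes "diagonalizes N X g" "N > 0" "Q N X < 0"
  shows "geodesic_path g ` {0<..} = geodesic N X"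
proof -
  define s where "s = sqrt (\<bar>Q N X\<bar> / N)"
  have s: "s \<noteq> 0" using assms by (simp add: s_def)
  have det: "det g = 1" using assms by (simp add: diagonalizes_def)
  have iff: "pz N (moebius_act g w) X = 0 \<longleftrightarrow> Re w = 0" if w: "w \<in> upper_half_plane" for w
  proof -
    define z where "z = moebius_act g w"
    define j where "j = of_real (g $ 2 $ 1) * w + of_real (g $ 2 $ 2)"
    have j: "j \<noteq> 0" unfolding j_def by (rule moebius_denom_nz[OF det w])
    have z: "z \<in> upper_half_plane" unfolding z_def by (rule moebius_upper_half_plane[OF det w])
    have dr: "g $ 1 $ 1 * g $ 2 $ 2 - g $ 1 $ 2 * g $ 2 $ 1 = 1" using det by (simp add: det_2)
    have d: "of_real (g $ 1 $ 1) * of_real (g $ 2 $ 2) - of_real (g $ 1 $ 2) * of_real (g $ 2 $ 1)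
              = (1::complex)"
      using dr by (simp flip: of_real_mult of_real_diff)
    have zj: "z * j = of_real (g $ 1 $ 1) * w + of_real (g $ 1 $ 2)"
      using j by (simp add: z_def moebius_act_def moebius_def j_def)
    have 1: "(of_real (g $ 2 $ 1) * z - of_real (g $ 1 $ 1)) * j = - 1"
      using zj d unfolding j_def by algebra
    have 2: "(of_real (g $ 2 $ 2) * z - of_real (g $ 1 $ 2)) * j = w"
      using zj d unfolding j_def by algebra
    have "X $ 2 $ 1 * (cmod z)\<^sup>2 - 2 * (X $ 1 $ 1) * Re z - X $ 1 $ 2 =
        2 * s * Re (cnj (of_real (g $ 2 $ 1) * z - of_real (g $ 1 $ 1)) *
                    (of_real (g $ 2 $ 2) * z - of_real (g $ 1 $ 2)))"
      unfolding diagonalizes_entries[OF assms(1)] s_def[symmetric] cmod_power2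
      by (simp add: algebra_simps power2_eq_square)
    also have "cnj (of_real (g $ 2 $ 1) * z - of_real (g $ 1 $ 1)) *
                    (of_real (g $ 2 $ 2) * z - of_real (g $ 1 $ 2)) =
               - w / (cnj j * j)"
    proof -
      from 1 j have "of_real (g $ 2 $ 1) * z - of_real (g $ 1 $ 1) = - 1 / j"
        by (subst eq_divide_eq) simp
      moreover from 2 j have "of_real (g $ 2 $ 2) * z - of_real (g $ 1 $ 2) = w / j"
        by (subst eq_divide_eq) simp
      ultimately show ?thesis by simp
    qed
    also have "- w / (cnj j * j) = - w / of_real ((cmod j)\<^sup>2)"
      by (metis complex_norm_square mult.commute)
    finally have "X $ 2 $ 1 * (cmod z)\<^sup>2 - 2 * (X $ 1 $ 1) * Re z - X $ 1 $ 2 =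
        - 2 * s * Re w / (cmod j)\<^sup>2" by (simp only: Re_divide_of_real) simp
    with s j z assms(2) show ?thesis
      by (simp add: pz_def z_def[symmetric] upper_half_plane_def)
  qed
  show ?thesis
  proof (intro subset_antisym subsetI)
    fix z assume "z \<in> geodesic_path g ` {0<..}"
    then obtain y where "y > 0" "z = moebius_act g (\<i> * of_real y)" by (auto simp: geodesic_path_def)
    moreover from this have "\<i> * of_real y \<in> upper_half_plane" by (simp add: upper_half_plane_def)
    ultimately show "z \<in> geodesic N X"
      using iff moebius_upper_half_plane[OF det] by (simp add: geodesic_def)
  next
    fix z assume z: "z \<in> geodesic N X"
    then obtain w where w: "w \<in> upper_half_plane" "moebius_act g w = z"
      using moebius_right_inverse[OF det] by (auto simp: geodesic_def)
    with z iff have "Re w = 0" by (auto simp: geodesic_def)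
    hence "w = \<i> * of_real (Im w)" by (simp add: complex_eq_iff)
    with w show "z \<in> geodesic_path g ` {0<..}"
      by (auto simp: geodesic_path_def upper_half_plane_def intro!: image_eqI[of _ _ "Im w"])
  qed
qed

end

theory Submission
  imports Defs "HOL-Complex_Analysis.Cauchy_Integral_Theorem" "HOL-Probability.Distributions"
begin

text \<open>The theta integral is unfolded over the \<open>\<Gamma>\<close>-orbits of vectors \<open>X \<in> h\<close>: the orbit of \<open>X\<close>
  contributes the integral of \<open>G Q\<^sub>X\<^sup>k\<^sup>+\<^sup>1 exp(-2\<pi>vR)\<close> over \<open>\<Gamma>\<^sub>X \<setminus> \<H>\<close>. The function \<open>R(X,z)\<close> is constant on the
  orbits of the one-parameter group generated by \<open>X\<close>, and the velocity of that flow is a multiple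
  of \<open>Q\<^sub>X\<close>, so along a flow line the integral of \<open>G Q\<^sub>X\<^sup>k\<^sup>+\<^sup>1\<close> is the increment of a primitive of
  \<open>G Q\<^sub>X\<^sup>k\<close>. For \<open>Q(X) > 0\<close> the flow lines are closed and the increment vanishes; for \<open>Q(X) = 0\<close> they are
  horocycles and it vanishes because \<open>G\<close> is cuspidal; for \<open>Q(X) < 0\<close> it is the cycle integral,
  independently of the line, and the transversal integral is Gaussian.\<close>


section \<open>Matrices and Moebius transformations\<close>

text \<open>The obstacle is to exchange the sum over \<open>h\<close> with the integral: the lift
  integrates over an arbitrary measurable fundamental domain, of whose shape near the cusps nothing
  is known. The integral of absolute values is therefore compared with one over finitely many
  translates of a Siegel set, where the exponential decay of \<open>G\<close> at the cusp absorbs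
  the growth of the theta series. For Q(X) = -m < 0 the transversal variable t contributes the
  integral of exp(-4 pi v m (1 + t^2)), that is exp(-4 pi v m) / (2 sqrt(v m)); the exponential
  turns the conjugate of q^(-m) into q^m, and the flow constant -2 sqrt(m N) leaves the factor -sqrt
  N. The integral along a flow line is the same for all t for two different reasons: if m/N is not a
  rational square, a generator of the stabilizer, found through Pell's equation, changes a primitive
  by a constant; if it is one, the line joins two cusps, and primitives on different lines approach
  each other at both ends. Multiplicities are counted in the group itself, whose centre has one or
  two elements, and they cancel for orbits of negative norm.\<close>

definition M2 :: "real \<Rightarrow> real \<Rightarrow> real \<Rightarrow> real \<Rightarrow> mat2" where
  "M2 a b c d = vector [vector [a, b], vector [c, d]]"

lemma M2_nth [simp]:
  "M2 a b c d $ 1 $ 1 = a" "M2 a b c d $ 1 $ 2 = b" "M2 a b c d $ 2 $ 1 = c" "M2 a b c d $ 2 $ 2 = d"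
  by (simp_all add: M2_def)

lemma mat2_eq_iff:
  "(A :: mat2) = B \<longleftrightarrow> A$1$1 = B$1$1 \<and> A$1$2 = B$1$2 \<and> A$2$1 = B$2$1 \<and> A$2$2 = B$2$2"
  unfolding vec_eq_iff forall_2 by blast

lemma M2_collapse: "M2 (A$1$1) (A$1$2) (A$2$1) (A$2$2) = A"
  by (simp add: mat2_eq_iff)

lemma mat2_mult_nth: "((A :: mat2) ** B) $ i $ j = A$i$1 * B$1$j + A$i$2 * B$2$j"
  by (simp add: matrix_matrix_mult_def sum_2)

lemma mat2_one_nth [simp]:
  "(mat 1 :: mat2) $ 1 $ 1 = 1" "(mat 1 :: mat2) $ 1 $ 2 = 0"
  "(mat 1 :: mat2) $ 2 $ 1 = 0" "(mat 1 :: mat2) $ 2 $ 2 = 1"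
  by (simp_all add: mat_def)

lemma M2_mult: "M2 a b c d ** M2 a' b' c' d' =
    M2 (a * a' + b * c') (a * b' + b * d') (c * a' + d * c') (c * b' + d * d')"
  by (simp add: mat2_eq_iff mat2_mult_nth)

lemma det_M2 [simp]: "det (M2 a b c d) = a * d - b * c"
  by (simp add: det_2)

lemma trace_mat2: "trace (X :: mat2) = X$1$1 + X$2$2"
  by (simp add: trace_def sum_2)

lemma invertible_det1: "det (g :: mat2) = 1 \<Longrightarrow> invertible g"
  by (simp add: invertible_det_nz)

lemma matrix_inv_right: "det (g :: mat2) = 1 \<Longrightarrow> g ** matrix_inv g = mat 1"
  using invertible_det1[of g] unfolding invertible_def matrix_inv_def by (metis (mono_tags, lifting) someI_ex)

lemma matrix_inv_left: "det (g :: mat2) = 1 \<Longrightarrow> matrix_inv g ** g = mat 1"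
  using invertible_det1[of g] unfolding invertible_def matrix_inv_def by (metis (mono_tags, lifting) someI_ex)

text \<open>\<open>matrix_inv\<close> is a choice of a two-sided inverse; uniqueness of inverses
  identifies it with the adjugate, which makes later computations entrywise.\<close>

lemma matrix_inv_M2: assumes "det (g :: mat2) = 1"
  shows "matrix_inv g = M2 (g$2$2) (- g$1$2) (- g$2$1) (g$1$1)"
proof -
  define k where "k = M2 (g$2$2) (- g$1$2) (- g$2$1) (g$1$1)"
  have "k ** g = mat 1"
    using assms by (simp add: mat2_eq_iff mat2_mult_nth k_def det_2 algebra_simps)
  hence "k = k ** (g ** matrix_inv g)" "k ** g = mat 1" using matrix_inv_right[OF assms] by simp_all
  hence "k = matrix_inv g" by (simp add: matrix_mul_assoc)
  thus ?thesis by (simp add: k_def)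
qed

lemma matrix_inv_nth:
  assumes "det (g :: mat2) = 1"
  shows "matrix_inv g $ 1 $ 1 = g$2$2" "matrix_inv g $ 1 $ 2 = - g$1$2"
    "matrix_inv g $ 2 $ 1 = - g$2$1" "matrix_inv g $ 2 $ 2 = g$1$1"
  using matrix_inv_M2[OF assms] by simp_all

lemma det_matrix_inv: "det (g :: mat2) = 1 \<Longrightarrow> det (matrix_inv g) = 1"
  by (simp add: matrix_inv_M2) (simp add: det_2 algebra_simps)

lemma matrix_inv_matrix_inv: "det (g :: mat2) = 1 \<Longrightarrow> matrix_inv (matrix_inv g) = g"
  by (subst matrix_inv_M2) (simp_all add: det_matrix_inv matrix_inv_nth mat2_eq_iff)

lemma det_uminus_mat2 [simp]: "det (- (g :: mat2)) = det g"
  by (simp add: det_2)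

lemma matrix_inv_mult: "det (g :: mat2) = 1 \<Longrightarrow> det h = 1 \<Longrightarrow>
    matrix_inv (g ** h) = matrix_inv h ** matrix_inv g"
  by (simp add: matrix_inv_M2 det_mul M2_mult) (simp add: mat2_eq_iff mat2_mult_nth algebra_simps)

lemma matrix_inv_uminus: "det (g :: mat2) = 1 \<Longrightarrow> matrix_inv (- g) = - matrix_inv g"
  by (simp add: matrix_inv_M2 mat2_eq_iff)

lemma mat2_mult_uminus [simp]: "(- (g :: mat2)) ** h = - (g ** h)" "g ** (- h) = - (g ** (h :: mat2))"
  by (simp_all add: mat2_eq_iff mat2_mult_nth)

lemma mat2_cancel_left:
  "det (g :: mat2) = 1 \<Longrightarrow> matrix_inv g ** (g ** h) = h"
  "det (g :: mat2) = 1 \<Longrightarrow> g ** (matrix_inv g ** h) = h"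
  by (simp_all add: matrix_mul_assoc matrix_inv_left matrix_inv_right)

lemma mat2_cancel_right:
  "det (g :: mat2) = 1 \<Longrightarrow> (h ** matrix_inv g) ** g = h"
  "det (g :: mat2) = 1 \<Longrightarrow> (h ** g) ** matrix_inv g = h"
  by (simp_all add: matrix_mul_assoc[symmetric] matrix_inv_left matrix_inv_right)

lemma conj_act_mult: "det g = 1 \<Longrightarrow> det h = 1 \<Longrightarrow> conj_act (g ** h) X = conj_act g (conj_act h X)"
  by (simp add: conj_act_def matrix_inv_mult matrix_mul_assoc)

lemma conj_act_one [simp]: "conj_act (mat 1) X = X"
  using matrix_inv_left[of "mat 1"] by (simp add: conj_act_def)

lemma conj_act_inv: "det g = 1 \<Longrightarrow> conj_act (matrix_inv g) (conj_act g X) = X"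
  "det g = 1 \<Longrightarrow> conj_act g (conj_act (matrix_inv g) X) = X"
  by (simp_all add: conj_act_mult[symmetric] det_matrix_inv matrix_inv_left matrix_inv_right)

lemma conj_act_inv_eq_iff: "det g = 1 \<Longrightarrow> conj_act (matrix_inv g) X = Y \<longleftrightarrow> X = conj_act g Y"
  using conj_act_inv by metis

lemma conj_act_uminus: "det g = 1 \<Longrightarrow> conj_act (- g) X = conj_act g X"
  by (simp add: conj_act_def matrix_inv_uminus)

lemma conj_act_uminus_one [simp]: "conj_act (- mat 1) X = X"
  by (simp add: conj_act_uminus)

lemma conj_act_eq_iff_commute: "det g = 1 \<Longrightarrow> conj_act g X = X \<longleftrightarrow> g ** X = X ** g"
  unfolding conj_act_def by (metis mat2_cancel_right)

lemma det_conj_act [simp]: "det g = 1 \<Longrightarrow> det (conj_act g X) = det X"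
  by (simp add: conj_act_def det_mul det_matrix_inv)

lemma Q_conj_act [simp]: "det g = 1 \<Longrightarrow> Q N (conj_act g X) = Q N X"
  by (simp add: Q_def)

lemma conj_act_nth:
  assumes "det g = 1"
  shows "conj_act g X $ 1 $ 1 = (g$1$1 * X$1$1 + g$1$2 * X$2$1) * g$2$2 - (g$1$1 * X$1$2 + g$1$2 * X$2$2) * g$2$1"
    "conj_act g X $ 1 $ 2 = - (g$1$1 * X$1$1 + g$1$2 * X$2$1) * g$1$2 + (g$1$1 * X$1$2 + g$1$2 * X$2$2) * g$1$1"
    "conj_act g X $ 2 $ 1 = (g$2$1 * X$1$1 + g$2$2 * X$2$1) * g$2$2 - (g$2$1 * X$1$2 + g$2$2 * X$2$2) * g$2$1"
    "conj_act g X $ 2 $ 2 = - (g$2$1 * X$1$1 + g$2$2 * X$2$1) * g$1$2 + (g$2$1 * X$1$2 + g$2$2 * X$2$2) * g$1$1"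
  using assms by (simp_all add: conj_act_def mat2_mult_nth matrix_inv_nth algebra_simps)

lemma trace_conj_act [simp]: assumes "det g = 1" shows "trace (conj_act g X) = trace X"
proof -
  have d: "g$1$1 * g$2$2 - g$1$2 * g$2$1 = 1" using assms by (simp add: det_2)
  show ?thesis unfolding trace_mat2 conj_act_nth[OF assms] using d by algebra
qed

text \<open>The factor of automorphy \<open>cz + d\<close>; \<open>aut_mult\<close> is its cocycle
  relation.\<close>

definition aut :: "mat2 \<Rightarrow> complex \<Rightarrow> complex" where
  "aut g z = of_real (g$2$1) * z + of_real (g$2$2)"

lemma aut_nz: "det g = 1 \<Longrightarrow> z \<in> upper_half_plane \<Longrightarrow> aut g z \<noteq> 0"
  unfolding aut_def by (rule moebius_denom_nz)

lemma moebius_act_eq: "moebius_act g z = (of_real (g$1$1) * z + of_real (g$1$2)) / aut g z"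
  by (simp add: moebius_act_def moebius_def aut_def)

lemma slash_eq: "slash w f g z = f (moebius_act g z) / aut g z ^ w"
  by (simp add: slash_def aut_def)

lemma moebius_act_one [simp]: "moebius_act (mat 1) z = z"
  by (simp add: moebius_act_eq aut_def)

lemma moebius_act_uminus [simp]: "moebius_act (- g) z = moebius_act g z"
proof -
  have "moebius_act (- g) z = (- (of_real (g$1$1) * z + of_real (g$1$2))) / (- aut g z)"
    by (simp add: moebius_act_eq aut_def)
  thus ?thesis by (simp only: minus_divide_divide moebius_act_eq)
qed

lemma aut_uminus [simp]: "aut (- g) z = - aut g z"
  by (simp add: aut_def)

lemma aut_mult:
  assumes "det h = 1" "z \<in> upper_half_plane"
  shows "aut (g ** h) z = aut g (moebius_act h z) * aut h z"
proof -
  have "aut g (moebius_act h z) * aut h z = of_real (g$2$1) * (moebius_act h z * aut h z) + of_real (g$2$2) * aut h z"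
    by (simp add: aut_def algebra_simps)
  also have "moebius_act h z * aut h z = of_real (h$1$1) * z + of_real (h$1$2)"
    using aut_nz[OF assms] by (simp add: moebius_act_eq)
  finally show ?thesis by (simp add: aut_def mat2_mult_nth algebra_simps)
qed

lemma moebius_act_mult:
  assumes "det g = 1" "det h = 1" "z \<in> upper_half_plane"
  shows "moebius_act (g ** h) z = moebius_act g (moebius_act h z)"
proof -
  have nz: "aut h z \<noteq> 0" "aut (g ** h) z \<noteq> 0"
    using aut_nz assms by (auto simp: det_mul)
  have "moebius_act g (moebius_act h z) =
      ((of_real (g$1$1) * moebius_act h z + of_real (g$1$2)) * aut h z) / (aut g (moebius_act h z) * aut h z)"
    using nz by (simp add: moebius_act_eq[of g])
  also have "(of_real (g$1$1) * moebius_act h z + of_real (g$1$2)) * aut h z =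
     of_real (g$1$1) * (of_real (h$1$1) * z + of_real (h$1$2)) + of_real (g$1$2) * aut h z"
    using nz by (simp add: moebius_act_eq[of h] distrib_right)
  also have "\<dots> = of_real ((g ** h)$1$1) * z + of_real ((g ** h)$1$2)"
    by (simp add: aut_def mat2_mult_nth algebra_simps)
  finally show ?thesis by (simp add: moebius_act_eq[of "g ** h"] aut_mult[OF assms(2,3)])
qed

lemma moebius_act_inv:
  assumes "det g = 1" "z \<in> upper_half_plane"
  shows "moebius_act (matrix_inv g) (moebius_act g z) = z"
    "moebius_act g (moebius_act (matrix_inv g) z) = z"
  using assms by (simp_all add: moebius_act_mult[symmetric] det_matrix_inv matrix_inv_left matrix_inv_right)

lemma Im_moebius_act:
  assumes "det g = 1" "z \<in> upper_half_plane"
  shows "Im (moebius_act g z) = Im z / (cmod (aut g z))\<^sup>2"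
proof -
  have "g$1$1 * g$2$2 - g$1$2 * g$2$1 = 1" using assms by (simp add: det_2)
  hence "Im (of_real (g $ 1 $ 1) * z + of_real (g $ 1 $ 2)) * Re (aut g z) - Re (of_real (g $ 1 $ 1) * z + of_real (g $ 1 $ 2)) * Im (aut g z) = Im z"
    by (simp add: aut_def) algebra
  thus ?thesis unfolding moebius_act_eq Im_divide cmod_power2 by simp
qed

lemma moebius_act_derivative:
  assumes "det g = 1" "z \<in> upper_half_plane"
  shows "(moebius_act g has_field_derivative 1 / (aut g z)\<^sup>2) (at z)"
proof -
  have nz: "of_real (g$2$1) * z + of_real (g$2$2) \<noteq> 0"
    using aut_nz[OF assms] by (simp add: aut_def)
  have d: "of_real (g $ 1 $ 1) * of_real (g $ 2 $ 2) - of_real (g $ 1 $ 2) * of_real (g $ 2 $ 1)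
              = (1::complex)"
    using assms(1) by (simp add: det_2 flip: of_real_mult of_real_diff)
  have "(moebius_act g has_field_derivative
     (of_real (g$1$1) * (of_real (g$2$1) * z + of_real (g$2$2)) - (of_real (g$1$1) * z + of_real (g$1$2)) * of_real (g$2$1)) /
      ((of_real (g$2$1) * z + of_real (g$2$2)) * (of_real (g$2$1) * z + of_real (g$2$2)))) (at z)"
    unfolding moebius_act_def moebius_def using nz by (auto intro!: derivative_eq_intros)
  also have "of_real (g$1$1) * (of_real (g$2$1) * z + of_real (g$2$2)) - (of_real (g$1$1) * z + of_real (g$1$2)) * of_real (g$2$1) = (1::complex)"
    using d by algebra
  finally show ?thesis by (simp add: aut_def power2_eq_square)
qed

lemma slash_mult:
  assumes "det g = 1" "det h = 1" "z \<in> upper_half_plane"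
  shows "slash w f (g ** h) z = slash w f g (moebius_act h z) / aut h z ^ w"
  using assms by (simp add: slash_eq moebius_act_mult aut_mult power_mult_distrib)

text \<open>\<open>QX\<close> is the binary quadratic form attached to \<open>X\<close>, so
  conjugating \<open>X\<close> amounts to weight -2 in \<open>z\<close>. After multiplication by
  \<open>(aut g z)\<^sup>2\<close> the image point enters only through
  \<open>w * j = a * z + b\<close>, and the claim is polynomial.\<close>

lemma QX_conj_act:
  assumes "det g = 1" "trace X = 0" "z \<in> upper_half_plane"
  shows "QX N (conj_act g X) (moebius_act g z) = QX N X z / (aut g z)\<^sup>2"
proof -
  define a b c d x1 x2 x3 j w where "a = complex_of_real (g$1$1)" "b = complex_of_real (g$1$2)"
    "c = complex_of_real (g$2$1)" "d = complex_of_real (g$2$2)" "x1 = complex_of_real (X$1$2)" 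
    "x2 = complex_of_real (X$1$1)" "x3 = complex_of_real (X$2$1)" "j = aut g z" "w = moebius_act g z"
  note defs = this
  have x22: "complex_of_real (X$2$2) = - x2" using assms(2) by (simp add: trace_mat2 defs add_eq_0_iff)
  have j: "j \<noteq> 0" "j = c * z + d" using aut_nz assms by (auto simp: defs aut_def)
  have wj: "w * j = a * z + b" using j by (simp add: moebius_act_eq defs)
  have det: "a * d - b * c = 1" using assms(1) by (simp add: det_2 defs flip: of_real_mult of_real_diff)
  have "(((c * x2 + d * x3) * d - (c * x1 - d * x2) * c) * w\<^sup>2
      - 2 * ((a * x2 + b * x3) * d - (a * x1 - b * x2) * c) * w - (- (a * x2 + b * x3) * b + (a * x1 - b * x2) * a)) * j\<^sup>2
      = (c * x2 * d + d * x3 * d - c * x1 * c + d * x2 * c) * (w * j)\<^sup>2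
      - 2 * ((a * x2 + b * x3) * d - (a * x1 - b * x2) * c) * (w * j) * j - (- (a * x2 + b * x3) * b + (a * x1 - b * x2) * a) * j\<^sup>2"
    by algebra
  also have "\<dots> = x3 * z\<^sup>2 - 2 * x2 * z - x1"
    unfolding wj using det by (subst (1 2) j(2), algebra)
  finally have "QX N (conj_act g X) w * j\<^sup>2 = QX N X z"
    unfolding QX_def conj_act_nth[OF assms(1)]
    by (simp add: defs[symmetric] x22 mult.assoc) 
  thus ?thesis using j by (simp add: defs[symmetric] field_simps)
qed

text \<open>With A = x3 z^2 - 2 x2 z - x1 and B = x3 |z|^2 - 2 x2 Re z - x1 one has |A|^2 = B^2 + 4
  y^2 (x2^2 + x1 x3). In this form the invariance of \<open>R\<close> follows from the covariance of
  \<open>QX\<close> and of \<open>Im\<close>.\<close>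

lemma R_eq:
  assumes "N > 0" "trace X = 0" "z \<in> upper_half_plane"
  shows "R N X z = (cmod (QX N X z))\<^sup>2 / (2 * N * (Im z)\<^sup>2)"
proof -
  define x y x1 x2 x3 where "x = Re z" "y = Im z" "x1 = X$1$2" "x2 = X$1$1" "x3 = X$2$1"
  note defs = this
  have x22: "X$2$2 = - x2" using assms(2) by (simp add: trace_mat2 defs add_eq_0_iff)
  have y: "y > 0" using assms by (simp add: defs upper_half_plane_def)
  have z: "Re z = x" "Im z = y" by (simp_all add: defs)
  have Qx: "QX N X z = Complex (N * (x3 * (x\<^sup>2 - y\<^sup>2) - 2 * x2 * x - x1)) (N * (2 * x3 * x * y - 2 * x2 * y))"
    by (simp add: QX_def complex_eq_iff z defs(3-5)[symmetric] power2_eq_square algebra_simps)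
  have 1: "bil N X X = - N * (2 * x2\<^sup>2 + 2 * x1 * x3)"
    by (simp add: bil_def trace_mat2 mat2_mult_nth defs(3-5)[symmetric] x22 power2_eq_square algebra_simps)
  have 2: "pz N z X = - (sqrt N / y) * (x3 * (x\<^sup>2 + y\<^sup>2) - 2 * x2 * x - x1)"
    by (simp add: pz_def cmod_power2 z defs(3-5)[symmetric])
  have 3: "(pz N z X)\<^sup>2 = N / y\<^sup>2 * (x3 * (x\<^sup>2 + y\<^sup>2) - 2 * x2 * x - x1)\<^sup>2"
    unfolding 2 power_mult_distrib power2_minus power_divide using assms by simp
  have 4: "(cmod (QX N X z))\<^sup>2 = (N * (x3 * (x\<^sup>2 - y\<^sup>2) - 2 * x2 * x - x1))\<^sup>2 + (N * (2 * x3 * x * y - 2 * x2 * y))\<^sup>2"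
    unfolding Qx cmod_power2 by simp
  have "N * N * ((x3 * (x\<^sup>2 + y\<^sup>2) - 2 * x2 * x - x1)\<^sup>2 + 2 * (2 * x2\<^sup>2 + 2 * x1 * x3) * y\<^sup>2) = (cmod (QX N X z))\<^sup>2"
    unfolding 4 by algebra
  hence "(cmod (QX N X z))\<^sup>2 / (2 * N * y\<^sup>2) = N * ((x3 * (x\<^sup>2 + y\<^sup>2) - 2 * x2 * x - x1)\<^sup>2 + 2 * (2 * x2\<^sup>2 + 2 * x1 * x3) * y\<^sup>2) / (2 * y\<^sup>2)"
    using assms(1) by (simp del: distrib_left_numeral add: mult.assoc flip: \<open>_ = (cmod (QX N X z))\<^sup>2\<close>)
  also have "\<dots> = R N X z"
    using y unfolding R_def 1 3 by (simp add: field_simps)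
  finally show ?thesis by (simp add: z)
qed

lemma R_conj_act:
  assumes "N > 0" "det g = 1" "trace X = 0" "z \<in> upper_half_plane"
  shows "R N (conj_act g X) (moebius_act g z) = R N X z"
proof -
  have "moebius_act g z \<in> upper_half_plane" using moebius_upper_half_plane assms by blast
  thus ?thesis using assms aut_nz[OF assms(2,4)]
    by (simp add: R_eq QX_conj_act Im_moebius_act norm_divide norm_power power_divide field_simps)
qed


section \<open>The hyperbolic measure\<close>

text \<open>Both measures agree on boxes, which determines Lebesgue measure; Fubini in real and
  imaginary part becomes available.\<close>

lemma lborel_complex: "(lborel :: complex measure) = distr (lborel \<Otimes>\<^sub>M lborel) borel (\<lambda>(x, y). Complex x y)"
proof (rule lborel_eqI)
  fix l u :: complex
  assume le: "\<And>b. b \<in> Basis \<Longrightarrow> l \<bullet> b \<le> u \<bullet> b"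
  have le': "Re l \<le> Re u" "Im l \<le> Im u" using le[of 1] le[of \<i>] by (auto simp: Basis_complex_def inner_complex_def)
  have m: "(\<lambda>(x, y). Complex x y) \<in> borel_measurable (lborel \<Otimes>\<^sub>M lborel)"
    unfolding Complex_eq by measurable
  have "(\<lambda>(x, y). Complex x y) -` box l u \<inter> space (lborel \<Otimes>\<^sub>M lborel) = {Re l<..<Re u} \<times> {Im l<..<Im u}"
    by (auto simp: box_def Basis_complex_def inner_complex_def space_pair_measure)
  thus "emeasure (distr (lborel \<Otimes>\<^sub>M lborel) borel (\<lambda>(x, y). Complex x y)) (box l u) = (\<Prod>b\<in>Basis. (u - l) \<bullet> b)"
    using le' by (simp add: emeasure_distr[OF m] lborel.emeasure_pair_measure_Times Basis_complex_def
        inner_complex_def ennreal_mult)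
qed simp

text \<open>The invariant measure dx dy / y^2, extended by zero to all of \<open>complex\<close>, so
  that values off the half-plane never matter.\<close>

definition hyp :: "complex measure" where
  "hyp = density lborel (\<lambda>z. ennreal (indicator upper_half_plane z / (Im z)\<^sup>2))"

lemma borel_uhp [measurable, simp]: "upper_half_plane \<in> sets borel"
  unfolding upper_half_plane_def by measurable

lemma open_uhp: "open upper_half_plane"
  unfolding upper_half_plane_def by (simp add: open_halfspace_Im_gt)

lemma convex_uhp: "convex upper_half_plane"
  unfolding upper_half_plane_def by (simp add: convex_halfspace_Im_gt)

lemma borel_Im [measurable]: "Im \<in> borel_measurable borel"
  by (intro borel_measurable_continuous_onI continuous_intros)

lemma borel_Re [measurable]: "Re \<in> borel_measurable borel"
  by (intro borel_measurable_continuous_onI continuous_intros)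

lemma sets_hyp [simp, measurable_cong]: "sets hyp = sets borel"
  by (simp add: hyp_def)

lemma space_hyp [simp]: "space hyp = UNIV"
  by (simp add: hyp_def)

lemma AE_hyp: "AE z in hyp. z \<in> upper_half_plane"
  unfolding hyp_def by (subst AE_density) (auto simp: indicator_def)

lemma null_sets_hyp: "A \<in> null_sets lborel \<Longrightarrow> A \<in> null_sets hyp"
  unfolding hyp_def by (subst null_sets_density_iff) (auto simp: null_sets_def intro: AE_I')

text \<open>In the coordinates \<open>z = e\<^sup>s(t + i)\<close> the hyperbolic measure is \<open>ds dt\<close>, and translations, dilations
  and the inversion become translations and reflections in one variable when the other is fixed.\<close>

definition hpt :: "real \<Rightarrow> real \<Rightarrow> complex" where
  "hpt s t = of_real (exp s) * (of_real t + \<i>)"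

lemma hpt_uhp [simp]: "hpt s t \<in> upper_half_plane"
  by (simp add: hpt_def upper_half_plane_def)

lemma Im_hpt [simp]: "Im (hpt s t) = exp s" and Re_hpt [simp]: "Re (hpt s t) = exp s * t"
  by (simp_all add: hpt_def)

lemma measurable_hpt2 [measurable (raw)]:
  assumes [measurable]: "f \<in> borel_measurable M" "g \<in> borel_measurable M"
  shows "(\<lambda>x. hpt (f x) (g x)) \<in> borel_measurable M"
  unfolding hpt_def by measurable

text \<open>On the compact intervals [exp(-n), exp n] this is the usual substitution y = exp s with
  dy / y = ds; monotone convergence removes the truncation.\<close>

lemma nn_integral_exp_substitution:
  fixes f :: "real \<Rightarrow> ennreal"
  assumes [measurable]: "f \<in> borel_measurable borel"
  shows "(\<integral>\<^sup>+y. f y * ennreal (indicator {0<..} y / y) \<partial>lborel) = (\<integral>\<^sup>+s. f (exp s) \<partial>lborel)"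
proof -
  define g where "g = (\<lambda>y. f y * ennreal (indicator {0<..} y / y))"
  have [measurable]: "g \<in> borel_measurable borel" unfolding g_def by measurable
  have 1: "(\<integral>\<^sup>+y. g y * indicator {exp (- real n)..exp (real n)} y \<partial>lborel) =
     (\<integral>\<^sup>+s. f (exp s) * indicator {- real n..real n} s \<partial>lborel)" for n
  \<comment> \<open>For n = 0 the intervals degenerate to single points, where the substitution rule
    does not apply but both integrals vanish.\<close>
  proof (cases "n = 0")
    case True
    have "AE y in lborel. g y * indicator {1..1} y = 0"
      using AE_lborel_singleton[of "1::real"] by eventually_elim auto
    moreover have "AE s in lborel. f (exp s) * indicator {0..0::real} s = 0"
      using AE_lborel_singleton[of "0::real"] by eventually_elim auto
    ultimately show ?thesis using True by (simp add: nn_integral_0_iff_AE)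
  next
    case False
    have "(\<integral>\<^sup>+y. g y * indicator {exp (- real n)..exp (real n)} y \<partial>lborel) =
      (\<integral>\<^sup>+s. g (exp s) * ennreal (exp s) * indicator {- real n..real n} s \<partial>lborel)"
      by (rule nn_integral_substitution_aux) (use False in \<open>auto intro!: continuous_intros derivative_eq_intros\<close>)
    moreover have "g (exp s) * ennreal (exp s) = f (exp s)" for s
      by (simp add: g_def mult.assoc flip: ennreal_mult)
    ultimately show ?thesis by simp
  qed
  have "(\<integral>\<^sup>+y. g y \<partial>lborel) = (\<integral>\<^sup>+y. (SUP n. g y * indicator {exp (- real n)..exp (real n)} y) \<partial>lborel)"
  proof (intro nn_integral_cong)
    fix y :: real
    show "g y = (SUP n. g y * indicator {exp (- real n)..exp (real n)} y)"
    proof (cases "y > 0")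
      case True
      obtain n where "\<bar>ln y\<bar> \<le> real n" using real_arch_simple by blast
      hence "- real n \<le> ln y" "ln y \<le> real n" by linarith+
      hence "exp (- real n) \<le> exp (ln y)" "exp (ln y) \<le> exp (real n)" by (simp_all only: exp_le_cancel_iff)
      hence "g y * indicator {exp (- real n)..exp (real n)} y = g y" using True by simp
      thus ?thesis by (intro antisym SUP_least) (auto intro!: SUP_upper2[of n] simp: indicator_def)
    qed (auto simp: g_def)
  qed
  also have "\<dots> = (SUP n. \<integral>\<^sup>+y. g y * indicator {exp (- real n)..exp (real n)} y \<partial>lborel)"
  proof (rule nn_integral_monotone_convergence_SUP)
    show "incseq (\<lambda>n y. g y * indicator {exp (- real n)..exp (real n)} y)"
    proof (rule incseq_SucI, rule le_funI)
      fix n :: nat and y :: real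
      have mono: "indicator A y \<le> (indicator B y :: ennreal)" if "A \<subseteq> B" for A B
        using that by (auto simp: indicator_def)
      have "{exp (- real n)..exp (real n)} \<subseteq> {exp (- real (Suc n))..exp (real (Suc n))}" by simp
      hence "indicator {exp (- real n)..exp (real n)} y \<le> (indicator {exp (- real (Suc n))..exp (real (Suc n))} y :: ennreal)"
        by (rule mono)
      thus "g y * indicator {exp (- real n)..exp (real n)} y \<le> g y * indicator {exp (- real (Suc n))..exp (real (Suc n))} y"
        by (rule mult_left_mono) simp
    qed
  qed measurable
  also have "\<dots> = (SUP n. \<integral>\<^sup>+s. f (exp s) * indicator {- real n..real n} s \<partial>lborel)"
    by (simp only: 1)
  also have "\<dots> = (\<integral>\<^sup>+s. (SUP n. f (exp s) * indicator {- real n..real n} s) \<partial>lborel)"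
    by (rule nn_integral_monotone_convergence_SUP[symmetric])
      (auto simp: incseq_def le_fun_def indicator_def)
  also have "\<dots> = (\<integral>\<^sup>+s. f (exp s) \<partial>lborel)"
  proof (intro nn_integral_cong)
    fix s :: real
    obtain n where "\<bar>s\<bar> \<le> real n" using real_arch_simple by blast
    hence "f (exp s) * indicator {- real n..real n} s = f (exp s)" by (auto simp: indicator_def)
    thus "(SUP n. f (exp s) * indicator {- real n..real n} s) = f (exp s)"
      by (intro antisym SUP_least) (auto intro!: SUP_upper2[of n] simp: indicator_def)
  qed
  finally show ?thesis by (simp add: g_def)
qed

text \<open>Fubini with y outside, then x = y t on each horizontal line and y = exp s, so that dx dy
  / y^2 = dt dy / y = dt ds.\<close>

lemma nn_integral_hyp:
  assumes [measurable]: "f \<in> borel_measurable borel"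
  shows "(\<integral>\<^sup>+z. f z \<partial>hyp) = (\<integral>\<^sup>+s. \<integral>\<^sup>+t. f (hpt s t) \<partial>lborel \<partial>lborel)"
proof -
  have mC [measurable]: "(\<lambda>(x, y). Complex x y) \<in> borel_measurable (borel \<Otimes>\<^sub>M borel)"
    unfolding Complex_eq by measurable
  have [measurable]: "(\<lambda>x. Complex (u x) (v x)) \<in> borel_measurable M"
    if "u \<in> borel_measurable M" "v \<in> borel_measurable M" for u v and M :: "'z measure"
    unfolding Complex_eq using that by measurable
  have "(\<integral>\<^sup>+z. f z \<partial>hyp) = (\<integral>\<^sup>+z. ennreal (indicator upper_half_plane z / (Im z)\<^sup>2) * f z \<partial>lborel)"
    unfolding hyp_def by (subst nn_integral_density) simp_all
  also have "\<dots> = (\<integral>\<^sup>+(x, y). ennreal (indicator upper_half_plane (Complex x y) / y\<^sup>2) * f (Complex x y) \<partial>(lborel \<Otimes>\<^sub>M lborel))"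
    by (subst lborel_complex, subst nn_integral_distr) (auto intro!: nn_integral_cong)
  also have "\<dots> = (\<integral>\<^sup>+y. \<integral>\<^sup>+x. ennreal (indicator upper_half_plane (Complex x y) / y\<^sup>2) * f (Complex x y) \<partial>lborel \<partial>lborel)"
    by (subst lborel_pair.nn_integral_snd[symmetric]) simp_all
  also have "\<dots> = (\<integral>\<^sup>+y. (\<integral>\<^sup>+t. f (Complex (y * t) y) \<partial>lborel) * ennreal (indicator {0<..} y / y) \<partial>lborel)"
  proof (intro nn_integral_cong)
    fix y :: real
    show "(\<integral>\<^sup>+x. ennreal (indicator upper_half_plane (Complex x y) / y\<^sup>2) * f (Complex x y) \<partial>lborel) =
      (\<integral>\<^sup>+t. f (Complex (y * t) y) \<partial>lborel) * ennreal (indicator {0<..} y / y)"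
    proof (cases "y > 0")
      case True
      have "(\<integral>\<^sup>+x. ennreal (indicator upper_half_plane (Complex x y) / y\<^sup>2) * f (Complex x y) \<partial>lborel) =
         ennreal (1 / y\<^sup>2) * (\<integral>\<^sup>+x. f (Complex x y) \<partial>lborel)"
        using True by (subst nn_integral_cmult[symmetric]) (auto simp: upper_half_plane_def)
      also have "(\<integral>\<^sup>+x. f (Complex x y) \<partial>lborel) = ennreal \<bar>y\<bar> * (\<integral>\<^sup>+t. f (Complex (0 + y * t) y) \<partial>lborel)"
        by (rule nn_integral_real_affine) (use True in auto)
      finally show ?thesis using True
        by (simp add: mult.assoc[symmetric] ennreal_mult[symmetric] power2_eq_square mult.commute)
    next
      case False
      hence "indicator upper_half_plane (Complex x y) = (0::real)" "indicator {0<..} y = (0::real)" for x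
        by (auto simp: upper_half_plane_def indicator_def)
      thus ?thesis by simp
    qed
  qed
  also have "\<dots> = (\<integral>\<^sup>+s. \<integral>\<^sup>+t. f (Complex (exp s * t) (exp s)) \<partial>lborel \<partial>lborel)"
    by (rule nn_integral_exp_substitution) measurable
  moreover have "Complex (exp s * t) (exp s) = hpt s t" for s t
    by (simp add: complex_eq_iff)
  ultimately show ?thesis by simp
qed

lemma hyp_eq_distr: "hyp = distr (lborel \<Otimes>\<^sub>M lborel) borel (\<lambda>(s, t). hpt s t)"
proof (rule measure_eqI)
  fix A assume "A \<in> sets hyp"
  hence [measurable]: "A \<in> sets borel" by simp
  have "emeasure hyp A = (\<integral>\<^sup>+z. indicator A z \<partial>hyp)" by (simp)
  also have "\<dots> = (\<integral>\<^sup>+s. \<integral>\<^sup>+t. indicator A (hpt s t) \<partial>lborel \<partial>lborel)" by (rule nn_integral_hyp) simp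
  also have "\<dots> = (\<integral>\<^sup>+(s, t). indicator A (hpt s t) \<partial>(lborel \<Otimes>\<^sub>M lborel))"
    by (subst lborel.nn_integral_fst[symmetric]) (simp_all)
  also have "\<dots> = (\<integral>\<^sup>+z. indicator A z \<partial>distr (lborel \<Otimes>\<^sub>M lborel) borel (\<lambda>(s, t). hpt s t))"
    by (subst nn_integral_distr) (auto intro!: nn_integral_cong)
  also have "\<dots> = emeasure (distr (lborel \<Otimes>\<^sub>M lborel) borel (\<lambda>(s, t). hpt s t)) A" by simp
  finally show "emeasure hyp A = emeasure (distr (lborel \<Otimes>\<^sub>M lborel) borel (\<lambda>(s, t). hpt s t)) A" .
qed simp

lemma sigma_finite_hyp: "sigma_finite_measure hyp"
  unfolding hyp_def
  by (subst sigma_finite_measure.sigma_finite_iff_density_finite[OF sigma_finite_lborel]) (auto)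

interpretation hyp: sigma_finite_measure hyp by (rule sigma_finite_hyp)

section \<open>Invariance of the hyperbolic measure under SL2(R)\<close>

lemma nn_integral_hyp_cong:
  "(\<And>z. z \<in> upper_half_plane \<Longrightarrow> f z = g z) \<Longrightarrow> (\<integral>\<^sup>+z. f z \<partial>hyp) = (\<integral>\<^sup>+z. g z \<partial>hyp)"
  using AE_hyp by (intro nn_integral_cong_AE) (auto elim!: eventually_mono)

text \<open>The map z -> a z + b shifts s by ln a and t by b exp(-s) / a; the second shift depends
  on s only, so integrating over t first removes it.\<close>

lemma nn_integral_hyp_affine:
  assumes [measurable]: "f \<in> borel_measurable borel" and a: "a > 0"
  shows "(\<integral>\<^sup>+z. f (of_real a * z + of_real b) \<partial>hyp) = (\<integral>\<^sup>+z. f z \<partial>hyp)"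
proof -
  have eq: "of_real a * hpt s t + of_real b = hpt (ln a + 1 * s) (b / a * exp (- s) + 1 * t)" for s t
    using a by (simp add: complex_eq_iff exp_add exp_minus field_simps)
  have "(\<integral>\<^sup>+z. f (of_real a * z + of_real b) \<partial>hyp) = 
      (\<integral>\<^sup>+s. \<integral>\<^sup>+t. f (hpt (ln a + 1 * s) (b / a * exp (- s) + 1 * t)) \<partial>lborel \<partial>lborel)"
    by (subst nn_integral_hyp) (simp_all only: eq, measurable)
  also have "\<dots> = (\<integral>\<^sup>+s. \<integral>\<^sup>+t. f (hpt (ln a + 1 * s) t) \<partial>lborel \<partial>lborel)"
  proof (rule nn_integral_cong)
    fix s :: real
    show "(\<integral>\<^sup>+t. f (hpt (ln a + 1 * s) (b / a * exp (- s) + 1 * t)) \<partial>lborel) = (\<integral>\<^sup>+t. f (hpt (ln a + 1 * s) t) \<partial>lborel)"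
      using nn_integral_real_affine[of "\<lambda>t. f (hpt (ln a + 1 * s) t)" 1 "b / a * exp (- s)"] by simp
  qed
  also have "\<dots> = (\<integral>\<^sup>+s. \<integral>\<^sup>+t. f (hpt s t) \<partial>lborel \<partial>lborel)"
    using nn_integral_real_affine[of "\<lambda>s. \<integral>\<^sup>+t. f (hpt s t) \<partial>lborel" 1 "ln a"] by simp
  finally show ?thesis by (simp add: nn_integral_hyp)
qed

lemma hpt_inversion: "- 1 / hpt s t = hpt (- ln (1 + t\<^sup>2) - s) (- t)"
proof -
  have "1 + t\<^sup>2 > 0" by (rule add_pos_nonneg) auto
  hence e: "exp (- ln (1 + t\<^sup>2) - s) = 1 / (exp s * (1 + t\<^sup>2))"
    by (simp add: exp_diff exp_minus field_simps)
  have nz: "1 + complex_of_real t ^ 2 \<noteq> 0" using \<open>1 + t\<^sup>2 > 0\<close>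
    by (metis less_irrefl of_real_1 of_real_add of_real_eq_0_iff of_real_power)
  have "hpt (- ln (1 + t\<^sup>2) - s) (- t) * hpt s t = 
     of_real (1 / (exp s * (1 + t\<^sup>2))) * (of_real (exp s) * ((of_real (- t) + \<i>) * (of_real t + \<i>)))"
    unfolding hpt_def e by (simp only: mult_ac)
  also have "(of_real (- t) + \<i>) * (of_real t + \<i>) = - of_real (1 + t\<^sup>2)"
    by (simp add: complex_eq_iff power2_eq_square)
  also have "of_real (1 / (exp s * (1 + t\<^sup>2))) * (of_real (exp s) * - complex_of_real (1 + t\<^sup>2)) = - 1"
    using nz by (simp add: exp_of_real[symmetric] divide_simps)
  finally have "hpt (- ln (1 + t\<^sup>2) - s) (- t) * hpt s t = - 1" .
  moreover have "hpt s t \<noteq> 0" by (simp add: complex_eq_iff)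
  ultimately show ?thesis by (metis nonzero_divide_eq_eq)
qed

text \<open>For fixed t the inversion sends t to -t and reflects s about -ln(1 + t^2) / 2; the order
  of integration is exchanged so that s can be dealt with first.\<close>

lemma nn_integral_hyp_inversion:
  assumes [measurable]: "f \<in> borel_measurable borel"
  shows "(\<integral>\<^sup>+z. f (- 1 / z) \<partial>hyp) = (\<integral>\<^sup>+z. f z \<partial>hyp)"
proof -
  have eq: "- 1 / hpt s t = hpt (- ln (1 + t\<^sup>2) + (- 1) * s) (- t)" for s t
    using hpt_inversion[of s t] by simp
  have "(\<integral>\<^sup>+z. f (- 1 / z) \<partial>hyp) = 
      (\<integral>\<^sup>+s. \<integral>\<^sup>+t. f (hpt (- ln (1 + t\<^sup>2) + (- 1) * s) (- t)) \<partial>lborel \<partial>lborel)"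
    by (subst nn_integral_hyp) (simp_all only: eq, measurable)
  also have "\<dots> = (\<integral>\<^sup>+t. \<integral>\<^sup>+s. f (hpt (- ln (1 + t\<^sup>2) + (- 1) * s) (- t)) \<partial>lborel \<partial>lborel)"
    by (rule lborel_pair.Fubini') measurable
  also have "\<dots> = (\<integral>\<^sup>+t. \<integral>\<^sup>+s. f (hpt s (- t)) \<partial>lborel \<partial>lborel)"
  proof (rule nn_integral_cong)
    fix t :: real
    show "(\<integral>\<^sup>+s. f (hpt (- ln (1 + t\<^sup>2) + (- 1) * s) (- t)) \<partial>lborel) = (\<integral>\<^sup>+s. f (hpt s (- t)) \<partial>lborel)"
      using nn_integral_real_affine[of "\<lambda>s. f (hpt s (- t))" "- 1" "- ln (1 + t\<^sup>2)"] by simp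
  qed
  also have "\<dots> = (\<integral>\<^sup>+t. \<integral>\<^sup>+s. f (hpt s t) \<partial>lborel \<partial>lborel)"
    using nn_integral_real_affine[of "\<lambda>t. \<integral>\<^sup>+s. f (hpt s t) \<partial>lborel" "- 1" 0] by simp
  also have "\<dots> = (\<integral>\<^sup>+s. \<integral>\<^sup>+t. f (hpt s t) \<partial>lborel \<partial>lborel)"
    by (rule lborel_pair.Fubini') measurable
  finally show ?thesis by (simp add: nn_integral_hyp)
qed

lemma measurable_moebius_act [measurable]: "moebius_act g \<in> borel_measurable borel"
  unfolding moebius_act_def moebius_def by measurable

text \<open>Bruhat decomposition: for c = 0 the map is affine with slope a^2, and otherwise it is
  a/c - 1 / (c^2 z + c d), an affine map followed by the inversion and a translation.\<close>

lemma nn_integral_hyp_moebius: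
  assumes [measurable]: "f \<in> borel_measurable borel" and det: "det g = 1"
  shows "(\<integral>\<^sup>+z. f (moebius_act g z) \<partial>hyp) = (\<integral>\<^sup>+z. f z \<partial>hyp)"
proof -
  define a b c d where "a = g$1$1" "b = g$1$2" "c = g$2$1" "d = g$2$2"
  note defs = this
  have d1: "a * d - b * c = 1" using det by (simp add: det_2 defs)
  hence d1': "of_real a * of_real d - of_real b * of_real c = (1 :: complex)"
    by (simp flip: of_real_mult of_real_diff)
  show ?thesis
  proof (cases "c = 0")
    case True
    with d1 have a: "a \<noteq> 0" "d = 1 / a" by (auto simp: divide_simps mult.commute)
    have "moebius_act g z = of_real (a\<^sup>2) * z + of_real (a * b)" for z
      using True a(1) by (simp add: moebius_act_eq aut_def defs[symmetric] a(2) field_simps power2_eq_square)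
    thus ?thesis using nn_integral_hyp_affine[of f "a\<^sup>2" "a * b"] a by simp
  next
    case False
    have eq: "moebius_act g z = of_real 1 * (- 1 / (of_real (c\<^sup>2) * z + of_real (c * d))) + of_real (a / c)"
      if z: "z \<in> upper_half_plane" for z
    proof -
      have nz: "of_real c * z + of_real d \<noteq> 0" using aut_nz[OF det z] by (simp add: aut_def defs)
      have c: "complex_of_real c \<noteq> 0" using False by simp
      have "of_real (c\<^sup>2) * z + of_real (c * d) = of_real c * (of_real c * z + of_real d)"
        by (simp add: power2_eq_square algebra_simps)
      moreover have "(of_real a * z + of_real b) / (of_real c * z + of_real d) = 
         (- 1 / (of_real c * (of_real c * z + of_real d))) + of_real a / of_real c"
      proof -
        have "of_real a * of_real d = 1 + of_real b * (of_real c :: complex)" using d1' by (simp add: algebra_simps)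
        thus ?thesis using nz c by (simp add: divide_simps) (simp add: algebra_simps)
      qed
      ultimately show ?thesis by (simp add: moebius_act_eq aut_def defs[symmetric])
    qed
    have "(\<integral>\<^sup>+z. f (moebius_act g z) \<partial>hyp) = (\<integral>\<^sup>+z. f (of_real 1 * (- 1 / (of_real (c\<^sup>2) * z + of_real (c * d))) + of_real (a / c)) \<partial>hyp)"
      by (rule nn_integral_hyp_cong) (simp only: eq)
    also have "\<dots> = (\<integral>\<^sup>+z. f (of_real 1 * (- 1 / z) + of_real (a / c)) \<partial>hyp)"
      by (rule nn_integral_hyp_affine) (use False in auto)
    also have "\<dots> = (\<integral>\<^sup>+z. f (of_real 1 * z + of_real (a / c)) \<partial>hyp)"
      by (rule nn_integral_hyp_inversion[where f = "\<lambda>z. f (of_real 1 * z + of_real (a / c))"]) measurable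
    also have "\<dots> = (\<integral>\<^sup>+z. f z \<partial>hyp)"
      by (rule nn_integral_hyp_affine) auto
    finally show ?thesis .
  qed
qed

lemma distr_hyp_moebius: "det g = 1 \<Longrightarrow> distr hyp borel (moebius_act g) = hyp"
proof (rule measure_eqI)
  fix A assume det: "det g = 1" and "A \<in> sets (distr hyp borel (moebius_act g))"
  hence [measurable]: "A \<in> sets borel" by simp
  have "emeasure (distr hyp borel (moebius_act g)) A = (\<integral>\<^sup>+z. indicator A z \<partial>distr hyp borel (moebius_act g))" by simp
  also have "\<dots> = (\<integral>\<^sup>+z. indicator A (moebius_act g z) \<partial>hyp)"
    by (subst nn_integral_distr) simp_all
  also have "\<dots> = emeasure hyp A" using det by (subst nn_integral_hyp_moebius) simp_all
  finally show "emeasure (distr hyp borel (moebius_act g)) A = emeasure hyp A" .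
qed simp

lemma null_sets_hyp_moebius:
  assumes "det g = 1" "A \<in> null_sets hyp"
  shows "moebius_act g -` A \<in> null_sets hyp"
proof -
  have "A \<in> null_sets (distr hyp borel (moebius_act g))" using assms distr_hyp_moebius by simp
  thus ?thesis using assms by (subst (asm) null_sets_distr_iff) (auto)
qed


section \<open>Discrete groups and fundamental domains\<close>

text \<open>Discreteness of lattice cosets and of groups is used in this form: all entries lie in
  (1/D) Z, so bounded regions contain finitely many such matrices.\<close>

definition denominator_bounded :: "nat \<Rightarrow> mat2 \<Rightarrow> bool" where
  "denominator_bounded D X \<longleftrightarrow> (\<forall>i j. real D * X $ i $ j \<in> \<int>)"

lemma finite_denominator_bounded:
  assumes "D > 0"
  shows "finite {X. denominator_bounded D X \<and> (\<forall>i j. \<bar>X $ i $ j\<bar> \<le> B)}"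
proof -
  define I where "I = (\<lambda>n::int. real_of_int n / real D) ` {- \<lceil>real D * B\<rceil>..\<lceil>real D * B\<rceil>}"
  have "x \<in> I" if x: "real D * x \<in> \<int>" "\<bar>x\<bar> \<le> B" for x
  proof -
    obtain n where n: "real D * x = of_int n" using x(1) by (auto elim: Ints_cases)
    have "\<bar>real D * x\<bar> \<le> real D * B" using x(2) assms by (simp add: abs_mult)
    hence "\<bar>real_of_int n\<bar> \<le> real D * B" by (simp add: n)
    hence "n \<in> {- \<lceil>real D * B\<rceil>..\<lceil>real D * B\<rceil>}" by (auto simp: abs_le_iff) linarith+
    moreover have "x = real_of_int n / real D" using n assms by (simp add: field_simps)
    ultimately show ?thesis by (auto simp: I_def)
  qed
  hence "{X. denominator_bounded D X \<and> (\<forall>i j. \<bar>X $ i $ j\<bar> \<le> B)} \<subseteq>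
     (\<lambda>(a, b, c, d). M2 a b c d) ` (I \<times> I \<times> I \<times> I)"
    by (intro subsetI, rule_tac x = "(x $ 1 $ 1, x $ 1 $ 2, x $ 2 $ 1, x $ 2 $ 2)" in image_eqI)
      (auto simp: denominator_bounded_def M2_collapse)
  moreover have "finite I" by (simp add: I_def)
  ultimately show ?thesis by (meson finite_SigmaI finite_imageI finite_subset)
qed

lemma denominator_bounded_countable:
  assumes "D > 0"
  shows "countable {X. denominator_bounded D X}"
proof -
  have "{X. denominator_bounded D X} \<subseteq> (\<Union>n::nat. {X. denominator_bounded D X \<and> (\<forall>i j. \<bar>X $ i $ j\<bar> \<le> real n)})"
  proof
    fix X assume X: "X \<in> {X. denominator_bounded D X}"
    obtain n where "Max (range (\<lambda>(i, j). \<bar>X $ i $ j\<bar>)) \<le> real n" using real_arch_simple by blast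
    hence "\<bar>X $ i $ j\<bar> \<le> real n" for i j
      using Max_ge[of "range (\<lambda>(i, j). \<bar>X $ i $ j\<bar>)" "\<bar>X $ i $ j\<bar>"] by fastforce
    thus "X \<in> (\<Union>n::nat. {X. denominator_bounded D X \<and> (\<forall>i j. \<bar>X $ i $ j\<bar> \<le> real n)})"
      using X by blast
  qed
  thus ?thesis
    by (rule countable_subset) (intro countable_UN countableI_type countable_finite finite_denominator_bounded assms)
qed

text \<open>A congruence subgroup of SL2(Q) need not be integral, but its entries have a common
  denominator \<open>D\<close>, which provides discreteness. The axioms survive adjoining -1, see
  \<open>pm_fuchsian\<close>.\<close>

locale fuchsian =
  fixes \<Gamma> :: "mat2 set" and D :: nat
  assumes det1: "g \<in> \<Gamma> \<Longrightarrow> det g = 1"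
    and one_mem: "mat 1 \<in> \<Gamma>"
    and mult_mem: "g \<in> \<Gamma> \<Longrightarrow> h \<in> \<Gamma> \<Longrightarrow> g ** h \<in> \<Gamma>"
    and inv_mem: "g \<in> \<Gamma> \<Longrightarrow> matrix_inv g \<in> \<Gamma>"
    and D_pos: "D > 0"
    and denominator: "g \<in> \<Gamma> \<Longrightarrow> denominator_bounded D g"
begin

lemma finite_bounded: "finite {g \<in> \<Gamma>. \<forall>i j. \<bar>g $ i $ j\<bar> \<le> B}"
  by (rule finite_subset[OF _ finite_denominator_bounded[OF D_pos, of B]]) (auto dest: denominator)

lemma countable_group: "countable \<Gamma>"
  by (rule countable_subset[OF _ denominator_bounded_countable[OF D_pos]]) (auto dest: denominator)

lemma group_rational: "g \<in> \<Gamma> \<Longrightarrow> g $ i $ j \<in> \<rat>"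
proof -
  assume "g \<in> \<Gamma>"
  hence "real D * g $ i $ j \<in> \<rat>" using denominator Ints_subset_Rats by (auto simp: denominator_bounded_def)
  hence "(real D * g $ i $ j) / real D \<in> \<rat>" by (intro Rats_divide) auto
  thus ?thesis using D_pos by simp
qed

lemma uminus_mem_iff: "g \<in> \<Gamma> \<Longrightarrow> - g \<in> \<Gamma> \<longleftrightarrow> - mat 1 \<in> \<Gamma>"
proof
  assume g: "g \<in> \<Gamma>"
  have "matrix_inv g ** (- g) = - mat 1" using matrix_inv_left[OF det1[OF g]] by simp
  thus "- g \<in> \<Gamma> \<Longrightarrow> - mat 1 \<in> \<Gamma>" using mult_mem inv_mem g by metis
  have "g ** (- mat 1) = - g" by (simp add: mat2_eq_iff mat2_mult_nth)
  thus "- mat 1 \<in> \<Gamma> \<Longrightarrow> - g \<in> \<Gamma>" using mult_mem g by metis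
qed

definition center_order :: nat where
  "center_order = card (\<Gamma> \<inter> {mat 1, - mat 1})"

lemma center_order_pos: "center_order > 0"
  using one_mem by (auto simp: center_order_def card_gt_0_iff)

lemma det1_neq_uminus: "det g = 1 \<Longrightarrow> g \<noteq> - (g :: mat2)"
  by (auto simp: mat2_eq_iff det_2)

text \<open>An element of SL2(R) is determined up to sign by its action on the half-plane; how many
  signs occur in the group is the same for all elements, namely two if it contains -1 and one
  otherwise.\<close>

lemma card_pm: assumes "g \<in> \<Gamma> \<or> - g \<in> \<Gamma>" shows "card (\<Gamma> \<inter> {g, - g}) = center_order"
proof -
  have *: "card (\<Gamma> \<inter> {g, - g}) = center_order" if g: "g \<in> \<Gamma>" for g
  proof (cases "- mat 1 \<in> \<Gamma>")
    case True
    hence "\<Gamma> \<inter> {g, - g} = {g, - g}" "\<Gamma> \<inter> {mat 1, - mat 1} = {mat 1, - mat 1}"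
      using uminus_mem_iff[OF g] g one_mem by auto
    thus ?thesis using det1_neq_uminus[OF det1[OF g]] det1_neq_uminus[of "mat 1"]
      by (simp add: center_order_def)
  next
    case False
    hence "\<Gamma> \<inter> {g, - g} = {g}" "\<Gamma> \<inter> {mat 1, - mat 1} = {mat 1}"
      using uminus_mem_iff[OF g] g one_mem by auto
    thus ?thesis by (simp add: center_order_def)
  qed
  show ?thesis using assms *[of g] *[of "- g"] by (auto simp: insert_commute)
qed

lemma pm_fuchsian: "fuchsian (\<Gamma> \<union> uminus ` \<Gamma>) D"
proof
  show "det g = 1" if "g \<in> \<Gamma> \<union> uminus ` \<Gamma>" for g using that det1 by auto
  show "g ** h \<in> \<Gamma> \<union> uminus ` \<Gamma>" if "g \<in> \<Gamma> \<union> uminus ` \<Gamma>" "h \<in> \<Gamma> \<union> uminus ` \<Gamma>" for g h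
    using that mult_mem by (auto simp: image_iff)
  show "matrix_inv g \<in> \<Gamma> \<union> uminus ` \<Gamma>" if "g \<in> \<Gamma> \<union> uminus ` \<Gamma>" for g
    using that inv_mem det1 by (auto simp: image_iff matrix_inv_uminus)
  show "denominator_bounded D g" if "g \<in> \<Gamma> \<union> uminus ` \<Gamma>" for g
    using that denominator by (auto simp: denominator_bounded_def)
qed (use one_mem D_pos in auto)

end

section \<open>The modular group and congruence subgroups\<close>

lemma det1_SL2Z: "g \<in> SL2Z \<Longrightarrow> det g = 1" by (simp add: SL2Z_def)

lemma fuchsian_SL2Z: "fuchsian SL2Z 1"
proof
  show "g ** h \<in> SL2Z" if "g \<in> SL2Z" "h \<in> SL2Z" for g h
    using that by (auto simp: SL2Z_def det_mul mat2_mult_nth)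
  show "matrix_inv g \<in> SL2Z" if "g \<in> SL2Z" for g
    using that matrix_inv_nth[of g] det_matrix_inv[of g] by (auto simp: SL2Z_def forall_2)
  show "mat 1 \<in> SL2Z" by (auto simp: SL2Z_def forall_2)
qed (auto simp: SL2Z_def denominator_bounded_def)

interpretation SL2Z: fuchsian SL2Z 1 by (rule fuchsian_SL2Z)

lemma rational_common_denominator:
  assumes "finite S" "S \<subseteq> \<rat>"
  shows "\<exists>D::nat. D > 0 \<and> (\<forall>x\<in>S. real D * x \<in> \<int>)"
  using assms
proof (induction S rule: finite_induct)
  case (insert x S)
  then obtain D where D: "D > 0" "\<forall>x\<in>S. real D * x \<in> \<int>" by auto
  obtain a b where ab: "b > 0" "x = of_int a / of_int b" using insert.prems by (auto elim: Rats_cases')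
  have "real (nat b) * x = of_int a" using ab by simp
  hence "real (nat b) * x \<in> \<int>" by (metis Ints_of_int)
  hence "real D * (real (nat b) * x) \<in> \<int>" by (rule Ints_mult[OF Ints_of_nat])
  moreover have "real (nat b) * (real D * y) \<in> \<int>" if "y \<in> S" for y using D that by (auto intro: Ints_mult[OF Ints_of_nat])
  ultimately have "\<forall>y\<in>insert x S. real (D * nat b) * y \<in> \<int>" by (simp add: ac_simps)
  moreover have "D * nat b > 0" using D ab by simp
  ultimately show ?case by blast
qed (auto intro: exI[of _ 1])

lemma rational_mat_common_denominator:
  assumes "finite S" "\<And>X. X \<in> S \<Longrightarrow> rational_mat X"
  shows "\<exists>D::nat. D > 0 \<and> (\<forall>X\<in>S. denominator_bounded D X)"
proof -
  have "finite (\<Union>X\<in>S. range (\<lambda>(i, j). X $ i $ j))" using assms by auto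
  moreover have "(\<Union>X\<in>S. range (\<lambda>(i, j). X $ i $ j)) \<subseteq> \<rat>" using assms by (auto simp: rational_mat_def)
  ultimately obtain D :: nat where "D > 0" "\<forall>x\<in>(\<Union>X\<in>S. range (\<lambda>(i, j). X $ i $ j)). real D * x \<in> \<int>"
    using rational_common_denominator by blast
  thus ?thesis by (intro exI[of _ D]) (auto simp: denominator_bounded_def)
qed

lemma denominator_bounded_mult_SL2Z:
  assumes "denominator_bounded D X" "g \<in> SL2Z"
  shows "denominator_bounded D (X ** g)" "denominator_bounded D (g ** X)"
proof -
  have X: "real D * X $ i $ j \<in> \<int>" and g: "g $ i $ j \<in> \<int>" for i j
    using assms by (auto simp: denominator_bounded_def SL2Z_def)
  have "real D * (X ** g) $ i $ j = (real D * X $ i $ 1) * g $ 1 $ j + (real D * X $ i $ 2) * g $ 2 $ j"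
    "real D * (g ** X) $ i $ j = g $ i $ 1 * (real D * X $ 1 $ j) + g $ i $ 2 * (real D * X $ 2 $ j)" for i j
    by (simp_all add: mat2_mult_nth algebra_simps)
  note eq = this
  show "denominator_bounded D (X ** g)" "denominator_bounded D (g ** X)"
    unfolding denominator_bounded_def eq by (intro allI conjI Ints_add Ints_mult X g)+
qed

text \<open>The group is a finite union of cosets of Gamma(n); a common denominator of the finitely
  many rational representatives survives multiplication by integral matrices.\<close>

lemma congruence_subgroup_fuchsian:
  assumes "congruence_subgroup \<Gamma>"
  shows "\<exists>D. fuchsian \<Gamma> D"
proof -
  from assms obtain n where G: "\<Gamma> \<subseteq> SL2Q" "mat 1 \<in> \<Gamma>" "\<And>g g'. g \<in> \<Gamma> \<Longrightarrow> g' \<in> \<Gamma> \<Longrightarrow> g ** g' \<in> \<Gamma>"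
    "\<And>g. g \<in> \<Gamma> \<Longrightarrow> matrix_inv g \<in> \<Gamma>" and n: "n \<ge> 1" "principal_congruence n \<subseteq> \<Gamma>"
    and fin: "finite ((\<lambda>g. (\<lambda>d. g ** d) ` principal_congruence n) ` \<Gamma>)"
    by (auto simp: congruence_subgroup_def)
  from fin obtain T where T: "T \<subseteq> \<Gamma>" "finite T"
    "(\<lambda>g. (\<lambda>d. g ** d) ` principal_congruence n) ` \<Gamma> = (\<lambda>g. (\<lambda>d. g ** d) ` principal_congruence n) ` T"
    using finite_subset_image[OF fin subset_refl] by metis
  have "rational_mat X" if "X \<in> T" for X using that T G by (auto simp: SL2Q_def)
  then obtain D where D: "D > 0" "\<forall>X\<in>T. denominator_bounded D X"
    using rational_mat_common_denominator[OF T(2)] by blast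
  have pc: "principal_congruence n \<subseteq> SL2Z" by (auto simp: principal_congruence_def)
  have id: "mat 1 \<in> principal_congruence n"
    using SL2Z.one_mem by (auto simp: principal_congruence_def intro!: exI[of _ 0])
  have "fuchsian \<Gamma> D"
  proof
    fix g assume g: "g \<in> \<Gamma>"
    show "det g = 1" using g G by (auto simp: SL2Q_def)
    from g have "(\<lambda>d. g ** d) ` principal_congruence n \<in> (\<lambda>g. (\<lambda>d. g ** d) ` principal_congruence n) ` T"
      using T(3) by blast
    then obtain t where t: "t \<in> T" "(\<lambda>d. g ** d) ` principal_congruence n = (\<lambda>d. t ** d) ` principal_congruence n"
      by auto
    have "g \<in> (\<lambda>d. g ** d) ` principal_congruence n" using id by (auto intro!: image_eqI[of _ _ "mat 1"])
    then obtain d where "d \<in> principal_congruence n" "g = t ** d" using t by auto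
    thus "denominator_bounded D g" using denominator_bounded_mult_SL2Z(1)[of D t d] D t pc by auto
  qed (use D G in auto)
  thus ?thesis by blast
qed

text \<open>The centre \<open>i 2\<^sup>1\<^sup>/\<^sup>4\<close> of the Dirichlet domain: its height has irrational square, so only \<open>\<plusminus>1\<close>
  among the rational matrices fixes it, and exceeds 1, so that for \<open>SL\<^sub>2(\<int>)\<close> the usual domain results.\<close>

definition base_height :: real where "base_height = sqrt (sqrt 2)"

text \<open>If d is the hyperbolic distance from z to i t with t = \<open>base_height\<close>, this
  is 2 t (cosh d - 1); comparing its values is comparing distances to the base point.\<close>

definition base_dist :: "complex \<Rightarrow> real" where
  "base_dist z = (cmod (z - \<i> * of_real base_height))\<^sup>2 / Im z"

lemma base_height: "base_height > 1" "base_height\<^sup>2 = sqrt 2"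
  by (simp_all add: base_height_def)

lemma base_dist_nonneg: "z \<in> upper_half_plane \<Longrightarrow> base_dist z \<ge> 0"
  by (simp add: base_dist_def upper_half_plane_def)

lemma base_dist_eq: "base_dist z = ((Re z)\<^sup>2 + (Im z - base_height)\<^sup>2) / Im z"
  by (simp add: base_dist_def cmod_power2)

lemma base_dist_moebius:
  assumes "det g = 1" "z \<in> upper_half_plane"
  shows "base_dist (moebius_act g z) = 
    (cmod (of_real (g$1$1) * z + of_real (g$1$2) - \<i> * of_real base_height * aut g z))\<^sup>2 / Im z"
proof -
  have nz: "aut g z \<noteq> 0" by (rule aut_nz[OF assms])
  have "moebius_act g z - \<i> * of_real base_height = 
    (of_real (g$1$1) * z + of_real (g$1$2) - \<i> * of_real base_height * aut g z) / aut g z"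
    using nz by (simp add: moebius_act_eq field_simps)
  thus ?thesis using nz unfolding base_dist_def Im_moebius_act[OF assms]
    by (simp add: norm_divide power_divide)
qed

lemma measurable_base_dist [measurable]: "base_dist \<in> borel_measurable borel"
  unfolding base_dist_def by measurable

lemma rational_sqrt_Ints:
  fixes x :: real
  assumes "x \<in> \<rat>" "x\<^sup>2 \<in> \<int>"
  shows "x \<in> \<int>"
proof -
  obtain a b where ab: "b > 0" "coprime a b" "x = of_int a / of_int b" using assms(1) by (rule Rats_cases')
  obtain n where "x\<^sup>2 = of_int n" using assms(2) by (rule Ints_cases)
  hence "real_of_int (a\<^sup>2) = real_of_int (n * b\<^sup>2)" using ab by (simp add: field_simps)
  hence "b dvd a\<^sup>2" by (simp only: of_int_eq_iff) (simp add: power2_eq_square)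
  moreover have "coprime b (a\<^sup>2)" using ab(2) by (simp add: coprime_commute)
  ultimately have "is_unit b" by (meson coprime_common_divisor dvd_refl)
  hence "b = 1" using ab(1) by auto
  thus ?thesis using ab by simp
qed

lemma sqrt2_irrational: "sqrt 2 \<notin> \<rat>"
proof
  assume "sqrt 2 \<in> \<rat>"
  hence "sqrt 2 \<in> \<int>" by (rule rational_sqrt_Ints) simp
  then obtain n :: int where n: "sqrt 2 = n" by (auto elim: Ints_cases)
  have "1 < sqrt 2" "sqrt 2 < 2" by (simp_all add: real_less_lsqrt)
  thus False unfolding n by simp
qed

text \<open>On each horizontal line the equation is polynomial of degree at most two in the real
  part, with leading and linear coefficients a^2 + t^2 c^2 - 1 and 2 a b + 2 t^2 c d. They do not
  both vanish, so every horizontal section is finite, and Fubini gives measure zero.\<close>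

lemma null_equidistant:
  assumes det: "det g = 1" and rat: "\<And>i j. g $ i $ j \<in> \<rat>" and ne: "g \<noteq> mat 1" "g \<noteq> - mat 1"
  shows "{z \<in> upper_half_plane. base_dist z = base_dist (moebius_act g z)} \<in> null_sets lborel"
proof -
  define a b c d t where "a = g$1$1" "b = g$1$2" "c = g$2$1" "d = g$2$2" "t = base_height"
  note defs = this
  have det': "a * d - b * c = 1" using det by (simp add: det_2 defs)
  define A where "A = {z \<in> upper_half_plane. base_dist z = base_dist (moebius_act g z)}"
  have [measurable]: "A \<in> sets borel" unfolding A_def by measurable
  have coeff: "a\<^sup>2 + t\<^sup>2 * c\<^sup>2 - 1 \<noteq> 0 \<or> 2 * a * b + 2 * t\<^sup>2 * c * d \<noteq> 0"
  proof (rule ccontr)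
    assume "\<not> ?thesis"
    hence 1: "a\<^sup>2 + sqrt 2 * c\<^sup>2 = 1" and 2: "2 * a * b + 2 * t\<^sup>2 * c * d = 0" using base_height by (auto simp: defs)
    \<comment> \<open>As t^2 = sqrt 2 is irrational while a and c are rational, the vanishing of the
      leading coefficient splits into c = 0 and a^2 = 1.\<close>
    have "c = 0"
    proof (rule ccontr)
      assume "c \<noteq> 0"
      hence "sqrt 2 = (1 - a\<^sup>2) / c\<^sup>2" using 1 by (simp add: field_simps)
      also have "\<dots> \<in> \<rat>" using rat by (auto simp: defs)
      finally show False using sqrt2_irrational by simp
    qed
    with 1 have a: "a = 1 \<or> a = - 1" by (simp add: power2_eq_1_iff)
    with 2 det' \<open>c = 0\<close> have "b = 0" "d = a" by auto
    with a \<open>c = 0\<close> have "g = mat 1 \<or> g = - mat 1" by (auto simp: mat2_eq_iff defs)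
    with ne show False by blast
  qed
  have "finite {x. Complex x y \<in> A}" for y
  proof (cases "y > 0")
    case y: True
    define p where "p = [:(t * c * y + b)\<^sup>2 + (a * y - t * d)\<^sup>2 - (y - t)\<^sup>2, 2 * a * b + 2 * t\<^sup>2 * c * d, a\<^sup>2 + t\<^sup>2 * c\<^sup>2 - 1:]"
    have "p \<noteq> 0" using coeff by (auto simp: p_def)
    moreover have "poly p x = 0" if "Complex x y \<in> A" for x
    proof -
      have "base_dist (Complex x y) = base_dist (moebius_act g (Complex x y))" using that by (simp add: A_def)
      also have "\<dots> = (cmod (of_real a * (Complex x y) + of_real b - \<i> * of_real t * (of_real c * Complex x y + of_real d)))\<^sup>2 / y"
        using that by (subst base_dist_moebius[OF det]) (auto simp: A_def defs aut_def)
      finally have "x\<^sup>2 + (y - t)\<^sup>2 = (cmod (of_real a * (Complex x y) + of_real b - \<i> * of_real t * (of_real c * Complex x y + of_real d)))\<^sup>2"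
        using y by (simp add: base_dist_eq defs(5))
      also have "\<dots> = (a * x + t * c * y + b)\<^sup>2 + (a * y - t * c * x - t * d)\<^sup>2"
        by (simp add: cmod_power2) algebra
      finally show "poly p x = 0" unfolding p_def by simp algebra
    qed
    ultimately show ?thesis using poly_roots_finite[of p] by (auto intro: finite_subset[rotated])
  next
    case False
    hence "{x. Complex x y \<in> A} = {}" by (auto simp: A_def upper_half_plane_def)
    thus ?thesis by (metis finite.emptyI)
  qed
  hence fin0: "emeasure lborel {x. Complex x y \<in> A} = 0" for y
    using finite_imp_null_set_lborel by (auto simp: null_sets_def)
  have mC [measurable]: "(\<lambda>(x, y). Complex x y) \<in> borel_measurable (borel \<Otimes>\<^sub>M borel)"
    unfolding Complex_eq by measurable
  have "emeasure lborel A = emeasure (lborel \<Otimes>\<^sub>M lborel) ((\<lambda>(x, y). Complex x y) -` A)"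
    by (subst lborel_complex) (simp add: emeasure_distr space_pair_measure)
  also have "\<dots> = (\<integral>\<^sup>+y. emeasure lborel ((\<lambda>x. (x, y)) -` ((\<lambda>(x, y). Complex x y) -` A)) \<partial>lborel)"
  proof (rule lborel_pair.emeasure_pair_measure_alt2)
    have "(\<lambda>(x, y). Complex x y) -` A \<inter> space (borel \<Otimes>\<^sub>M borel) \<in> sets (borel \<Otimes>\<^sub>M borel)" by measurable
    thus "(\<lambda>(x, y). Complex x y) -` A \<in> sets (lborel \<Otimes>\<^sub>M lborel)"
      by (simp add: space_pair_measure cong: sets_pair_measure_cong)
  qed
  also have "\<dots> = 0" using fin0 by (simp add: vimage_def)
  finally show ?thesis by (auto simp: null_sets_def A_def[symmetric])
qed

section \<open>Dirichlet domains\<close>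

context fuchsian
begin

text \<open>A bounded \<open>base_dist\<close> confines w = g z to a bounded region away from the
  real axis. Then |cz + d|^2 = Im z / Im w and |az + b| = |w| |cz + d| are bounded, which bounds the
  entries of g.\<close>

lemma finite_base_dist_le:
  assumes z: "z \<in> upper_half_plane"
  shows "finite {g \<in> \<Gamma>. base_dist (moebius_act g z) \<le> B}"
proof -
  \<comment> \<open>With v = Im w, the disc |w - i t|^2 <= B v is the same as (Re w)^2 + v^2 + t^2
    <= (B + 2 t) v, whence v <= M and t^2 <= M v.\<close>
  define t M where "t = base_height" "M = B + 2 * t"
  have t: "t > 0" using base_height by (simp add: t_M_def)
  define K1 where "K1 = sqrt (Im z * M / t\<^sup>2)"
  define K where "K = max K1 ((sqrt (B * M) + t) * K1)"
  have y: "Im z > 0" using z by (simp add: upper_half_plane_def)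
  have lin: "\<bar>p\<bar> \<le> K / Im z \<and> \<bar>q\<bar> \<le> K + K / Im z * cmod z" if "cmod (of_real p * z + of_real q) \<le> K" for p q
  proof -
    have "\<bar>p\<bar> * Im z = \<bar>Im (of_real p * z + of_real q)\<bar>" using y by (simp add: abs_mult)
    also have "\<dots> \<le> K" using that abs_Im_le_cmod order_trans by blast
    finally have 1: "\<bar>p\<bar> \<le> K / Im z" using y by (simp add: field_simps)
    have "\<bar>q\<bar> = cmod ((of_real p * z + of_real q) - of_real p * z)" by simp
    also have "\<dots> \<le> cmod (of_real p * z + of_real q) + cmod (of_real p * z)" by (rule norm_triangle_ineq4)
    also have "\<dots> \<le> K + K / Im z * cmod z" using that 1 
      by (intro add_mono) (auto simp: norm_mult simp del: times_divide_eq_left intro!: mult_right_mono)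
    finally show ?thesis using 1 by blast
  qed
  have "\<bar>g $ i $ j\<bar> \<le> max (K / Im z) (K + K / Im z * cmod z)" 
    if g: "g \<in> \<Gamma>" and le: "base_dist (moebius_act g z) \<le> B" for g i j
  proof -
    define w v where "w = moebius_act g z" "v = Im w"
    have det: "det g = 1" using det1 g by blast
    have w: "w \<in> upper_half_plane" unfolding w_v_def by (rule moebius_upper_half_plane[OF det z])
    hence v: "v > 0" by (simp add: upper_half_plane_def w_v_def)
    have j: "aut g z \<noteq> 0" by (rule aut_nz[OF det z])
    have B: "B \<ge> 0" using le base_dist_nonneg[OF w] by (simp add: w_v_def)
    hence M: "M > 0" using t by (simp add: t_M_def)
    have d: "(Re w)\<^sup>2 + (v - t)\<^sup>2 \<le> B * v" using le v by (simp add: base_dist_eq w_v_def[symmetric] t_M_def[symmetric] pos_divide_le_eq)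
    have "v\<^sup>2 + t\<^sup>2 - M * v = ((Re w)\<^sup>2 + (v - t)\<^sup>2 - B * v) - (Re w)\<^sup>2"
      unfolding t_M_def by (simp add: power2_eq_square algebra_simps)
    hence d2: "v\<^sup>2 + t\<^sup>2 \<le> M * v" using d zero_le_power2[of "Re w"] by linarith
    hence "v * v \<le> M * v" using zero_le_power2[of t] unfolding power2_eq_square by linarith
    hence vM: "v \<le> M" using v by simp
    have "t\<^sup>2 \<le> M * v" using d2 zero_le_power2[of v] by linarith
    have "(cmod (aut g z))\<^sup>2 = Im z / v"
      using Im_moebius_act[OF det z] j v by (simp add: w_v_def[symmetric] field_simps)
    also have "\<dots> \<le> Im z * M / t\<^sup>2" using \<open>t\<^sup>2 \<le> M * v\<close> t v y by (simp add: field_simps)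
    finally have K1: "cmod (aut g z) \<le> K1" unfolding K1_def by (simp add: real_le_rsqrt)
    have "(cmod (w - \<i> * of_real t))\<^sup>2 \<le> B * M"
      using d mult_left_mono[OF vM B] by (simp add: cmod_power2 w_v_def[symmetric])
    hence "cmod (w - \<i> * of_real t) \<le> sqrt (B * M)" by (simp add: real_le_rsqrt)
    moreover have "cmod w \<le> cmod (w - \<i> * of_real t) + cmod (\<i> * of_real t)" by (metis diff_add_cancel norm_triangle_ineq)
    ultimately have cw: "cmod w \<le> sqrt (B * M) + t" using t by (simp add: norm_mult)
    have "of_real (g$1$1) * z + of_real (g$1$2) = w * aut g z"
      using j by (simp add: w_v_def moebius_act_eq)
    hence "cmod (of_real (g$1$1) * z + of_real (g$1$2)) \<le> (sqrt (B * M) + t) * K1"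
      using cw K1 t B M by (simp add: norm_mult mult_mono)
    hence "cmod (of_real (g$1$1) * z + of_real (g$1$2)) \<le> K" "cmod (of_real (g$2$1) * z + of_real (g$2$2)) \<le> K"
      using K1 by (auto simp: K_def aut_def)
    from lin[OF this(1)] lin[OF this(2)]
    have "\<forall>i j. \<bar>g $ i $ j\<bar> \<le> max (K / Im z) (K + K / Im z * cmod z)" by (simp add: forall_2 le_max_iff_disj)
    thus ?thesis by blast
  qed
  thus ?thesis by (intro finite_subset[OF _ finite_bounded[of "max (K / Im z) (K + K / Im z * cmod z)"]]) auto
qed

lemma exists_min_base_dist:
  assumes z: "z \<in> upper_half_plane"
  shows "\<exists>g\<in>\<Gamma>. \<forall>h\<in>\<Gamma>. base_dist (moebius_act g z) \<le> base_dist (moebius_act h (moebius_act g z))"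
proof -
  define f where "f g = base_dist (moebius_act g z)" for g
  define S where "S = {g \<in> \<Gamma>. f g \<le> f (mat 1)}"
  have S: "finite S" "S \<noteq> {}" using finite_base_dist_le[OF z] one_mem by (auto simp: S_def f_def)
  define g where "g = arg_min_on f S"
  have g: "g \<in> S" "\<And>h. h \<in> S \<Longrightarrow> f g \<le> f h"
    using arg_min_if_finite[OF S, of f] unfolding g_def by (auto simp: not_less[symmetric])
  have "f g \<le> f h" if "h \<in> \<Gamma>" for h
    using g that by (cases "h \<in> S") (auto simp: S_def)
  hence "f g \<le> f (h ** g)" if "h \<in> \<Gamma>" for h using that g mult_mem by (auto simp: S_def)
  thus ?thesis using g z unfolding f_def S_def
    by (intro bexI[of _ g]) (auto simp: moebius_act_mult det1)
qed

lemma moebius_image_eq: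
  assumes "det g = 1" "F \<subseteq> upper_half_plane"
  shows "moebius_act g ` F = {z \<in> upper_half_plane. moebius_act (matrix_inv g) z \<in> F}"
  using assms moebius_act_inv[OF assms(1)] moebius_upper_half_plane[OF assms(1)]
  by (auto simp: image_iff subset_iff) metis

text \<open>The Dirichlet domain of the base point: every orbit has a nearest point, and a translate
  meets the domain only in an equidistant locus, a null set. This gives meaning to the choice in
  \<open>quotient_integral\<close>.\<close>

lemma fundamental_domain_exists: "\<exists>F. fundamental_domain \<Gamma> F"
proof -
  define F where "F = {z \<in> upper_half_plane. \<forall>g\<in>\<Gamma>. base_dist z \<le> base_dist (moebius_act g z)}"
  have F_uhp: "F \<subseteq> upper_half_plane" by (auto simp: F_def)
  have "F = upper_half_plane \<inter> (\<Inter>g\<in>\<Gamma>. {z. base_dist z \<le> base_dist (moebius_act g z)})" by (auto simp: F_def)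
  moreover have "\<dots> \<in> sets borel"
    using countable_group one_mem by (intro sets.Int sets.countable_INT') (auto, measurable)
  ultimately have F_borel: "F \<in> sets borel" by simp
  have cover: "\<exists>g\<in>\<Gamma>. moebius_act g z \<in> F" if "z \<in> upper_half_plane" for z
    using exists_min_base_dist[OF that] moebius_upper_half_plane[OF det1 that] by (auto simp: F_def)
  have "negligible (F \<inter> moebius_act g ` F)" if g: "g \<in> \<Gamma>" "g \<noteq> mat 1" "g \<noteq> - mat 1" for g
  proof -
    define h where "h = matrix_inv g"
    have det: "det g = 1" using g det1 by blast
    have h: "h \<in> \<Gamma>" "det h = 1" "matrix_inv h = g"
      using g inv_mem det by (auto simp: h_def det_matrix_inv matrix_inv_matrix_inv)
    have "matrix_inv (mat 1) = (mat 1 :: mat2)" "matrix_inv (- mat 1) = (- mat 1 :: mat2)"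
      by (subst matrix_inv_M2; simp add: mat2_eq_iff)+
    hence hne: "h \<noteq> mat 1" "h \<noteq> - mat 1"
      using h(3) g(2,3) by metis+
    have "base_dist z = base_dist (moebius_act h z)" if "z \<in> F \<inter> moebius_act g ` F" for z
    proof -
      have z: "z \<in> upper_half_plane" "moebius_act h z \<in> F" "z \<in> F"
        using that moebius_image_eq[OF det F_uhp] by (auto simp: h_def)
      have "base_dist z \<le> base_dist (moebius_act h z)" using z h by (auto simp: F_def)
      moreover have "base_dist (moebius_act h z) \<le> base_dist (moebius_act g (moebius_act h z))"
        using z(2) g by (auto simp: F_def)
      ultimately show ?thesis using moebius_act_inv[OF det z(1)] by (simp add: h_def)
    qed
    hence "F \<inter> moebius_act g ` F \<subseteq> {z \<in> upper_half_plane. base_dist z = base_dist (moebius_act h z)}"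
      using F_uhp by auto
    moreover have "negligible {z \<in> upper_half_plane. base_dist z = base_dist (moebius_act h z)}"
      using null_equidistant[OF h(2) group_rational[OF h(1)] hne]
      by (simp add: negligible_iff_null_sets null_sets_completionI)
    ultimately show ?thesis by (rule negligible_subset[rotated])
  qed
  hence "fundamental_domain \<Gamma> F" using F_uhp F_borel cover unfolding fundamental_domain_def by blast
  thus ?thesis by blast
qed

text \<open>The preimages of the overlaps of \<open>F\<close> with its images form a countable union
  of null sets; outside it, two elements that move z into \<open>F\<close> agree up to sign.\<close>

lemma AE_card_fundamental_domain:
  assumes F: "fundamental_domain \<Gamma> F"
  shows "AE z in hyp. finite {g \<in> \<Gamma>. moebius_act g z \<in> F} \<and> card {g \<in> \<Gamma>. moebius_act g z \<in> F} = center_order"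
proof -
  have F': "F \<subseteq> upper_half_plane" "F \<in> sets borel" "\<And>z. z \<in> upper_half_plane \<Longrightarrow> \<exists>g\<in>\<Gamma>. moebius_act g z \<in> F"
    "\<And>g. g \<in> \<Gamma> \<Longrightarrow> g \<noteq> mat 1 \<Longrightarrow> g \<noteq> - mat 1 \<Longrightarrow> negligible (F \<inter> moebius_act g ` F)"
    using F by (auto simp: fundamental_domain_def)
  note [measurable] = F'(2)
  define P where "P = \<Gamma> \<times> (\<Gamma> - {mat 1, - mat 1})"
  define bad where "bad = (\<Union>(g, k)\<in>P. moebius_act g -` (F \<inter> moebius_act k ` F))"
  have "moebius_act g -` (F \<inter> moebius_act k ` F) \<in> null_sets hyp" if "(g, k) \<in> P" for g k
  proof -
    have gk: "g \<in> \<Gamma>" "k \<in> \<Gamma>" "det g = 1" "det k = 1" "k \<noteq> mat 1" "k \<noteq> - mat 1" using that det1 by (auto simp: P_def)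
    have "moebius_act k ` F \<in> sets borel" unfolding moebius_image_eq[OF gk(4) F'(1)] by measurable
    hence "F \<inter> moebius_act k ` F \<in> sets lborel" by simp
    moreover have "F \<inter> moebius_act k ` F \<in> null_sets lebesgue"
      using F'(4) gk by (simp add: negligible_iff_null_sets)
    ultimately have "F \<inter> moebius_act k ` F \<in> null_sets lborel"
      by (simp add: null_sets_completion_iff)
    thus ?thesis using null_sets_hyp_moebius null_sets_hyp gk by blast
  qed
  moreover have "countable P" unfolding P_def using countable_group by auto
  ultimately have "bad \<in> null_sets hyp" unfolding bad_def by (intro null_sets_UN') auto
  hence "AE z in hyp. z \<notin> bad" by (rule AE_not_in)
  thus ?thesis using AE_hyp
  proof eventually_elim
    fix z assume nb: "z \<notin> bad" and z: "z \<in> upper_half_plane"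
    obtain g where g: "g \<in> \<Gamma>" "moebius_act g z \<in> F" using F'(3) z by blast
    have "k = g \<or> k = - g" if k: "k \<in> \<Gamma>" "moebius_act k z \<in> F" for k
    proof (rule ccontr)
      assume ne: "\<not> ?thesis"
      define l where "l = g ** matrix_inv k"
      have det: "det g = 1" "det k = 1" using g k det1 by auto
      have l: "l \<in> \<Gamma>" using g k mult_mem inv_mem by (auto simp: l_def)
      have "l ** k = g" using det by (simp add: l_def mat2_cancel_right)
      have "mat 1 ** k = k" "(- mat 1) ** k = - k" by simp_all
      hence "l \<noteq> mat 1" "l \<noteq> - mat 1" using ne \<open>l ** k = g\<close> by (auto; metis minus_minus)+
      hence "(g, l) \<in> P" using g l by (simp add: P_def)
      moreover have "moebius_act g z = moebius_act l (moebius_act k z)"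
        using \<open>l ** k = g\<close> moebius_act_mult[of l k z] det1 l det z by simp
      hence "moebius_act g z \<in> F \<inter> moebius_act l ` F" using g k by auto
      ultimately have "z \<in> bad" by (auto simp: bad_def)
      with nb show False by blast
    qed
    hence "{g \<in> \<Gamma>. moebius_act g z \<in> F} = \<Gamma> \<inter> {g, - g}" using g by auto
    thus "finite {g \<in> \<Gamma>. moebius_act g z \<in> F} \<and> card {g \<in> \<Gamma>. moebius_act g z \<in> F} = center_order"
      using card_pm[of g] g by simp
  qed
qed

end

text \<open>At the orbit point w nearest to the base point, comparison with w + 1, w - 1 and -1/w
  gives |Re w| <= 1/2 and |w| >= 1; the height 1/2 is a convenient weakening of sqrt 3 / 2.\<close>

lemma SL2Z_reduction:
  assumes "z \<in> upper_half_plane"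
  shows "\<exists>g\<in>SL2Z. \<bar>Re (moebius_act g z)\<bar> \<le> 1/2 \<and> Im (moebius_act g z) \<ge> 1/2"
proof -
  define t where "t = base_height"
  have t: "t > 1" using base_height by (simp add: t_def)
  obtain g where g: "g \<in> SL2Z" and min: "\<forall>h\<in>SL2Z. base_dist (moebius_act g z) \<le> base_dist (moebius_act h (moebius_act g z))"
    using SL2Z.exists_min_base_dist[OF assms] by blast
  define w where "w = moebius_act g z"
  have w: "w \<in> upper_half_plane" unfolding w_def using moebius_upper_half_plane det1_SL2Z g assms by blast
  hence y: "Im w > 0" by (simp add: upper_half_plane_def)
  have nz: "w \<noteq> 0" using y by auto
  have tr: "(Re w)\<^sup>2 \<le> (Re w + n)\<^sup>2" if "n \<in> {1, - 1}" for n
  proof -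
    have "M2 1 n 0 1 \<in> SL2Z" using that by (auto simp: SL2Z_def forall_2)
    hence "base_dist w \<le> base_dist (moebius_act (M2 1 n 0 1) w)" using min by (auto simp: w_def)
    also have "moebius_act (M2 1 n 0 1) w = w + of_real n" by (simp add: moebius_act_eq aut_def)
    finally show ?thesis using y by (simp add: base_dist_eq divide_le_cancel)
  qed
  have re: "\<bar>Re w\<bar> \<le> 1/2" using tr[of 1] tr[of "- 1"] by (simp add: power2_eq_square algebra_simps abs_le_iff)
  have "M2 0 (- 1) 1 0 \<in> SL2Z" by (auto simp: SL2Z_def forall_2)
  hence "base_dist w \<le> base_dist (moebius_act (M2 0 (- 1) 1 0) w)" using min by (auto simp: w_def)
  also have "\<dots> = (cmod (- 1 - \<i> * of_real t * w))\<^sup>2 / Im w"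
    using w by (subst base_dist_moebius) (auto simp: aut_def t_def)
  finally have "(Re w)\<^sup>2 + (Im w - t)\<^sup>2 \<le> (cmod (- 1 - \<i> * of_real t * w))\<^sup>2"
    using y by (simp add: base_dist_eq divide_le_cancel t_def)
  also have "\<dots> = (t * Im w - 1)\<^sup>2 + (t * Re w)\<^sup>2" by (simp add: cmod_power2)
  \<comment> \<open>The comparison amounts to (t^2 - 1)(|w|^2 - 1) >= 0, which is informative
    because t exceeds 1.\<close>
  finally have "(t\<^sup>2 - 1) * 1 \<le> (t\<^sup>2 - 1) * ((Re w)\<^sup>2 + (Im w)\<^sup>2)" by (simp add: power2_eq_square algebra_simps)
  moreover have "t\<^sup>2 - 1 > 0" using t by simp
  ultimately have 1: "1 \<le> (Re w)\<^sup>2 + (Im w)\<^sup>2" by (metis mult_le_cancel_left_pos)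
  have "(Re w)\<^sup>2 \<le> (1/2)\<^sup>2" using re by (metis abs_ge_zero power2_abs power_mono)
  hence "(1/2)\<^sup>2 \<le> (Im w)\<^sup>2" using 1 by (simp add: power2_eq_square)
  hence "1/2 \<le> Im w" using y by (rule_tac power2_le_imp_le) auto
  thus ?thesis using g re by (auto simp: w_def)
qed


section \<open>Unfolding\<close>

lemma nn_integral_indicator_count_space:
  "A \<subseteq> B \<Longrightarrow> finite A \<Longrightarrow> (\<integral>\<^sup>+x. indicator A x \<partial>count_space B) = of_nat (card A)"
  by (subst nn_integral_indicator) (auto simp: emeasure_count_space_finite)

context fuchsian
begin

text \<open>Both sides are the integral of \<open>\<phi> X\<^sub>0 z\<close> over the pairs \<open>(\<gamma>, z)\<close> with \<open>z \<in> E\<close> and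
  \<open>\<gamma>z \<in> F\<close>: summing over \<open>\<gamma>\<close> first gives the right-hand side, and substituting \<open>z \<mapsto> \<gamma>\<^sup>-\<^sup>1z\<close>
  first the left-hand side.\<close>

lemma nn_integral_unfold:
  fixes \<phi> :: "mat2 \<Rightarrow> complex \<Rightarrow> ennreal" and X0 :: mat2
  defines "orb \<equiv> (\<lambda>\<gamma>. conj_act \<gamma> X0) ` \<Gamma>"
  assumes F: "fundamental_domain \<Gamma> F"
    and [measurable]: "E \<in> sets borel" "\<And>X. \<phi> X \<in> borel_measurable borel"
    and equivariant: "\<And>\<gamma> X z. \<gamma> \<in> \<Gamma> \<Longrightarrow> X \<in> orb \<Longrightarrow> z \<in> upper_half_plane \<Longrightarrow>
       \<phi> (conj_act \<gamma> X) (moebius_act \<gamma> z) = \<phi> X z"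
    and fin: "\<And>z. z \<in> upper_half_plane \<Longrightarrow> finite {\<delta> \<in> \<Gamma>. conj_act \<delta> X0 = X0 \<and> moebius_act \<delta> z \<in> E}"
    and card: "\<And>z. z \<in> upper_half_plane \<Longrightarrow> card {\<delta> \<in> \<Gamma>. conj_act \<delta> X0 = X0 \<and> moebius_act \<delta> z \<in> E} = c"
  shows "of_nat c * (\<integral>\<^sup>+X. \<integral>\<^sup>+z. \<phi> X z * indicator F z \<partial>hyp \<partial>count_space orb) =
         of_nat center_order * (\<integral>\<^sup>+z. \<phi> X0 z * indicator E z \<partial>hyp)"
proof -
  have [measurable]: "F \<in> sets borel" using F by (simp add: fundamental_domain_def)
  note cnt = countable_group
  have cnto: "countable orb" using cnt by (simp add: orb_def)
  have X0: "X0 \<in> orb" using one_mem by (auto simp: orb_def intro!: image_eqI[of _ _ "mat 1"])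
  \<comment> \<open>Almost every point is moved into \<open>F\<close> by exactly
    \<open>center_order\<close> elements, so the sum over \<gamma> collapses to that
    constant.\<close>
  have A: "AE z in hyp. \<phi> X0 z * indicator E z * (\<integral>\<^sup>+\<gamma>. indicator F (moebius_act \<gamma> z) \<partial>count_space \<Gamma>) =
      of_nat center_order * (\<phi> X0 z * indicator E z)"
    using AE_card_fundamental_domain[OF F]
  proof eventually_elim
    fix z assume z: "finite {g \<in> \<Gamma>. moebius_act g z \<in> F} \<and> card {g \<in> \<Gamma>. moebius_act g z \<in> F} = center_order"
    have "(\<integral>\<^sup>+\<gamma>. indicator F (moebius_act \<gamma> z) \<partial>count_space \<Gamma>) =
       (\<integral>\<^sup>+\<gamma>. indicator {g \<in> \<Gamma>. moebius_act g z \<in> F} \<gamma> \<partial>count_space \<Gamma>)"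
      by (intro nn_integral_cong) (auto simp: indicator_def)
    also have "\<dots> = of_nat center_order" using z by (subst nn_integral_indicator_count_space) auto
    finally show "\<phi> X0 z * indicator E z * (\<integral>\<^sup>+\<gamma>. indicator F (moebius_act \<gamma> z) \<partial>count_space \<Gamma>) =
      of_nat center_order * (\<phi> X0 z * indicator E z)" by (simp add: mult.commute)
  qed
  have B: "(\<integral>\<^sup>+z. \<phi> X0 z * indicator E z * indicator F (moebius_act \<gamma> z) \<partial>hyp) =
      (\<integral>\<^sup>+z. \<phi> (conj_act \<gamma> X0) z * indicator E (moebius_act (matrix_inv \<gamma>) z) * indicator F z \<partial>hyp)"
    if g: "\<gamma> \<in> \<Gamma>" for \<gamma>
  proof -
    have det: "det \<gamma> = 1" using g det1 by blast
    have "(\<integral>\<^sup>+z. \<phi> (conj_act \<gamma> X0) z * indicator E (moebius_act (matrix_inv \<gamma>) z) * indicator F z \<partial>hyp) = 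
      (\<integral>\<^sup>+z. \<phi> (conj_act \<gamma> X0) (moebius_act \<gamma> z) * indicator E (moebius_act (matrix_inv \<gamma>) (moebius_act \<gamma> z)) * indicator F (moebius_act \<gamma> z) \<partial>hyp)"
      by (rule nn_integral_hyp_moebius[symmetric, OF _ det]) measurable
    also have "\<dots> = (\<integral>\<^sup>+z. \<phi> X0 z * indicator E z * indicator F (moebius_act \<gamma> z) \<partial>hyp)"
      by (rule nn_integral_hyp_cong) (simp add: equivariant g X0 moebius_act_inv det)
    finally show ?thesis ..
  qed
  have C: "(\<integral>\<^sup>+\<gamma>. \<phi> (conj_act \<gamma> X0) z * indicator E (moebius_act (matrix_inv \<gamma>) z) \<partial>count_space \<Gamma>) =
      of_nat c * (\<integral>\<^sup>+X. \<phi> X z \<partial>count_space orb)" if z: "z \<in> upper_half_plane" for z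
  proof -
    \<comment> \<open>The indicator of X = \<gamma> X0 spreads each summand over the orbit, so that
      the sum over \<gamma> can be grouped by the vector it produces.\<close>
    define h where "h X \<gamma> = \<phi> X z * (indicator E (moebius_act (matrix_inv \<gamma>) z) * indicator {conj_act \<gamma> X0} X)" for X \<gamma>
    have "(\<integral>\<^sup>+\<gamma>. \<phi> (conj_act \<gamma> X0) z * indicator E (moebius_act (matrix_inv \<gamma>) z) \<partial>count_space \<Gamma>) =
      (\<integral>\<^sup>+\<gamma>. \<integral>\<^sup>+X. h X \<gamma> \<partial>count_space orb \<partial>count_space \<Gamma>)"
    proof (rule nn_integral_cong)
      fix \<gamma> assume "\<gamma> \<in> space (count_space \<Gamma>)"
      hence mem: "conj_act \<gamma> X0 \<in> orb" by (auto simp: orb_def)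
      have "(\<integral>\<^sup>+X. h X \<gamma> \<partial>count_space orb) = (\<integral>\<^sup>+X. (\<phi> (conj_act \<gamma> X0) z * indicator E (moebius_act (matrix_inv \<gamma>) z)) * indicator {conj_act \<gamma> X0} X \<partial>count_space orb)"
        by (intro nn_integral_cong) (auto simp: h_def indicator_def)
      also have "\<dots> = (\<phi> (conj_act \<gamma> X0) z * indicator E (moebius_act (matrix_inv \<gamma>) z)) * 1"
        using mem by (subst nn_integral_cmult) (auto simp: nn_integral_indicator_count_space)
      finally show "\<phi> (conj_act \<gamma> X0) z * indicator E (moebius_act (matrix_inv \<gamma>) z) = (\<integral>\<^sup>+X. h X \<gamma> \<partial>count_space orb)" by simp
    qed
    also have "\<dots> = (\<integral>\<^sup>+X. \<integral>\<^sup>+\<gamma>. h X \<gamma> \<partial>count_space \<Gamma> \<partial>count_space orb)"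
      using cnto by (intro nn_integral_count_space_nn_integral) auto
    also have "\<dots> = (\<integral>\<^sup>+X. of_nat c * \<phi> X z \<partial>count_space orb)"
    proof (rule nn_integral_cong)
      fix X assume "X \<in> space (count_space orb)"
      then obtain \<gamma>0 where g0: "\<gamma>0 \<in> \<Gamma>" "X = conj_act \<gamma>0 X0" by (auto simp: orb_def)
      have det0: "det \<gamma>0 = 1" using g0 det1 by blast
      define w where "w = moebius_act (matrix_inv \<gamma>0) z"
      have w: "w \<in> upper_half_plane" unfolding w_def by (intro moebius_upper_half_plane det_matrix_inv det0 z)
      define S where "S = {\<delta> \<in> \<Gamma>. conj_act \<delta> X0 = X0 \<and> moebius_act \<delta> w \<in> E}"
      define T where "T = {\<gamma> \<in> \<Gamma>. conj_act \<gamma> X0 = X \<and> moebius_act (matrix_inv \<gamma>) z \<in> E}"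
      \<comment> \<open>The elements carrying \<open>X0\<close> to \<open>X\<close> form a coset of
        the stabilizer; multiplying the inverse of a stabilizer element by \<gamma>0 matches the
        condition at \<open>w\<close> with the condition at \<open>z\<close>, so there are
        \<open>c\<close> of them.\<close>
      have bij: "bij_betw (\<lambda>\<delta>. \<gamma>0 ** matrix_inv \<delta>) S T"
      proof (rule bij_betw_byWitness[where f' = "\<lambda>\<gamma>. matrix_inv \<gamma> ** \<gamma>0"])
        show "\<forall>a\<in>S. matrix_inv (\<gamma>0 ** matrix_inv a) ** \<gamma>0 = a"
          using det0 det1 by (auto simp: S_def matrix_inv_mult det_matrix_inv matrix_inv_matrix_inv mat2_cancel_right)
        show "\<forall>a\<in>T. \<gamma>0 ** matrix_inv (matrix_inv a ** \<gamma>0) = a"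
          using det0 det1 by (auto simp: T_def matrix_inv_mult det_matrix_inv matrix_inv_matrix_inv mat2_cancel_left)
        show "(\<lambda>\<delta>. \<gamma>0 ** matrix_inv \<delta>) ` S \<subseteq> T"
        proof safe
          fix \<delta> assume "\<delta> \<in> S"
          hence d: "\<delta> \<in> \<Gamma>" "det \<delta> = 1" "conj_act \<delta> X0 = X0" "moebius_act \<delta> w \<in> E" using det1 by (auto simp: S_def)
          have "conj_act (matrix_inv \<delta>) X0 = X0" using d conj_act_inv(1)[of \<delta> X0] by simp
          hence "conj_act (\<gamma>0 ** matrix_inv \<delta>) X0 = X" using g0 d det0 by (simp add: conj_act_mult det_matrix_inv)
          moreover have "moebius_act (matrix_inv (\<gamma>0 ** matrix_inv \<delta>)) z = moebius_act \<delta> w"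
            using d det0 z by (simp add: matrix_inv_mult det_matrix_inv matrix_inv_matrix_inv w_def moebius_act_mult)
          ultimately show "\<gamma>0 ** matrix_inv \<delta> \<in> T" using d g0 inv_mem mult_mem by (auto simp: T_def)
        qed
        show "(\<lambda>\<gamma>. matrix_inv \<gamma> ** \<gamma>0) ` T \<subseteq> S"
        proof safe
          fix \<gamma> assume "\<gamma> \<in> T"
          hence d: "\<gamma> \<in> \<Gamma>" "det \<gamma> = 1" "conj_act \<gamma> X0 = X" "moebius_act (matrix_inv \<gamma>) z \<in> E" using det1 by (auto simp: T_def)
          have "conj_act (matrix_inv \<gamma>) (conj_act \<gamma>0 X0) = X0" using d g0 conj_act_inv(1)[of \<gamma> X0] by simp
          moreover have "moebius_act (matrix_inv \<gamma> ** \<gamma>0) w = moebius_act (matrix_inv \<gamma>) z"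
            using d det0 z w by (simp add: det_matrix_inv moebius_act_mult) (simp add: w_def moebius_act_inv det0 z)
          ultimately show "matrix_inv \<gamma> ** \<gamma>0 \<in> S" using d g0 det0 inv_mem mult_mem
            by (auto simp: S_def conj_act_mult det_matrix_inv)
        qed
      qed
      have "finite S" "card S = c" using fin[OF w] card[OF w] by (simp_all add: S_def)
      hence T: "finite T" "card T = c" using bij_betw_finite[OF bij] bij_betw_same_card[OF bij] by simp_all
      have "(\<integral>\<^sup>+\<gamma>. h X \<gamma> \<partial>count_space \<Gamma>) = (\<integral>\<^sup>+\<gamma>. \<phi> X z * indicator T \<gamma> \<partial>count_space \<Gamma>)"
        by (intro nn_integral_cong) (auto simp: h_def indicator_def T_def)
      also have "\<dots> = \<phi> X z * of_nat c"
        using T by (subst nn_integral_cmult) (auto simp: nn_integral_indicator_count_space T_def)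
      finally show "(\<integral>\<^sup>+\<gamma>. h X \<gamma> \<partial>count_space \<Gamma>) = of_nat c * \<phi> X z" by (simp add: mult.commute)
    qed
    also have "\<dots> = of_nat c * (\<integral>\<^sup>+X. \<phi> X z \<partial>count_space orb)"
      by (subst nn_integral_cmult) auto
    finally show ?thesis .
  qed
  have "of_nat center_order * (\<integral>\<^sup>+z. \<phi> X0 z * indicator E z \<partial>hyp) = (\<integral>\<^sup>+z. of_nat center_order * (\<phi> X0 z * indicator E z) \<partial>hyp)"
    by (subst nn_integral_cmult) auto
  also have "\<dots> = (\<integral>\<^sup>+z. \<phi> X0 z * indicator E z * (\<integral>\<^sup>+\<gamma>. indicator F (moebius_act \<gamma> z) \<partial>count_space \<Gamma>) \<partial>hyp)"
    by (rule nn_integral_cong_AE) (use A in \<open>auto elim!: eventually_mono\<close>)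
  also have "\<dots> = (\<integral>\<^sup>+z. \<integral>\<^sup>+\<gamma>. \<phi> X0 z * indicator E z * indicator F (moebius_act \<gamma> z) \<partial>count_space \<Gamma> \<partial>hyp)"
    by (intro nn_integral_cong nn_integral_cmult[symmetric]) auto
  also have "\<dots> = (\<integral>\<^sup>+\<gamma>. \<integral>\<^sup>+z. \<phi> X0 z * indicator E z * indicator F (moebius_act \<gamma> z) \<partial>hyp \<partial>count_space \<Gamma>)"
    using cnt by (intro nn_integral_count_space_nn_integral) measurable
  also have "\<dots> = (\<integral>\<^sup>+\<gamma>. \<integral>\<^sup>+z. \<phi> (conj_act \<gamma> X0) z * indicator E (moebius_act (matrix_inv \<gamma>) z) * indicator F z \<partial>hyp \<partial>count_space \<Gamma>)"
    by (rule nn_integral_cong) (use B in simp)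
  also have "\<dots> = (\<integral>\<^sup>+z. \<integral>\<^sup>+\<gamma>. \<phi> (conj_act \<gamma> X0) z * indicator E (moebius_act (matrix_inv \<gamma>) z) * indicator F z \<partial>count_space \<Gamma> \<partial>hyp)"
    using cnt by (intro nn_integral_count_space_nn_integral[symmetric]) measurable
  also have "\<dots> = (\<integral>\<^sup>+z. (of_nat c * (\<integral>\<^sup>+X. \<phi> X z \<partial>count_space orb)) * indicator F z \<partial>hyp)"
    by (rule nn_integral_hyp_cong) (subst C[symmetric], auto simp: nn_integral_multc)
  also have "\<dots> = (\<integral>\<^sup>+z. \<integral>\<^sup>+X. of_nat c * (\<phi> X z * indicator F z) \<partial>count_space orb \<partial>hyp)"
    by (intro nn_integral_cong) (simp add: nn_integral_cmult nn_integral_multc mult.assoc)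
  also have "\<dots> = (\<integral>\<^sup>+X. \<integral>\<^sup>+z. of_nat c * (\<phi> X z * indicator F z) \<partial>hyp \<partial>count_space orb)"
    using cnto by (intro nn_integral_count_space_nn_integral) measurable
  also have "\<dots> = of_nat c * (\<integral>\<^sup>+X. \<integral>\<^sup>+z. \<phi> X z * indicator F z \<partial>hyp \<partial>count_space orb)"
    by (simp add: nn_integral_cmult)
  finally show ?thesis ..
qed

end

section \<open>From nonnegative to complex integrands\<close>

lemma has_sum_of_nn_integral_count_space:
  fixes f :: "'a \<Rightarrow> real"
  assumes "\<And>x. x \<in> A \<Longrightarrow> f x \<ge> 0" "S \<ge> 0" "(\<integral>\<^sup>+x. ennreal (f x) \<partial>count_space A) = ennreal S"
  shows "(f has_sum S) A"
proof -
  have i: "integrable (count_space A) f"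
    using assms by (intro integrableI_nonneg) (auto simp: AE_count_space)
  hence abs: "Infinite_Set_Sum.abs_summable_on f A" by (simp add: abs_summable_on_def)
  have "ennreal S = ennreal (infsetsum f A)"
    using nn_integral_conv_infsetsum[OF abs assms(1)] assms(3) by simp
  moreover have "infsetsum f A \<ge> 0" using assms by (simp add: infsetsum_nonneg)
  ultimately have "S = infsetsum f A" using assms(2) by simp
  also have "\<dots> = infsum f A" by (rule infsetsum_infsum[OF abs])
  finally have "S = infsum f A" .
  moreover have "f summable_on A"
    using abs abs_summable_equivalent abs_summable_summable by blast
  ultimately show ?thesis by simp
qed

lemma has_sum_minus_intro:
  fixes f g :: "'a \<Rightarrow> complex"
  shows "(f has_sum a) A \<Longrightarrow> (g has_sum b) A \<Longrightarrow> ((\<lambda>x. f x - g x) has_sum (a - b)) A"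
  using has_sum_add[where f = f and a = a and A = A and g = "\<lambda>x. - g x" and b = "- b"] by (simp add: has_sum_uminus)

text \<open>Unfolding is available for nonnegative integrands; a complex one is recovered from the
  positive and negative parts of its real and imaginary part.\<close>

lemma integral_complex_parts:
  fixes f :: "'a \<Rightarrow> complex"
  assumes "integrable M f"
  shows "(\<integral>x. f x \<partial>M) = (of_real (\<integral>x. max 0 (Re (f x)) \<partial>M) - of_real (\<integral>x. max 0 (- Re (f x)) \<partial>M)) +
     \<i> * (of_real (\<integral>x. max 0 (Im (f x)) \<partial>M) - of_real (\<integral>x. max 0 (- Im (f x)) \<partial>M))"
proof -
  have i: "integrable M (\<lambda>x. Re (f x))" "integrable M (\<lambda>x. Im (f x))" using assms by auto
  have "(\<integral>x. max 0 (g x) \<partial>M) - (\<integral>x. max 0 (- g x) \<partial>M) = (\<integral>x. g x \<partial>M)" if "integrable M g" for g :: "'a \<Rightarrow> real"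
  proof -
    have "(\<integral>x. max 0 (g x) \<partial>M) - (\<integral>x. max 0 (- g x) \<partial>M) = (\<integral>x. max 0 (g x) - max 0 (- g x) \<partial>M)"
      by (rule Bochner_Integration.integral_diff[symmetric]) (use that in auto)
    also have "(\<lambda>x. max 0 (g x) - max 0 (- g x)) = g" by auto
    finally show ?thesis .
  qed
  from this[OF i(1)] this[OF i(2)] show ?thesis
    using assms by (simp add: complex_eq_iff integral_Re integral_Im)
qed

context fuchsian
begin

text \<open>Finiteness passes through \<open>nn_integral_unfold\<close> to the integral over
  \<open>E\<close> because \<open>center_order\<close> is positive; once all quantities are finite,
  the factor c > 0 can be divided out.\<close>

lemma has_sum_unfold_nonneg:
  fixes p :: "mat2 \<Rightarrow> complex \<Rightarrow> real" and X0 :: mat2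
  defines "orb \<equiv> (\<lambda>\<gamma>. conj_act \<gamma> X0) ` \<Gamma>"
  assumes F: "fundamental_domain \<Gamma> F"
    and [measurable]: "E \<in> sets borel" "\<And>X. p X \<in> borel_measurable borel"
    and nonneg: "\<And>X z. p X z \<ge> 0"
    and equivariant: "\<And>\<gamma> X z. \<gamma> \<in> \<Gamma> \<Longrightarrow> X \<in> orb \<Longrightarrow> z \<in> upper_half_plane \<Longrightarrow>
       p (conj_act \<gamma> X) (moebius_act \<gamma> z) = p X z"
    and fin: "\<And>z. z \<in> upper_half_plane \<Longrightarrow> finite {\<delta> \<in> \<Gamma>. conj_act \<delta> X0 = X0 \<and> moebius_act \<delta> z \<in> E}"
    and card: "\<And>z. z \<in> upper_half_plane \<Longrightarrow> card {\<delta> \<in> \<Gamma>. conj_act \<delta> X0 = X0 \<and> moebius_act \<delta> z \<in> E} = c"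
    and c: "c > 0"
    and finite: "(\<integral>\<^sup>+X. \<integral>\<^sup>+z. ennreal (p X z) * indicator F z \<partial>hyp \<partial>count_space orb) < \<infinity>"
  shows "set_integrable hyp E (p X0)"
    and "((\<lambda>X. LINT z:F|hyp. p X z) has_sum (real center_order / real c * (LINT z:E|hyp. p X0 z))) orb"
proof -
  have [measurable]: "F \<in> sets borel" using F by (simp add: fundamental_domain_def)
  have eq: "of_nat c * (\<integral>\<^sup>+X. \<integral>\<^sup>+z. ennreal (p X z) * indicator F z \<partial>hyp \<partial>count_space orb) =
         of_nat center_order * (\<integral>\<^sup>+z. ennreal (p X0 z) * indicator E z \<partial>hyp)"
    unfolding orb_def
    by (rule nn_integral_unfold[where \<phi> = "\<lambda>X z. ennreal (p X z)"])
      (use F fin card equivariant in \<open>auto simp: orb_def\<close>)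
  have "of_nat center_order * (\<integral>\<^sup>+z. ennreal (p X0 z) * indicator E z \<partial>hyp) < \<infinity>"
    unfolding eq[symmetric] using finite by (simp add: ennreal_mult_less_top ennreal_of_nat_eq_real_of_nat)
  hence finE: "(\<integral>\<^sup>+z. ennreal (p X0 z) * indicator E z \<partial>hyp) < \<infinity>"
    using center_order_pos by (auto simp: ennreal_mult_less_top)
  have ind: "ennreal (p X z) * indicator A z = ennreal (indicator A z *\<^sub>R p X z)" for X z A
    by (simp add: indicator_def)
  show iE: "set_integrable hyp E (p X0)"
    unfolding set_integrable_def using finE nonneg by (intro integrableI_nonneg) (auto simp: ind)
  have LE: "(\<integral>\<^sup>+z. ennreal (p X0 z) * indicator E z \<partial>hyp) = ennreal (LINT z:E|hyp. p X0 z)"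
    using iE nonneg unfolding ind set_lebesgue_integral_def set_integrable_def
    by (intro nn_integral_eq_integral) auto
  have fX: "(\<integral>\<^sup>+z. ennreal (p X z) * indicator F z \<partial>hyp) < \<infinity>" if "X \<in> orb" for X
  proof -
    have "(\<integral>\<^sup>+z. ennreal (p X z) * indicator F z \<partial>hyp) = 
       (\<integral>\<^sup>+Y. (\<integral>\<^sup>+z. ennreal (p Y z) * indicator F z \<partial>hyp) * indicator {X} Y \<partial>count_space orb)"
      using that by simp
    also have "\<dots> \<le> (\<integral>\<^sup>+X. \<integral>\<^sup>+z. ennreal (p X z) * indicator F z \<partial>hyp \<partial>count_space orb)"
      by (intro nn_integral_mono) (auto simp: indicator_def)
    finally show ?thesis using finite by (rule order.strict_trans1)
  qed
  have LF: "(\<integral>\<^sup>+z. ennreal (p X z) * indicator F z \<partial>hyp) = ennreal (LINT z:F|hyp. p X z)" if "X \<in> orb" for X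
    using fX[OF that] nonneg unfolding ind set_lebesgue_integral_def set_integrable_def
    by (intro nn_integral_eq_integral integrableI_nonneg) auto
  have nnE: "(LINT z:E|hyp. p X0 z) \<ge> 0"
    unfolding set_lebesgue_integral_def using nonneg by (intro integral_nonneg_AE) auto
  have "of_nat c * (\<integral>\<^sup>+X. ennreal (LINT z:F|hyp. p X z) \<partial>count_space orb) = of_nat center_order * ennreal (LINT z:E|hyp. p X0 z)"
    using eq unfolding LE by (simp add: LF cong: nn_integral_cong_simp)
  also have "\<dots> = of_nat c * ennreal (real center_order / real c * (LINT z:E|hyp. p X0 z))"
    using c nnE by (simp add: ennreal_of_nat_eq_real_of_nat ennreal_mult[symmetric])
  finally have "(\<integral>\<^sup>+X. ennreal (LINT z:F|hyp. p X z) \<partial>count_space orb) = ennreal (real center_order / real c * (LINT z:E|hyp. p X0 z))"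
    using c by (subst (asm) ennreal_mult_cancel_left) auto
  thus "((\<lambda>X. LINT z:F|hyp. p X z) has_sum (real center_order / real c * (LINT z:E|hyp. p X0 z))) orb"
    using nnE nonneg by (intro has_sum_of_nn_integral_count_space)
      (auto simp: set_lebesgue_integral_def intro!: integral_nonneg_AE)
qed

lemma has_sum_unfold:
  fixes \<phi> :: "mat2 \<Rightarrow> complex \<Rightarrow> complex" and X0 :: mat2
  defines "orb \<equiv> (\<lambda>\<gamma>. conj_act \<gamma> X0) ` \<Gamma>"
  assumes F: "fundamental_domain \<Gamma> F"
    and [measurable]: "E \<in> sets borel" "\<And>X. \<phi> X \<in> borel_measurable borel"
    and equivariant: "\<And>\<gamma> X z. \<gamma> \<in> \<Gamma> \<Longrightarrow> X \<in> orb \<Longrightarrow> z \<in> upper_half_plane \<Longrightarrow>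
       \<phi> (conj_act \<gamma> X) (moebius_act \<gamma> z) = \<phi> X z"
    and fin: "\<And>z. z \<in> upper_half_plane \<Longrightarrow> finite {\<delta> \<in> \<Gamma>. conj_act \<delta> X0 = X0 \<and> moebius_act \<delta> z \<in> E}"
    and card: "\<And>z. z \<in> upper_half_plane \<Longrightarrow> card {\<delta> \<in> \<Gamma>. conj_act \<delta> X0 = X0 \<and> moebius_act \<delta> z \<in> E} = c"
    and c: "c > 0"
    and finite: "(\<integral>\<^sup>+X. \<integral>\<^sup>+z. ennreal (cmod (\<phi> X z)) * indicator F z \<partial>hyp \<partial>count_space orb) < \<infinity>"
  shows "set_integrable hyp E (\<phi> X0)"
    and "((\<lambda>X. LINT z:F|hyp. \<phi> X z) has_sum (of_nat center_order / of_nat c * (LINT z:E|hyp. \<phi> X0 z))) orb"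
proof -
  have [measurable]: "F \<in> sets borel" using F by (simp add: fundamental_domain_def)
  \<comment> \<open>Each of the four parts is a nonnegative function r of the value, bounded by the
    modulus; it inherits equivariance and finiteness, so the nonnegative case applies.\<close>
  have part: "((\<lambda>X. LINT z:F|hyp. r (\<phi> X z)) has_sum (real center_order / real c * (LINT z:E|hyp. r (\<phi> X0 z)))) orb"
     "set_integrable hyp E (\<lambda>z. r (\<phi> X0 z))"
    if [measurable]: "r \<in> borel_measurable borel" and r: "\<And>w. 0 \<le> r w" "\<And>w. r w \<le> cmod w" for r
  proof -
    have f: "(\<integral>\<^sup>+X. \<integral>\<^sup>+z. ennreal (r (\<phi> X z)) * indicator F z \<partial>hyp \<partial>count_space orb) < \<infinity>"
      by (rule order.strict_trans1[OF _ finite]) (intro nn_integral_mono mult_right_mono ennreal_leI r, simp)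
    note * = has_sum_unfold_nonneg[where p = "\<lambda>X z. r (\<phi> X z)" and E = E and c = c, OF F]
    show "((\<lambda>X. LINT z:F|hyp. r (\<phi> X z)) has_sum (real center_order / real c * (LINT z:E|hyp. r (\<phi> X0 z)))) orb"
      unfolding orb_def by (rule *(2)) (use r fin card c f equivariant in \<open>auto simp: orb_def\<close>)
    show "set_integrable hyp E (\<lambda>z. r (\<phi> X0 z))"
      by (rule *(1)) (use r fin card c f equivariant in \<open>auto simp: orb_def\<close>)
  qed
  show iE: "set_integrable hyp E (\<phi> X0)"
  proof -
    have "set_integrable hyp E (\<lambda>z. cmod (\<phi> X0 z))" by (rule part(2)) auto
    thus ?thesis unfolding set_integrable_def
      by (rule Bochner_Integration.integrable_bound) auto
  qed
  have iF: "set_integrable hyp F (\<phi> X)" if "X \<in> orb" for X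
  proof -
    have "(\<integral>\<^sup>+z. ennreal (cmod (\<phi> X z)) * indicator F z \<partial>hyp) = 
       (\<integral>\<^sup>+Y. (\<integral>\<^sup>+z. ennreal (cmod (\<phi> Y z)) * indicator F z \<partial>hyp) * indicator {X} Y \<partial>count_space orb)"
      using that by simp
    also have "\<dots> \<le> (\<integral>\<^sup>+X. \<integral>\<^sup>+z. ennreal (cmod (\<phi> X z)) * indicator F z \<partial>hyp \<partial>count_space orb)"
      by (intro nn_integral_mono) (auto simp: indicator_def)
    finally have "(\<integral>\<^sup>+z. ennreal (cmod (\<phi> X z)) * indicator F z \<partial>hyp) < \<infinity>" using finite by (rule order.strict_trans1)
    also have "(\<lambda>z. ennreal (cmod (\<phi> X z)) * indicator F z) = (\<lambda>z. ennreal (norm (indicator F z *\<^sub>R \<phi> X z)))"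
      by (auto simp: indicator_def)
    finally show ?thesis unfolding set_integrable_def by (intro integrableI_bounded) auto
  qed
  have parts: "(LINT z:A|hyp. \<phi> X z) = 
    (of_real (LINT z:A|hyp. max 0 (Re (\<phi> X z))) - of_real (LINT z:A|hyp. max 0 (- Re (\<phi> X z)))) +
     \<i> * (of_real (LINT z:A|hyp. max 0 (Im (\<phi> X z))) - of_real (LINT z:A|hyp. max 0 (- Im (\<phi> X z))))"
    if "set_integrable hyp A (\<phi> X)" for A X
  proof -
    have m: "max 0 (Re (indicator A z *\<^sub>R w)) = indicator A z *\<^sub>R max 0 (Re w)"
      "max 0 (- Re (indicator A z *\<^sub>R w)) = indicator A z *\<^sub>R max 0 (- Re w)"
      "max 0 (Im (indicator A z *\<^sub>R w)) = indicator A z *\<^sub>R max 0 (Im w)"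
      "max 0 (- Im (indicator A z *\<^sub>R w)) = indicator A z *\<^sub>R max 0 (- Im w)" for z w
      by (auto simp: indicator_def)
    show ?thesis using integral_complex_parts[OF that[unfolded set_integrable_def]]
      unfolding m set_lebesgue_integral_def .
  qed
  have b: "max 0 (Re w) \<le> cmod w" "max 0 (- Re w) \<le> cmod w" "max 0 (Im w) \<le> cmod w" "max 0 (- Im w) \<le> cmod w" for w
    using abs_Re_le_cmod[of w] abs_Im_le_cmod[of w] by auto
  have m: "(\<lambda>w. max 0 (Re w)) \<in> borel_measurable borel" "(\<lambda>w. max 0 (- Re w)) \<in> borel_measurable borel"
    "(\<lambda>w. max 0 (Im w)) \<in> borel_measurable borel" "(\<lambda>w. max 0 (- Im w)) \<in> borel_measurable borel"
    by measurable
  have "((\<lambda>X. (of_real (LINT z:F|hyp. max 0 (Re (\<phi> X z))) - of_real (LINT z:F|hyp. max 0 (- Re (\<phi> X z)))) +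
     \<i> * (of_real (LINT z:F|hyp. max 0 (Im (\<phi> X z))) - of_real (LINT z:F|hyp. max 0 (- Im (\<phi> X z))))) has_sum
    ((of_real (real center_order / real c * (LINT z:E|hyp. max 0 (Re (\<phi> X0 z)))) - of_real (real center_order / real c * (LINT z:E|hyp. max 0 (- Re (\<phi> X0 z))))) +
     \<i> * (of_real (real center_order / real c * (LINT z:E|hyp. max 0 (Im (\<phi> X0 z)))) - of_real (real center_order / real c * (LINT z:E|hyp. max 0 (- Im (\<phi> X0 z))))))) orb"
    by (intro has_sum_add has_sum_minus_intro has_sum_cmult_right has_sum_of_real part(1)) (intro b m max.cobounded1)+
  also have "((of_real (real center_order / real c * (LINT z:E|hyp. max 0 (Re (\<phi> X0 z)))) - of_real (real center_order / real c * (LINT z:E|hyp. max 0 (- Re (\<phi> X0 z))))) +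
     \<i> * (of_real (real center_order / real c * (LINT z:E|hyp. max 0 (Im (\<phi> X0 z)))) - of_real (real center_order / real c * (LINT z:E|hyp. max 0 (- Im (\<phi> X0 z)))))) = 
     of_nat center_order / of_nat c * (LINT z:E|hyp. \<phi> X0 z)"
    unfolding parts[OF iE] by (simp add: algebra_simps)
  finally show "((\<lambda>X. LINT z:F|hyp. \<phi> X z) has_sum (of_nat center_order / of_nat c * (LINT z:E|hyp. \<phi> X0 z))) orb"
    by (subst has_sum_cong[OF parts[OF iF]])
qed

text \<open>Pairs (\<gamma>, z) with z in \<open>F\<close> and \<gamma> z in \<open>B\<close> are
  counted in two ways: every z in \<open>F\<close> has at least one \<gamma>, while almost every
  point of \<open>B\<close> arises from exactly \<open>center_order\<close> of them. An estimate on
  one convenient covering set thus serves whatever domain is chosen.\<close>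

lemma nn_integral_fundamental_domain_le:
  fixes \<psi> :: "complex \<Rightarrow> ennreal"
  assumes F: "fundamental_domain \<Gamma> F"
    and [measurable]: "B \<in> sets borel" "\<psi> \<in> borel_measurable borel"
    and invariant: "\<And>\<gamma> z. \<gamma> \<in> \<Gamma> \<Longrightarrow> z \<in> upper_half_plane \<Longrightarrow> \<psi> (moebius_act \<gamma> z) = \<psi> z"
    and cover: "\<And>z. z \<in> upper_half_plane \<Longrightarrow> \<exists>\<gamma>\<in>\<Gamma>. moebius_act \<gamma> z \<in> B"
  shows "(\<integral>\<^sup>+z. \<psi> z * indicator F z \<partial>hyp) \<le> of_nat center_order * (\<integral>\<^sup>+z. \<psi> z * indicator B z \<partial>hyp)"
proof -
  have [measurable]: "F \<in> sets borel" using F by (simp add: fundamental_domain_def)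
  note cnt = countable_group
  have inv: "bij_betw matrix_inv \<Gamma> \<Gamma>"
    by (rule bij_betw_byWitness[where f' = matrix_inv]) (auto simp: matrix_inv_matrix_inv det1 inv_mem)
  have "(\<integral>\<^sup>+z. \<psi> z * indicator F z \<partial>hyp) \<le> (\<integral>\<^sup>+z. \<integral>\<^sup>+\<gamma>. \<psi> z * indicator F z * indicator B (moebius_act \<gamma> z) \<partial>count_space \<Gamma> \<partial>hyp)"
  proof (rule nn_integral_mono_AE, rule eventually_mono[OF AE_hyp])
    fix z assume "z \<in> upper_half_plane"
    then obtain \<gamma> where g: "\<gamma> \<in> \<Gamma>" "moebius_act \<gamma> z \<in> B" using cover by blast
    have "\<psi> z * indicator F z = (\<integral>\<^sup>+\<gamma>'. \<psi> z * indicator F z * indicator {\<gamma>} \<gamma>' \<partial>count_space \<Gamma>)"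
      using g by (subst nn_integral_cmult) (auto simp: nn_integral_indicator_count_space)
    also have "\<dots> \<le> (\<integral>\<^sup>+\<gamma>. \<psi> z * indicator F z * indicator B (moebius_act \<gamma> z) \<partial>count_space \<Gamma>)"
      using g by (intro nn_integral_mono) (auto simp: indicator_def)
    finally show "\<psi> z * indicator F z \<le> (\<integral>\<^sup>+\<gamma>. \<psi> z * indicator F z * indicator B (moebius_act \<gamma> z) \<partial>count_space \<Gamma>)" .
  qed
  also have "\<dots> = (\<integral>\<^sup>+\<gamma>. \<integral>\<^sup>+z. \<psi> z * indicator F z * indicator B (moebius_act \<gamma> z) \<partial>hyp \<partial>count_space \<Gamma>)"
    using cnt by (intro nn_integral_count_space_nn_integral) measurable
  also have "\<dots> = (\<integral>\<^sup>+\<gamma>. \<integral>\<^sup>+z. \<psi> z * indicator B z * indicator F (moebius_act (matrix_inv \<gamma>) z) \<partial>hyp \<partial>count_space \<Gamma>)"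
  proof (rule nn_integral_cong)
    fix \<gamma> assume "\<gamma> \<in> space (count_space \<Gamma>)"
    hence g: "\<gamma> \<in> \<Gamma>" "det \<gamma> = 1" using det1 by auto
    have "(\<integral>\<^sup>+z. \<psi> z * indicator B z * indicator F (moebius_act (matrix_inv \<gamma>) z) \<partial>hyp) =
      (\<integral>\<^sup>+z. \<psi> (moebius_act \<gamma> z) * indicator B (moebius_act \<gamma> z) * indicator F (moebius_act (matrix_inv \<gamma>) (moebius_act \<gamma> z)) \<partial>hyp)"
      by (rule nn_integral_hyp_moebius[symmetric, OF _ g(2)]) measurable
    also have "\<dots> = (\<integral>\<^sup>+z. \<psi> z * indicator F z * indicator B (moebius_act \<gamma> z) \<partial>hyp)"
      by (rule nn_integral_hyp_cong) (simp add: invariant g moebius_act_inv mult_ac)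
    finally show "(\<integral>\<^sup>+z. \<psi> z * indicator F z * indicator B (moebius_act \<gamma> z) \<partial>hyp) =
      (\<integral>\<^sup>+z. \<psi> z * indicator B z * indicator F (moebius_act (matrix_inv \<gamma>) z) \<partial>hyp)" ..
  qed
  also have "\<dots> = (\<integral>\<^sup>+\<gamma>. \<integral>\<^sup>+z. \<psi> z * indicator B z * indicator F (moebius_act \<gamma> z) \<partial>hyp \<partial>count_space \<Gamma>)"
    by (rule nn_integral_bij_count_space[OF inv])
  also have "\<dots> = (\<integral>\<^sup>+z. \<integral>\<^sup>+\<gamma>. \<psi> z * indicator B z * indicator F (moebius_act \<gamma> z) \<partial>count_space \<Gamma> \<partial>hyp)"
    using cnt by (intro nn_integral_count_space_nn_integral[symmetric]) measurable
  also have "\<dots> = (\<integral>\<^sup>+z. of_nat center_order * (\<psi> z * indicator B z) \<partial>hyp)"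
  proof (rule nn_integral_cong_AE, rule eventually_mono[OF AE_card_fundamental_domain[OF F]])
    fix z assume z: "finite {g \<in> \<Gamma>. moebius_act g z \<in> F} \<and> card {g \<in> \<Gamma>. moebius_act g z \<in> F} = center_order"
    have "(\<integral>\<^sup>+\<gamma>. \<psi> z * indicator B z * indicator F (moebius_act \<gamma> z) \<partial>count_space \<Gamma>) =
       (\<integral>\<^sup>+\<gamma>. \<psi> z * indicator B z * indicator {g \<in> \<Gamma>. moebius_act g z \<in> F} \<gamma> \<partial>count_space \<Gamma>)"
      by (intro nn_integral_cong) (auto simp: indicator_def)
    also have "\<dots> = \<psi> z * indicator B z * of_nat center_order"
      using z by (subst nn_integral_cmult) (auto simp: nn_integral_indicator_count_space)
    finally show "(\<integral>\<^sup>+\<gamma>. \<psi> z * indicator B z * indicator F (moebius_act \<gamma> z) \<partial>count_space \<Gamma>) =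
      of_nat center_order * (\<psi> z * indicator B z)" by (simp add: mult.commute)
  qed
  also have "\<dots> = of_nat center_order * (\<integral>\<^sup>+z. \<psi> z * indicator B z \<partial>hyp)"
    by (subst nn_integral_cmult) auto
  finally show ?thesis .
qed

text \<open>\<open>pos\<close> is a coordinate that \<open>u n\<close> shifts by n \<omega>, so
  exactly one n moves z into the half-open strip of width \<omega>; only the choice of sign
  remains.\<close>

lemma card_cyclic_stabilizer:
  fixes u :: "int \<Rightarrow> mat2" and pos :: "complex \<Rightarrow> real"
  assumes \<omega>: "\<omega> > 0"
    and stab: "{\<delta> \<in> \<Gamma> \<union> uminus ` \<Gamma>. conj_act \<delta> X = X} = {g. \<exists>n. g = u n \<or> g = - u n}"
    and pos: "\<And>n z. z \<in> upper_half_plane \<Longrightarrow> pos (moebius_act (u n) z) = pos z + of_int n * \<omega>"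
    and z: "z \<in> upper_half_plane"
  shows "finite {\<delta> \<in> \<Gamma>. conj_act \<delta> X = X \<and> moebius_act \<delta> z \<in> {z \<in> upper_half_plane. 0 \<le> pos z \<and> pos z < \<omega>}}"
    and "card {\<delta> \<in> \<Gamma>. conj_act \<delta> X = X \<and> moebius_act \<delta> z \<in> {z \<in> upper_half_plane. 0 \<le> pos z \<and> pos z < \<omega>}} = center_order"
proof -
  define n where "n = - \<lfloor>pos z / \<omega>\<rfloor>"
  have iff: "0 \<le> pos z + of_int m * \<omega> \<and> pos z + of_int m * \<omega> < \<omega> \<longleftrightarrow> m = n" for m
  proof -
    have "0 \<le> pos z + of_int m * \<omega> \<and> pos z + of_int m * \<omega> < \<omega> \<longleftrightarrow> of_int (- m) \<le> pos z / \<omega> \<and> pos z / \<omega> < of_int (- m) + 1"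
      using \<omega> by (simp add: field_simps) linarith
    also have "\<dots> \<longleftrightarrow> \<lfloor>pos z / \<omega>\<rfloor> = - m" by (auto simp: floor_eq_iff)
    finally show ?thesis by (auto simp: n_def)
  qed
  have un: "u m \<in> \<Gamma> \<or> - u m \<in> \<Gamma>" "conj_act (u m) X = X" "det (u m) = 1" for m
  proof -
    have "u m \<in> {\<delta> \<in> \<Gamma> \<union> uminus ` \<Gamma>. conj_act \<delta> X = X}" unfolding stab by blast
    thus "u m \<in> \<Gamma> \<or> - u m \<in> \<Gamma>" "conj_act (u m) X = X" "det (u m) = 1" using det1 by auto
  qed
  have "{\<delta> \<in> \<Gamma>. conj_act \<delta> X = X \<and> moebius_act \<delta> z \<in> {z \<in> upper_half_plane. 0 \<le> pos z \<and> pos z < \<omega>}} = \<Gamma> \<inter> {u n, - u n}"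
  proof (intro equalityI subsetI)
    fix \<delta> assume d: "\<delta> \<in> {\<delta> \<in> \<Gamma>. conj_act \<delta> X = X \<and> moebius_act \<delta> z \<in> {z \<in> upper_half_plane. 0 \<le> pos z \<and> pos z < \<omega>}}"
    hence "\<delta> \<in> {\<delta> \<in> \<Gamma> \<union> uminus ` \<Gamma>. conj_act \<delta> X = X}" by blast
    then obtain m where m: "\<delta> = u m \<or> \<delta> = - u m" unfolding stab by blast
    hence "moebius_act \<delta> z = moebius_act (u m) z" by auto
    hence "m = n" using d pos[OF z, of m] iff[of m] by auto
    thus "\<delta> \<in> \<Gamma> \<inter> {u n, - u n}" using d m by blast
  next
    fix \<delta> assume d: "\<delta> \<in> \<Gamma> \<inter> {u n, - u n}"
    hence "moebius_act \<delta> z = moebius_act (u n) z" "conj_act \<delta> X = X"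
      using un by (auto simp: conj_act_uminus)
    moreover have "moebius_act (u n) z \<in> upper_half_plane" using un z moebius_upper_half_plane by blast
    ultimately show "\<delta> \<in> {\<delta> \<in> \<Gamma>. conj_act \<delta> X = X \<and> moebius_act \<delta> z \<in> {z \<in> upper_half_plane. 0 \<le> pos z \<and> pos z < \<omega>}}"
      using d pos[OF z, of n] iff[of n] by auto
  qed
  thus "finite {\<delta> \<in> \<Gamma>. conj_act \<delta> X = X \<and> moebius_act \<delta> z \<in> {z \<in> upper_half_plane. 0 \<le> pos z \<and> pos z < \<omega>}}"
    "card {\<delta> \<in> \<Gamma>. conj_act \<delta> X = X \<and> moebius_act \<delta> z \<in> {z \<in> upper_half_plane. 0 \<le> pos z \<and> pos z < \<omega>}} = center_order"
    using card_pm[OF un(1)[of n]] by simp_all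
qed

end

text \<open>The generator is the least positive element, which exists because bounded parts are
  finite; division with remainder does the rest.\<close>

lemma discrete_subgroup_cyclic:
  fixes A :: "real set"
  assumes zero: "0 \<in> A" and add: "\<And>a b. a \<in> A \<Longrightarrow> b \<in> A \<Longrightarrow> a + b \<in> A" and minus: "\<And>a. a \<in> A \<Longrightarrow> - a \<in> A"
    and finite: "\<And>B. finite {a \<in> A. \<bar>a\<bar> \<le> B}" and nontrivial: "\<exists>a\<in>A. a \<noteq> 0"
  shows "\<exists>\<omega>>0. A = {of_int n * \<omega> | n. True}"
proof -
  obtain a0 where a0: "a0 \<in> A" "a0 > 0" using nontrivial minus by (metis neg_0_less_iff_less linorder_neqE_linordered_idom)
  define S where "S = {a \<in> A. 0 < a \<and> a \<le> a0}"
  have S: "finite S" "S \<noteq> {}"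
    using a0 by (auto simp: S_def intro!: finite_subset[OF _ finite[of a0]])
  define \<omega> where "\<omega> = Min S"
  have w: "\<omega> \<in> A" "\<omega> > 0" using Min_in[OF S] by (auto simp: \<omega>_def S_def)
  have min: "\<omega> \<le> a" if "a \<in> A" "a > 0" for a
    using Min_le[OF S(1), of a] Min_le[OF S(1), of a0] a0 that by (cases "a \<le> a0") (auto simp: \<omega>_def S_def)
  have mult_nat: "of_nat n * \<omega> \<in> A" for n
    by (induction n) (use zero add w in \<open>auto simp: distrib_right\<close>)
  have mult: "of_int n * \<omega> \<in> A" for n
    using mult_nat[of "nat n"] minus[OF mult_nat[of "nat (- n)"]] by (cases "n \<ge> 0") auto
  have "a \<in> {of_int n * \<omega> | n. True}" if a: "a \<in> A" for a
  proof -
    define n where "n = \<lfloor>a / \<omega>\<rfloor>"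
    have "a + - (of_int n * \<omega>) \<in> A" using a mult add minus by blast
    moreover have "of_int n \<le> a / \<omega>" "a / \<omega> < of_int n + 1" unfolding n_def by linarith+
    hence "0 \<le> a + - (of_int n * \<omega>)" "a + - (of_int n * \<omega>) < \<omega>" using w by (simp_all add: field_simps)
    ultimately have "a + - (of_int n * \<omega>) = 0" using min by fastforce
    thus ?thesis by auto
  qed
  thus ?thesis using w mult by (intro exI[of _ \<omega>]) auto
qed


section \<open>Absolute convergence\<close>

lemma power_le_fact_exp:
  fixes x :: real
  assumes "x \<ge> 0"
  shows "x ^ n \<le> fact n * exp x"
proof -
  have "x ^ n / fact n = (\<Sum>i\<in>{n}. x ^ i / fact i)" by simp
  also have "\<dots> \<le> (\<Sum>i. x ^ i / fact i)"
    using summable_exp[of x] assms by (intro sum_le_suminf) (auto simp: field_simps)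
  also have "\<dots> = exp x" by (simp add: exp_def field_simps)
  finally show ?thesis by (simp add: field_simps)
qed

lemma power_mult_exp_le:
  fixes x c :: real
  assumes "x \<ge> 0" "c > 0"
  shows "x ^ n * exp (- c * x) \<le> fact n / c ^ n"
proof -
  have "(c * x) ^ n \<le> fact n * exp (c * x)" using assms by (intro power_le_fact_exp) auto
  hence "(c * x) ^ n * exp (- c * x) \<le> fact n" by (simp add: exp_minus field_simps)
  thus ?thesis using assms by (simp add: power_mult_distrib field_simps)
qed

lemma power_mult_gauss_le:
  fixes t a :: real
  assumes "t \<ge> 0" "a > 0"
  shows "t ^ n * exp (- a * t\<^sup>2) \<le> 1 + fact n / a ^ n"
proof (cases "t \<le> 1")
  case True
  have "t ^ n * exp (- a * t\<^sup>2) \<le> 1 * 1" using assms True by (intro mult_mono power_le_one) auto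
  thus ?thesis using assms by (simp add: add_increasing2)
next
  case False
  hence "t ^ n \<le> t ^ (2 * n)" by (intro power_increasing) auto
  hence "t ^ n * exp (- a * t\<^sup>2) \<le> (t\<^sup>2) ^ n * exp (- a * t\<^sup>2)" by (simp add: power_mult)
  also have "\<dots> \<le> fact n / a ^ n" using assms by (intro power_mult_exp_le) auto
  finally show ?thesis by simp
qed

text \<open>Convergence at the single height 1/4 bounds the coefficients by a geometric sequence. At
  heights y >= 1/2 the terms are then at most B r^n with r = exp(-pi y / d), and the missing
  constant term leaves a factor r.\<close>

lemma norm_exp_power_series_le:
  fixes a :: "nat \<Rightarrow> complex" and d :: nat
  assumes d: "d > 0" and a0: "a 0 = 0"
    and sums: "\<And>z. z \<in> upper_half_plane \<Longrightarrow> (\<lambda>n. a n * exp (2 * of_real pi * \<i> * of_nat n * z / of_nat d)) sums f z"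
  shows "\<exists>C. \<forall>z. Im z \<ge> 1/2 \<longrightarrow> cmod (f z) \<le> C * exp (- (pi / d) * Im z)"
proof -
  have norm: "cmod (exp (2 * of_real pi * \<i> * of_nat n * z / of_nat d)) = exp (- (2 * pi / d * Im z)) ^ n" for n z
  proof -
    have "Re (2 * of_real pi * \<i> * of_nat n * z / of_nat d) = real n * (- (2 * pi / d * Im z))"
      by (simp add: Re_divide_of_nat)
    thus ?thesis by (simp only: norm_exp_eq_Re exp_of_nat_mult)
  qed
  define z0 where "z0 = \<i> * of_real (1/4)"
  have "z0 \<in> upper_half_plane" by (simp add: z0_def upper_half_plane_def)
  from sums[OF this] have "summable (\<lambda>n. a n * exp (2 * of_real pi * \<i> * of_nat n * z0 / of_nat d))"
    by (rule sums_summable)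
  then obtain B where B: "\<And>n. cmod (a n * exp (2 * of_real pi * \<i> * of_nat n * z0 / of_nat d)) \<le> B"
    using summable_imp_bounded bounded_iff by (metis (mono_tags, lifting) rangeI)
  have B0: "B \<ge> 0" using order_trans[OF norm_ge_zero B] .
  define r0 where "r0 = exp (- (pi / d) * (1/2))"
  have r0: "r0 < 1" using d by (simp add: r0_def)
  have bnd: "cmod (f z) \<le> B / (1 - r0) * exp (- (pi / d) * Im z)" if z: "Im z \<ge> 1/2" for z
  proof -
    define r where "r = exp (- (pi / d) * Im z)"
    have r: "0 < r" "r \<le> r0" using z d by (auto simp: r_def r0_def field_simps)
    have zH: "z \<in> upper_half_plane" using z by (simp add: upper_half_plane_def)
    have tm: "cmod (a n * exp (2 * of_real pi * \<i> * of_nat n * z / of_nat d)) \<le> B * r ^ n" for n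
    proof -
      define e0 where "e0 = exp (- (2 * pi / d * Im z0))"
      have e0: "e0 > 0" by (simp add: e0_def)
      have "cmod (a n) * e0 ^ n \<le> B" using B[of n] unfolding norm_mult norm e0_def .
      hence "cmod (a n) \<le> B / e0 ^ n" using e0 by (simp add: field_simps)
      hence "cmod (a n) * exp (- (2 * pi / d * Im z)) ^ n \<le> B / e0 ^ n * exp (- (2 * pi / d * Im z)) ^ n"
        by (intro mult_right_mono) auto
      also have "\<dots> = B * (exp (- (2 * pi / d * Im z)) / e0) ^ n" by (simp add: power_divide)
      also have "\<dots> \<le> B * r ^ n"
      proof (intro mult_left_mono power_mono)
        \<comment> \<open>Half of the exponent pays for the height 1/4 of \<open>z0\<close>: since y
          >= 1/2, one has 2 pi (y - 1/4) / d >= pi y / d.\<close>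
        have "pi / d * (1/2) \<le> pi / d * Im z" using z d by (intro mult_left_mono) auto
        thus "exp (- (2 * pi / d * Im z)) / e0 \<le> r"
          by (simp add: e0_def r_def z0_def exp_diff[symmetric] algebra_simps) 
      qed (use B0 e0 in auto)
      finally show ?thesis unfolding norm_mult norm .
    qed
    have "(\<lambda>n. a (Suc n) * exp (2 * of_real pi * \<i> * of_nat (Suc n) * z / of_nat d)) sums f z"
      using sums[OF zH] a0 by (subst sums_Suc_iff) simp
    moreover have "(\<lambda>n. (B * r) * r ^ n) sums ((B * r) * (1 / (1 - r)))"
      by (intro sums_mult geometric_sums) (use r r0 in auto)
    ultimately have "cmod (f z) \<le> (B * r) * (1 / (1 - r))"
      by (rule norm_sums_le) (use tm[of "Suc _"] in \<open>simp add: mult.assoc\<close>)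
    also have "\<dots> \<le> (B * r) * (1 / (1 - r0))"
      using r r0 B0 by (intro mult_left_mono divide_left_mono) auto
    finally show ?thesis by (simp add: r_def)
  qed
  thus ?thesis by blast
qed

lemma cusp_form_decay:
  assumes "f \<in> cusp_forms \<Gamma> w" "\<sigma> \<in> SL2Z"
  shows "\<exists>C c. c > 0 \<and> (\<forall>z. Im z \<ge> 1/2 \<longrightarrow> cmod (slash w f \<sigma> z) \<le> C * exp (- c * Im z))"
proof -
  obtain d :: nat and a where "d > 0" "a 0 = 0"
    "\<And>z. z \<in> upper_half_plane \<Longrightarrow> (\<lambda>n. a n * exp (2 * of_real pi * \<i> * of_nat n * z / of_nat d)) sums slash w f \<sigma> z"
    using assms by (auto simp: cusp_forms_def)
  from norm_exp_power_series_le[OF this] \<open>d > 0\<close> show ?thesis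
    by (metis divide_pos_pos of_nat_0_less_iff pi_gt_zero)
qed

section \<open>Siegel sets and the theta sum on them\<close>

definition siegel_set :: "complex set" where
  "siegel_set = {z. \<bar>Re z\<bar> \<le> 1/2 \<and> 1/2 \<le> Im z}"

lemma siegel_set_uhp: "siegel_set \<subseteq> upper_half_plane"
  by (auto simp: siegel_set_def upper_half_plane_def)

lemma borel_siegel_set [measurable, simp]: "siegel_set \<in> sets borel"
  unfolding siegel_set_def by measurable

text \<open>In the coordinates s, t the section at fixed s >= -ln 2 is an interval of length
  exp(-s), and all other sections are empty.\<close>

lemma emeasure_siegel_set: "emeasure hyp siegel_set < \<infinity>"
proof -
  have "emeasure hyp siegel_set = (\<integral>\<^sup>+s. \<integral>\<^sup>+t. indicator siegel_set (hpt s t) \<partial>lborel \<partial>lborel)"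
    using nn_integral_hyp[of "indicator siegel_set"] by simp
  also have "\<dots> \<le> (\<integral>\<^sup>+s. ennreal (exp (- s)) * indicator {- ln 2..} s \<partial>lborel)"
  proof (rule nn_integral_mono)
    fix s :: real
    have "(\<integral>\<^sup>+t. indicator siegel_set (hpt s t) \<partial>lborel) \<le> (\<integral>\<^sup>+t. indicator {- (exp (- s) / 2)..exp (- s) / 2} t * indicator {- ln 2..} s \<partial>lborel)"
    proof (rule nn_integral_mono)
      fix t :: real
      have "t \<in> {- (exp (- s) / 2)..exp (- s) / 2} \<and> s \<ge> - ln 2" if "hpt s t \<in> siegel_set"
      proof -
        have "exp s * \<bar>t\<bar> \<le> 1/2" "1/2 \<le> exp s" using that by (auto simp: siegel_set_def abs_mult)
        moreover from this(2) have "ln (1/2) \<le> s" by (metis exp_le_cancel_iff exp_ln half_gt_zero zero_less_one)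
        ultimately have "\<bar>t\<bar> \<le> exp (- s) / 2" "- ln 2 \<le> s" by (simp_all add: exp_minus field_simps ln_div)
        thus ?thesis by auto
      qed
      thus "(indicator siegel_set (hpt s t) :: ennreal) \<le> indicator {- (exp (- s) / 2)..exp (- s) / 2} t * indicator {- ln 2..} s"
        by (auto simp: indicator_def)
    qed
    also have "\<dots> = ennreal (exp (- s)) * indicator {- ln 2..} s"
      by (subst nn_integral_multc) auto
    finally show "(\<integral>\<^sup>+t. indicator siegel_set (hpt s t) \<partial>lborel) \<le> ennreal (exp (- s)) * indicator {- ln 2..} s" .
  qed
  also have "\<dots> = ennreal (0 - (- exp (- (- ln 2))))"
  proof (rule nn_integral_FTC_atLeast)
    show "((\<lambda>s::real. - exp (- s)) \<longlongrightarrow> 0) at_top"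
      using tendsto_minus[OF filterlim_compose[OF exp_at_bot filterlim_uminus_at_bot_at_top]] by simp
  qed (auto intro!: derivative_eq_intros)
  finally show ?thesis by (rule order.strict_trans1) auto
qed

text \<open>A summable majorant on trace-zero matrices of bounded denominator; \<open>X$2$2\<close>
  is determined by the trace. Its reciprocal is a polynomial of degree six, which a Gaussian still
  dominates.\<close>

definition theta_weight :: "mat2 \<Rightarrow> real" where
  "theta_weight X = 1 / ((1 + (X$1$1)\<^sup>2) * (1 + (X$1$2)\<^sup>2) * (1 + (X$2$1)\<^sup>2))"

lemma nn_integral_int_weight:
  assumes "D > 0"
  shows "(\<integral>\<^sup>+n. ennreal (1 / (1 + (of_int n / real D)\<^sup>2)) \<partial>count_space UNIV) < \<infinity>"
proof -
  have s: "summable (\<lambda>n. 1 / (1 + (real n / real D)\<^sup>2))"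
  proof (rule summable_comparison_test[OF _ summable_mult[OF inverse_power_summable[of 2]]])
    show "\<exists>N. \<forall>n\<ge>N. norm (1 / (1 + (real n / real D)\<^sup>2)) \<le> (real D)\<^sup>2 * inverse (real n ^ 2)"
    proof (intro exI[of _ 1] allI impI)
      fix n :: nat assume n: "n \<ge> 1"
      have "1 / (1 + (real n / real D)\<^sup>2) \<le> 1 / (real n / real D)\<^sup>2"
        using n assms by (intro divide_left_mono) (auto intro!: mult_pos_pos add_pos_nonneg)
      also have "\<dots> = (real D)\<^sup>2 * inverse (real n ^ 2)" using assms by (simp add: field_simps)
      finally show "norm (1 / (1 + (real n / real D)\<^sup>2)) \<le> (real D)\<^sup>2 * inverse (real n ^ 2)"
        by simp
    qed
  qed auto
  have nat: "(\<integral>\<^sup>+n. ennreal (1 / (1 + (real n / real D)\<^sup>2)) \<partial>count_space UNIV) < \<infinity>"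
    using s by (subst nn_integral_count_space_nat, subst suminf_ennreal2) auto
  define f where "f n = ennreal (1 / (1 + (of_int n / real D)\<^sup>2))" for n :: int
  have "(\<integral>\<^sup>+n. f n \<partial>count_space UNIV) \<le> (\<integral>\<^sup>+n. f n * indicator (range int) n + f n * indicator (range (\<lambda>n. - int n)) n \<partial>count_space UNIV)"
  proof (rule nn_integral_mono)
    fix n :: int
    have "n \<in> range int \<or> n \<in> range (\<lambda>n. - int n)"
      by (cases n rule: int_cases2) auto
    thus "f n \<le> f n * indicator (range int) n + f n * indicator (range (\<lambda>n. - int n)) n"
      by (auto simp: indicator_def)
  qed
  also have "\<dots> = (\<integral>\<^sup>+n. f n \<partial>count_space (range int)) + (\<integral>\<^sup>+n. f n \<partial>count_space (range (\<lambda>n. - int n)))"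
    by (subst nn_integral_add) (auto simp: nn_integral_count_space_indicator[symmetric])
  also have "(\<integral>\<^sup>+n. f n \<partial>count_space (range int)) = (\<integral>\<^sup>+n. f (int n) \<partial>count_space UNIV)"
    by (rule nn_integral_bij_count_space[symmetric]) (auto simp: bij_betw_def inj_on_def)
  also have "(\<integral>\<^sup>+n. f n \<partial>count_space (range (\<lambda>n. - int n))) = (\<integral>\<^sup>+n. f (- int n) \<partial>count_space UNIV)"
    by (rule nn_integral_bij_count_space[symmetric]) (auto simp: bij_betw_def inj_on_def)
  also have "(\<integral>\<^sup>+n. f (int n) \<partial>count_space UNIV) + (\<integral>\<^sup>+n. f (- int n) \<partial>count_space UNIV) < \<infinity>"
    using nat by (simp add: f_def)
  finally show ?thesis by (simp add: f_def)
qed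

text \<open>The three free entries embed the index set in a copy of Z^3, where the weight factors
  into three convergent one-variable sums.\<close>

lemma nn_integral_theta_weight:
  assumes D: "D > 0"
  shows "(\<integral>\<^sup>+X. ennreal (theta_weight X) \<partial>count_space {X. trace X = 0 \<and> denominator_bounded D X}) < \<infinity>"
proof -
  define f where "f n = ennreal (1 / (1 + (of_int n / real D)\<^sup>2))" for n :: int
  define S where "S = (\<integral>\<^sup>+n. f n \<partial>count_space UNIV)"
  have S: "S < \<infinity>" unfolding S_def f_def by (rule nn_integral_int_weight[OF D])
  define m where "m = (\<lambda>(a, b, c). M2 (of_int a / real D) (of_int b / real D) (of_int c / real D) (- (of_int a / real D)))"
  have inj: "inj m" using D by (auto simp: inj_on_def m_def mat2_eq_iff)
  have sub: "{X. trace X = 0 \<and> denominator_bounded D X} \<subseteq> range m"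
  proof
    fix X assume X: "X \<in> {X. trace X = 0 \<and> denominator_bounded D X}"
    have ex: "\<exists>n. X $ i $ j = of_int n / real D" for i j
    proof -
      have "real D * X $ i $ j \<in> \<int>" using X by (auto simp: denominator_bounded_def)
      then obtain n where "real D * X $ i $ j = of_int n" by (auto elim: Ints_cases)
      thus ?thesis using D by (intro exI[of _ n]) (simp add: field_simps)
    qed
    obtain a b c where "X$1$1 = of_int a / real D" "X$1$2 = of_int b / real D" "X$2$1 = of_int c / real D"
      using ex by metis
    hence "X = m (a, b, c)" using X by (auto simp: m_def mat2_eq_iff trace_mat2)
    thus "X \<in> range m" by blast
  qed
  have "(\<integral>\<^sup>+X. ennreal (theta_weight X) \<partial>count_space {X. trace X = 0 \<and> denominator_bounded D X}) =
     (\<integral>\<^sup>+X. ennreal (theta_weight X) * indicator {X. trace X = 0 \<and> denominator_bounded D X} X \<partial>count_space UNIV)"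
    by (rule nn_integral_count_space_indicator) auto
  also have "\<dots> \<le> (\<integral>\<^sup>+X. ennreal (theta_weight X) * indicator (range m) X \<partial>count_space UNIV)"
    using sub by (intro nn_integral_mono) (auto simp: indicator_def)
  also have "\<dots> = (\<integral>\<^sup>+X. ennreal (theta_weight X) \<partial>count_space (range m))"
    by (rule nn_integral_count_space_indicator[symmetric]) auto
  also have "\<dots> = (\<integral>\<^sup>+p. ennreal (theta_weight (m p)) \<partial>count_space UNIV)"
    by (rule nn_integral_bij_count_space[symmetric]) (use inj in \<open>auto simp: bij_betw_def\<close>)
  also have "\<dots> = (\<integral>\<^sup>+a. \<integral>\<^sup>+b. \<integral>\<^sup>+c. f a * (f b * f c) \<partial>count_space UNIV \<partial>count_space UNIV \<partial>count_space UNIV)"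
  proof -
    have "ennreal (theta_weight (m (a, b, c))) = f a * (f b * f c)" for a b c
      by (simp add: theta_weight_def m_def f_def ennreal_mult[symmetric] mult_ac)
    thus ?thesis
      by (subst nn_integral_fst_count_space[symmetric], subst nn_integral_fst_count_space[symmetric]) simp
  qed
  also have "\<dots> = S * S * S"
    by (simp add: nn_integral_cmult nn_integral_multc S_def mult.assoc)
  also have "\<dots> < \<infinity>" using S by (simp add: ennreal_mult_less_top)
  finally show ?thesis .
qed

text \<open>With \<open>A = (x\<^sub>3z\<^sup>2 - 2x\<^sub>2z - x\<^sub>1)\<close> and \<open>B = x\<^sub>3|z|\<^sup>2 - 2x\<^sub>2x - x\<^sub>1\<close> the majorant
  \<open>R(X,z) + Q(X)\<close> equals \<open>N(B\<^sup>2 + |A|\<^sup>2)/(4y\<^sup>2)\<close>, and on a Siegel set \<open>B\<^sup>2 + |A|\<^sup>2\<close> controls all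
  coordinates of \<open>X\<close>.\<close>

lemma siegel_majorant:
  assumes N: "N > 0" and tr: "trace X = 0" and w: "w \<in> siegel_set"
  shows "\<exists>M\<ge>0. R N X w + Q N X = N * M\<^sup>2 / (4 * (Im w)\<^sup>2) \<and> cmod (QX N X w) \<le> N * M \<and>
    1 / theta_weight X \<le> 37 ^ 3 * (1 + M ^ 6)"
proof -
  define x y x1 x2 x3 where "x = Re w" "y = Im w" "x1 = X$1$2" "x2 = X$1$1" "x3 = X$2$1"
  note defs = this
  have x22: "X$2$2 = - x2" using tr by (simp add: trace_mat2 defs add_eq_0_iff)
  have y: "y \<ge> 1/2" and x: "\<bar>x\<bar> \<le> 1/2" using w by (auto simp: defs siegel_set_def)
  have wH: "w \<in> upper_half_plane" using w siegel_set_uhp by blast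
  define A1 A2 B where "A1 = x3 * (x\<^sup>2 - y\<^sup>2) - 2 * x2 * x - x1" "A2 = 2 * x3 * x * y - 2 * x2 * y"
    "B = x3 * (x\<^sup>2 + y\<^sup>2) - 2 * x2 * x - x1"
  note AB = this
  define M where "M = sqrt (B\<^sup>2 + A1\<^sup>2 + A2\<^sup>2)"
  have M2: "M\<^sup>2 = B\<^sup>2 + A1\<^sup>2 + A2\<^sup>2" by (simp add: M_def)
  have M0: "M \<ge> 0" by (simp add: M_def)
  have Qx: "QX N X w = Complex (N * A1) (N * A2)"
    by (simp add: QX_def complex_eq_iff AB defs power2_eq_square algebra_simps)
  have cQ: "(cmod (QX N X w))\<^sup>2 = N\<^sup>2 * (A1\<^sup>2 + A2\<^sup>2)" unfolding Qx cmod_power2 by (simp add: algebra_simps power2_eq_square)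
  \<comment> \<open>\<open>R\<close> has two expressions, one through B by definition and one
    through |A| by \<open>R_eq\<close>; their sum, with 2 Q added, is the symmetric
    majorant.\<close>
  have pz: "(pz N w X)\<^sup>2 = N / y\<^sup>2 * B\<^sup>2"
    unfolding pz_def using N by (simp add: AB defs cmod_power2 power_mult_distrib power_divide)
  have bQ: "bil N X X = 2 * Q N X"
    by (simp add: bil_def Q_def det_2 trace_mat2 mat2_mult_nth defs[symmetric] x22 power2_eq_square algebra_simps)
  have "R N X w = (cmod (QX N X w))\<^sup>2 / (2 * N * y\<^sup>2)" using R_eq[OF N tr wH] by (simp add: defs)
  hence R1: "R N X w = N * (A1\<^sup>2 + A2\<^sup>2) / (2 * y\<^sup>2)" unfolding cQ using N by (simp add: power2_eq_square)
  have R2: "R N X w = N * B\<^sup>2 / (2 * y\<^sup>2) - 2 * Q N X" by (simp add: R_def pz bQ)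
  have "2 * (R N X w + Q N X) = R N X w + (R N X w + 2 * Q N X)" by simp
  also have "\<dots> = N * (A1\<^sup>2 + A2\<^sup>2) / (2 * y\<^sup>2) + N * B\<^sup>2 / (2 * y\<^sup>2)" using R1 R2 by simp
  also have "\<dots> = N * M\<^sup>2 / (2 * y\<^sup>2)" by (simp add: M2 add_divide_distrib[symmetric] algebra_simps)
  finally have maj: "R N X w + Q N X = N * M\<^sup>2 / (4 * y\<^sup>2)" by simp
  have "(cmod (QX N X w))\<^sup>2 \<le> (N * M)\<^sup>2" unfolding cQ power_mult_distrib M2 by (intro mult_left_mono) auto
  hence cQM: "cmod (QX N X w) \<le> N * M" using N M0 by (rule_tac power2_le_imp_le) auto
  have cB: "\<bar>B\<bar> \<le> M" and cA1: "\<bar>A1\<bar> \<le> M" and cA2: "\<bar>A2\<bar> \<le> M"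
    by (intro power2_le_imp_le[OF _ M0]; simp add: M2)+
  \<comment> \<open>The entries are recovered in turn: B - A1 = 2 x3 y^2 gives x3, then A2 gives x2
    and B gives x1; |x| <= 1/2 and y >= 1/2 keep the constants absolute.\<close>
  have "2 * \<bar>x3\<bar> * y\<^sup>2 = \<bar>B - A1\<bar>" by (simp add: AB abs_mult algebra_simps)
  hence x3y: "\<bar>x3\<bar> * y\<^sup>2 \<le> M" using cB cA1 by linarith
  have y2: "y\<^sup>2 \<ge> 1/4" using power_mono[OF y, of 2] by (simp add: power2_eq_square)
  have "\<bar>x3\<bar> * (1/4) \<le> \<bar>x3\<bar> * y\<^sup>2" using y2 by (intro mult_left_mono) auto
  hence x3: "\<bar>x3\<bar> \<le> 4 * M" using x3y by linarith
  have "\<bar>x2\<bar> * (2 * (1/2)) \<le> \<bar>x2\<bar> * (2 * y)" using y by (intro mult_left_mono) auto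
  also have "\<dots> = \<bar>2 * x3 * x * y - A2\<bar>" using y by (simp add: AB abs_mult)
  also have "\<dots> \<le> \<bar>2 * x3 * x * y\<bar> + \<bar>A2\<bar>" by (rule abs_triangle_ineq4)
  finally have x2a: "\<bar>x2\<bar> \<le> \<bar>2 * x3 * x * y\<bar> + M" using cA2 by simp
  have "\<bar>2 * x3 * x * y\<bar> = \<bar>x3\<bar> * (2 * \<bar>x\<bar>) * y" using y by (simp add: abs_mult)
  also have "\<dots> \<le> \<bar>x3\<bar> * 1 * y" using x y by (intro mult_right_mono mult_left_mono) auto
  also have "\<dots> \<le> \<bar>x3\<bar> * (2 * y\<^sup>2)" using y by (simp add: power2_eq_square mult_left_mono)
  also have "\<dots> \<le> 2 * M" using x3y by simp
  finally have x2: "\<bar>x2\<bar> \<le> 3 * M" using x2a by simp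
  have "x1 = x3 * (x\<^sup>2 + y\<^sup>2) - 2 * x2 * x - B" by (simp add: AB)
  hence "\<bar>x1\<bar> \<le> \<bar>x3 * x\<^sup>2\<bar> + \<bar>x3 * y\<^sup>2\<bar> + \<bar>2 * x2 * x\<bar> + \<bar>B\<bar>" by (simp add: algebra_simps)
  moreover have "\<bar>x3 * x\<^sup>2\<bar> \<le> 4 * M * (1/4)"
  proof -
    have "x\<^sup>2 \<le> (1/2)\<^sup>2" using x by (metis abs_ge_zero power2_abs power_mono)
    hence "\<bar>x3\<bar> * x\<^sup>2 \<le> (4 * M) * (1/4)" using x3 M0 by (intro mult_mono) (auto simp: power2_eq_square)
    thus ?thesis by (simp add: abs_mult)
  qed
  moreover have "\<bar>2 * x2 * x\<bar> \<le> 3 * M"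
  proof -
    have "\<bar>x2\<bar> * (2 * \<bar>x\<bar>) \<le> 3 * M * 1" using x x2 M0 by (intro mult_mono) auto
    thus ?thesis by (simp add: abs_mult)
  qed
  moreover have "\<bar>x3 * y\<^sup>2\<bar> \<le> M" using x3y by (simp add: abs_mult)
  ultimately have x1: "\<bar>x1\<bar> \<le> 6 * M" using cB by simp
  have sq: "1 + t\<^sup>2 \<le> 1 + 36 * M\<^sup>2" if "\<bar>t\<bar> \<le> 6 * M" for t
    using power_mono[OF that abs_ge_zero, of 2] by (simp add: power_mult_distrib)
  have "1 / theta_weight X = (1 + x2\<^sup>2) * (1 + x1\<^sup>2) * (1 + x3\<^sup>2)" by (simp add: theta_weight_def defs)
  also have "\<dots> \<le> (1 + 36 * M\<^sup>2) * (1 + 36 * M\<^sup>2) * (1 + 36 * M\<^sup>2)"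
    using x1 x2 x3 M0 by (intro mult_mono sq) (auto intro!: mult_nonneg_nonneg add_nonneg_nonneg)
  also have "\<dots> = (1 + 36 * M\<^sup>2) ^ 3" by (simp add: power3_eq_cube)
  also have "\<dots> \<le> 37 ^ 3 * (1 + M ^ 6)"
  proof (cases "M \<le> 1")
    case True
    hence "M\<^sup>2 \<le> 1" using M0 by (simp add: power_le_one)
    hence "(1 + 36 * M\<^sup>2) ^ 3 \<le> 37 ^ 3" by (intro power_mono) auto
    also have "\<dots> \<le> 37 ^ 3 * (1 + M ^ 6)" by (simp add: algebra_simps)
    finally show ?thesis .
  next
    case False
    hence "1 + 36 * M\<^sup>2 \<le> 37 * M\<^sup>2" using one_le_power[of M 2] by simp
    hence "(1 + 36 * M\<^sup>2) ^ 3 \<le> (37 * M\<^sup>2) ^ 3" by (intro power_mono) auto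
    also have "\<dots> = 37 ^ 3 * M ^ 6" by (simp add: power_mult_distrib power_mult[symmetric])
    also have "\<dots> \<le> 37 ^ 3 * (1 + M ^ 6)" by simp
    finally show ?thesis .
  qed
  finally show ?thesis using maj cQM M0 by (intro exI[of _ M]) (auto simp: defs)
qed

text \<open>The majorant is a Gaussian in M / y, so growth in M of |QX|^(k+1) and of 1 /
  \<open>theta_weight\<close> costs powers of y, which the exponential decay of f absorbs. The
  exponents k + 1 and k + 7 come from M^(k+1) (1 + M^6).\<close>

lemma siegel_theta_bound:
  assumes N: "N > 0" and v: "v > 0" and f: "\<And>z. Im z \<ge> 1/2 \<Longrightarrow> cmod (f z) \<le> C * exp (- c * Im z)" and c: "c > 0"
  shows "\<exists>K\<ge>0. \<forall>X w. trace X = 0 \<longrightarrow> w \<in> siegel_set \<longrightarrow>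
    cmod (f w) * cmod (QX N X w) ^ (k + 1) * exp (- 2 * pi * v * (R N X w + Q N X)) \<le> K * theta_weight X"
proof -
  \<comment> \<open>The exponent 2 pi v N M^2 / (4 y^2) equals a (M / y)^2.\<close>
  define a where "a = pi * v * N / 2"
  have a: "a > 0" using N v by (simp add: a_def)
  define E where "E i = (1 + fact i / a ^ i) * (fact i / c ^ i)" for i :: nat
  have E0: "E i \<ge> 0" for i using a c by (simp add: E_def add_nonneg_nonneg)
  have C0: "C \<ge> 0" using order_trans[OF norm_ge_zero f[of \<i>]] by (simp add: zero_le_mult_iff)
  define K where "K = N ^ (k + 1) * C * 37 ^ 3 * (E (k + 1) + E (k + 7))"
  have K0: "K \<ge> 0" using N C0 E0 by (simp add: K_def)
  have main: "cmod (f w) * cmod (QX N X w) ^ (k + 1) * exp (- 2 * pi * v * (R N X w + Q N X)) \<le> K * theta_weight X"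
    if tr: "trace X = 0" and w: "w \<in> siegel_set" for X w
  proof -
    define y where "y = Im w"
    have y: "y \<ge> 1/2" using w by (simp add: siegel_set_def y_def)
    obtain M where M: "M \<ge> 0" "R N X w + Q N X = N * M\<^sup>2 / (4 * y\<^sup>2)" "cmod (QX N X w) \<le> N * M"
      "1 / theta_weight X \<le> 37 ^ 3 * (1 + M ^ 6)"
      using siegel_majorant[OF N tr w] by (auto simp: y_def)
    have tw: "theta_weight X > 0" by (simp add: theta_weight_def add_pos_nonneg)
    define e where "e = exp (- a * (M / y)\<^sup>2)"
    have e: "exp (- 2 * pi * v * (R N X w + Q N X)) = e"
      unfolding M(2) e_def a_def power_divide using y by (simp add: field_simps)
    have mono: "M ^ i * e * exp (- c * y) \<le> E i" for i
    proof -
      have "M ^ i * e * exp (- c * y) = ((M / y) ^ i * e) * (y ^ i * exp (- c * y))"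
        using y by (simp add: power_divide)
      also have "\<dots> \<le> (1 + fact i / a ^ i) * (fact i / c ^ i)"
        unfolding e_def using y M(1) a c
        by (intro mult_mono power_mult_gauss_le power_mult_exp_le) (auto intro!: add_nonneg_nonneg mult_nonneg_nonneg)
      finally show ?thesis by (simp add: E_def)
    qed
    have "cmod (f w) * cmod (QX N X w) ^ (k + 1) * e * (1 / theta_weight X) \<le>
       (C * exp (- c * y)) * (N * M) ^ (k + 1) * e * (37 ^ 3 * (1 + M ^ 6))"
      using f[of w] y M N tw C0 by (intro mult_mono power_mono) (auto simp: y_def e_def)
    also have "\<dots> = N ^ (k + 1) * C * 37 ^ 3 * (M ^ (k + 1) * e * exp (- c * y) + M ^ (k + 7) * e * exp (- c * y))"
      by (simp add: power_mult_distrib algebra_simps power_add[symmetric] numeral_eq_Suc)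
    also have "\<dots> \<le> K" unfolding K_def using N C0 by (intro mult_left_mono add_mono mono) auto
    finally show ?thesis unfolding e using tw by (simp add: field_simps)
  qed
  show ?thesis using K0 main by blast
qed

text \<open>There are finitely many residue patterns modulo n, and two matrices of SL2(Z) with the
  same pattern differ by a left factor in Gamma(n).\<close>

lemma SL2Z_finite_cosets:
  assumes n: "n \<ge> 1"
  shows "\<exists>T. finite T \<and> T \<subseteq> SL2Z \<and> (\<forall>g\<in>SL2Z. \<exists>\<sigma>\<in>T. \<exists>\<gamma>\<in>principal_congruence n. g = \<gamma> ** \<sigma>)"
proof -
  define r where "r g = (\<lambda>i j. \<lfloor>g $ i $ j\<rfloor> mod int n)" for g :: mat2
  have "r ` SL2Z \<subseteq> (\<lambda>(a, b, c, d) i j. if i = 1 then (if j = 1 then a else b) else (if j = 1 then c else d)) ` 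
     ({0..<int n} \<times> {0..<int n} \<times> {0..<int n} \<times> {0..<int n})"
  proof
    fix f assume "f \<in> r ` SL2Z"
    then obtain g where g: "f = r g" by blast
    have "r g = (\<lambda>i j. if i = 1 then (if j = 1 then r g 1 1 else r g 1 2) else (if j = 1 then r g 2 1 else r g 2 2))"
      by (intro ext) (metis exhaust_2)
    moreover have "r g i j \<in> {0..<int n}" for i j using n by (simp add: r_def)
    ultimately show "f \<in> (\<lambda>(a, b, c, d) i j. if i = 1 then (if j = 1 then a else b) else (if j = 1 then c else d)) ` 
       ({0..<int n} \<times> {0..<int n} \<times> {0..<int n} \<times> {0..<int n})"
      unfolding g by (intro image_eqI[of _ _ "(r g 1 1, r g 1 2, r g 2 1, r g 2 2)"]) auto
  qed
  hence "finite (r ` SL2Z)" by (rule finite_subset) auto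
  then obtain T where T: "T \<subseteq> SL2Z" "finite T" "r ` SL2Z = r ` T"
    by (metis finite_subset_image subset_refl)
  have "\<exists>\<sigma>\<in>T. \<exists>\<gamma>\<in>principal_congruence n. g = \<gamma> ** \<sigma>" if g: "g \<in> SL2Z" for g
  proof -
    have "r g \<in> r ` T" using T(3) g by blast
    then obtain \<sigma> where s: "\<sigma> \<in> T" "r g = r \<sigma>" by blast
    have sZ: "\<sigma> \<in> SL2Z" using s T by blast
    have dets: "det \<sigma> = 1" "det g = 1" using det1_SL2Z sZ g by auto
    have "\<exists>a. g $ i $ j = \<sigma> $ i $ j + of_int (int n * a)" for i j
    proof -
      have "g $ i $ j \<in> \<int>" "\<sigma> $ i $ j \<in> \<int>" using g sZ by (auto simp: SL2Z_def)
      then obtain p q where pq: "g $ i $ j = of_int p" "\<sigma> $ i $ j = of_int q" by (auto elim!: Ints_cases)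
      have "p mod int n = q mod int n" using fun_cong[OF fun_cong[OF s(2)], of i j] by (simp add: r_def pq)
      hence "int n dvd p - q" by (simp add: mod_eq_dvd_iff)
      then obtain a where "p - q = int n * a" by (auto simp: dvd_def)
      hence "of_int p = real_of_int q + of_int (int n * a)" by (metis add.commute diff_add_cancel of_int_add)
      thus ?thesis using pq by auto
    qed
    then obtain E where E: "\<And>i j. g $ i $ j = \<sigma> $ i $ j + of_int (int n * E i j)" by metis
    define \<gamma> where "\<gamma> = g ** matrix_inv \<sigma>"
    have "\<gamma> \<in> SL2Z" unfolding \<gamma>_def using g sZ SL2Z.mult_mem SL2Z.inv_mem by blast
    moreover have "\<exists>a::int. \<gamma> $ i $ j = mat 1 $ i $ j + of_int (int n * a)" for i j
    proof -
      define \<tau> where "\<tau> = matrix_inv \<sigma>"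
      have "\<tau> \<in> SL2Z" unfolding \<tau>_def using sZ SL2Z.inv_mem by blast
      then have "\<tau> $ 1 $ j \<in> \<int>" "\<tau> $ 2 $ j \<in> \<int>" by (auto simp: SL2Z_def)
      then obtain p q where pq: "\<tau> $ 1 $ j = of_int p" "\<tau> $ 2 $ j = of_int q" by (auto elim!: Ints_cases)
      have "\<gamma> $ i $ j = (\<sigma> ** \<tau>) $ i $ j + of_int (int n * (E i 1 * p + E i 2 * q))"
        unfolding \<gamma>_def \<tau>_def[symmetric] mat2_mult_nth E[of i] pq by (simp add: algebra_simps)
      also have "\<sigma> ** \<tau> = mat 1" unfolding \<tau>_def by (rule matrix_inv_right[OF dets(1)])
      finally show ?thesis by blast
    qed
    ultimately have "\<gamma> \<in> principal_congruence n" by (auto simp: principal_congruence_def)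
    moreover have "g = \<gamma> ** \<sigma>" using dets by (simp add: \<gamma>_def mat2_cancel_right)
    ultimately show ?thesis using s(1) by blast
  qed
  thus ?thesis using T by blast
qed

text \<open>What is kept of the lattice: \<open>h\<close> is a set of trace-zero matrices of bounded
  denominator, stable under the group. Stability of a single coset combines the invariance of L with
  the trivial action on L'/L. \<open>conductor\<close> is an n with Gamma(n) inside the
  group.\<close>

locale shintani_data = fuchsian +
  fixes N :: real and k :: nat and G :: "complex \<Rightarrow> complex" and \<tau> :: complex
    and h :: "mat2 set" and conductor denom :: nat
  assumes N_pos: "N > 0" and N_rat: "N \<in> \<rat>"
    and cusp_form: "G \<in> cusp_forms \<Gamma> (2 * k + 2)"
    and conductor: "conductor \<ge> 1" "principal_congruence conductor \<subseteq> \<Gamma>"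
    and denom_pos: "denom > 0"
    and h_denominator: "X \<in> h \<Longrightarrow> denominator_bounded denom X"
    and h_trace: "X \<in> h \<Longrightarrow> trace X = 0"
    and h_invariant: "\<gamma> \<in> \<Gamma> \<Longrightarrow> X \<in> h \<Longrightarrow> conj_act \<gamma> X \<in> h"
    and tau: "\<tau> \<in> upper_half_plane"
begin

section \<open>The summand of the lift and its equivariance\<close>

lemma v_pos: "Im \<tau> > 0"
  using tau by (simp add: upper_half_plane_def)

text \<open>The values of \<open>G\<close> off the half-plane are arbitrary and need not be measurable.\<close>

definition G0 :: "complex \<Rightarrow> complex" where
  "G0 z = (if z \<in> upper_half_plane then G z else 0)"

lemma G_holomorphic: "G holomorphic_on upper_half_plane"
  using cusp_form by (simp add: cusp_forms_def)

lemma measurable_G0 [measurable]: "G0 \<in> borel_measurable borel"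
proof -
  have "(\<lambda>z. if z \<in> upper_half_plane then G z else 0) \<in> borel_measurable borel"
    by (rule borel_measurable_continuous_on_if)
      (auto intro: holomorphic_on_imp_continuous_on[OF G_holomorphic])
  thus ?thesis by (simp add: G0_def[abs_def])
qed

lemma measurable_QX [measurable]: "QX N X \<in> borel_measurable borel"
  unfolding QX_def by (intro borel_measurable_continuous_onI continuous_intros)

lemma measurable_R [measurable]: "R N X \<in> borel_measurable borel"
  unfolding R_def pz_def by measurable

text \<open>On the half-plane, \<open>G\<close> times the conjugate theta kernel times y^(2k+2) is
  the sum of \<open>coef X * phi X z\<close>: conjugation turns \<open>QX\<close> at the conjugate
  point into \<open>QX\<close> at z, the powers of y cancel, and \<open>coef\<close> collects what
  is independent of z and constant on orbits.\<close>

definition phi :: "mat2 \<Rightarrow> complex \<Rightarrow> complex" where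
  "phi X z = G0 z * QX N X z ^ (k + 1) * of_real (exp (- 2 * pi * Im \<tau> * R N X z))"

definition coef :: "mat2 \<Rightarrow> complex" where
  "coef X = of_real (sqrt (Im \<tau>)) * cnj (exp (2 * of_real pi * \<i> * of_real (Q N X) * \<tau>))"

lemma measurable_phi [measurable]: "phi X \<in> borel_measurable borel"
  unfolding phi_def by measurable

lemma G_moebius:
  assumes "\<gamma> \<in> \<Gamma>" "z \<in> upper_half_plane"
  shows "G (moebius_act \<gamma> z) = aut \<gamma> z ^ (2 * k + 2) * G z"
proof -
  have "slash (2 * k + 2) G \<gamma> z = G z" using cusp_form assms by (simp add: cusp_forms_def)
  thus ?thesis using aut_nz[OF det1[OF assms(1)] assms(2)] by (simp add: slash_eq field_simps)
qed

text \<open>Weight 2k + 2 of the slash action against weight -2 of \<open>QX\<close>, taken k + 1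
  times. It holds for all g of determinant 1 and so also covers the passage to a cusp, where the
  slash of \<open>G\<close> is another function.\<close>

lemma G_QX_moebius:
  assumes "det g = 1" "trace X = 0" "z \<in> upper_half_plane"
  shows "G (moebius_act g z) * QX N X (moebius_act g z) ^ (k + 1) =
    slash (2 * k + 2) G g z * QX N (conj_act (matrix_inv g) X) z ^ (k + 1)"
proof -
  define Y where "Y = conj_act (matrix_inv g) X"
  have Y: "X = conj_act g Y" "trace Y = 0"
    using assms by (simp_all add: Y_def conj_act_inv det_matrix_inv)
  have "aut g z ^ (2 * k + 2) = ((aut g z)\<^sup>2) ^ (k + 1)" by (simp only: power_mult[symmetric]) (simp add: algebra_simps)
  thus ?thesis unfolding Y_def[symmetric] unfolding Y(1) using aut_nz[OF assms(1,3)]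
    by (simp only: QX_conj_act[OF assms(1) Y(2) assms(3)] slash_eq power_divide) simp
qed

lemma phi_equivariant:
  assumes "\<gamma> \<in> \<Gamma>" "trace X = 0" "z \<in> upper_half_plane"
  shows "phi (conj_act \<gamma> X) (moebius_act \<gamma> z) = phi X z"
proof -
  have det: "det \<gamma> = 1" using det1 assms by blast
  have "G (moebius_act \<gamma> z) * QX N (conj_act \<gamma> X) (moebius_act \<gamma> z) ^ (k + 1) = G z * QX N X z ^ (k + 1)"
    using assms G_QX_moebius[OF det, of "conj_act \<gamma> X" z] cusp_form
    by (simp add: det conj_act_inv cusp_forms_def)
  thus ?thesis using moebius_upper_half_plane[OF det assms(3)] assms
    by (simp add: phi_def G0_def R_conj_act N_pos det)
qed

lemma coef_conj_act [simp]: "det g = 1 \<Longrightarrow> coef (conj_act g X) = coef X"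
  by (simp add: coef_def)

lemma h_countable: "countable h"
  by (rule countable_subset[OF _ denominator_bounded_countable[OF denom_pos]]) (auto dest: h_denominator)

lemma norm_coef_phi:
  assumes "z \<in> upper_half_plane"
  shows "cmod (coef X * phi X z) = sqrt (Im \<tau>) * (cmod (G z) * cmod (QX N X z) ^ (k + 1) * exp (- 2 * pi * Im \<tau> * (R N X z + Q N X)))"
proof -
  have "cmod (exp (2 * of_real pi * \<i> * of_real (Q N X) * \<tau>)) = exp (- 2 * pi * Im \<tau> * Q N X)"
    by (simp add: norm_exp_eq_Re)
  moreover have "exp (- 2 * pi * Im \<tau> * (R N X z + Q N X)) = exp (- 2 * pi * Im \<tau> * R N X z) * exp (- 2 * pi * Im \<tau> * Q N X)"
    by (simp add: exp_add[symmetric] algebra_simps)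
  ultimately show ?thesis using assms v_pos
    by (simp add: coef_def phi_def G0_def norm_mult norm_power mult_ac)
qed

text \<open>Reduction by SL2(Z) followed by the coset decomposition modulo Gamma(n): finitely many
  SL2(Z)-translates of one Siegel set meet every orbit of the group.\<close>

lemma siegel_cover:
  "\<exists>T. finite T \<and> T \<subseteq> SL2Z \<and> (\<forall>z\<in>upper_half_plane. \<exists>\<gamma>\<in>\<Gamma>. \<exists>\<sigma>\<in>T. moebius_act (matrix_inv \<sigma>) (moebius_act \<gamma> z) \<in> siegel_set)"
proof -
  obtain T where T: "finite T" "T \<subseteq> SL2Z" "\<forall>g\<in>SL2Z. \<exists>\<sigma>\<in>T. \<exists>\<gamma>\<in>principal_congruence conductor. g = \<gamma> ** \<sigma>"
    using SL2Z_finite_cosets[OF conductor(1)] by blast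
  have "\<exists>\<gamma>\<in>\<Gamma>. \<exists>\<sigma>\<in>T. moebius_act (matrix_inv \<sigma>) (moebius_act \<gamma> z) \<in> siegel_set" if z: "z \<in> upper_half_plane" for z
  proof -
    obtain g where g: "g \<in> SL2Z" "moebius_act g z \<in> siegel_set"
      using SL2Z_reduction[OF z] by (auto simp: siegel_set_def)
    obtain \<sigma> \<gamma> where s: "\<sigma> \<in> T" "\<gamma> \<in> \<Gamma>" "matrix_inv g = \<gamma> ** \<sigma>"
      using T(3) SL2Z.inv_mem[OF g(1)] conductor(2) by blast
    have det: "det \<sigma> = 1" "det \<gamma> = 1" "det g = 1" using s T(2) g det1 det1_SL2Z by auto
    have "g = matrix_inv (\<gamma> ** \<sigma>)" using s(3) matrix_inv_matrix_inv[OF det(3)] by metis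
    hence "g = matrix_inv \<sigma> ** matrix_inv \<gamma>" using det by (simp add: matrix_inv_mult)
    hence "moebius_act g z = moebius_act (matrix_inv \<sigma>) (moebius_act (matrix_inv \<gamma>) z)"
      using z det by (simp add: moebius_act_mult det_matrix_inv)
    thus ?thesis using g s inv_mem by auto
  qed
  thus ?thesis using T by blast
qed

text \<open>The sum \<psi> of absolute values is invariant, so it may be integrated over the Siegel
  cover instead of \<open>F\<close>. On the translate by \<sigma>, putting z = \<sigma> w replaces
  \<open>h\<close> by its conjugate and \<open>G\<close> by its slash;
  \<open>siegel_theta_bound\<close> then bounds \<psi> by a constant, and the volume is
  finite.\<close>

lemma theta_absolutely_convergent:
  assumes F: "fundamental_domain \<Gamma> F"
  shows "(\<integral>\<^sup>+X. \<integral>\<^sup>+z. ennreal (cmod (coef X * phi X z)) * indicator F z \<partial>hyp \<partial>count_space h) < \<infinity>"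
proof -
  have [measurable]: "F \<in> sets borel" using F by (simp add: fundamental_domain_def)
  note cnt = h_countable
  define \<psi> where "\<psi> z = (\<integral>\<^sup>+X. ennreal (cmod (coef X * phi X z)) \<partial>count_space h)" for z
  have [measurable]: "\<psi> \<in> borel_measurable borel"
  proof (cases "finite h")
    case True
    thus ?thesis unfolding \<psi>_def by (simp add: nn_integral_count_space_finite)
  next
    case False
    have "\<psi> z = (\<Sum>n. ennreal (cmod (coef (from_nat_into h n) * phi (from_nat_into h n) z)))" for z
      unfolding \<psi>_def using nn_integral_bij_count_space[OF bij_betw_from_nat_into[OF cnt False], symmetric]
      by (simp add: nn_integral_count_space_nat)
    hence "\<psi> = (\<lambda>z. \<Sum>n. ennreal (cmod (coef (from_nat_into h n) * phi (from_nat_into h n) z)))" by (rule ext)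
    thus ?thesis by simp
  qed
  obtain T where T: "finite T" "T \<subseteq> SL2Z"
    "\<And>z. z \<in> upper_half_plane \<Longrightarrow> \<exists>\<gamma>\<in>\<Gamma>. \<exists>\<sigma>\<in>T. moebius_act (matrix_inv \<sigma>) (moebius_act \<gamma> z) \<in> siegel_set"
    using siegel_cover by blast
  define B where "B = (\<Union>\<sigma>\<in>T. moebius_act (matrix_inv \<sigma>) -` siegel_set)"
  have [measurable]: "moebius_act g -` siegel_set \<in> sets borel" for g
    using measurable_sets_borel[OF measurable_moebius_act borel_siegel_set] by simp
  have [measurable]: "B \<in> sets borel" unfolding B_def using T by auto
  have piece: "(\<integral>\<^sup>+z. \<psi> z * indicator (moebius_act (matrix_inv \<sigma>) -` siegel_set) z \<partial>hyp) < \<infinity>" if "\<sigma> \<in> T" for \<sigma>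
  proof -
    have s: "\<sigma> \<in> SL2Z" and det: "det \<sigma> = 1" using that T det1_SL2Z by auto
    obtain C c where C: "c > 0" "\<And>z. Im z \<ge> 1/2 \<Longrightarrow> cmod (slash (2 * k + 2) G \<sigma> z) \<le> C * exp (- c * Im z)"
      using cusp_form_decay[OF cusp_form s] by blast
    obtain K where K: "K \<ge> 0" "\<And>X w. trace X = 0 \<Longrightarrow> w \<in> siegel_set \<Longrightarrow>
      cmod (slash (2 * k + 2) G \<sigma> w) * cmod (QX N X w) ^ (k + 1) * exp (- 2 * pi * Im \<tau> * (R N X w + Q N X)) \<le> K * theta_weight X"
      using siegel_theta_bound[OF N_pos v_pos C(2) C(1), of k] by blast
    define W where "W = (\<integral>\<^sup>+X. ennreal (theta_weight X) \<partial>count_space {X. trace X = 0 \<and> denominator_bounded denom X})"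
    have W: "W < \<infinity>" unfolding W_def by (rule nn_integral_theta_weight[OF denom_pos])
    have "\<psi> (moebius_act \<sigma> w) \<le> ennreal (sqrt (Im \<tau>) * K) * W" if w: "w \<in> siegel_set" for w
    proof -
      have wH: "w \<in> upper_half_plane" using w siegel_set_uhp by blast
      have swH: "moebius_act \<sigma> w \<in> upper_half_plane" by (rule moebius_upper_half_plane[OF det wH])
      \<comment> \<open>Conjugation by an element of SL2(Z) keeps the denominator bound, so the
        transformed index set stays where \<open>theta_weight\<close> is summable.\<close>
      define c' where "c' X = conj_act (matrix_inv \<sigma>) X" for X
      have inj: "inj_on c' h" unfolding c'_def inj_on_def using conj_act_inv(2)[OF det] by metis
      have img: "c' ` h \<subseteq> {X. trace X = 0 \<and> denominator_bounded denom X}"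
        using h_trace h_denominator det s SL2Z.inv_mem[OF s]
        by (auto simp: c'_def det_matrix_inv) (simp add: conj_act_def matrix_inv_matrix_inv denominator_bounded_mult_SL2Z)
      have bnd: "ennreal (cmod (coef X * phi X (moebius_act \<sigma> w))) \<le> ennreal (sqrt (Im \<tau>) * K) * ennreal (theta_weight (c' X))" if X: "X \<in> h" for X
      proof -
        have trX: "trace X = 0" "trace (c' X) = 0" using X h_trace det by (auto simp: c'_def det_matrix_inv)
        have RX: "R N X (moebius_act \<sigma> w) = R N (c' X) w" "Q N X = Q N (c' X)"
          using R_conj_act[OF N_pos det trX(2) wH] by (simp_all add: c'_def conj_act_inv det det_matrix_inv)
        have "cmod (G (moebius_act \<sigma> w)) * cmod (QX N X (moebius_act \<sigma> w)) ^ (k + 1) = 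
            cmod (slash (2 * k + 2) G \<sigma> w) * cmod (QX N (c' X) w) ^ (k + 1)"
          using arg_cong[OF G_QX_moebius[OF det trX(1) wH], of cmod] by (simp add: norm_mult norm_power c'_def)
        hence "cmod (coef X * phi X (moebius_act \<sigma> w)) = sqrt (Im \<tau>) * (cmod (slash (2 * k + 2) G \<sigma> w) * cmod (QX N (c' X) w) ^ (k + 1) * exp (- 2 * pi * Im \<tau> * (R N (c' X) w + Q N (c' X))))"
          by (simp only: norm_coef_phi[OF swH] RX)
        also have "\<dots> \<le> sqrt (Im \<tau>) * (K * theta_weight (c' X))"
          using K(2)[OF trX(2) w] v_pos by (intro mult_left_mono) auto
        finally have *: "cmod (coef X * phi X (moebius_act \<sigma> w)) \<le> (sqrt (Im \<tau>) * K) * theta_weight (c' X)" by (simp add: mult.assoc)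
        have tw: "theta_weight (c' X) \<ge> 0" by (simp add: theta_weight_def)
        show ?thesis using ennreal_leI[OF *] v_pos K(1) tw by (simp add: ennreal_mult)
      qed
      have "\<psi> (moebius_act \<sigma> w) \<le> (\<integral>\<^sup>+X. ennreal (sqrt (Im \<tau>) * K) * ennreal (theta_weight (c' X)) \<partial>count_space h)"
        unfolding \<psi>_def by (intro nn_integral_mono bnd) simp
      also have "\<dots> = ennreal (sqrt (Im \<tau>) * K) * (\<integral>\<^sup>+X. ennreal (theta_weight (c' X)) \<partial>count_space h)"
        by (simp add: nn_integral_cmult)
      also have "(\<integral>\<^sup>+X. ennreal (theta_weight (c' X)) \<partial>count_space h) = (\<integral>\<^sup>+X. ennreal (theta_weight X) \<partial>count_space (c' ` h))"
        by (rule nn_integral_bij_count_space) (use inj in \<open>simp add: bij_betw_def\<close>)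
      also have "\<dots> = (\<integral>\<^sup>+X. ennreal (theta_weight X) * indicator (c' ` h) X \<partial>count_space UNIV)"
        by (rule nn_integral_count_space_indicator) auto
      also have "\<dots> \<le> (\<integral>\<^sup>+X. ennreal (theta_weight X) * indicator {X. trace X = 0 \<and> denominator_bounded denom X} X \<partial>count_space UNIV)"
        using img by (intro nn_integral_mono) (auto simp: indicator_def)
      also have "\<dots> = W" unfolding W_def by (rule nn_integral_count_space_indicator[symmetric]) auto
      finally show ?thesis by (simp add: mult_left_mono)
    qed
    note bound = this
    have "(\<integral>\<^sup>+z. \<psi> z * indicator (moebius_act (matrix_inv \<sigma>) -` siegel_set) z \<partial>hyp) =
      (\<integral>\<^sup>+w. \<psi> (moebius_act \<sigma> w) * indicator (moebius_act (matrix_inv \<sigma>) -` siegel_set) (moebius_act \<sigma> w) \<partial>hyp)"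
      by (rule nn_integral_hyp_moebius[symmetric, OF _ det]) measurable
    also have "\<dots> = (\<integral>\<^sup>+w. \<psi> (moebius_act \<sigma> w) * indicator siegel_set w \<partial>hyp)"
      by (rule nn_integral_hyp_cong) (simp add: indicator_def moebius_act_inv det)
    also have "\<dots> \<le> (\<integral>\<^sup>+w. (ennreal (sqrt (Im \<tau>) * K) * W) * indicator siegel_set w \<partial>hyp)"
      using bound by (intro nn_integral_mono) (auto simp: indicator_def)
    also have "\<dots> = (ennreal (sqrt (Im \<tau>) * K) * W) * emeasure hyp siegel_set"
      by (subst nn_integral_cmult) auto
    also have "\<dots> < \<infinity>" using W emeasure_siegel_set by (simp add: ennreal_mult_less_top)
    finally show ?thesis .
  qed
  have inv: "\<psi> (moebius_act \<gamma> z) = \<psi> z" if g: "\<gamma> \<in> \<Gamma>" and z: "z \<in> upper_half_plane" for \<gamma> z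
  proof -
    have det: "det \<gamma> = 1" using det1 g by blast
    have bij: "bij_betw (conj_act \<gamma>) h h"
      by (rule bij_betw_byWitness[where f' = "conj_act (matrix_inv \<gamma>)"])
        (auto simp: conj_act_inv det h_invariant g inv_mem)
    have "\<psi> (moebius_act \<gamma> z) = (\<integral>\<^sup>+X. ennreal (cmod (coef (conj_act \<gamma> X) * phi (conj_act \<gamma> X) (moebius_act \<gamma> z))) \<partial>count_space h)"
      unfolding \<psi>_def by (rule nn_integral_bij_count_space[OF bij, symmetric])
    also have "\<dots> = \<psi> z" unfolding \<psi>_def
      by (rule nn_integral_cong) (simp add: det phi_equivariant g z h_trace)
    finally show ?thesis .
  qed
  have "(\<integral>\<^sup>+X. \<integral>\<^sup>+z. ennreal (cmod (coef X * phi X z)) * indicator F z \<partial>hyp \<partial>count_space h) =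
    (\<integral>\<^sup>+z. \<integral>\<^sup>+X. ennreal (cmod (coef X * phi X z)) * indicator F z \<partial>count_space h \<partial>hyp)"
    using cnt by (intro nn_integral_count_space_nn_integral[symmetric]) measurable
  also have "\<dots> = (\<integral>\<^sup>+z. \<psi> z * indicator F z \<partial>hyp)"
    unfolding \<psi>_def by (simp add: nn_integral_multc)
  also have "\<dots> \<le> of_nat center_order * (\<integral>\<^sup>+z. \<psi> z * indicator B z \<partial>hyp)"
  proof (rule nn_integral_fundamental_domain_le[OF F])
    show "\<exists>\<gamma>\<in>\<Gamma>. moebius_act \<gamma> z \<in> B" if "z \<in> upper_half_plane" for z
      using T(3)[OF that] by (auto simp: B_def)
  qed (auto simp: inv)
  also have "(\<integral>\<^sup>+z. \<psi> z * indicator B z \<partial>hyp) \<le> (\<integral>\<^sup>+z. (\<Sum>\<sigma>\<in>T. \<psi> z * indicator (moebius_act (matrix_inv \<sigma>) -` siegel_set) z) \<partial>hyp)"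
  proof (rule nn_integral_mono)
    fix z
    show "\<psi> z * indicator B z \<le> (\<Sum>\<sigma>\<in>T. \<psi> z * indicator (moebius_act (matrix_inv \<sigma>) -` siegel_set) z)"
    proof (cases "z \<in> B")
      case True
      then obtain \<sigma> where s: "\<sigma> \<in> T" "z \<in> moebius_act (matrix_inv \<sigma>) -` siegel_set" by (auto simp: B_def)
      have "\<psi> z * indicator B z = \<psi> z * indicator (moebius_act (matrix_inv \<sigma>) -` siegel_set) z" using True s by simp
      also have "\<dots> \<le> (\<Sum>\<sigma>\<in>T. \<psi> z * indicator (moebius_act (matrix_inv \<sigma>) -` siegel_set) z)"
        using s(1) T(1) by (intro member_le_sum[where f = "\<lambda>\<sigma>. \<psi> z * indicator (moebius_act (matrix_inv \<sigma>) -` siegel_set) z"]) auto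
      finally show ?thesis .
    qed simp
  qed
  also have "\<dots> = (\<Sum>\<sigma>\<in>T. \<integral>\<^sup>+z. \<psi> z * indicator (moebius_act (matrix_inv \<sigma>) -` siegel_set) z \<partial>hyp)"
    by (rule nn_integral_sum) measurable
  also have "of_nat center_order * \<dots> < \<infinity>"
    using piece T(1) by (simp add: ennreal_mult_less_top ennreal_of_nat_eq_real_of_nat)
  finally show ?thesis by (simp add: mult_left_mono)
qed

end


section \<open>Orbits of definite and isotropic vectors\<close>

lemma integral_hyp_moebius:
  fixes f :: "complex \<Rightarrow> complex"
  assumes [measurable]: "f \<in> borel_measurable borel" and "det g = 1"
  shows "(LINT z|hyp. f (moebius_act g z)) = (LINT z|hyp. f z)"
proof -
  have "(LINT z|hyp. f z) = (LINT z|distr hyp borel (moebius_act g). f z)"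
    using distr_hyp_moebius assms by simp
  also have "\<dots> = (LINT z|hyp. f (moebius_act g z))" by (rule integral_distr) auto
  finally show ?thesis ..
qed

lemma integral_hyp_cong:
  fixes f g :: "complex \<Rightarrow> complex"
  assumes [measurable]: "f \<in> borel_measurable borel" "g \<in> borel_measurable borel"
    and "\<And>z. z \<in> upper_half_plane \<Longrightarrow> f z = g z"
  shows "(LINT z|hyp. f z) = (LINT z|hyp. g z)"
  by (rule integral_cong_AE) (use AE_hyp assms in \<open>auto elim!: eventually_mono\<close>)

lemma integral_hyp_hpt:
  fixes f :: "complex \<Rightarrow> complex"
  assumes [measurable]: "f \<in> borel_measurable borel" and f: "integrable hyp f"
  shows "(LINT z|hyp. f z) = (LINT s|lborel. LINT t|lborel. f (hpt s t))"
    and "(LINT z|hyp. f z) = (LINT t|lborel. LINT s|lborel. f (hpt s t))"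
proof -
  have i: "integrable (lborel \<Otimes>\<^sub>M lborel) (\<lambda>(s, t). f (hpt s t))"
    using f unfolding hyp_eq_distr by (subst (asm) integrable_distr_eq) (auto simp: case_prod_unfold)
  have "(LINT z|hyp. f z) = (LINT p|(lborel \<Otimes>\<^sub>M lborel). (case p of (s, t) \<Rightarrow> f (hpt s t)))"
    unfolding hyp_eq_distr by (subst integral_distr) (auto simp: case_prod_unfold)
  also have "\<dots> = (LINT s|lborel. LINT t|lborel. f (hpt s t))"
    using lborel_pair.integral_fst'[OF i] by simp
  finally show 1: "(LINT z|hyp. f z) = (LINT s|lborel. LINT t|lborel. f (hpt s t))" .
  show "(LINT z|hyp. f z) = (LINT t|lborel. LINT s|lborel. f (hpt s t))"
    unfolding 1 using lborel_pair.Fubini_integral[OF i] by simp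
qed

text \<open>For trace 0 and determinant 1 one has Y^2 = -1, so this is cos \<theta> + sin \<theta> Y
  = exp(\<theta> Y), the rotations about the fixed point of Y.\<close>

definition flow_rotation :: "mat2 \<Rightarrow> real \<Rightarrow> mat2" where
  "flow_rotation Y \<theta> = M2 (cos \<theta> + sin \<theta> * Y$1$1) (sin \<theta> * Y$1$2) (sin \<theta> * Y$2$1) (cos \<theta> - sin \<theta> * Y$1$1)"

lemma flow_rotation:
  assumes "det Y = 1" "trace Y = 0"
  shows "det (flow_rotation Y \<theta>) = 1" "conj_act (flow_rotation Y \<theta>) (r *\<^sub>R Y) = r *\<^sub>R Y"
proof -
  have y22: "Y$2$2 = - Y$1$1" using assms(2) by (simp add: trace_mat2 add_eq_0_iff)
  have dY: "Y$1$1 * - Y$1$1 - Y$1$2 * Y$2$1 = 1" using assms(1) y22 by (simp add: det_2)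
  have sc: "(sin \<theta>)\<^sup>2 + (cos \<theta>)\<^sup>2 = 1" by simp
  show d: "det (flow_rotation Y \<theta>) = 1"
    unfolding flow_rotation_def det_M2 using dY sc by algebra
  show "conj_act (flow_rotation Y \<theta>) (r *\<^sub>R Y) = r *\<^sub>R Y"
    unfolding conj_act_eq_iff_commute[OF d]
    by (simp add: mat2_eq_iff mat2_mult_nth flow_rotation_def y22 algebra_simps)
qed

section \<open>Flow lines and definite vectors\<close>

context shintani_data
begin

lemma exists_primitive:
  "\<exists>P. \<forall>z\<in>upper_half_plane. (P has_field_derivative G z * QX N X z ^ k) (at z)"
proof -
  have "(\<lambda>z. G z * QX N X z ^ k) holomorphic_on upper_half_plane"
    unfolding QX_def by (intro holomorphic_intros G_holomorphic)
  from holomorphic_convex_primitive'[OF convex_uhp open_uhp this]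
  obtain P where "\<And>z. z \<in> upper_half_plane \<Longrightarrow> (P has_field_derivative G z * QX N X z ^ k) (at z within upper_half_plane)"
    by blast
  hence "(P has_field_derivative G z * QX N X z ^ k) (at z)" if "z \<in> upper_half_plane" for z
    using that at_within_open[OF that open_uhp] by metis
  thus ?thesis by blast
qed

text \<open>On a curve with velocity \<alpha> Q_X, the integrand G Q_X^(k+1) ds is dP / \<alpha>:
  one factor of Q_X is spent on the velocity.\<close>

lemma flow_integral:
  fixes c :: "real \<Rightarrow> complex"
  assumes P: "\<And>z. z \<in> upper_half_plane \<Longrightarrow> (P has_field_derivative G z * QX N X z ^ k) (at z)"
    and c: "\<And>s. c s \<in> upper_half_plane"
    and c': "\<And>s. (c has_vector_derivative \<alpha> * QX N X (c s)) (at s)"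
    and "\<alpha> \<noteq> 0" "a \<le> b"
  shows "set_integrable lborel {a..b} (\<lambda>s. G (c s) * QX N X (c s) ^ (k + 1))"
    and "(LINT s:{a..b}|lborel. G (c s) * QX N X (c s) ^ (k + 1)) = (P (c b) - P (c a)) / \<alpha>"
proof -
  have cont_c: "continuous_on {a..b} c"
    using c' by (intro continuous_at_imp_continuous_on ballI has_vector_derivative_continuous) blast
  have "continuous_on {a..b} (\<lambda>s. G (c s))"
    by (rule continuous_on_compose2[OF holomorphic_on_imp_continuous_on[OF G_holomorphic] cont_c]) (use c in auto)
  hence cont: "continuous_on {a..b} (\<lambda>s. G (c s) * QX N X (c s) ^ (k + 1))"
    unfolding QX_def by (intro continuous_intros cont_c)
  have d: "((\<lambda>s. P (c s) / \<alpha>) has_vector_derivative G (c s) * QX N X (c s) ^ (k + 1)) (at s within {a..b})" for s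
  proof -
    have "(P \<circ> c has_vector_derivative (\<alpha> * QX N X (c s)) * (G (c s) * QX N X (c s) ^ k)) (at s)"
      by (rule field_vector_diff_chain_at[OF c' P[OF c]])
    hence "((\<lambda>s. (1 / \<alpha>) * P (c s)) has_vector_derivative (1 / \<alpha>) * ((\<alpha> * QX N X (c s)) * (G (c s) * QX N X (c s) ^ k))) (at s)"
      unfolding o_def by (rule has_vector_derivative_mult_right)
    hence "((\<lambda>s. P (c s) / \<alpha>) has_vector_derivative G (c s) * QX N X (c s) ^ (k + 1)) (at s)"
      using \<open>\<alpha> \<noteq> 0\<close> by (simp add: mult_ac)
    thus ?thesis by (rule has_vector_derivative_at_within)
  qed
  note FTC = has_bochner_integral_FTC_Icc[OF \<open>a \<le> b\<close> d cont]
  show "set_integrable lborel {a..b} (\<lambda>s. G (c s) * QX N X (c s) ^ (k + 1))"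
    using FTC unfolding set_integrable_def by (rule integrable.intros)
  show "(LINT s:{a..b}|lborel. G (c s) * QX N X (c s) ^ (k + 1)) = (P (c b) - P (c a)) / \<alpha>"
    using has_bochner_integral_integral_eq[OF FTC] by (simp add: set_lebesgue_integral_def diff_divide_distrib)
qed

lemma orbit_subset: "X \<in> h \<Longrightarrow> (\<lambda>\<gamma>. conj_act \<gamma> X) ` \<Gamma> \<subseteq> h"
  using h_invariant by blast

lemma coef_nonzero: "coef X \<noteq> 0"
  using v_pos by (simp add: coef_def)

text \<open>\<open>coef\<close> has constant nonzero modulus on an orbit, so convergence of the full
  theta integral restricts to the orbit without that factor.\<close>

lemma orbit_finite:
  assumes F: "fundamental_domain \<Gamma> F" and X: "X \<in> h"
  shows "(\<integral>\<^sup>+Y. \<integral>\<^sup>+z. ennreal (cmod (phi Y z)) * indicator F z \<partial>hyp \<partial>count_space ((\<lambda>\<gamma>. conj_act \<gamma> X) ` \<Gamma>)) < \<infinity>"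
proof -
  have [measurable]: "F \<in> sets borel" using F by (simp add: fundamental_domain_def)
  define orb where "orb = (\<lambda>\<gamma>. conj_act \<gamma> X) ` \<Gamma>"
  have sub: "orb \<subseteq> h" using orbit_subset[OF X] by (simp add: orb_def)
  define c where "c = cmod (coef X)"
  have c: "c > 0" using coef_nonzero by (simp add: c_def)
  have cY: "cmod (coef Y) = c" if "Y \<in> orb" for Y using that det1 by (auto simp: orb_def c_def)
  define a where "a Y = (\<integral>\<^sup>+z. ennreal (cmod (coef Y * phi Y z)) * indicator F z \<partial>hyp)" for Y
  have "ennreal c * (\<integral>\<^sup>+Y. \<integral>\<^sup>+z. ennreal (cmod (phi Y z)) * indicator F z \<partial>hyp \<partial>count_space orb) =
      (\<integral>\<^sup>+Y. a Y \<partial>count_space orb)"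
  proof (subst nn_integral_cmult[symmetric], simp, rule nn_integral_cong)
    fix Y assume "Y \<in> space (count_space orb)"
    hence "cmod (coef Y) = c" using cY by simp
    thus "ennreal c * (\<integral>\<^sup>+z. ennreal (cmod (phi Y z)) * indicator F z \<partial>hyp) = a Y"
      using c unfolding a_def by (subst nn_integral_cmult[symmetric]) (auto simp: norm_mult ennreal_mult mult.assoc)
  qed
  also have "\<dots> = (\<integral>\<^sup>+Y. a Y * indicator orb Y \<partial>count_space UNIV)" by (rule nn_integral_count_space_indicator) auto
  also have "\<dots> \<le> (\<integral>\<^sup>+Y. a Y * indicator h Y \<partial>count_space UNIV)"
    using sub by (intro nn_integral_mono) (auto simp: indicator_def)
  also have "\<dots> = (\<integral>\<^sup>+Y. a Y \<partial>count_space h)" by (rule nn_integral_count_space_indicator[symmetric]) auto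
  also have "\<dots> < \<infinity>" unfolding a_def by (rule theta_absolutely_convergent[OF F])
  finally show ?thesis using c by (auto simp: orb_def ennreal_mult_less_top)
qed

lemma orbit_has_sum:
  assumes F: "fundamental_domain \<Gamma> F" and X: "X \<in> h" and E: "E \<in> sets borel"
    and fin: "\<And>z. z \<in> upper_half_plane \<Longrightarrow> finite {\<delta> \<in> \<Gamma>. conj_act \<delta> X = X \<and> moebius_act \<delta> z \<in> E}"
    and card: "\<And>z. z \<in> upper_half_plane \<Longrightarrow> card {\<delta> \<in> \<Gamma>. conj_act \<delta> X = X \<and> moebius_act \<delta> z \<in> E} = c"
    and c: "c > 0"
  shows "set_integrable hyp E (phi X)"
    and "((\<lambda>Y. LINT z:F|hyp. phi Y z) has_sum (of_nat center_order / of_nat c * (LINT z:E|hyp. phi X z))) ((\<lambda>\<gamma>. conj_act \<gamma> X) ` \<Gamma>)"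
proof -
  have eq: "phi (conj_act \<gamma> Y) (moebius_act \<gamma> z) = phi Y z"
    if "\<gamma> \<in> \<Gamma>" "Y \<in> (\<lambda>\<gamma>. conj_act \<gamma> X) ` \<Gamma>" "z \<in> upper_half_plane" for \<gamma> Y z
    using that orbit_subset[OF X] h_trace by (intro phi_equivariant) auto
  show "set_integrable hyp E (phi X)"
    by (rule has_sum_unfold(1)[OF F E measurable_phi eq fin card c orbit_finite[OF F X]])
  show "((\<lambda>Y. LINT z:F|hyp. phi Y z) has_sum (of_nat center_order / of_nat c * (LINT z:E|hyp. phi X z))) ((\<lambda>\<gamma>. conj_act \<gamma> X) ` \<Gamma>)"
    by (rule has_sum_unfold(2)[OF F E measurable_phi eq fin card c orbit_finite[OF F X]])
qed

text \<open>The centralizer of X consists of the matrices \<alpha> + \<beta> X, and determinant 1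
  reads \<alpha>^2 + \<beta>^2 det X = 1. For det X > 0 this is an ellipse, so the entries are
  bounded and discreteness applies.\<close>

lemma finite_definite_stabilizer:
  assumes X: "trace X = 0" "det X > 0"
  shows "finite {\<delta> \<in> \<Gamma>. conj_act \<delta> X = X}"
proof -
  define x1 x2 x3 where "x1 = X$1$2" "x2 = X$1$1" "x3 = X$2$1"
  note defs = this
  have x22: "X$2$2 = - x2" using X(1) by (simp add: trace_mat2 defs add_eq_0_iff)
  have dX: "det X = - x2\<^sup>2 - x1 * x3" by (simp add: det_2 x22 defs[symmetric] power2_eq_square)
  have x3: "x3 \<noteq> 0" using X(2) dX by auto
  define \<Delta> where "\<Delta> = det X"
  define B where "B = 1 + (\<bar>x1\<bar> + \<bar>x2\<bar> + \<bar>x3\<bar>) / sqrt \<Delta>"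
  have "\<forall>i j. \<bar>g $ i $ j\<bar> \<le> B" if g: "g \<in> \<Gamma>" "conj_act g X = X" for g
  proof -
    define a b c d where "a = g$1$1" "b = g$1$2" "c = g$2$1" "d = g$2$2"
    note gd = this
    have det: "det g = 1" using g det1 by blast
    have "g ** X = X ** g" using g conj_act_eq_iff_commute[OF det] by blast
    hence e: "(g ** X) $ i $ j = (X ** g) $ i $ j" for i j by simp
    have 2: "c * x2 + d * x3 = x3 * a + (- x2) * c" using e[of 2 1] unfolding mat2_mult_nth x22 unfolding defs gd .
    have 3: "a * x2 + b * x3 = x2 * a + x1 * c" using e[of 1 1] unfolding mat2_mult_nth x22 unfolding defs gd .
    \<comment> \<open>\<alpha> comes from the trace and \<beta> from the lower left entry; x3 is
      nonzero because x3 = 0 would make det X nonpositive.\<close>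
    define \<beta> \<alpha> where "\<beta> = c / x3" "\<alpha> = (a + d) / 2"
    have c: "c = \<beta> * x3" using x3 by (simp add: \<beta>_\<alpha>_def)
    have "b * x3 = (\<beta> * x1) * x3" using 3 c by (simp add: algebra_simps)
    hence b: "b = \<beta> * x1" using x3 by simp
    have "(a - d) * x3 = (2 * \<beta> * x2) * x3" using 2 c by (simp add: algebra_simps)
    hence "a - d = 2 * \<beta> * x2" using x3 by simp
    hence ad: "a = \<alpha> + \<beta> * x2" "d = \<alpha> - \<beta> * x2" by (simp_all add: \<beta>_\<alpha>_def field_simps)
    have "a * d - b * c = 1" using det by (simp add: det_2 gd)
    hence \<alpha>\<beta>: "\<alpha>\<^sup>2 + \<beta>\<^sup>2 * \<Delta> = 1" unfolding ad b c \<Delta>_def dX by (simp add: power2_eq_square algebra_simps)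
    have "\<beta>\<^sup>2 * \<Delta> \<ge> 0" using X(2) by (simp add: \<Delta>_def)
    hence "\<alpha>\<^sup>2 \<le> 1" using \<alpha>\<beta> by linarith
    hence "\<alpha>\<^sup>2 \<le> 1\<^sup>2" by simp
    have "\<beta>\<^sup>2 * \<Delta> \<le> 1" using \<alpha>\<beta> zero_le_power2[of \<alpha>] by linarith
    hence "(\<bar>\<beta>\<bar> * sqrt \<Delta>)\<^sup>2 \<le> 1\<^sup>2" using X(2) by (simp add: power_mult_distrib \<Delta>_def)
    hence "\<bar>\<beta>\<bar> * sqrt \<Delta> \<le> 1" by (rule power2_le_imp_le) simp
    have \<alpha>: "\<bar>\<alpha>\<bar> \<le> 1" using \<open>\<alpha>\<^sup>2 \<le> 1\<^sup>2\<close> by (simp add: abs_square_le_1)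
    have \<beta>: "\<bar>\<beta>\<bar> \<le> 1 / sqrt \<Delta>" using \<open>\<bar>\<beta>\<bar> * sqrt \<Delta> \<le> 1\<close> X(2) by (simp add: field_simps \<Delta>_def)
    define S where "S = \<bar>x1\<bar> + \<bar>x2\<bar> + \<bar>x3\<bar>"
    have \<beta>x: "\<bar>\<beta> * x\<bar> \<le> S / sqrt \<Delta>" if "\<bar>x\<bar> \<le> S" for x
      using mult_mono[OF \<beta> that] X(2) by (simp add: abs_mult \<Delta>_def)
    have "\<bar>\<beta> * x1\<bar> \<le> S / sqrt \<Delta>" "\<bar>\<beta> * x2\<bar> \<le> S / sqrt \<Delta>" "\<bar>\<beta> * x3\<bar> \<le> S / sqrt \<Delta>"
      by (rule \<beta>x; simp add: S_def)+
    hence "\<bar>a\<bar> \<le> B" "\<bar>b\<bar> \<le> B" "\<bar>c\<bar> \<le> B" "\<bar>d\<bar> \<le> B"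
      using \<alpha> unfolding ad b c B_def S_def[symmetric] by linarith+
    thus ?thesis by (simp add: forall_2 gd)
  qed
  thus ?thesis by (intro finite_subset[OF _ finite_bounded[of B]]) auto
qed

text \<open>Averaging over the rotations fixing X does not change the integral, since
  \<open>hyp\<close> is invariant. \<open>R\<close> is constant on each circle, so the average at z
  is the increment of a primitive over \<theta> in [0, pi]; the end of this interval is -1, which
  acts as the identity.\<close>

lemma integral_phi_definite:
  assumes X: "trace X = 0" "det X > 0" and int: "integrable hyp (phi X)"
  shows "(LINT z|hyp. phi X z) = 0"
proof -
  define r where "r = sqrt (det X)"
  have r: "r > 0" "r\<^sup>2 = det X" using X by (simp_all add: r_def)
  define Y where "Y = (1 / r) *\<^sub>R X"
  have XY: "X = r *\<^sub>R Y" using r by (simp add: Y_def)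
  have trY: "trace Y = 0" using X by (simp add: Y_def trace_mat2 add_divide_distrib[symmetric])
  have dY: "det Y = 1"
  proof -
    have "det X = r\<^sup>2 * det Y" unfolding XY by (simp add: det_2 power2_eq_square algebra_simps)
    thus ?thesis using r X(2) by simp
  qed
  define \<rho> where "\<rho> = flow_rotation Y"
  have det: "det (\<rho> \<theta>) = 1" and fix_X: "conj_act (\<rho> \<theta>) X = X" for \<theta>
    using flow_rotation[OF dY trY] by (simp_all add: \<rho>_def XY)
  obtain P where P: "\<And>z. z \<in> upper_half_plane \<Longrightarrow> (P has_field_derivative G z * QX N X z ^ k) (at z)"
    using exists_primitive by blast
  \<comment> \<open>The velocity of the rotation is (2 y2 z + y1 - y3 z^2) / j^2, while Q_X at the
    moved point is -N r times this.\<close>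
  define \<alpha> where "\<alpha> = - 1 / complex_of_real (N * r)"
  have \<alpha>: "\<alpha> \<noteq> 0" using r N_pos by (simp add: \<alpha>_def)
  have der: "((\<lambda>\<theta>. moebius_act (\<rho> \<theta>) z) has_vector_derivative \<alpha> * QX N X (moebius_act (\<rho> \<theta>) z)) (at \<theta>)"
    if z: "z \<in> upper_half_plane" for z \<theta>
  proof -
    define y1 y2 y3 where "y1 = complex_of_real (Y$1$2)" "y2 = complex_of_real (Y$1$1)" "y3 = complex_of_real (Y$2$1)"
    note yd = this
    define C S where "C = complex_of_real (cos \<theta>)" "S = complex_of_real (sin \<theta>)"
    define j where "j = aut (\<rho> \<theta>) z"
    have j: "j \<noteq> 0" unfolding j_def by (rule aut_nz[OF det z])
    have j': "j = S * y3 * z + (C - S * y2)" by (simp add: j_def aut_def \<rho>_def flow_rotation_def C_S_def yd)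
    have sc: "S\<^sup>2 + C\<^sup>2 = 1" unfolding C_S_def by (simp flip: of_real_power of_real_add)
    have act: "moebius_act (\<rho> \<theta>) z = ((of_real (cos \<theta>) + of_real (sin \<theta>) * y2) * z + of_real (sin \<theta>) * y1) /
      (of_real (sin \<theta>) * y3 * z + (of_real (cos \<theta>) - of_real (sin \<theta>) * y2))" for \<theta>
      by (simp add: moebius_act_eq aut_def \<rho>_def flow_rotation_def yd)
    have dc: "((\<lambda>\<theta>. complex_of_real (cos \<theta>)) has_vector_derivative - S) (at \<theta>)"
      and ds: "((\<lambda>\<theta>. complex_of_real (sin \<theta>)) has_vector_derivative C) (at \<theta>)"
      unfolding C_S_def using has_vector_derivative_of_real[of cos "- sin \<theta>" "at \<theta>"] has_vector_derivative_of_real[of sin "cos \<theta>" "at \<theta>"]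
      by (auto intro!: derivative_eq_intros simp: has_real_derivative_iff_has_vector_derivative[symmetric])
    define n n' jd where "n = (C + S * y2) * z + S * y1" "n' = (- S + C * y2) * z + C * y1" "jd = C * y3 * z + (- S - C * y2)"
    have "((\<lambda>\<theta>. ((of_real (cos \<theta>) + of_real (sin \<theta>) * y2) * z + of_real (sin \<theta>) * y1) /
      (of_real (sin \<theta>) * y3 * z + (of_real (cos \<theta>) - of_real (sin \<theta>) * y2))) has_vector_derivative (n' * j - n * jd) / (j * j)) (at \<theta>)"
    proof -
      have 1: "((\<lambda>\<theta>. (of_real (cos \<theta>) + of_real (sin \<theta>) * y2) * z + of_real (sin \<theta>) * y1) has_vector_derivative n') (at \<theta>)"
        unfolding n_n'_jd_def by (intro has_vector_derivative_add has_vector_derivative_mult_left dc ds)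
      have 2: "((\<lambda>\<theta>. of_real (sin \<theta>) * y3 * z + (of_real (cos \<theta>) - of_real (sin \<theta>) * y2)) has_vector_derivative jd) (at \<theta>)"
        unfolding n_n'_jd_def by (intro has_vector_derivative_add has_vector_derivative_diff has_vector_derivative_mult_left dc ds)
      define J where "J \<theta> = of_real (sin \<theta>) * y3 * z + (of_real (cos \<theta>) - of_real (sin \<theta>) * y2)" for \<theta>
      have J: "J \<theta> = j" by (simp add: J_def j' C_S_def)
      have "(inverse has_field_derivative - (inverse j ^ Suc (Suc 0))) (at (J \<theta>))"
        unfolding J by (rule DERIV_inverse[OF j])
      from field_vector_diff_chain_at[OF 2[folded J_def] this]
      have 3: "((\<lambda>\<theta>. inverse (J \<theta>)) has_vector_derivative jd * - (inverse j ^ Suc (Suc 0))) (at \<theta>)"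
        by (simp add: o_def)
      have "((of_real (cos \<theta>) + of_real (sin \<theta>) * y2) * z + of_real (sin \<theta>) * y1) * (jd * - (inverse j ^ Suc (Suc 0))) + n' * inverse (J \<theta>) = (n' * j - n * jd) / (j * j)"
        using j by (simp add: J n_n'_jd_def(1) C_S_def[symmetric] field_simps)
      with has_vector_derivative_mult[OF 1 3] show ?thesis by (simp add: J_def divide_inverse)
    qed
    also have "n' * j - n * jd = (S\<^sup>2 + C\<^sup>2) * (2 * y2 * z + y1 - y3 * z\<^sup>2)"
      unfolding n_n'_jd_def j' by algebra
    also have "\<dots> = 2 * y2 * z + y1 - y3 * z\<^sup>2" by (simp add: sc)
    also have "\<dots> / (j * j) = \<alpha> * QX N X (moebius_act (\<rho> \<theta>) z)"
    proof -
      have "QX N X (moebius_act (\<rho> \<theta>) z) = QX N X z / j\<^sup>2"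
        using QX_conj_act[OF det X(1) z] fix_X by (simp add: j_def)
      moreover have "QX N X z = - of_real (N * r) * (2 * y2 * z + y1 - y3 * z\<^sup>2)"
        by (simp add: QX_def XY yd algebra_simps)
      ultimately show ?thesis using r N_pos by (simp add: \<alpha>_def power2_eq_square diff_divide_distrib add_divide_distrib)
    qed
    finally show ?thesis unfolding act .
  qed
  have Rinv: "R N X (moebius_act (\<rho> \<theta>) z) = R N X z" if "z \<in> upper_half_plane" for z \<theta>
    using R_conj_act[OF N_pos det X(1) that] fix_X by simp
  have uhp: "moebius_act (\<rho> \<theta>) z \<in> upper_half_plane" if "z \<in> upper_half_plane" for z \<theta>
    by (rule moebius_upper_half_plane[OF det that])
  have circle: "(LINT \<theta>|lborel. indicator {0..pi} \<theta> *\<^sub>R phi X (moebius_act (\<rho> \<theta>) z)) = 0"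
    if z: "z \<in> upper_half_plane" for z
  proof -
    have "(LINT \<theta>|lborel. indicator {0..pi} \<theta> *\<^sub>R phi X (moebius_act (\<rho> \<theta>) z)) = 
      (LINT \<theta>:{0..pi}|lborel. G (moebius_act (\<rho> \<theta>) z) * QX N X (moebius_act (\<rho> \<theta>) z) ^ (k + 1) * of_real (exp (- 2 * pi * Im \<tau> * R N X z)))"
      unfolding set_lebesgue_integral_def by (intro Bochner_Integration.integral_cong) (simp_all add: phi_def G0_def uhp z Rinv)
    also have "\<dots> = (LINT \<theta>:{0..pi}|lborel. G (moebius_act (\<rho> \<theta>) z) * QX N X (moebius_act (\<rho> \<theta>) z) ^ (k + 1)) * of_real (exp (- 2 * pi * Im \<tau> * R N X z))"
      by (rule set_integral_mult_left)
    also have "(LINT \<theta>:{0..pi}|lborel. G (moebius_act (\<rho> \<theta>) z) * QX N X (moebius_act (\<rho> \<theta>) z) ^ (k + 1)) = 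
      (P (moebius_act (\<rho> pi) z) - P (moebius_act (\<rho> 0) z)) / \<alpha>"
      by (rule flow_integral(2)[OF P]) (use uhp z der \<alpha> in auto)
    moreover have "\<rho> pi = - mat 1" "\<rho> 0 = mat 1" by (simp_all add: \<rho>_def flow_rotation_def mat2_eq_iff)
    ultimately show ?thesis by simp
  qed
  define f where "f = (\<lambda>(z, \<theta>). indicator {0..pi} \<theta> *\<^sub>R phi X (moebius_act (\<rho> \<theta>) z))"
  have [measurable]: "(\<lambda>(z, \<theta>). moebius_act (\<rho> \<theta>) z) \<in> borel_measurable (borel \<Otimes>\<^sub>M borel)"
    unfolding \<rho>_def flow_rotation_def moebius_act_def moebius_def M2_nth by measurable
  have fm [measurable]: "f \<in> borel_measurable (hyp \<Otimes>\<^sub>M lborel)"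
    unfolding f_def by measurable
  interpret pair_sigma_finite hyp "lborel :: real measure"
    by (simp add: pair_sigma_finite_def sigma_finite_hyp sigma_finite_lborel)
  have "(\<integral>\<^sup>+p. ennreal (cmod (f p)) \<partial>(hyp \<Otimes>\<^sub>M lborel)) = (\<integral>\<^sup>+\<theta>. \<integral>\<^sup>+z. ennreal (cmod (f (z, \<theta>))) \<partial>hyp \<partial>lborel)"
    by (rule nn_integral_snd[symmetric]) measurable
  also have "\<dots> = (\<integral>\<^sup>+\<theta>. (\<integral>\<^sup>+z. ennreal (cmod (phi X z)) \<partial>hyp) * indicator {0..pi} \<theta> \<partial>lborel)"
  proof (rule nn_integral_cong)
    fix \<theta> :: real
    have "(\<integral>\<^sup>+z. ennreal (cmod (f (z, \<theta>))) \<partial>hyp) = (\<integral>\<^sup>+z. indicator {0..pi} \<theta> * ennreal (cmod (phi X (moebius_act (\<rho> \<theta>) z))) \<partial>hyp)"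
      by (intro nn_integral_cong) (auto simp: f_def indicator_def)
    also have "\<dots> = indicator {0..pi} \<theta> * (\<integral>\<^sup>+z. ennreal (cmod (phi X (moebius_act (\<rho> \<theta>) z))) \<partial>hyp)"
      by (rule nn_integral_cmult) measurable
    also have "(\<integral>\<^sup>+z. ennreal (cmod (phi X (moebius_act (\<rho> \<theta>) z))) \<partial>hyp) = (\<integral>\<^sup>+z. ennreal (cmod (phi X z)) \<partial>hyp)"
      by (rule nn_integral_hyp_moebius[OF _ det]) measurable
    finally show "(\<integral>\<^sup>+z. ennreal (cmod (f (z, \<theta>))) \<partial>hyp) = (\<integral>\<^sup>+z. ennreal (cmod (phi X z)) \<partial>hyp) * indicator {0..pi} \<theta>"
      by (simp add: mult.commute)
  qed
  also have "\<dots> = (\<integral>\<^sup>+z. ennreal (cmod (phi X z)) \<partial>hyp) * ennreal pi"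
    by (subst nn_integral_cmult) auto
  also have "\<dots> < \<infinity>" using int by (simp add: integrable_iff_bounded ennreal_mult_less_top)
  finally have i: "integrable (hyp \<Otimes>\<^sub>M lborel) (case_prod (\<lambda>z \<theta>. f (z, \<theta>)))"
    by (intro integrableI_bounded) auto
  \<comment> \<open>Integrating over z first gives pi times the wanted integral, integrating over
    \<theta> first gives zero.\<close>
  have "of_real pi * (LINT z|hyp. phi X z) = (LINT \<theta>|lborel. LINT z|hyp. f (z, \<theta>))"
  proof -
    have "(LINT z|hyp. f (z, \<theta>)) = of_real (indicator {0..pi} \<theta>) * (LINT z|hyp. phi X z)" for \<theta>
      unfolding f_def by (simp add: integral_hyp_moebius[OF _ det] scaleR_conv_of_real)
    thus ?thesis by (simp add: scaleR_conv_of_real[symmetric])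
  qed
  also have "\<dots> = (LINT z|hyp. LINT \<theta>|lborel. f (z, \<theta>))" by (rule Fubini_integral[OF i])
  also have "\<dots> = (LINT z|hyp. 0)"
    by (rule integral_hyp_cong) (use circle in \<open>auto simp: f_def intro!: borel_measurable_lebesgue_integral\<close>)
  finally show ?thesis by simp
qed

text \<open>The stabilizer is finite, so the unfolded domain is the whole half-plane with
  multiplicity \<open>card S\<close>.\<close>

lemma orbit_sum_definite:
  assumes F: "fundamental_domain \<Gamma> F" and X: "X \<in> h" "Q N X > 0"
  shows "((\<lambda>Y. LINT z:F|hyp. phi Y z) has_sum 0) ((\<lambda>\<gamma>. conj_act \<gamma> X) ` \<Gamma>)"
proof -
  have tr: "trace X = 0" and d: "det X > 0" using X h_trace N_pos by (auto simp: Q_def zero_less_mult_iff)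
  define S where "S = {\<delta> \<in> \<Gamma>. conj_act \<delta> X = X}"
  have S: "finite S" unfolding S_def by (rule finite_definite_stabilizer[OF tr d])
  have eq: "{\<delta> \<in> \<Gamma>. conj_act \<delta> X = X \<and> moebius_act \<delta> z \<in> upper_half_plane} = S" if "z \<in> upper_half_plane" for z
    using moebius_upper_half_plane[OF det1 that] by (auto simp: S_def)
  have c: "card S > 0" using S one_mem by (auto simp: card_gt_0_iff S_def)
  have i: "set_integrable hyp upper_half_plane (phi X)"
    by (rule orbit_has_sum(1)[OF F X(1) borel_uhp, of "card S"]) (use eq S c in auto)
  have ind: "indicator upper_half_plane z *\<^sub>R phi X z = phi X z" for z
    by (simp add: indicator_def phi_def G0_def)
  have "(LINT z:upper_half_plane|hyp. phi X z) = 0"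
    using integral_phi_definite[OF tr d] i by (simp add: set_integrable_def set_lebesgue_integral_def ind)
  moreover have "((\<lambda>Y. LINT z:F|hyp. phi Y z) has_sum (of_nat center_order / of_nat (card S) * (LINT z:upper_half_plane|hyp. phi X z))) ((\<lambda>\<gamma>. conj_act \<gamma> X) ` \<Gamma>)"
    by (rule orbit_has_sum(2)[OF F X(1) borel_uhp, of "card S"]) (use eq S c in auto)
  ultimately show ?thesis by simp
qed

end

section \<open>One-parameter subgroups, cusps and isotropic vectors\<close>

lemma conj_act_hom: "det g = 1 \<Longrightarrow> conj_act g (A ** B) = conj_act g A ** conj_act g B"
proof -
  assume "det g = 1"
  hence "matrix_inv g ** (g ** (B ** matrix_inv g)) = B ** matrix_inv g" by (rule mat2_cancel_left)
  thus ?thesis by (simp add: conj_act_def matrix_mul_assoc[symmetric])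
qed

lemma conj_act_uminus_right: "conj_act g (- A) = - conj_act g A"
  by (simp add: conj_act_def)

lemma conj_act_matrix_inv: "det g = 1 \<Longrightarrow> conj_act (matrix_inv g) A = matrix_inv g ** A ** g"
  by (simp add: conj_act_def matrix_inv_matrix_inv)

lemma conj_act_one_right [simp]: "det g = 1 \<Longrightarrow> conj_act g (mat 1) = mat 1"
  by (simp add: conj_act_def matrix_inv_right)

lemma conj_act_conj_act: "det g = 1 \<Longrightarrow> det d = 1 \<Longrightarrow> conj_act (conj_act g d) (conj_act g X) = conj_act g (conj_act d X)"
  by (metis conj_act_mult conj_act_inv(1) conj_act_def det_conj_act mat2_cancel_right(1))

lemma moebius_act_conj_act: "det g = 1 \<Longrightarrow> det d = 1 \<Longrightarrow> z \<in> upper_half_plane \<Longrightarrow>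
    moebius_act (conj_act g d) z = moebius_act g (moebius_act d (moebius_act (matrix_inv g) z))"
  by (simp add: conj_act_def moebius_act_mult det_mul det_matrix_inv moebius_upper_half_plane)

lemma abs_conj_act_le:
  assumes "det g = 1" and Y: "\<And>i j. \<bar>Y $ i $ j\<bar> \<le> M"
  shows "\<bar>conj_act g Y $ i $ j\<bar> \<le> 2 * M * (\<bar>g$1$1\<bar> + \<bar>g$1$2\<bar> + \<bar>g$2$1\<bar> + \<bar>g$2$2\<bar>)\<^sup>2"
proof -
  define S where "S = \<bar>g$1$1\<bar> + \<bar>g$1$2\<bar> + \<bar>g$2$1\<bar> + \<bar>g$2$2\<bar>"
  have M: "M \<ge> 0" using order_trans[OF abs_ge_zero Y[of 1 1]] .
  have S: "\<bar>g$1$1\<bar> + \<bar>g$1$2\<bar> \<le> S" "\<bar>g$2$1\<bar> + \<bar>g$2$2\<bar> \<le> S" "\<bar>g $ i $ j\<bar> \<le> S" "S \<ge> 0" for i j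
    using exhaust_2[of i] exhaust_2[of j] by (auto simp: S_def)
  have lin: "\<bar>x * Y $ i $ j + x' * Y $ i' $ j'\<bar> \<le> S * M" if "\<bar>x\<bar> + \<bar>x'\<bar> \<le> S" for x x' i j i' j'
  proof -
    have "\<bar>x * Y $ i $ j + x' * Y $ i' $ j'\<bar> \<le> \<bar>x\<bar> * \<bar>Y $ i $ j\<bar> + \<bar>x'\<bar> * \<bar>Y $ i' $ j'\<bar>"
      by (metis abs_mult abs_triangle_ineq)
    also have "\<dots> \<le> \<bar>x\<bar> * M + \<bar>x'\<bar> * M" by (intro add_mono mult_left_mono Y) auto
    also have "\<dots> = (\<bar>x\<bar> + \<bar>x'\<bar>) * M" by (simp add: distrib_right)
    also have "\<dots> \<le> S * M" using that M by (rule mult_right_mono)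
    finally show ?thesis .
  qed
  have two: "\<bar>p * x + q * y\<bar> \<le> 2 * M * S\<^sup>2" if "\<bar>p\<bar> \<le> S * M" "\<bar>q\<bar> \<le> S * M" "\<bar>x\<bar> \<le> S" "\<bar>y\<bar> \<le> S" for p q x y
  proof -
    have "\<bar>p * x + q * y\<bar> \<le> \<bar>p\<bar> * \<bar>x\<bar> + \<bar>q\<bar> * \<bar>y\<bar>" by (metis abs_mult abs_triangle_ineq)
    also have "\<dots> \<le> (S * M) * S + (S * M) * S" using that S(4) M by (intro add_mono mult_mono) auto
    finally show ?thesis by (simp add: power2_eq_square)
  qed
  have dec: "conj_act g Y $ i $ j = (g $ i $ 1 * Y$1$1 + g $ i $ 2 * Y$2$1) * matrix_inv g $ 1 $ j + (g $ i $ 1 * Y$1$2 + g $ i $ 2 * Y$2$2) * matrix_inv g $ 2 $ j"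
    by (simp add: conj_act_def mat2_mult_nth)
  have inv: "\<bar>matrix_inv g $ i $ j\<bar> \<le> S" for i j
    using exhaust_2[of i] exhaust_2[of j] S(3) by (auto simp: matrix_inv_nth[OF assms(1)])
  have row: "\<bar>g $ i $ 1\<bar> + \<bar>g $ i $ 2\<bar> \<le> S" using exhaust_2[of i] S by auto
  show ?thesis unfolding dec S_def[symmetric] by (intro two lin row inv)
qed

context fuchsian
begin

lemma finite_parameter:
  fixes m :: "real \<Rightarrow> mat2"
  assumes "inj m" "\<And>a i j. \<bar>a\<bar> \<le> B \<Longrightarrow> \<bar>m a $ i $ j\<bar> \<le> C"
  shows "finite {a. m a \<in> \<Gamma> \<and> \<bar>a\<bar> \<le> B}"
proof -
  have "finite (m -` {g \<in> \<Gamma>. \<forall>i j. \<bar>g $ i $ j\<bar> \<le> C})"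
    by (rule finite_vimageI[OF finite_bounded assms(1)])
  thus ?thesis by (rule finite_subset[rotated]) (use assms(2) in auto)
qed

text \<open>The parameters landing in the group form a subgroup of the reals; bounded parameters
  give bounded matrices, of which the group has finitely many, so this subgroup is discrete.\<close>

lemma one_parameter_cyclic:
  fixes m :: "real \<Rightarrow> mat2"
  assumes inj: "inj m" and zero: "m 0 = mat 1" and add: "\<And>a b. m (a + b) = m a ** m b"
    and bounded: "\<And>B. \<exists>C. \<forall>a i j. \<bar>a\<bar> \<le> B \<longrightarrow> \<bar>m a $ i $ j\<bar> \<le> C"
    and nontrivial: "\<exists>a. a \<noteq> 0 \<and> m a \<in> \<Gamma>"
  shows "\<exists>\<omega>>0. {a. m a \<in> \<Gamma>} = {of_int n * \<omega> | n. True}"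
proof (rule discrete_subgroup_cyclic)
  show "- a \<in> {a. m a \<in> \<Gamma>}" if a: "a \<in> {a. m a \<in> \<Gamma>}" for a
  proof -
    have "m a ** m (- a) = mat 1" using add[of a "- a"] zero by simp
    moreover have "det (m a) = 1" using a det1 by blast
    ultimately have "m (- a) = matrix_inv (m a)" by (metis mat2_cancel_left(1) matrix_mul_rid)
    thus ?thesis using a inv_mem by simp
  qed
  show "finite {a \<in> {a. m a \<in> \<Gamma>}. \<bar>a\<bar> \<le> B}" for B
  proof -
    obtain C where "\<And>a i j. \<bar>a\<bar> \<le> B \<Longrightarrow> \<bar>m a $ i $ j\<bar> \<le> C" using bounded[of B] by blast
    from finite_parameter[OF inj this, of B] show ?thesis by simp
  qed
qed (use zero one_mem add mult_mem nontrivial in auto)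

end

lemma rational_vector_primitive:
  assumes "x \<in> \<rat>" "y \<in> \<rat>" "x \<noteq> 0 \<or> y \<noteq> (0::real)"
  shows "\<exists>p q r. coprime p q \<and> r \<noteq> 0 \<and> x = r * of_int p \<and> y = r * of_int q"
proof -
  obtain D :: nat where D: "D > 0" "real D * x \<in> \<int>" "real D * y \<in> \<int>"
    using rational_common_denominator[of "{x, y}"] assms by auto
  obtain a b where ab: "real D * x = of_int a" "real D * y = of_int b" using D by (auto elim!: Ints_cases)
  have nz: "a \<noteq> 0 \<or> b \<noteq> 0" using ab assms(3) D(1) by auto
  define d where "d = gcd a b"
  have d: "d \<noteq> 0" using nz by (simp add: d_def)
  have "a = d * (a div d)" "b = d * (b div d)" by (simp_all add: d_def)
  hence "real_of_int a = of_int d * of_int (a div d)" "real_of_int b = of_int d * of_int (b div d)"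
    by (metis of_int_mult)+
  hence "x = of_int d / real D * of_int (a div d)" "y = of_int d / real D * of_int (b div d)"
    using ab D(1) by (simp_all add: field_simps)
  moreover have "coprime (a div d) (b div d)" using nz unfolding d_def by (rule div_gcd_coprime)
  ultimately show ?thesis using d D(1) by (intro exI[of _ "a div d"] exI[of _ "b div d"] exI[of _ "of_int d / real D"]) auto
qed

text \<open>A rational eigenvalue has a rational eigenvector, which scales to a primitive integral
  one and completes by Bezout to a matrix in SL2(Z). With r = 0 this moves the cusp of an isotropic
  vector to infinity, with r nonzero one end of a geodesic.\<close>

lemma SL2Z_triangular:
  assumes tr: "trace X = 0" and rat: "rational_mat X" and r: "r \<in> \<rat>" "det X = - r\<^sup>2" and nz: "X \<noteq> 0"
  shows "\<exists>\<sigma>\<in>SL2Z. conj_act (matrix_inv \<sigma>) X $ 1 $ 1 = r \<and> conj_act (matrix_inv \<sigma>) X $ 2 $ 1 = 0 \<and> conj_act (matrix_inv \<sigma>) X $ 2 $ 2 = - r"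
proof -
  define x1 x2 x3 where "x1 = X$1$2" "x2 = X$1$1" "x3 = X$2$1"
  note defs = this
  have x22: "X$2$2 = - x2" using tr by (simp add: trace_mat2 defs add_eq_0_iff)
  have dX: "x2 * x2 + x1 * x3 = r * r" using r(2) by (simp add: det_2 x22 defs[symmetric] power2_eq_square)
  have rats: "x1 \<in> \<rat>" "x2 \<in> \<rat>" "x3 \<in> \<rat>" using rat by (auto simp: rational_mat_def defs)
  \<comment> \<open>An eigenvector for r: (x2 + r, x3) if x3 is nonzero; otherwise (1, 0) if x2 = r,
    and (x1, 2 r) if x2 = -r.\<close>
  have "\<exists>v1 v2. v1 \<in> \<rat> \<and> v2 \<in> \<rat> \<and> (v1 \<noteq> 0 \<or> v2 \<noteq> 0) \<and> x2 * v1 + x1 * v2 = r * v1 \<and> x3 * v1 - x2 * v2 = r * v2"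
  proof (cases "x3 = 0")
    case False
    show ?thesis by (intro exI[of _ "x2 + r"] exI[of _ x3]) (use False rats r dX in \<open>auto simp: algebra_simps\<close>)
  next
    case True
    show ?thesis
    proof (cases "x2 = r")
      case True
      thus ?thesis using \<open>x3 = 0\<close> by (intro exI[of _ 1] exI[of _ 0]) auto
    next
      case False
      have "x2 * x2 = r * r" using dX True by simp
      hence x2: "x2 = - r" using False by (auto simp: square_eq_iff)
      hence "r \<noteq> 0" using False by auto
      thus ?thesis using True x2 rats r by (intro exI[of _ x1] exI[of _ "2 * r"]) auto
    qed
  qed
  then obtain v1 v2 where v: "v1 \<in> \<rat>" "v2 \<in> \<rat>" "v1 \<noteq> 0 \<or> v2 \<noteq> 0"
    "x2 * v1 + x1 * v2 = r * v1" "x3 * v1 - x2 * v2 = r * v2" by blast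
  obtain p q c where pq: "coprime p q" "c \<noteq> 0" "v1 = c * of_int p" "v2 = c * of_int q"
    using rational_vector_primitive[OF v(1-3)] by blast
  obtain u w where uw: "u * p + w * q = 1" using bezout_int[of p q] pq(1) by (auto simp: coprime_iff_gcd_eq_1)
  define P Q' U W where "P = real_of_int p" "Q' = real_of_int q" "U = real_of_int u" "W = real_of_int w"
  have uw': "U * P + W * Q' = 1" using uw unfolding P_Q'_U_W_def by (metis of_int_1 of_int_add of_int_mult)
  have "c * (x2 * P + x1 * Q') = c * (r * P)" "c * (x3 * P - x2 * Q') = c * (r * Q')"
    using v(4,5) by (simp_all add: pq(3,4) P_Q'_U_W_def algebra_simps)
  hence ev: "x2 * P + x1 * Q' = r * P" "x3 * P - x2 * Q' = r * Q'" using pq(2) by simp_all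
  define \<sigma> where "\<sigma> = M2 P (- W) Q' U"
  have det: "det \<sigma> = 1" using uw' by (simp add: \<sigma>_def algebra_simps)
  have "\<sigma> \<in> SL2Z" using det by (auto simp: SL2Z_def forall_2 \<sigma>_def P_Q'_U_W_def)
  moreover have "conj_act (matrix_inv \<sigma>) X $ 1 $ 1 = r \<and> conj_act (matrix_inv \<sigma>) X $ 2 $ 1 = 0 \<and> conj_act (matrix_inv \<sigma>) X $ 2 $ 2 = - r"
    unfolding conj_act_nth[OF det_matrix_inv[OF det]] matrix_inv_nth[OF det]
    unfolding \<sigma>_def M2_nth x22 unfolding defs[symmetric]
    using uw' ev by (intro conjI) algebra+
  ultimately show ?thesis by blast
qed

context shintani_data
begin

lemma h_rational: "X \<in> h \<Longrightarrow> rational_mat X"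
proof -
  assume X: "X \<in> h"
  have "X $ i $ j \<in> \<rat>" for i j
  proof -
    have "real denom * X $ i $ j \<in> \<rat>" using h_denominator[OF X] Ints_subset_Rats by (auto simp: denominator_bounded_def)
    hence "(real denom * X $ i $ j) / real denom \<in> \<rat>" by (intro Rats_divide) auto
    thus ?thesis using denom_pos by simp
  qed
  thus ?thesis by (simp add: rational_mat_def)
qed

text \<open>The form G Q_X^k dz is invariant under the stabilizer of X, the weights 2k + 2, -2k and
  -2 adding up to zero; so the increment has derivative zero on a convex set. The sign of \<delta>
  is harmless because the weight of \<open>G\<close> is even.\<close>

lemma primitive_increment:
  assumes P: "\<And>z. z \<in> upper_half_plane \<Longrightarrow> (P has_field_derivative G z * QX N X z ^ k) (at z)"
    and \<delta>: "\<delta> \<in> \<Gamma> \<union> uminus ` \<Gamma>" "conj_act \<delta> X = X" and tr: "trace X = 0"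
  shows "\<exists>K. \<forall>z\<in>upper_half_plane. P (moebius_act \<delta> z) - P z = K"
proof -
  have det: "det \<delta> = 1" using \<delta> det1 by auto
  have "((\<lambda>z. P (moebius_act \<delta> z) - P z) has_field_derivative 0) (at z within upper_half_plane)"
    if z: "z \<in> upper_half_plane" for z
  proof -
    define j where "j = aut \<delta> z"
    have j: "j \<noteq> 0" unfolding j_def by (rule aut_nz[OF det z])
    have dz: "moebius_act \<delta> z \<in> upper_half_plane" by (rule moebius_upper_half_plane[OF det z])
    have G: "G (moebius_act \<delta> z) = j ^ (2 * k + 2) * G z"
      using \<delta>(1) G_moebius[OF _ z] by (auto simp: j_def)
    have QX: "QX N X (moebius_act \<delta> z) = QX N X z / j\<^sup>2"
      using QX_conj_act[OF det tr z] \<delta>(2) by (simp add: j_def)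
    have "(P \<circ> moebius_act \<delta> has_field_derivative (G (moebius_act \<delta> z) * QX N X (moebius_act \<delta> z) ^ k) * (1 / j\<^sup>2)) (at z)"
      unfolding j_def by (rule DERIV_chain[OF P[OF dz] moebius_act_derivative[OF det z]])
    hence "((\<lambda>z. P (moebius_act \<delta> z) - P z) has_field_derivative
       (G (moebius_act \<delta> z) * QX N X (moebius_act \<delta> z) ^ k) * (1 / j\<^sup>2) - G z * QX N X z ^ k) (at z)"
      unfolding o_def by (intro DERIV_diff P[OF z])
    also have "j ^ (2 * k + 2) = (j\<^sup>2) ^ k * j\<^sup>2" by (simp add: power_add power_mult power2_eq_square)
    hence "(G (moebius_act \<delta> z) * QX N X (moebius_act \<delta> z) ^ k) * (1 / j\<^sup>2) - G z * QX N X z ^ k = 0"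
      using j by (simp add: G QX power_divide)
    finally show ?thesis by (rule DERIV_subset) simp
  qed
  from has_field_derivative_zero_constant[OF convex_uhp this] show ?thesis by blast
qed

lemma set_integral_moebius:
  assumes [measurable]: "E \<in> sets borel" and det: "det g = 1" and E: "set_integrable hyp E (phi X)"
  shows "integrable hyp (\<lambda>w. indicator E (moebius_act g w) *\<^sub>R phi X (moebius_act g w))"
    and "(LINT z:E|hyp. phi X z) = (LINT w|hyp. indicator E (moebius_act g w) *\<^sub>R phi X (moebius_act g w))"
proof -
  have "integrable (distr hyp borel (moebius_act g)) (\<lambda>z. indicator E z *\<^sub>R phi X z)"
    using E by (simp add: distr_hyp_moebius[OF det] set_integrable_def)
  thus "integrable hyp (\<lambda>w. indicator E (moebius_act g w) *\<^sub>R phi X (moebius_act g w))"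
    by (subst (asm) integrable_distr_eq) auto
  show "(LINT z:E|hyp. phi X z) = (LINT w|hyp. indicator E (moebius_act g w) *\<^sub>R phi X (moebius_act g w))"
    unfolding set_lebesgue_integral_def
    by (rule integral_hyp_moebius[OF _ det, symmetric]) measurable
qed

text \<open>Gamma(n) is normal in SL2(Z); here the entries are computed.\<close>

lemma unipotent_in_principal_congruence:
  assumes "\<sigma> \<in> SL2Z" shows "conj_act \<sigma> (M2 1 (real n) 0 1) \<in> principal_congruence n"
proof -
  have det: "det \<sigma> = 1" using det1_SL2Z assms by blast
  have "\<sigma> $ i $ j \<in> \<int>" for i j using assms by (auto simp: SL2Z_def)
  hence "\<exists>n. \<sigma> $ i $ j = of_int n" for i j by (blast elim: Ints_cases)
  then obtain a b c d where s: "\<sigma>$1$1 = of_int a" "\<sigma>$1$2 = of_int b" "\<sigma>$2$1 = of_int c" "\<sigma>$2$2 = of_int d"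
    by metis
  have ad: "real_of_int a * of_int d - of_int b * of_int c = 1" using det by (simp add: det_2 s)
  have "M2 1 (real n) 0 1 \<in> SL2Z" by (auto simp: SL2Z_def forall_2)
  hence Z: "conj_act \<sigma> (M2 1 (real n) 0 1) \<in> SL2Z"
    unfolding conj_act_def using assms SL2Z.mult_mem SL2Z.inv_mem by blast
  have e: "conj_act \<sigma> (M2 1 (real n) 0 1) $ 1 $ 1 = 1 + of_int (int n * (- a * c))"
    "conj_act \<sigma> (M2 1 (real n) 0 1) $ 1 $ 2 = 0 + of_int (int n * (a * a))"
    "conj_act \<sigma> (M2 1 (real n) 0 1) $ 2 $ 1 = 0 + of_int (int n * (- c * c))"
    "conj_act \<sigma> (M2 1 (real n) 0 1) $ 2 $ 2 = 1 + of_int (int n * (a * c))"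
    unfolding conj_act_nth[OF det] s using ad by (simp_all add: algebra_simps)
  have "\<exists>a::int. conj_act \<sigma> (M2 1 (real n) 0 1) $ i $ j = mat 1 $ i $ j + of_int (int n * a)" for i j
    using exhaust_2[of i] exhaust_2[of j] e by (metis mat2_one_nth)
  thus ?thesis using Z by (auto simp: principal_congruence_def)
qed

text \<open>After moving the isotropic line to infinity, the stabilizer is generated up to sign by a
  translation by \<omega>, and the flow lines are horizontal. The increment K of the primitive over
  one period is the same at all heights, yet at height n it is at most a constant times exp(-c n);
  hence K = 0.\<close>

lemma orbit_sum_parabolic:
  assumes F: "fundamental_domain \<Gamma> F" and X: "X \<in> h" "Q N X = 0" "X \<noteq> 0"
  shows "((\<lambda>Y. LINT z:F|hyp. phi Y z) has_sum 0) ((\<lambda>\<gamma>. conj_act \<gamma> X) ` \<Gamma>)"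
proof -
  have tr: "trace X = 0" and dX: "det X = 0" using X h_trace N_pos by (auto simp: Q_def)
  obtain \<sigma> where s: "\<sigma> \<in> SL2Z" "conj_act (matrix_inv \<sigma>) X $ 1 $ 1 = 0" "conj_act (matrix_inv \<sigma>) X $ 2 $ 1 = 0" "conj_act (matrix_inv \<sigma>) X $ 2 $ 2 = 0"
    using SL2Z_triangular[OF tr h_rational[OF X(1)], of 0] dX X(3) by auto
  have det: "det \<sigma> = 1" using det1_SL2Z s by blast
  define x where "x = conj_act (matrix_inv \<sigma>) X $ 1 $ 2"
  define Y where "Y = M2 0 x 0 0"
  have Y: "conj_act (matrix_inv \<sigma>) X = Y" using s by (simp add: Y_def x_def mat2_eq_iff)
  hence XY: "X = conj_act \<sigma> Y" using conj_act_inv(2)[OF det] by metis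
  have x0: "x \<noteq> 0"
  proof
    assume "x = 0"
    hence "Y = 0" by (simp add: Y_def mat2_eq_iff)
    hence "X = 0" unfolding XY by (simp add: conj_act_def mat2_eq_iff mat2_mult_nth)
    with X(3) show False by blast
  qed
  define U where "U = \<Gamma> \<union> uminus ` \<Gamma>"
  interpret U: fuchsian U D unfolding U_def by (rule pm_fuchsian)
  have U_minus: "- g \<in> U" if "g \<in> U" for g using that by (auto simp: U_def image_iff)
  define m where "m t = conj_act \<sigma> (M2 1 t 0 1)" for t
  have m_inj: "inj m"
  proof (rule injI)
    fix a b assume "m a = m b"
    hence "M2 1 a 0 1 = M2 1 b 0 1" unfolding m_def using conj_act_inv(1)[OF det] by metis
    thus "a = b" by (simp add: mat2_eq_iff)
  qed
  have one: "M2 1 0 0 1 = mat 1" by (simp add: mat2_eq_iff)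
  have "\<exists>\<omega>>0. {a. m a \<in> U} = {of_int n * \<omega> | n. True}"
  proof (rule U.one_parameter_cyclic[OF m_inj])
    show "m 0 = mat 1" by (simp add: m_def one det)
    show "m (a + b) = m a ** m b" for a b
      unfolding m_def conj_act_hom[OF det, symmetric] by (simp add: M2_mult add.commute)
    show "\<exists>C. \<forall>a i j. \<bar>a\<bar> \<le> B \<longrightarrow> \<bar>m a $ i $ j\<bar> \<le> C" for B
    proof (intro exI allI impI)
      fix a i j assume "\<bar>a\<bar> \<le> B"
      hence "\<bar>M2 1 a 0 1 $ i $ j\<bar> \<le> 1 + B" for i j
        using exhaust_2[of i] exhaust_2[of j] abs_ge_zero[of a] by auto
      thus "\<bar>m a $ i $ j\<bar> \<le> 2 * (1 + B) * (\<bar>\<sigma>$1$1\<bar> + \<bar>\<sigma>$1$2\<bar> + \<bar>\<sigma>$2$1\<bar> + \<bar>\<sigma>$2$2\<bar>)\<^sup>2"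
        unfolding m_def by (rule abs_conj_act_le[OF det])
    qed
    \<comment> \<open>Containing Gamma(n), the group has a nontrivial unipotent element at every
      cusp.\<close>
    show "\<exists>a. a \<noteq> 0 \<and> m a \<in> U"
      using unipotent_in_principal_congruence[OF s(1), of conductor] conductor
      by (intro exI[of _ "real conductor"]) (auto simp: m_def U_def)
  qed
  then obtain \<omega> where \<omega>: "\<omega> > 0" "{a. m a \<in> U} = {of_int n * \<omega> | n. True}" by blast
  define u where "u n = m (of_int n * \<omega>)" for n :: int
  have uU: "u n \<in> U" for n using \<omega>(2) by (auto simp: u_def)
  have det_u: "det (M2 1 t 0 1) = 1" for t by simp
  have fixY: "conj_act (M2 1 t 0 1) Y = Y" for t
    unfolding conj_act_eq_iff_commute[OF det_u] Y_def M2_mult by simp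
  have fixX: "conj_act (m t) X = X" for t
    unfolding m_def XY conj_act_conj_act[OF det det_u] fixY ..
  have stab: "{\<delta> \<in> \<Gamma> \<union> uminus ` \<Gamma>. conj_act \<delta> X = X} = {g. \<exists>n. g = u n \<or> g = - u n}"
  proof (intro equalityI subsetI)
    fix \<delta> assume d: "\<delta> \<in> {\<delta> \<in> \<Gamma> \<union> uminus ` \<Gamma>. conj_act \<delta> X = X}"
    hence dU: "\<delta> \<in> U" and dd: "det \<delta> = 1" and dX: "conj_act \<delta> X = X" using U.det1 by (auto simp: U_def)
    define \<epsilon> where "\<epsilon> = conj_act (matrix_inv \<sigma>) \<delta>"
    have de: "det \<epsilon> = 1" using dd det by (simp add: \<epsilon>_def det_matrix_inv)
    have d_e: "\<delta> = conj_act \<sigma> \<epsilon>" unfolding \<epsilon>_def by (simp add: conj_act_inv det)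
    have "conj_act \<epsilon> Y = Y" unfolding \<epsilon>_def Y[symmetric]
      by (subst conj_act_conj_act) (simp_all add: det det_matrix_inv dd dX)
    hence "\<epsilon> ** Y = Y ** \<epsilon>" using conj_act_eq_iff_commute[OF de] by blast
    hence e: "(\<epsilon> ** Y) $ i $ j = (Y ** \<epsilon>) $ i $ j" for i j by simp
    have c: "\<epsilon>$2$1 = 0" and ad: "\<epsilon>$1$1 = \<epsilon>$2$2"
      using e[of 1 1] e[of 1 2] x0 by (simp_all add: mat2_mult_nth Y_def)
    have "\<epsilon>$1$1 * \<epsilon>$1$1 = 1" using de c ad by (simp add: det_2)
    hence "\<epsilon>$1$1 = 1 \<or> \<epsilon>$1$1 = - 1" by (simp add: square_eq_1_iff)
    then obtain t where "\<epsilon> = M2 1 t 0 1 \<or> \<epsilon> = - M2 1 t 0 1"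
    proof
      assume "\<epsilon>$1$1 = 1" thus ?thesis using c ad that[of "\<epsilon>$1$2"] by (simp add: mat2_eq_iff)
    next
      assume "\<epsilon>$1$1 = - 1" thus ?thesis using c ad that[of "- \<epsilon>$1$2"] by (simp add: mat2_eq_iff)
    qed
    hence dm: "\<delta> = m t \<or> \<delta> = - m t" by (auto simp: d_e m_def conj_act_uminus_right)
    hence "m t \<in> U" using dU U_minus[of "- m t"] by auto
    then obtain n where "t = of_int n * \<omega>" using \<omega>(2) by auto
    thus "\<delta> \<in> {g. \<exists>n. g = u n \<or> g = - u n}" using dm by (auto simp: u_def)
  next
    fix \<delta> assume "\<delta> \<in> {g. \<exists>n. g = u n \<or> g = - u n}"
    then obtain n where n: "\<delta> = u n \<or> \<delta> = - u n" by blast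
    have "conj_act \<delta> X = X" using n fixX by (auto simp: u_def m_def conj_act_uminus det)
    moreover have "\<delta> \<in> U" using n uU[of n] by (auto simp: U_def)
    ultimately show "\<delta> \<in> {\<delta> \<in> \<Gamma> \<union> uminus ` \<Gamma>. conj_act \<delta> X = X}" by (simp add: U_def)
  qed
  define pos where "pos z = Re (moebius_act (matrix_inv \<sigma>) z)" for z
  have act_u: "moebius_act (u n) z = moebius_act \<sigma> (moebius_act (matrix_inv \<sigma>) z + of_int n * of_real \<omega>)" if "z \<in> upper_half_plane" for n z
    unfolding u_def m_def moebius_act_conj_act[OF det det_u that] by (simp add: moebius_act_eq[of "M2 _ _ _ _"] aut_def)
  have tr_uhp: "w + of_int n * of_real \<omega> \<in> upper_half_plane" if "w \<in> upper_half_plane" for w n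
    using that by (simp add: upper_half_plane_def)
  have inv_uhp: "moebius_act (matrix_inv \<sigma>) z \<in> upper_half_plane" if "z \<in> upper_half_plane" for z
    by (intro moebius_upper_half_plane det_matrix_inv det that)
  have pos: "pos (moebius_act (u n) z) = pos z + of_int n * \<omega>" if z: "z \<in> upper_half_plane" for n z
    by (simp add: pos_def act_u[OF z] moebius_act_inv[OF det tr_uhp[OF inv_uhp[OF z]]])
  define E where "E = {z \<in> upper_half_plane. 0 \<le> pos z \<and> pos z < \<omega>}"
  have [measurable]: "E \<in> sets borel" unfolding E_def pos_def by measurable
  note card = card_cyclic_stabilizer[OF \<omega>(1) stab pos, folded E_def]
  note sum = orbit_has_sum[OF F X(1) _ card center_order_pos]
  obtain P where P: "\<And>z. z \<in> upper_half_plane \<Longrightarrow> (P has_field_derivative G z * QX N X z ^ k) (at z)"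
    using exists_primitive by blast
  have u1: "u 1 \<in> \<Gamma> \<union> uminus ` \<Gamma>" "conj_act (u 1) X = X" using uU[of 1] fixX by (auto simp: U_def u_def)
  obtain K where K: "\<And>z. z \<in> upper_half_plane \<Longrightarrow> P (moebius_act (u 1) z) - P z = K"
    using primitive_increment[OF P u1 tr] by blast
  have K': "P (moebius_act \<sigma> (w + of_real \<omega>)) - P (moebius_act \<sigma> w) = K" if w: "w \<in> upper_half_plane" for w
    using K[of "moebius_act \<sigma> w"] act_u[of "moebius_act \<sigma> w" 1] moebius_upper_half_plane[OF det w]
    by (simp add: moebius_act_inv[OF det w])
  have Nx: "N * x \<noteq> 0" using N_pos x0 by simp
  have QX_s: "QX N X (moebius_act \<sigma> w) = - of_real (N * x) / (aut \<sigma> w)\<^sup>2" if w: "w \<in> upper_half_plane" for w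
  proof -
    have "QX N X (moebius_act \<sigma> w) = QX N Y w / (aut \<sigma> w)\<^sup>2"
      unfolding XY by (rule QX_conj_act[OF det _ w]) (simp add: Y_def trace_mat2)
    thus ?thesis by (simp add: QX_def Y_def)
  qed
  have act_der: "(moebius_act \<sigma> has_field_derivative 1 / (aut \<sigma> w)\<^sup>2) (at w)" if "w \<in> upper_half_plane" for w
    by (rule moebius_act_derivative[OF det that])
  have K0: "K = 0"
  proof -
    obtain C c where C: "c > 0" "\<And>z. Im z \<ge> 1/2 \<Longrightarrow> cmod (slash (2 * k + 2) G \<sigma> z) \<le> C * exp (- c * Im z)"
      using cusp_form_decay[OF cusp_form s(1)] by blast
    have "cmod K \<le> (C * \<bar>N * x\<bar> ^ k * \<omega>) * exp (- c * real n)" if n: "n \<ge> 1" for n :: nat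
    proof -
      \<comment> \<open>On the horizontal line at height n, a bound on the derivative times the
        length \<omega> controls the increment.\<close>
      define S where "S = {w. Im w = real n}"
      have S: "S \<subseteq> upper_half_plane" using n by (auto simp: S_def upper_half_plane_def)
      have "convex S" unfolding S_def convex_def by (auto simp: distrib_right[symmetric])
      moreover have "((\<lambda>w. P (moebius_act \<sigma> w)) has_field_derivative
           (G (moebius_act \<sigma> w) * QX N X (moebius_act \<sigma> w) ^ k) * (1 / (aut \<sigma> w)\<^sup>2)) (at w within S)" if "w \<in> S" for w
        using DERIV_chain2[OF P[OF moebius_upper_half_plane[OF det]] act_der] S that
        by (meson DERIV_subset subsetD subset_UNIV)
      moreover have "cmod ((G (moebius_act \<sigma> w) * QX N X (moebius_act \<sigma> w) ^ k) * (1 / (aut \<sigma> w)\<^sup>2)) \<le> C * exp (- c * real n) * \<bar>N * x\<bar> ^ k"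
        if w: "w \<in> S" for w
      proof -
        have wH: "w \<in> upper_half_plane" using S w by blast
        have j: "aut \<sigma> w \<noteq> 0" by (rule aut_nz[OF det wH])
        have "aut \<sigma> w ^ (2 * k + 2) = ((aut \<sigma> w)\<^sup>2) ^ k * (aut \<sigma> w)\<^sup>2" by (simp add: power_add power_mult power2_eq_square)
        hence "(G (moebius_act \<sigma> w) * QX N X (moebius_act \<sigma> w) ^ k) * (1 / (aut \<sigma> w)\<^sup>2) = slash (2 * k + 2) G \<sigma> w * (- of_real (N * x)) ^ k"
          using j unfolding QX_s[OF wH] slash_eq power_divide by simp
        also have "cmod \<dots> = cmod (slash (2 * k + 2) G \<sigma> w) * \<bar>N * x\<bar> ^ k"
          by (simp only: norm_mult norm_power norm_minus_cancel norm_of_real)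
        also have "\<dots> \<le> C * exp (- c * real n) * \<bar>N * x\<bar> ^ k"
          using C(2)[of w] w n by (intro mult_right_mono) (auto simp: S_def)
        finally show ?thesis .
      qed
      ultimately have "cmod (P (moebius_act \<sigma> (\<i> * of_real (real n) + of_real \<omega>)) - P (moebius_act \<sigma> (\<i> * of_real (real n)))) \<le>
         C * exp (- c * real n) * \<bar>N * x\<bar> ^ k * cmod ((\<i> * of_real (real n) + of_real \<omega>) - \<i> * of_real (real n))"
        by (rule field_differentiable_bound) (auto simp: S_def)
      also have "P (moebius_act \<sigma> (\<i> * of_real (real n) + of_real \<omega>)) - P (moebius_act \<sigma> (\<i> * of_real (real n))) = K"
        by (rule K') (use n in \<open>simp add: upper_half_plane_def\<close>)
      finally show ?thesis using \<omega>(1) by (simp add: mult_ac)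
    qed
    moreover have "(\<lambda>n. (C * \<bar>N * x\<bar> ^ k * \<omega>) * exp (- c * real n)) \<longlonglongrightarrow> (C * \<bar>N * x\<bar> ^ k * \<omega>) * 0"
    proof (intro tendsto_mult tendsto_const)
      have "(\<lambda>n. exp (- c) ^ n) \<longlonglongrightarrow> 0" using C(1) by (intro LIMSEQ_power_zero) auto
      moreover have "exp (- c) ^ n = exp (- c * real n)" for n by (simp add: exp_of_nat_mult[symmetric] mult.commute)
      ultimately show "(\<lambda>n. exp (- c * real n)) \<longlonglongrightarrow> 0" by simp
    qed
    ultimately have "cmod K \<le> (C * \<bar>N * x\<bar> ^ k * \<omega>) * 0"
      by (intro LIMSEQ_le_const) (auto intro!: exI[of _ 1])
    thus ?thesis by simp
  qed
  have iE: "set_integrable hyp E (phi X)" by (rule sum(1)) auto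
  have "(LINT z:E|hyp. phi X z) = (LINT s|lborel. LINT t|lborel. indicator E (moebius_act \<sigma> (hpt s t)) *\<^sub>R phi X (moebius_act \<sigma> (hpt s t)))"
    unfolding set_integral_moebius(2)[OF _ det iE, simplified]
    by (rule integral_hyp_hpt(1)[OF _ set_integral_moebius(1)[OF _ det iE]]) measurable
  also have "\<dots> = (LINT s|(lborel :: real measure). 0)"
  proof (rule Bochner_Integration.integral_cong[OF refl])
    fix s :: real
    define c where "c t = moebius_act \<sigma> (hpt s t)" for t
    \<comment> \<open>Increasing t at fixed s gives velocity exp s / j^2 after \<sigma> is applied,
      and Q_X = -N x / j^2 there; the quotient is constant along the line.\<close>
    define \<alpha> where "\<alpha> = - complex_of_real (exp s / (N * x))"
    define b where "b = \<omega> * exp (- s)"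
    have b: "0 \<le> b" using \<omega>(1) by (simp add: b_def)
    have cH: "c t \<in> upper_half_plane" for t by (simp add: c_def moebius_upper_half_plane det)
    have der: "(c has_vector_derivative \<alpha> * QX N X (c t)) (at t)" for t
    proof -
      have "((\<lambda>t. hpt s t) has_vector_derivative of_real (exp s)) (at t)"
        unfolding hpt_def by (auto intro!: derivative_eq_intros)
      from field_vector_diff_chain_at[OF this act_der[OF hpt_uhp]]
      have "(c has_vector_derivative of_real (exp s) * (1 / (aut \<sigma> (hpt s t))\<^sup>2)) (at t)" by (simp add: c_def[abs_def] o_def)
      also have "of_real (exp s) * (1 / (aut \<sigma> (hpt s t))\<^sup>2) = \<alpha> * QX N X (c t)"
        using Nx unfolding c_def QX_s[OF hpt_uhp] by (simp add: \<alpha>_def)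
      finally show ?thesis .
    qed
    have ind: "indicator E (c t) = (indicator {0..<b} t :: real)" for t
    proof -
      have "pos (c t) = exp s * t" by (simp add: pos_def c_def moebius_act_inv[OF det hpt_uhp])
      hence "c t \<in> E \<longleftrightarrow> 0 \<le> exp s * t \<and> exp s * t < \<omega>" using cH by (simp add: E_def)
      also have "\<dots> \<longleftrightarrow> t \<in> {0..<b}" by (simp add: b_def exp_minus zero_le_mult_iff field_simps)
      finally show ?thesis by (simp add: indicator_def)
    qed
    define W where "W = exp (- 2 * pi * Im \<tau> * (N * x\<^sup>2 / (2 * (exp s)\<^sup>2)))"
    have Rc: "R N X (c t) = N * x\<^sup>2 / (2 * (exp s)\<^sup>2)" for t
    proof -
      have "R N X (c t) = R N Y (hpt s t)" unfolding c_def XY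
        by (rule R_conj_act[OF N_pos det]) (simp_all add: Y_def trace_mat2)
      also have "\<dots> = (N * x)\<^sup>2 / (2 * N * (exp s)\<^sup>2)"
        by (subst R_eq) (simp_all add: N_pos Y_def trace_mat2 QX_def norm_mult power_mult_distrib)
      also have "\<dots> = N * x\<^sup>2 / (2 * (exp s)\<^sup>2)" using N_pos by (simp add: power2_eq_square)
      finally show ?thesis .
    qed
    have "(LINT t|lborel. indicator E (c t) *\<^sub>R phi X (c t)) = (LINT t:{0..<b}|lborel. (G (c t) * QX N X (c t) ^ (k + 1)) * of_real W)"
      unfolding set_lebesgue_integral_def ind using cH by (simp add: phi_def G0_def Rc W_def)
    also have "\<dots> = (LINT t:{0..<b}|lborel. G (c t) * QX N X (c t) ^ (k + 1)) * of_real W"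
      by (rule set_integral_mult_left)
    also have "(LINT t:{0..<b}|lborel. G (c t) * QX N X (c t) ^ (k + 1)) = (LINT t:{0..b}|lborel. G (c t) * QX N X (c t) ^ (k + 1))"
      by (rule set_integral_discrete_difference[where X = "{b}"]) auto
    also have "\<dots> = (P (c b) - P (c 0)) / \<alpha>"
      by (rule flow_integral(2)[OF P cH der _ b]) (use Nx in \<open>auto simp: \<alpha>_def\<close>)
    also have "hpt s b = hpt s 0 + of_real \<omega>" by (simp add: complex_eq_iff b_def exp_minus)
    hence "P (c b) - P (c 0) = K" unfolding c_def using K'[OF hpt_uhp] by simp
    finally show "(LINT t|lborel. indicator E (moebius_act \<sigma> (hpt s t)) *\<^sub>R phi X (moebius_act \<sigma> (hpt s t))) = 0"
      by (simp add: c_def K0)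
  qed
  finally have "(LINT z:E|hyp. phi X z) = 0" by simp
  moreover have "((\<lambda>Y. LINT z:F|hyp. phi Y z) has_sum (of_nat center_order / of_nat center_order * (LINT z:E|hyp. phi X z))) ((\<lambda>\<gamma>. conj_act \<gamma> X) ` \<Gamma>)"
    by (rule sum(2)) auto
  ultimately show ?thesis by simp
qed

text \<open>The exponent k + 1 is positive even for k = 0, so the zero form kills the
  summand.\<close>

lemma orbit_sum_zero:
  assumes "0 \<in> h"
  shows "((\<lambda>Y. LINT z:F|hyp. phi Y z) has_sum 0) ((\<lambda>\<gamma>. conj_act \<gamma> 0) ` \<Gamma>)"
proof -
  have "conj_act \<gamma> 0 = 0" for \<gamma> by (simp add: conj_act_def mat2_eq_iff mat2_mult_nth)
  hence "(\<lambda>\<gamma>. conj_act \<gamma> 0) ` \<Gamma> = {0}" using one_mem by auto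
  moreover have "phi 0 = (\<lambda>_. 0)" by (rule ext) (simp add: phi_def QX_def)
  ultimately show ?thesis by (intro has_sum_finiteI) (auto simp: set_lebesgue_integral_def)
qed

end


section \<open>Orbits of negative norm\<close>

text \<open>Infinitely many approximations p / q of sqrt D have norm p^2 - D q^2 bounded by 2 sqrt D
  + 1. By the pigeonhole principle two of them share their norm M and their residues modulo M, and
  then their quotient is a unit with integral coefficients.\<close>

lemma pell_solution:
  fixes D :: nat
  assumes nsq: "\<nexists>n::nat. D = n\<^sup>2"
  shows "\<exists>x y :: int. y \<noteq> 0 \<and> x\<^sup>2 - int D * y\<^sup>2 = 1"
proof -
  define \<theta> where "\<theta> = sqrt (real D)"
  have th: "\<theta>\<^sup>2 = real D" "\<theta> \<ge> 0" by (simp_all add: \<theta>_def)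
  have irr: "\<theta> \<notin> \<rat>"
  proof
    assume "\<theta> \<in> \<rat>"
    hence "\<theta> \<in> \<int>" by (rule rational_sqrt_Ints) (simp add: th)
    then obtain n where n: "\<theta> = of_int n" by (auto elim: Ints_cases)
    hence "real D = real ((nat n)\<^sup>2)" using th by (simp add: n)
    thus False using nsq by (simp only: of_nat_eq_iff) blast
  qed
  hence inf: "infinite (approx_set \<theta>)" using rational_iff_finite_approx_set by blast
  define nm where "nm = (\<lambda>(p, q). p\<^sup>2 - int D * q\<^sup>2)"
  define B where "B = \<lceil>2 * \<theta> + 1\<rceil>"
  have approx: "q > 0 \<and> nm (p, q) \<noteq> 0 \<and> \<bar>nm (p, q)\<bar> \<le> B" if "(p, q) \<in> approx_set \<theta>" for p q
  proof -
    have q: "q > 0" and lt: "\<bar>\<theta> - of_int p / of_int q\<bar> < 1 / (of_int q)\<^sup>2" using that by (auto simp: approx_set_def)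
    define a where "a = of_int q * \<theta> - of_int p"
    have q1: "real_of_int q \<ge> 1" using q by simp
    have "a = of_int q * (\<theta> - of_int p / of_int q)" using q by (simp add: a_def right_diff_distrib)
    moreover have "\<bar>real_of_int q\<bar> = of_int q" using q by simp
    ultimately have "\<bar>a\<bar> = of_int q * \<bar>\<theta> - of_int p / of_int q\<bar>" by (simp only: abs_mult)
    also have "\<dots> \<le> of_int q * (1 / (of_int q)\<^sup>2)" using lt q by (intro mult_left_mono) auto
    also have "\<dots> = 1 / of_int q" using q by (simp add: power2_eq_square)
    finally have a: "\<bar>a\<bar> \<le> 1 / of_int q" .
    have "real_of_int (nm (p, q)) = a * a - 2 * of_int q * \<theta> * a"
      using th by (simp add: nm_def a_def power2_eq_square algebra_simps)
    hence "\<bar>real_of_int (nm (p, q))\<bar> \<le> \<bar>a\<bar> * \<bar>a\<bar> + 2 * of_int q * \<theta> * \<bar>a\<bar>"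
      using q th(2) abs_triangle_ineq4[of "a * a" "2 * of_int q * \<theta> * a"] by (simp add: abs_mult)
    also have "\<dots> \<le> 1 * 1 + 2 * of_int q * \<theta> * (1 / of_int q)"
    proof -
      have "1 / real_of_int q \<le> 1" using q1 by simp
      hence "\<bar>a\<bar> \<le> 1" using a by linarith
      thus ?thesis using a q th(2) by (intro add_mono mult_mono mult_left_mono) auto
    qed
    also have "\<dots> = 2 * \<theta> + 1" using q by simp
    finally have "\<bar>nm (p, q)\<bar> \<le> B" unfolding B_def by linarith
    moreover have "nm (p, q) \<noteq> 0"
    proof
      assume "nm (p, q) = 0"
      hence "p\<^sup>2 = int D * q\<^sup>2" by (simp add: nm_def)
      hence "(real_of_int p)\<^sup>2 = real D * (real_of_int q)\<^sup>2" by (metis of_int_mult of_int_of_nat_eq of_int_power)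
      hence "real D = (\<bar>real_of_int p\<bar> / of_int q)\<^sup>2" using q by (simp add: power_divide)
      hence "\<theta> = \<bar>real_of_int p\<bar> / of_int q" using q by (simp add: \<theta>_def)
      thus False using irr by (auto simp flip: of_int_abs)
    qed
    ultimately show ?thesis using q by simp
  qed
  define f where "f = (\<lambda>(p, q). (nm (p, q), p mod nm (p, q), q mod nm (p, q)))"
  have "f ` approx_set \<theta> \<subseteq> {- B..B} \<times> {- B..B} \<times> {- B..B}"
  proof safe
    fix p q M a b assume pq: "(p, q) \<in> approx_set \<theta>" and e: "(M, a, b) = f (p, q)"
    have M: "M = nm (p, q)" "M \<noteq> 0" "\<bar>M\<bar> \<le> B" "a = p mod M" "b = q mod M" using e approx[OF pq] by (auto simp: f_def)
    have "\<bar>a\<bar> < \<bar>M\<bar>" "\<bar>b\<bar> < \<bar>M\<bar>" using M by (simp_all add: abs_mod_less)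
    thus "M \<in> {- B..B}" "a \<in> {- B..B}" "b \<in> {- B..B}" using M by auto
  qed
  hence "finite (f ` approx_set \<theta>)" by (rule finite_subset) auto
  from pigeonhole_infinite[OF inf this] obtain s where s: "s \<in> approx_set \<theta>" "infinite {a \<in> approx_set \<theta>. f a = f s}" by blast
  hence "infinite ({a \<in> approx_set \<theta>. f a = f s} - {s})" by simp
  hence "{a \<in> approx_set \<theta>. f a = f s} - {s} \<noteq> {}" by (rule infinite_imp_nonempty)
  then obtain t where t: "t \<in> approx_set \<theta>" "f t = f s" "t \<noteq> s" by auto
  obtain p q p' q' where st: "s = (p, q)" "t = (p', q')" by (cases s, cases t)
  define M where "M = nm (p, q)"
  have M: "p\<^sup>2 - int D * q\<^sup>2 = M" "p'\<^sup>2 - int D * q'\<^sup>2 = M" "M \<noteq> 0" "q > 0" "q' > 0"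
    using s(1) t(1,2) approx st by (auto simp: f_def M_def nm_def)
  have "p' mod M = p mod M" "q' mod M = q mod M" using t(2) M st by (auto simp: f_def nm_def)
  hence "M dvd p' - p" "M dvd q' - q" by (simp_all add: mod_eq_dvd_iff)
  then obtain a b where "p' - p = M * a" "q' - q = M * b" by (auto simp: dvd_def)
  hence ab: "p' = p + M * a" "q' = q + M * b" by linarith+
  \<comment> \<open>The coefficients of (p - q sqrt D)(p' + q' sqrt D) / M; the congruences modulo M
    make the division exact, which explains this form.\<close>
  define x y where "x = 1 + p * a - int D * q * b" "y = p * b - q * a"
  have Mx: "p * p' - int D * q * q' = M * x" "p * q' - p' * q = M * y"
    using M(1) unfolding ab x_y_def by (simp_all add: power2_eq_square algebra_simps)
  have "M * M * (x\<^sup>2 - int D * y\<^sup>2) = (M * x)\<^sup>2 - int D * (M * y)\<^sup>2" by (simp add: power2_eq_square algebra_simps)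
  also have "\<dots> = (p\<^sup>2 - int D * q\<^sup>2) * (p'\<^sup>2 - int D * q'\<^sup>2)"
    unfolding Mx[symmetric] by (simp add: power2_eq_square algebra_simps)
  also have "\<dots> = M * M * 1" using M by simp
  finally have "x\<^sup>2 - int D * y\<^sup>2 = 1" using M(3) by simp
  moreover have "y \<noteq> 0"
  proof
    assume "y = 0"
    hence pq: "p * q' = p' * q" using Mx by simp
    have "M * q'\<^sup>2 = (p * q')\<^sup>2 - int D * q\<^sup>2 * q'\<^sup>2" unfolding M(1)[symmetric] by (simp add: power2_eq_square algebra_simps)
    also have "\<dots> = M * q\<^sup>2" unfolding pq M(2)[symmetric] by (simp add: power2_eq_square algebra_simps)
    finally have "q'\<^sup>2 = q\<^sup>2" using M(3) by simp
    hence "q' = q" using M by (simp add: power2_eq_iff)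
    moreover from this have "p = p'" using pq M by simp
    ultimately show False using t(3) st by simp
  qed
  ultimately show ?thesis by blast
qed

section \<open>Integrals along and across a geodesic, and its diagonalization\<close>

lemma gaussian_integral:
  assumes "a > 0"
  shows "(LINT t|lborel. exp (- a * t\<^sup>2)) = sqrt (pi / a)"
proof -
  define \<sigma> where "\<sigma> = sqrt (1 / (2 * a))"
  have s: "\<sigma> > 0" "\<sigma>\<^sup>2 = 1 / (2 * a)" using assms by (simp_all add: \<sigma>_def)
  have nd: "normal_density 0 \<sigma> t = exp (- a * t\<^sup>2) / sqrt (pi / a)" for t
    unfolding normal_density_def s(2) using assms by (simp add: field_simps)
  have "1 = (LINT t|lborel. exp (- a * t\<^sup>2) / sqrt (pi / a))"
    unfolding nd[symmetric] by (rule integral_normal_density[OF s(1), symmetric])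
  also have "\<dots> = (LINT t|lborel. exp (- a * t\<^sup>2)) / sqrt (pi / a)" by (rule integral_divide_zero)
  finally have "(LINT t|lborel. exp (- a * t\<^sup>2)) / sqrt (pi / a) = 1" ..
  moreover have "sqrt (pi / a) \<noteq> 0" using assms by simp
  ultimately have "(LINT t|lborel. exp (- a * t\<^sup>2)) = 1 * sqrt (pi / a)" using nonzero_divide_eq_eq by blast
  thus ?thesis by simp
qed

lemma integral_exp_substitution:
  fixes h :: "real \<Rightarrow> complex"
  assumes [measurable]: "h \<in> borel_measurable borel"
  shows "(LINT y:{0<..}|lborel. h y) = (LINT s|lborel. of_real (exp s) * h (exp s))"
proof -
  have eq: "density lborel (\<lambda>y. ennreal (indicator {0<..} y / y)) = distr lborel borel (exp :: real \<Rightarrow> real)"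
  proof (rule measure_eqI)
    fix A assume "A \<in> sets (density lborel (\<lambda>y. ennreal (indicator {0<..} y / y)))"
    hence [measurable]: "A \<in> sets (borel :: real measure)" by simp
    have "emeasure (density lborel (\<lambda>y. ennreal (indicator {0<..} y / y))) A = (\<integral>\<^sup>+y. indicator A y * ennreal (indicator {0<..} y / y) \<partial>lborel)"
      by (subst emeasure_density) (auto simp: mult.commute)
    also have "\<dots> = (\<integral>\<^sup>+s. indicator A (exp s) \<partial>lborel)" by (rule nn_integral_exp_substitution) measurable
    also have "\<dots> = (\<integral>\<^sup>+y. indicator A y \<partial>distr lborel borel (exp :: real \<Rightarrow> real))" by (subst nn_integral_distr) auto
    finally show "emeasure (density lborel (\<lambda>y. ennreal (indicator {0<..} y / y))) A = emeasure (distr lborel borel (exp :: real \<Rightarrow> real)) A" by simp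
  qed simp
  have "(LINT s|lborel. of_real (exp s) * h (exp s)) = (LINT y|distr lborel borel (exp :: real \<Rightarrow> real). of_real y * h y)"
    by (subst integral_distr) auto
  also have "\<dots> = (LINT y|lborel. (indicator {0<..} y / y) *\<^sub>R (of_real y * h y))"
    unfolding eq[symmetric] by (subst integral_density) (auto simp: indicator_def)
  also have "\<dots> = (LINT y:{0<..}|lborel. h y)"
    unfolding set_lebesgue_integral_def by (intro Bochner_Integration.integral_cong) (auto simp: indicator_def scaleR_conv_of_real)
  finally show ?thesis ..
qed

lemma integrable_exp_abs: "integrable lborel (\<lambda>s::real. exp (- \<bar>s\<bar>))"
proof -
  define f where "f s = ennreal (exp (- s)) * indicator {0..} s" for s :: real
  have [measurable]: "f \<in> borel_measurable borel" unfolding f_def by measurable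
  have "(\<integral>\<^sup>+s. f s \<partial>lborel) = ennreal (0 - (- exp (- 0)))" unfolding f_def
  proof (rule nn_integral_FTC_atLeast)
    show "((\<lambda>s::real. - exp (- s)) \<longlongrightarrow> 0) at_top"
      using tendsto_minus[OF filterlim_compose[OF exp_at_bot filterlim_uminus_at_bot_at_top]] by simp
  qed (auto intro!: derivative_eq_intros)
  hence 1: "(\<integral>\<^sup>+s. f s \<partial>lborel) = 1" by simp
  hence 2: "(\<integral>\<^sup>+s. f (- s) \<partial>lborel) = 1" using nn_integral_real_affine[of f "- 1" 0] by simp
  have "(\<integral>\<^sup>+s. ennreal (exp (- \<bar>s\<bar>)) \<partial>lborel) \<le> (\<integral>\<^sup>+s. f s + f (- s) \<partial>lborel)"
    by (intro nn_integral_mono) (auto simp: f_def indicator_def)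
  also have "\<dots> = (\<integral>\<^sup>+s. f s \<partial>lborel) + (\<integral>\<^sup>+s. f (- s) \<partial>lborel)" by (rule nn_integral_add) measurable
  also have "\<dots> < \<infinity>" unfolding 1 2 by simp
  finally show ?thesis by (intro integrableI_nonneg) auto
qed

text \<open>The columns of g are eigenvectors for s and -s, scaled to determinant 1. This gives
  meaning to the choice of g in \<open>cycle_integral\<close>.\<close>

lemma diagonalizes_exists:
  assumes N: "N > 0" and tr: "trace X = 0" and Q: "Q N X < 0"
  shows "\<exists>g. diagonalizes N X g"
proof -
  define x1 x2 x3 where "x1 = X$1$2" "x2 = X$1$1" "x3 = X$2$1"
  note defs = this
  have x22: "X$2$2 = - x2" using tr by (simp add: trace_mat2 defs add_eq_0_iff)
  have dX: "det X = - (x2 * x2 + x1 * x3)" by (simp add: det_2 x22 defs[symmetric])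
  define s where "s = sqrt (\<bar>Q N X\<bar> / N)"
  have "det X < 0" using Q N by (simp add: Q_def mult_less_0_iff)
  hence s: "s > 0" "s * s = x2 * x2 + x1 * x3"
    using N dX by (simp_all add: s_def Q_def abs_mult)
  have X: "X = M2 x2 x1 x3 (- x2)" by (simp add: mat2_eq_iff defs x22)
  have diag: "diagonalizes N X g" if det: "det g = 1" and eq: "X ** g = g ** M2 s 0 0 (- s)" for g
  proof -
    have "matrix_inv g ** X ** g = M2 s 0 0 (- s)"
      using mat2_cancel_left(1)[OF det, of "M2 s 0 0 (- s)"] eq by (simp add: matrix_mul_assoc[symmetric])
    also have "\<dots> = s *\<^sub>R diag2 1 (- 1)" by (simp add: mat2_eq_iff diag2_def)
    finally show ?thesis using det by (simp add: diagonalizes_def s_def)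
  qed
  show ?thesis
  proof (cases "x3 = 0")
    case False
    \<comment> \<open>The columns are proportional to (x2 + s, x3) and (x2 - s, x3), whose
      determinant 2 s x3 is divided out of the first.\<close>
    define g where "g = M2 ((x2 + s) / (2 * s * x3)) (x2 - s) (1 / (2 * s)) x3"
    have "det g = 1" using False s(1) by (simp add: g_def field_simps)
    moreover have "X ** g = g ** M2 s 0 0 (- s)"
      unfolding X g_def M2_mult using False s by (simp add: mat2_eq_iff field_simps)
    ultimately show ?thesis using diag by blast
  next
    case True
    hence "s * s = x2 * x2" using s by simp
    hence "x2 = s \<or> x2 = - s" by (auto simp: square_eq_iff)
    thus ?thesis
    proof
      assume x2: "x2 = s"
      have "det (M2 1 (- x1 / (2 * s)) 0 1) = 1" by simp
      moreover have "X ** M2 1 (- x1 / (2 * s)) 0 1 = M2 1 (- x1 / (2 * s)) 0 1 ** M2 s 0 0 (- s)"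
        unfolding X M2_mult using True x2 s(1) by (simp add: mat2_eq_iff field_simps)
      ultimately show ?thesis using diag by blast
    next
      assume x2: "x2 = - s"
      have "det (M2 (x1 / (2 * s)) (- 1) 1 0) = 1" by simp
      moreover have "X ** M2 (x1 / (2 * s)) (- 1) 1 0 = M2 (x1 / (2 * s)) (- 1) 1 0 ** M2 s 0 0 (- s)"
        unfolding X M2_mult using True x2 s(1) by (simp add: mat2_eq_iff field_simps)
      ultimately show ?thesis using diag by blast
    qed
  qed
qed

section \<open>Decay of the integrand towards a cusp\<close>

context shintani_data
begin

text \<open>As g and \<sigma> send infinity to the same cusp, g = \<sigma> u with u upper
  triangular; u multiplies heights by p^2 and contributes a constant factor, so the bound starts at
  height 1 / (2 p^2) instead of 1/2.\<close>

lemma slash_decay: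
  assumes \<sigma>: "\<sigma> \<in> SL2Z" and det: "det g = 1" and tri: "(matrix_inv \<sigma> ** g) $ 2 $ 1 = 0"
  shows "\<exists>C c B. C \<ge> 0 \<and> c > 0 \<and> B > 0 \<and> (\<forall>w. Im w \<ge> B \<longrightarrow> cmod (slash (2 * k + 2) G g w) \<le> C * exp (- c * Im w))"
proof -
  have dets: "det \<sigma> = 1" using det1_SL2Z \<sigma> by blast
  define u where "u = matrix_inv \<sigma> ** g"
  have gu: "g = \<sigma> ** u" unfolding u_def by (simp add: mat2_cancel_left dets)
  have detu: "det u = 1" unfolding u_def by (simp add: det_mul det_matrix_inv dets det)
  define p where "p = u$1$1"
  have "p * u$2$2 = 1" using detu tri by (simp add: det_2 u_def[symmetric] p_def)
  hence p: "p \<noteq> 0" "u$2$2 = 1 / p" by (auto simp: eq_divide_eq mult.commute)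
  have aut: "aut u w = of_real (1 / p)" for w using tri by (simp add: aut_def u_def[symmetric] p)
  obtain C c where C: "c > 0" "\<And>z. Im z \<ge> 1/2 \<Longrightarrow> cmod (slash (2 * k + 2) G \<sigma> z) \<le> C * exp (- c * Im z)"
    using cusp_form_decay[OF cusp_form \<sigma>] by blast
  have C0: "C \<ge> 0" using order_trans[OF norm_ge_zero C(2)[of \<i>]] by (simp add: zero_le_mult_iff)
  have "cmod (slash (2 * k + 2) G g w) \<le> (C * \<bar>p\<bar> ^ (2 * k + 2)) * exp (- (c * p\<^sup>2) * Im w)"
    if w: "Im w \<ge> 1 / (2 * p\<^sup>2)" for w
  proof -
    have p2: "p\<^sup>2 > 0" using p by simp
    have "Im w > 0" using w p2 by (smt (verit) divide_pos_pos mult_pos_pos)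
    hence wH: "w \<in> upper_half_plane" by (simp add: upper_half_plane_def)
    have im: "Im (moebius_act u w) = p\<^sup>2 * Im w"
      using p by (simp add: Im_moebius_act[OF detu wH] aut norm_divide power_divide)
    have "Im (moebius_act u w) \<ge> 1/2" using w p2 unfolding im by (simp add: field_simps)
    hence "cmod (slash (2 * k + 2) G \<sigma> (moebius_act u w)) \<le> C * exp (- c * (p\<^sup>2 * Im w))" using C(2) im by metis
    hence "cmod (slash (2 * k + 2) G \<sigma> (moebius_act u w)) * \<bar>p\<bar> ^ (2 * k + 2) \<le> C * exp (- c * (p\<^sup>2 * Im w)) * \<bar>p\<bar> ^ (2 * k + 2)"
      by (rule mult_right_mono) simp
    moreover have "cmod (slash (2 * k + 2) G g w) = cmod (slash (2 * k + 2) G \<sigma> (moebius_act u w)) * \<bar>p\<bar> ^ (2 * k + 2)"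
      unfolding gu slash_mult[OF dets detu wH] aut using p by (simp add: norm_divide norm_power power_divide norm_mult power_one_over)
    moreover have "- c * (p\<^sup>2 * Im w) = - (c * p\<^sup>2) * Im w" by simp
    ultimately show ?thesis by (simp only: mult_ac)
  qed
  thus ?thesis using C C0 p by (intro exI[of _ "C * \<bar>p\<bar> ^ (2 * k + 2)"] exI[of _ "c * p\<^sup>2"] exI[of _ "1 / (2 * p\<^sup>2)"]) auto
qed

text \<open>The exponential decay is exchanged for a single 1 / y, which is enough: at w =
  \<open>hpt s t\<close> the bound is exp(-s) times a constant depending on t, integrable towards s
  = infinity.\<close>

lemma cusp_line_bound:
  assumes \<sigma>: "\<sigma> \<in> SL2Z" and det: "det g = 1" and tri: "(matrix_inv \<sigma> ** g) $ 2 $ 1 = 0" and tr: "trace X = 0"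
    and QX: "\<And>w. cmod (QX N (conj_act (matrix_inv g) X) w) = a * cmod w" and a: "a \<ge> 0"
  shows "\<exists>C B. C \<ge> 0 \<and> B > 0 \<and> (\<forall>w. Im w \<ge> B \<longrightarrow>
    cmod (G (moebius_act g w) * QX N X (moebius_act g w) ^ (k + 1)) \<le> C * (1 + \<bar>Re w\<bar> / Im w) ^ (k + 1) / Im w)"
proof -
  obtain C c B where C: "C \<ge> 0" "c > 0" "B > 0" "\<And>w. Im w \<ge> B \<Longrightarrow> cmod (slash (2 * k + 2) G g w) \<le> C * exp (- c * Im w)"
    using slash_decay[OF \<sigma> det tri] by blast
  define C' where "C' = C * a ^ (k + 1) * (fact (k + 2) / c ^ (k + 2))"
  have "cmod (G (moebius_act g w) * QX N X (moebius_act g w) ^ (k + 1)) \<le> C' * (1 + \<bar>Re w\<bar> / Im w) ^ (k + 1) / Im w"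
    if w: "Im w \<ge> B" for w
  proof -
    define y where "y = Im w"
    have y: "y > 0" using w C(3) by (simp add: y_def)
    have wH: "w \<in> upper_half_plane" using y by (simp add: y_def upper_half_plane_def)
    define r where "r = 1 + \<bar>Re w\<bar> / y"
    have "cmod w \<le> \<bar>Re w\<bar> + \<bar>Im w\<bar>" by (rule cmod_le)
    also have "\<dots> = y * r" using y by (simp add: r_def field_simps y_def[symmetric])
    finally have cw: "cmod w \<le> y * r" .
    have r: "r \<ge> 0" using y by (simp add: r_def)
    have "cmod (G (moebius_act g w) * QX N X (moebius_act g w) ^ (k + 1)) = cmod (slash (2 * k + 2) G g w) * (a * cmod w) ^ (k + 1)"
      unfolding G_QX_moebius[OF det tr wH] by (simp only: norm_mult norm_power QX)
    also have "\<dots> \<le> (C * exp (- c * y)) * (a * (y * r)) ^ (k + 1)"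
      using C(4)[OF w] cw a C(1) r y by (intro mult_mono power_mono mult_left_mono) (auto simp: y_def)
    also have "\<dots> = (C * a ^ (k + 1) * r ^ (k + 1)) * (y ^ (k + 2) * exp (- c * y)) / y"
      using y by (simp add: power_mult_distrib field_simps)
    also have "\<dots> \<le> (C * a ^ (k + 1) * r ^ (k + 1)) * (fact (k + 2) / c ^ (k + 2)) / y"
      using y C r a by (intro divide_right_mono mult_left_mono power_mult_exp_le) auto
    also have "\<dots> = C' * r ^ (k + 1) / y" by (simp add: C'_def mult_ac)
    finally show ?thesis by (simp add: r_def y_def)
  qed
  moreover have "C' \<ge> 0" using C a by (simp add: C'_def)
  ultimately show ?thesis using C(3) by blast
qed

end

text \<open>The real matrix g takes the imaginary axis to the geodesic of X. In the coordinates s, t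
  of the preimage under g, s runs along the geodesic and t is constant on the curves equidistant
  from it.\<close>

locale hyperbolic_vector = shintani_data +
  fixes X g :: mat2 and m :: real
  assumes X_mem: "X \<in> h" and m_pos: "m > 0" and Q_X: "Q N X = - m" and diag: "diagonalizes N X g"
begin

definition \<kappa> :: real where "\<kappa> = sqrt (m * N)"

lemma kappa_pos: "\<kappa> > 0" using m_pos N_pos by (simp add: \<kappa>_def)

lemma det_g: "det g = 1" using diag by (simp add: diagonalizes_def)

lemma trace_X: "trace X = 0" using h_trace X_mem by blast

text \<open>The positive eigenvalue of X; whether it is rational decides between open and closed
  geodesics.\<close>

definition root :: real where "root = sqrt (m / N)"

lemma root_pos: "root > 0" using m_pos N_pos by (simp add: root_def)

lemma N_root: "N * root = \<kappa>"
  using N_pos by (simp add: root_def \<kappa>_def real_sqrt_divide real_sqrt_mult field_simps)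

lemma conj_X: "conj_act (matrix_inv g) X = M2 root 0 0 (- root)"
  using diag m_pos unfolding conj_act_matrix_inv[OF det_g] diagonalizes_def Q_X root_def
  by (simp add: mat2_eq_iff diag2_def)

lemma X_conj: "X = conj_act g (M2 root 0 0 (- root))"
  using conj_X conj_act_inv(2)[OF det_g] by metis

lemma QX_diag: "QX N (M2 root 0 0 (- root)) w = - 2 * of_real \<kappa> * w"
  by (simp add: QX_def N_root[symmetric])

lemma QX_g: "w \<in> upper_half_plane \<Longrightarrow> QX N X (moebius_act g w) = - 2 * of_real \<kappa> * w / (aut g w)\<^sup>2"
  by (subst X_conj, subst QX_conj_act[OF det_g]) (simp_all add: trace_mat2 QX_diag)

lemma g_uhp: "w \<in> upper_half_plane \<Longrightarrow> moebius_act g w \<in> upper_half_plane"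
  by (rule moebius_upper_half_plane[OF det_g])

text \<open>Diagonalization makes Q_X proportional to w, and the factor (exp s)^2 cancels against
  the height: \<open>R\<close> depends on t alone, which isolates the Gaussian.\<close>

lemma R_g: "R N X (moebius_act g (hpt s t)) = 2 * m * (1 + t\<^sup>2)"
proof -
  have "R N X (moebius_act g (hpt s t)) = R N (M2 root 0 0 (- root)) (hpt s t)"
    by (subst X_conj, rule R_conj_act[OF N_pos det_g]) (simp_all add: trace_mat2)
  also have "\<dots> = (cmod (- 2 * of_real \<kappa> * hpt s t))\<^sup>2 / (2 * N * (exp s)\<^sup>2)"
    by (subst R_eq) (simp_all add: N_pos trace_mat2 QX_diag)
  also have "(cmod (- 2 * of_real \<kappa> * hpt s t))\<^sup>2 = 4 * \<kappa>\<^sup>2 * (cmod (hpt s t))\<^sup>2"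
    by (simp add: norm_mult power_mult_distrib)
  also have "(cmod (hpt s t))\<^sup>2 = (exp s)\<^sup>2 * (1 + t\<^sup>2)" by (simp add: cmod_power2 power_mult_distrib algebra_simps)
  also have "\<kappa>\<^sup>2 = m * N" using m_pos N_pos by (simp add: \<kappa>_def)
  finally show ?thesis using N_pos by simp
qed

text \<open>The integrand without its Gaussian factor on the image under g of a Euclidean ray from
  0; t = 0 is the geodesic itself.\<close>

definition line :: "real \<Rightarrow> real \<Rightarrow> complex" where
  "line t s = G (moebius_act g (hpt s t)) * QX N X (moebius_act g (hpt s t)) ^ (k + 1)"

lemma measurable_line [measurable]: "line t \<in> borel_measurable borel"
proof -
  have "line t = (\<lambda>s. G0 (moebius_act g (hpt s t)) * QX N X (moebius_act g (hpt s t)) ^ (k + 1))"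
    by (rule ext) (simp add: line_def G0_def g_uhp)
  thus ?thesis by simp
qed

text \<open>Dilation has velocity w, which g transports to w / j^2, and Q_X at the image point is -2
  \<kappa> w / j^2.\<close>

lemma line_flow:
  "((\<lambda>s. moebius_act g (hpt s t)) has_vector_derivative (- 1 / (2 * of_real \<kappa>)) * QX N X (moebius_act g (hpt s t))) (at s)"
proof -
  have "((\<lambda>s. complex_of_real (exp s)) has_vector_derivative of_real (exp s)) (at s)"
    by (intro has_vector_derivative_of_real) (auto intro!: derivative_eq_intros simp: has_real_derivative_iff_has_vector_derivative[symmetric])
  hence "((\<lambda>s. hpt s t) has_vector_derivative hpt s t) (at s)"
    unfolding hpt_def by (rule has_vector_derivative_mult_left)
  from field_vector_diff_chain_at[OF this moebius_act_derivative[OF det_g hpt_uhp]]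
  have "((\<lambda>s. moebius_act g (hpt s t)) has_vector_derivative hpt s t * (1 / (aut g (hpt s t))\<^sup>2)) (at s)" by (simp add: o_def)
  also have "hpt s t * (1 / (aut g (hpt s t))\<^sup>2) = (- 1 / (2 * of_real \<kappa>)) * QX N X (moebius_act g (hpt s t))"
    using kappa_pos by (simp add: QX_g)
  finally show ?thesis .
qed

lemma line_integral:
  assumes P: "\<And>z. z \<in> upper_half_plane \<Longrightarrow> (P has_field_derivative G z * QX N X z ^ k) (at z)" and "a \<le> b"
  shows "set_integrable lborel {a..b} (line t)"
    and "(LINT s:{a..b}|lborel. line t s) = - 2 * of_real \<kappa> * (P (moebius_act g (hpt b t)) - P (moebius_act g (hpt a t)))"
proof -
  note F = flow_integral[where c = "\<lambda>s. moebius_act g (hpt s t)", OF P g_uhp[OF hpt_uhp] line_flow _ \<open>a \<le> b\<close>]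
  show "set_integrable lborel {a..b} (line t)"
    using F(1) kappa_pos by (simp add: line_def[abs_def])
  show "(LINT s:{a..b}|lborel. line t s) = - 2 * of_real \<kappa> * (P (moebius_act g (hpt b t)) - P (moebius_act g (hpt a t)))"
    using F(2) kappa_pos by (simp add: line_def[abs_def] field_simps)
qed

text \<open>Since the integral along each ray has the same value J, a Gaussian in t is all that is
  left. Its factor exp(-4 pi v m) converts the exponential in the conjugate of \<tau> into the
  holomorphic q^m.\<close>

lemma tube_integral:
  assumes [measurable]: "I \<in> sets borel"
  defines "E \<equiv> {z \<in> upper_half_plane. ln (Im (moebius_act (matrix_inv g) z)) \<in> I}"
  assumes E: "set_integrable hyp E (phi X)" and J: "\<And>t. (LINT s:I|lborel. line t s) = J"
  shows "coef X * (LINT z:E|hyp. phi X z) = J / (2 * of_real (sqrt m)) * exp (2 * of_real pi * \<i> * of_real m * \<tau>)"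
proof -
  have [measurable]: "E \<in> sets borel" unfolding E_def by measurable
  define v where "v = Im \<tau>"
  have v: "v > 0" using v_pos by (simp add: v_def)
  define W where "W t = exp (- 2 * pi * v * (2 * m * (1 + t\<^sup>2)))" for t
  have "(LINT z:E|hyp. phi X z) = (LINT t|lborel. LINT s|lborel. indicator E (moebius_act g (hpt s t)) *\<^sub>R phi X (moebius_act g (hpt s t)))"
    unfolding set_integral_moebius(2)[OF \<open>E \<in> sets borel\<close> det_g E]
    by (rule integral_hyp_hpt(2)[OF _ set_integral_moebius(1)[OF \<open>E \<in> sets borel\<close> det_g E]]) measurable
  also have "\<dots> = (LINT t|lborel. J * of_real (W t))"
  proof (rule Bochner_Integration.integral_cong[OF refl])
    fix t :: real
    have ind: "indicator E (moebius_act g (hpt s t)) = (indicator I s :: real)" for s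
      by (simp add: E_def indicator_def g_uhp moebius_act_inv[OF det_g])
    have "(LINT s|lborel. indicator E (moebius_act g (hpt s t)) *\<^sub>R phi X (moebius_act g (hpt s t))) = (LINT s:I|lborel. line t s * of_real (W t))"
      unfolding set_lebesgue_integral_def ind by (simp add: phi_def G0_def g_uhp R_g line_def W_def v_def)
    also have "\<dots> = (LINT s:I|lborel. line t s) * of_real (W t)" by (rule set_integral_mult_left)
    finally show "(LINT s|lborel. indicator E (moebius_act g (hpt s t)) *\<^sub>R phi X (moebius_act g (hpt s t))) = J * of_real (W t)"
      by (simp add: J)
  qed
  also have "\<dots> = J * of_real (LINT t|lborel. W t)" by simp
  also have "(LINT t|lborel. W t) = exp (- 4 * pi * v * m) / (2 * sqrt (v * m))"
  proof -
    have "W t = exp (- 4 * pi * v * m) * exp (- (4 * pi * v * m) * t\<^sup>2)" for t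
      by (simp add: W_def exp_add[symmetric] algebra_simps)
    hence "(LINT t|lborel. W t) = exp (- 4 * pi * v * m) * sqrt (pi / (4 * pi * v * m))"
      using gaussian_integral[of "4 * pi * v * m"] v m_pos by simp
    also have "pi / (4 * pi * v * m) = 1 / (2\<^sup>2 * (v * m))" by simp
    also have "sqrt \<dots> = 1 / (2 * sqrt (v * m))" by (simp only: real_sqrt_divide real_sqrt_mult real_sqrt_abs) simp
    finally show ?thesis by simp
  qed
  finally have L: "(LINT z:E|hyp. phi X z) = J * of_real (exp (- 4 * pi * v * m) / (2 * sqrt (v * m)))" .
  have "coef X = of_real (sqrt v) * cnj (exp (2 * of_real pi * \<i> * of_real (- m) * \<tau>))"
    by (simp add: coef_def Q_X v_def)
  also have "cnj (exp (2 * of_real pi * \<i> * of_real (- m) * \<tau>)) = exp (2 * of_real pi * \<i> * of_real m * cnj \<tau>)"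
    by (simp add: exp_cnj)
  finally have "coef X * (LINT z:E|hyp. phi X z) = J * of_real (sqrt v / (2 * sqrt (v * m))) * 
     (exp (2 * of_real pi * \<i> * of_real m * cnj \<tau>) * of_real (exp (- 4 * pi * v * m)))"
    unfolding L by (simp add: mult_ac)
  \<comment> \<open>The factor sqrt v of the theta kernel is what makes the imaginary part of \<tau>
    drop out.\<close>
  also have "sqrt v / (2 * sqrt (v * m)) = 1 / (2 * sqrt m)" using v by (simp add: real_sqrt_mult)
  also have "exp (2 * of_real pi * \<i> * of_real m * cnj \<tau>) * of_real (exp (- 4 * pi * v * m)) = exp (2 * of_real pi * \<i> * of_real m * \<tau>)"
    unfolding exp_of_real[symmetric] exp_add[symmetric]
    by (rule arg_cong[of _ _ exp]) (simp add: complex_eq_iff v_def algebra_simps)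
  finally show ?thesis by simp
qed

text \<open>With y = exp s the line integral becomes one over the ray t = 0; the tangent vector
  supplies the missing factor of Q_X, up to -2 \<kappa>.\<close>

lemma cycle_line_integral:
  assumes [measurable]: "A \<in> sets borel" and A: "A \<subseteq> {0<..}"
  shows "(LINT y:A|lborel. G (geodesic_path g y) * QX N X (geodesic_path g y) ^ k * vector_derivative (geodesic_path g) (at y)) =
    (LINT s:{s. exp s \<in> A}|lborel. line 0 s) / (- 2 * of_real \<kappa>)"
proof -
  define H where "H y = indicator A y *\<^sub>R (G0 (moebius_act g (\<i> * of_real y)) * QX N X (moebius_act g (\<i> * of_real y)) ^ k * (\<i> / (aut g (\<i> * of_real y))\<^sup>2))" for y
  have [measurable]: "H \<in> borel_measurable borel" unfolding H_def aut_def by measurable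
  have vd: "vector_derivative (geodesic_path g) (at y) = \<i> / (aut g (\<i> * of_real y))\<^sup>2" if "y > 0" for y
  proof -
    have "((\<lambda>y. \<i> * complex_of_real y) has_vector_derivative \<i>) (at y)"
      by (auto intro!: derivative_eq_intros)
    moreover have "\<i> * of_real y \<in> upper_half_plane" using that by (simp add: upper_half_plane_def)
    ultimately have "(moebius_act g \<circ> (\<lambda>y. \<i> * complex_of_real y) has_vector_derivative \<i> * (1 / (aut g (\<i> * of_real y))\<^sup>2)) (at y)"
      by (intro field_vector_diff_chain_at moebius_act_derivative det_g)
    thus ?thesis by (simp add: vector_derivative_at geodesic_path_def[abs_def] o_def)
  qed
  have "(LINT y:A|lborel. G (geodesic_path g y) * QX N X (geodesic_path g y) ^ k * vector_derivative (geodesic_path g) (at y)) = (LINT y:{0<..}|lborel. H y)"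
    unfolding set_lebesgue_integral_def
  proof (rule Bochner_Integration.integral_cong[OF refl])
    fix y :: real
    show "indicator A y *\<^sub>R (G (geodesic_path g y) * QX N X (geodesic_path g y) ^ k * vector_derivative (geodesic_path g) (at y)) = indicator {0<..} y *\<^sub>R H y"
    proof (cases "y \<in> A")
      case True
      hence y: "y > 0" using A by auto
      hence "moebius_act g (\<i> * of_real y) \<in> upper_half_plane" by (intro g_uhp) (simp add: upper_half_plane_def)
      thus ?thesis using True y by (simp add: H_def G0_def vd geodesic_path_def)
    qed (simp add: H_def)
  qed
  also have "\<dots> = (LINT s|lborel. of_real (exp s) * H (exp s))" by (rule integral_exp_substitution) measurable
  also have "\<dots> = (LINT s:{s. exp s \<in> A}|lborel. line 0 s / (- 2 * of_real \<kappa>))"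
    unfolding set_lebesgue_integral_def
  proof (rule Bochner_Integration.integral_cong[OF refl])
    fix s :: real
    have w: "\<i> * complex_of_real (exp s) = hpt s 0" by (simp add: hpt_def mult.commute)
    show "of_real (exp s) * H (exp s) = indicator {s. exp s \<in> A} s *\<^sub>R (line 0 s / (- 2 * of_real \<kappa>))"
    proof (cases "exp s \<in> A")
      case True
      have "of_real (exp s) * H (exp s) = G (moebius_act g (hpt s 0)) * QX N X (moebius_act g (hpt s 0)) ^ k * ((\<i> * of_real (exp s)) / (aut g (hpt s 0))\<^sup>2)"
        using True g_uhp[OF hpt_uhp, of s 0] unfolding H_def w[symmetric] G0_def by (simp add: mult_ac)
      also have "(\<i> * of_real (exp s)) / (aut g (hpt s 0))\<^sup>2 = QX N X (moebius_act g (hpt s 0)) / (- 2 * of_real \<kappa>)"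
        unfolding w using kappa_pos by (simp add: QX_g)
      finally show ?thesis using True by (simp add: line_def)
    qed (simp add: H_def)
  qed
  also have "\<dots> = (LINT s:{s. exp s \<in> A}|lborel. line 0 s) / (- 2 * of_real \<kappa>)"
    by (rule set_integral_divide_zero)
  finally show ?thesis .
qed

lemma kappa_over_sqrt: "\<kappa> / sqrt m = sqrt N"
  using m_pos by (simp add: \<kappa>_def real_sqrt_mult)

text \<open>The stabilizer count equals \<open>center_order\<close> and cancels against it in the
  unfolding; -2 \<kappa> / (2 sqrt m) = -sqrt N is the constant of the theorem.\<close>

lemma orbit_sum_from_tube:
  assumes F: "fundamental_domain \<Gamma> F" and [measurable]: "I \<in> sets borel"
  defines "E \<equiv> {z \<in> upper_half_plane. ln (Im (moebius_act (matrix_inv g) z)) \<in> I}"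
  assumes fin: "\<And>z. z \<in> upper_half_plane \<Longrightarrow> finite {\<delta> \<in> \<Gamma>. conj_act \<delta> X = X \<and> moebius_act \<delta> z \<in> E}"
    and card: "\<And>z. z \<in> upper_half_plane \<Longrightarrow> card {\<delta> \<in> \<Gamma>. conj_act \<delta> X = X \<and> moebius_act \<delta> z \<in> E} = center_order"
    and J: "\<And>t. (LINT s:I|lborel. line t s) = - 2 * of_real \<kappa> * C"
  shows "\<exists>S. ((\<lambda>Y. LINT z:F|hyp. phi Y z) has_sum S) ((\<lambda>\<gamma>. conj_act \<gamma> X) ` \<Gamma>) \<and>
    coef X * S = - of_real (sqrt N) * C * exp (2 * of_real pi * \<i> * of_real m * \<tau>)"
proof -
  have E: "E \<in> sets borel" unfolding E_def by measurable
  note * = orbit_has_sum[OF F X_mem E fin card center_order_pos]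
  have "((\<lambda>Y. LINT z:F|hyp. phi Y z) has_sum (LINT z:E|hyp. phi X z)) ((\<lambda>\<gamma>. conj_act \<gamma> X) ` \<Gamma>)"
    using *(2) center_order_pos by simp
  moreover have "coef X * (LINT z:E|hyp. phi X z) = (- 2 * of_real \<kappa> * C) / (2 * of_real (sqrt m)) * exp (2 * of_real pi * \<i> * of_real m * \<tau>)"
    unfolding E_def by (rule tube_integral[OF assms(2) *(1)[unfolded E_def] J])
  moreover have "(- 2 * of_real \<kappa> * C) / (2 * of_real (sqrt m)) = - of_real (\<kappa> / sqrt m) * C" by simp
  ultimately show ?thesis unfolding kappa_over_sqrt by metis
qed

end

section \<open>Closed geodesics\<close>

locale closed_geodesic = hyperbolic_vector +
  fixes \<epsilon> :: real
  assumes gen: "stabilizer_generator \<Gamma> X g \<epsilon>"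
begin

definition rot :: "int \<Rightarrow> mat2" where
  "rot n = conj_act g (diag2 (\<epsilon> powi n) (\<epsilon> powi (- n)))"

lemma eps: "\<epsilon> > 1" using gen by (simp add: stabilizer_generator_def)

lemma det_diag2: "det (diag2 (\<epsilon> powi n) (\<epsilon> powi (- n))) = 1"
  using eps by (simp add: diag2_def det_2 power_int_minus)

text \<open>\<open>stabilizer_generator\<close> speaks of diagonal coordinates; conjugating back by
  g gives the cyclic description, up to sign, that \<open>card_cyclic_stabilizer\<close> asks
  for.\<close>

lemma stabilizer_rot: "{\<delta> \<in> \<Gamma> \<union> uminus ` \<Gamma>. conj_act \<delta> X = X} = {d. \<exists>n. d = rot n \<or> d = - rot n}"
proof -
  define U where "U = \<Gamma> \<union> uminus ` \<Gamma>"
  interpret U: fuchsian U D unfolding U_def by (rule pm_fuchsian)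
  have U_minus: "- d \<in> U" if "d \<in> U" for d using that by (auto simp: U_def image_iff)
  define Y where "Y = conj_act (matrix_inv g) X"
  have XY: "X = conj_act g Y" by (simp add: Y_def conj_act_inv det_g)
  have S: "{d \<in> conj_act (matrix_inv g) ` U. conj_act d Y = Y} = {s *\<^sub>R diag2 (\<epsilon> powi n) (\<epsilon> powi (- n)) | s n. s \<in> {1, -1}}"
    using gen by (simp add: stabilizer_generator_def conj_act_matrix_inv[OF det_g, symmetric] U_def Y_def)
  have iff: "conj_act d Y = Y \<longleftrightarrow> conj_act (conj_act g d) X = X" if "det d = 1" for d
    unfolding XY conj_act_conj_act[OF det_g that] using conj_act_inv(1)[OF det_g] by metis
  have inj: "conj_act (matrix_inv g) d = e \<longleftrightarrow> d = conj_act g e" for d e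
    by (rule conj_act_inv_eq_iff[OF det_g])
  show ?thesis unfolding U_def[symmetric]
  proof (intro equalityI subsetI)
    fix \<delta> assume d: "\<delta> \<in> {\<delta> \<in> U. conj_act \<delta> X = X}"
    have det: "det (conj_act (matrix_inv g) \<delta>) = 1" using d U.det1 by (simp add: det_matrix_inv det_g)
    have "conj_act (matrix_inv g) \<delta> \<in> {d \<in> conj_act (matrix_inv g) ` U. conj_act d Y = Y}"
      using d iff[OF det] by (simp add: conj_act_inv det_g)
    then obtain s n where "s \<in> {1, - 1 :: real}" "conj_act (matrix_inv g) \<delta> = s *\<^sub>R diag2 (\<epsilon> powi n) (\<epsilon> powi (- n))"
      unfolding S by blast
    hence "\<delta> = conj_act g (s *\<^sub>R diag2 (\<epsilon> powi n) (\<epsilon> powi (- n)))" "s = 1 \<or> s = - 1" using inj by auto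
    hence "\<delta> = rot n \<or> \<delta> = - rot n" by (auto simp: rot_def conj_act_uminus_right)
    thus "\<delta> \<in> {d. \<exists>n. d = rot n \<or> d = - rot n}" by blast
  next
    fix \<delta> assume "\<delta> \<in> {d. \<exists>n. d = rot n \<or> d = - rot n}"
    then obtain n where n: "\<delta> = rot n \<or> \<delta> = - rot n" by blast
    have "diag2 (\<epsilon> powi n) (\<epsilon> powi (- n)) \<in> {s *\<^sub>R diag2 (\<epsilon> powi n) (\<epsilon> powi (- n)) | s n. s \<in> {1, -1}}"
      by (rule CollectI, rule exI[of _ 1], rule exI[of _ n]) simp
    hence 1: "diag2 (\<epsilon> powi n) (\<epsilon> powi (- n)) \<in> conj_act (matrix_inv g) ` U" "conj_act (diag2 (\<epsilon> powi n) (\<epsilon> powi (- n))) Y = Y"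
      unfolding S[symmetric] by auto
    then obtain d where d: "d \<in> U" "conj_act (matrix_inv g) d = diag2 (\<epsilon> powi n) (\<epsilon> powi (- n))" by force
    hence r: "rot n \<in> U" using inj by (simp add: rot_def)
    have "conj_act (rot n) X = X" unfolding rot_def using iff[OF det_diag2] 1 by blast
    hence "conj_act \<delta> X = X" using n U.det1[OF r] by (auto simp: conj_act_uminus)
    moreover have "\<delta> \<in> U" using n r U_minus by blast
    ultimately show "\<delta> \<in> {\<delta> \<in> U. conj_act \<delta> X = X}" by blast
  qed
qed

lemma rot_act:
  assumes z: "z \<in> upper_half_plane"
  shows "moebius_act (rot n) z = moebius_act g (of_real (\<epsilon> powi n * \<epsilon> powi n) * moebius_act (matrix_inv g) z)"
proof -
  define e where "e = \<epsilon> powi n"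
  have e: "e \<noteq> 0" using eps by (simp add: e_def)
  have "diag2 (\<epsilon> powi n) (\<epsilon> powi (- n)) = M2 e 0 0 (1 / e)"
    by (simp add: e_def diag2_def M2_def power_int_minus divide_inverse)
  moreover have "moebius_act (M2 e 0 0 (1 / e)) w = of_real (e * e) * w" for w
    using e by (simp add: moebius_act_eq aut_def)
  ultimately show ?thesis unfolding rot_def moebius_act_conj_act[OF det_g det_diag2 z] e_def by simp
qed

text \<open>In diagonal coordinates \<open>rot 1\<close> is the dilation by \<epsilon>^2, which
  carries the start of one period of every ray to its end. By \<open>primitive_increment\<close> the
  increment K is common to all rays, in particular to the geodesic.\<close>

lemma orbit_sum_closed:
  assumes F: "fundamental_domain \<Gamma> F"
  shows "\<exists>S. ((\<lambda>Y. LINT z:F|hyp. phi Y z) has_sum S) ((\<lambda>\<gamma>. conj_act \<gamma> X) ` \<Gamma>) \<and>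
    coef X * S = - of_real (sqrt N) * (LINT y:{1<..<\<epsilon>\<^sup>2}|lborel. G (geodesic_path g y) * QX N X (geodesic_path g y) ^ k * vector_derivative (geodesic_path g) (at y))
      * exp (2 * of_real pi * \<i> * of_real m * \<tau>)"
proof -
  \<comment> \<open>The translation length: \<open>rot n\<close> multiplies heights in diagonal
    coordinates by \<epsilon>^(2n), hence shifts their logarithm by n \<omega>.\<close>
  define \<omega> where "\<omega> = 2 * ln \<epsilon>"
  have \<omega>: "\<omega> > 0" using eps by (simp add: \<omega>_def)
  have e_pos: "\<epsilon> > 0" using eps by simp
  have lnpow: "ln (\<epsilon> powi n * \<epsilon> powi n) = of_int n * \<omega>" for n
  proof -
    have "\<epsilon> powi n = exp (of_int n * ln \<epsilon>)" using exp_power_int[of "ln \<epsilon>" n] e_pos by simp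
    thus ?thesis by (simp add: exp_add[symmetric] \<omega>_def)
  qed
  define pos where "pos z = ln (Im (moebius_act (matrix_inv g) z))" for z
  have inv_uhp: "moebius_act (matrix_inv g) z \<in> upper_half_plane" if "z \<in> upper_half_plane" for z
    by (intro moebius_upper_half_plane det_matrix_inv det_g that)
  have pos: "pos (moebius_act (rot n) z) = pos z + of_int n * \<omega>" if z: "z \<in> upper_half_plane" for n z
  proof -
    define w where "w = moebius_act (matrix_inv g) z"
    have w: "Im w > 0" using inv_uhp[OF z] by (simp add: w_def upper_half_plane_def)
    have c: "\<epsilon> powi n * \<epsilon> powi n > 0" using e_pos by simp
    have "of_real (\<epsilon> powi n * \<epsilon> powi n) * w \<in> upper_half_plane" using w c by (simp add: upper_half_plane_def del: of_real_mult)
    hence "pos (moebius_act (rot n) z) = ln ((\<epsilon> powi n * \<epsilon> powi n) * Im w)"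
      unfolding pos_def rot_act[OF z] w_def[symmetric] by (simp add: moebius_act_inv[OF det_g] del: of_real_mult)
    also have "\<dots> = ln (\<epsilon> powi n * \<epsilon> powi n) + ln (Im w)" using w c by (simp only: ln_mult_pos)
    finally show ?thesis by (simp only: lnpow pos_def w_def add.commute)
  qed
  obtain P where P: "\<And>z. z \<in> upper_half_plane \<Longrightarrow> (P has_field_derivative G z * QX N X z ^ k) (at z)"
    using exists_primitive by blast
  have r1: "rot 1 \<in> \<Gamma> \<union> uminus ` \<Gamma>" "conj_act (rot 1) X = X"
  proof -
    have "rot 1 \<in> {\<delta> \<in> \<Gamma> \<union> uminus ` \<Gamma>. conj_act \<delta> X = X}" unfolding stabilizer_rot by blast
    thus "rot 1 \<in> \<Gamma> \<union> uminus ` \<Gamma>" "conj_act (rot 1) X = X" by auto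
  qed
  obtain K where K: "\<And>z. z \<in> upper_half_plane \<Longrightarrow> P (moebius_act (rot 1) z) - P z = K"
    using primitive_increment[OF P r1 trace_X] by blast
  have J: "(LINT s:{0..<\<omega>}|lborel. line t s) = - 2 * of_real \<kappa> * K" for t
  proof -
    have "(LINT s:{0..<\<omega>}|lborel. line t s) = (LINT s:{0..\<omega>}|lborel. line t s)"
      by (rule set_integral_discrete_difference[where X = "{\<omega>}"]) auto
    also have "\<dots> = - 2 * of_real \<kappa> * (P (moebius_act g (hpt \<omega> t)) - P (moebius_act g (hpt 0 t)))"
      by (rule line_integral(2)[OF P]) (use \<omega> in auto)
    also have "hpt \<omega> t = of_real (\<epsilon> powi 1 * \<epsilon> powi 1) * hpt 0 t"
    proof -
      have "exp \<omega> = \<epsilon> * \<epsilon>" using e_pos by (simp add: \<omega>_def exp_double power2_eq_square)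
      thus ?thesis by (simp add: hpt_def)
    qed
    also have "moebius_act g (of_real (\<epsilon> powi 1 * \<epsilon> powi 1) * hpt 0 t) = moebius_act (rot 1) (moebius_act g (hpt 0 t))"
      by (subst rot_act[OF g_uhp[OF hpt_uhp]]) (simp add: moebius_act_inv[OF det_g])
    also have "P \<dots> - P (moebius_act g (hpt 0 t)) = K" by (rule K[OF g_uhp[OF hpt_uhp]])
    finally show ?thesis .
  qed
  have "(LINT y:{1<..<\<epsilon>\<^sup>2}|lborel. G (geodesic_path g y) * QX N X (geodesic_path g y) ^ k * vector_derivative (geodesic_path g) (at y)) =
    (LINT s:{s. exp s \<in> {1<..<\<epsilon>\<^sup>2}}|lborel. line 0 s) / (- 2 * of_real \<kappa>)"
    by (rule cycle_line_integral) auto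
  also have "(LINT s:{s. exp s \<in> {1<..<\<epsilon>\<^sup>2}}|lborel. line 0 s) = (LINT s:{0..<\<omega>}|lborel. line 0 s)"
  \<comment> \<open>\<open>cycle_interval\<close> is open while the tiling strip is half-open; after
    y = exp s they differ by the point 0.\<close>
  proof (rule set_integral_discrete_difference[where X = "{0}"])
    have e2: "\<epsilon>\<^sup>2 = exp \<omega>" using e_pos by (simp add: \<omega>_def exp_double)
    have "{s. exp s \<in> {1<..<\<epsilon>\<^sup>2}} = {0<..<\<omega>}" unfolding e2 by (simp add: set_eq_iff)
    moreover have "({0<..<\<omega>} - {0..<\<omega>}) \<union> ({0..<\<omega>} - {0<..<\<omega>}) \<subseteq> {0}"
      by (rule subsetI, simp, linarith)
    ultimately show "({s. exp s \<in> {1<..<\<epsilon>\<^sup>2}} - {0..<\<omega>}) \<union> ({0..<\<omega>} - {s. exp s \<in> {1<..<\<epsilon>\<^sup>2}}) \<subseteq> {0}" by simp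
  qed auto
  also have "\<dots> / (- 2 * of_real \<kappa>) = K" unfolding J using kappa_pos by simp
  finally have CK: "(LINT y:{1<..<\<epsilon>\<^sup>2}|lborel. G (geodesic_path g y) * QX N X (geodesic_path g y) ^ k * vector_derivative (geodesic_path g) (at y)) = K" .
  have Eeq: "{z \<in> upper_half_plane. ln (Im (moebius_act (matrix_inv g) z)) \<in> {0..<\<omega>}} = {z \<in> upper_half_plane. 0 \<le> pos z \<and> pos z < \<omega>}"
    by (auto simp: pos_def)
  have fin: "finite {\<delta> \<in> \<Gamma>. conj_act \<delta> X = X \<and> moebius_act \<delta> z \<in> {z \<in> upper_half_plane. ln (Im (moebius_act (matrix_inv g) z)) \<in> {0..<\<omega>}}}"
    and card: "card {\<delta> \<in> \<Gamma>. conj_act \<delta> X = X \<and> moebius_act \<delta> z \<in> {z \<in> upper_half_plane. ln (Im (moebius_act (matrix_inv g) z)) \<in> {0..<\<omega>}}} = center_order"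
    if "z \<in> upper_half_plane" for z
    unfolding Eeq by (rule card_cyclic_stabilizer[OF \<omega> stabilizer_rot pos that]; assumption)+
  show ?thesis unfolding CK
    by (rule orbit_sum_from_tube[OF F _ fin card J]; (assumption | simp))
qed

end

text \<open>The first column of u satisfies the eigenvector equation of T for r; the second diagonal
  entry of the triangular T is -r, so its lower component must vanish.\<close>

lemma triangular_of_eigenbasis:
  assumes "T $ 2 $ 1 = 0" "T $ 2 $ 2 = - r" "T ** u = u ** M2 r 0 0 (- r)" "r \<noteq> 0"
  shows "(u :: mat2) $ 2 $ 1 = 0"
proof -
  have "(T ** u) $ 2 $ 1 = (u ** M2 r 0 0 (- r)) $ 2 $ 1" using assms(3) by simp
  hence "- r * u $ 2 $ 1 = u $ 2 $ 1 * r" using assms(1,2) by (simp add: mat2_mult_nth)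
  thus ?thesis using assms(4) by simp
qed

section \<open>Geodesics joining two cusps\<close>

locale open_geodesic = hyperbolic_vector +
  assumes root_rational: "root \<in> \<rat>"
begin

text \<open>Exchanges the ends 0 and infinity of the imaginary axis, so that estimates at infinity
  also serve at 0.\<close>

definition swap :: mat2 where "swap = M2 0 (- 1) 1 0"

lemma det_swap: "det swap = 1" by (simp add: swap_def)

lemma det_X: "det X = - root\<^sup>2"
proof -
  have "det X = det (M2 root 0 0 (- root))" by (subst X_conj) (rule det_conj_act[OF det_g])
  thus ?thesis by (simp add: power2_eq_square)
qed

lemma X_nonzero: "X \<noteq> 0"
  using Q_X m_pos by (auto simp: Q_def det_2)

text \<open>The end g(infinity) of the geodesic is an eigenline of X for a rational eigenvalue,
  hence a cusp. The triangular form of X at this cusp is recorded for the computation of the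
  stabilizer.\<close>

lemma cusp_at_infinity:
  "\<exists>\<sigma>\<in>SL2Z. (matrix_inv \<sigma> ** g) $ 2 $ 1 = 0 \<and> conj_act (matrix_inv \<sigma>) X $ 1 $ 1 = root \<and>
    conj_act (matrix_inv \<sigma>) X $ 2 $ 1 = 0 \<and> conj_act (matrix_inv \<sigma>) X $ 2 $ 2 = - root"
proof -
  obtain \<sigma> where s: "\<sigma> \<in> SL2Z" "conj_act (matrix_inv \<sigma>) X $ 1 $ 1 = root"
    "conj_act (matrix_inv \<sigma>) X $ 2 $ 1 = 0" "conj_act (matrix_inv \<sigma>) X $ 2 $ 2 = - root"
    using SL2Z_triangular[OF trace_X h_rational[OF X_mem] root_rational det_X X_nonzero] by blast
  have det: "det \<sigma> = 1" using s det1_SL2Z by blast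
  have "X ** g = g ** M2 root 0 0 (- root)"
    by (subst X_conj) (simp add: conj_act_def mat2_cancel_right[OF det_g])
  hence "conj_act (matrix_inv \<sigma>) X ** (matrix_inv \<sigma> ** g) = (matrix_inv \<sigma> ** g) ** M2 root 0 0 (- root)"
    unfolding conj_act_matrix_inv[OF det] by (simp add: matrix_mul_assoc[symmetric] mat2_cancel_left[OF det])
  hence "(matrix_inv \<sigma> ** g) $ 2 $ 1 = 0"
    using triangular_of_eigenbasis[OF s(3,4)] root_pos by simp
  thus ?thesis using s by blast
qed

text \<open>Reversing the geodesic by \<open>swap\<close> exchanges the eigenvalues, so the argument
  runs with \<open>- root\<close>.\<close>

lemma cusp_at_zero: "\<exists>\<sigma>\<in>SL2Z. (matrix_inv \<sigma> ** (g ** swap)) $ 2 $ 1 = 0"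
proof -
  have "det X = - (- root)\<^sup>2" using det_X by simp
  then obtain \<sigma> where s: "\<sigma> \<in> SL2Z" "conj_act (matrix_inv \<sigma>) X $ 2 $ 1 = 0" "conj_act (matrix_inv \<sigma>) X $ 2 $ 2 = - (- root)"
    using SL2Z_triangular[OF trace_X h_rational[OF X_mem] _ _ X_nonzero, of "- root"] root_rational by auto
  have det: "det \<sigma> = 1" using s det1_SL2Z by blast
  have sw: "M2 root 0 0 (- root) ** swap = swap ** M2 (- root) 0 0 (- (- root))"
    by (simp add: swap_def M2_mult)
  have "X ** (g ** swap) = g ** (M2 root 0 0 (- root) ** swap)"
    by (subst X_conj) (simp add: conj_act_def matrix_mul_assoc mat2_cancel_right[OF det_g])
  hence "X ** (g ** swap) = (g ** swap) ** M2 (- root) 0 0 (- (- root))" unfolding sw by (simp add: matrix_mul_assoc)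
  hence "conj_act (matrix_inv \<sigma>) X ** (matrix_inv \<sigma> ** (g ** swap)) = (matrix_inv \<sigma> ** (g ** swap)) ** M2 (- root) 0 0 (- (- root))"
    unfolding conj_act_matrix_inv[OF det] by (simp add: matrix_mul_assoc[symmetric] mat2_cancel_left[OF det])
  hence "(matrix_inv \<sigma> ** (g ** swap)) $ 2 $ 1 = 0"
    using triangular_of_eigenbasis[OF s(2,3)] root_pos by simp
  thus ?thesis using s by blast
qed

text \<open>Towards s = infinity the ray runs into the cusp g(infinity), towards s = -infinity into
  g(0), which w = -1 / \<open>hpt s t\<close> moves to infinity. Uniformity in |t| <= T serves to
  compare different rays.\<close>

lemma line_tails:
  "\<exists>C s1. C \<ge> 0 \<and> s1 \<ge> 0 \<and> (\<forall>t s. \<bar>t\<bar> \<le> T \<longrightarrow> \<bar>s\<bar> \<ge> s1 \<longrightarrow> cmod (line t s) \<le> C * exp (- \<bar>s\<bar>))"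
proof -
  obtain \<sigma>1 where s1: "\<sigma>1 \<in> SL2Z" "(matrix_inv \<sigma>1 ** g) $ 2 $ 1 = 0" using cusp_at_infinity by blast
  obtain \<sigma>2 where s2: "\<sigma>2 \<in> SL2Z" "(matrix_inv \<sigma>2 ** (g ** swap)) $ 2 $ 1 = 0" using cusp_at_zero by blast
  have kap: "2 * \<kappa> \<ge> 0" using kappa_pos by simp
  have q1: "cmod (QX N (conj_act (matrix_inv g) X) w) = (2 * \<kappa>) * cmod w" for w
    using kappa_pos by (simp add: conj_X QX_diag norm_mult)
  have gs: "det (g ** swap) = 1" by (simp add: det_mul det_g det_swap)
  have "conj_act (matrix_inv (g ** swap)) X = conj_act (matrix_inv swap) (M2 root 0 0 (- root))"
    by (simp add: matrix_inv_mult det_g det_swap conj_act_mult det_matrix_inv conj_X)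
  moreover have "matrix_inv swap = M2 0 1 (- 1) 0"
    by (simp add: matrix_inv_M2[OF det_swap]) (simp add: swap_def)
  hence "conj_act (matrix_inv swap) (M2 root 0 0 (- root)) = M2 (- root) 0 0 root"
    unfolding conj_act_matrix_inv[OF det_swap] by (simp add: swap_def M2_mult)
  ultimately have "conj_act (matrix_inv (g ** swap)) X = M2 (- root) 0 0 root" by simp
  hence q2: "cmod (QX N (conj_act (matrix_inv (g ** swap)) X) w) = (2 * \<kappa>) * cmod w" for w
    using N_pos root_pos by (simp add: QX_def N_root[symmetric] norm_mult abs_mult)
  obtain C1 B1 where 1: "C1 \<ge> 0" "B1 > 0" "\<And>w. Im w \<ge> B1 \<Longrightarrow>
    cmod (G (moebius_act g w) * QX N X (moebius_act g w) ^ (k + 1)) \<le> C1 * (1 + \<bar>Re w\<bar> / Im w) ^ (k + 1) / Im w"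
    using cusp_line_bound[OF s1(1) det_g s1(2) trace_X q1 kap] by blast
  obtain C2 B2 where 2: "C2 \<ge> 0" "B2 > 0" "\<And>w. Im w \<ge> B2 \<Longrightarrow>
    cmod (G (moebius_act (g ** swap) w) * QX N X (moebius_act (g ** swap) w) ^ (k + 1)) \<le> C2 * (1 + \<bar>Re w\<bar> / Im w) ^ (k + 1) / Im w"
    using cusp_line_bound[OF s2(1) gs s2(2) trace_X q2 kap] by blast
  define T' where "T' = \<bar>T\<bar>"
  \<comment> \<open>Large enough that exp s reaches B1 at one end and exp(-s) / (1 + t^2) reaches B2
    at the other, for all |t| <= T'.\<close>
  define a where "a = max \<bar>ln B1\<bar> \<bar>ln (B2 * (1 + T'\<^sup>2))\<bar> + 1"
  define C where "C = C1 * (1 + T') ^ (k + 1) + C2 * (1 + T') ^ (k + 1) * (1 + T'\<^sup>2)"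
  have T': "T' \<ge> 0" "1 + T'\<^sup>2 > 0" by (auto simp: T'_def intro: add_pos_nonneg)
  have C: "C1 * (1 + T') ^ (k + 1) \<le> C" "C2 * (1 + T') ^ (k + 1) * (1 + T'\<^sup>2) \<le> C" "C \<ge> 0"
    using 1(1) 2(1) T' by (auto simp: C_def)
  have "cmod (line t s) \<le> C * exp (- \<bar>s\<bar>)" if t: "\<bar>t\<bar> \<le> T" and s: "\<bar>s\<bar> \<ge> a" for t s
  proof (cases "s \<ge> 0")
    case True
    have tT: "\<bar>t\<bar> \<le> T'" using t by (simp add: T'_def)
    have "ln B1 \<le> s" using s True by (simp add: a_def)
    hence "exp (ln B1) \<le> exp s" by simp
    hence "B1 \<le> exp s" using 1(2) by simp
    hence "cmod (line t s) \<le> C1 * (1 + \<bar>t\<bar>) ^ (k + 1) / exp s"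
      using 1(3)[of "hpt s t"] by (simp add: line_def abs_mult)
    also have "\<dots> = C1 * (1 + \<bar>t\<bar>) ^ (k + 1) * exp (- \<bar>s\<bar>)" using True by (simp add: exp_minus field_simps)
    also have "\<dots> \<le> C1 * (1 + T') ^ (k + 1) * exp (- \<bar>s\<bar>)"
      using 1(1) tT by (intro mult_right_mono mult_left_mono power_mono) auto
    also have "\<dots> \<le> C * exp (- \<bar>s\<bar>)" using C by (intro mult_right_mono) auto
    finally show ?thesis .
  next
    case False
    have tT: "\<bar>t\<bar> \<le> T'" using t by (simp add: T'_def)
    hence "\<bar>t\<bar>\<^sup>2 \<le> T'\<^sup>2" by (intro power_mono) auto
    hence t2: "1 + t\<^sup>2 \<le> 1 + T'\<^sup>2" by simp
    have t2p: "1 + t\<^sup>2 > 0" by (intro add_pos_nonneg) auto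
    define w where "w = - 1 / hpt s t"
    have w: "w = hpt (- ln (1 + t\<^sup>2) - s) (- t)" unfolding w_def by (rule hpt_inversion)
    have imw: "Im w = exp (- s) / (1 + t\<^sup>2)" unfolding w Im_hpt using t2p by (simp add: exp_diff exp_minus field_simps)
    have wH: "w \<in> upper_half_plane" unfolding w by simp
    have "moebius_act swap w = - 1 / w" using wH by (simp add: moebius_act_eq aut_def swap_def)
    also have "\<dots> = hpt s t" by (simp add: w_def)
    finally have act: "moebius_act (g ** swap) w = moebius_act g (hpt s t)"
      by (simp add: moebius_act_mult det_g det_swap wH)
    have "ln (B2 * (1 + T'\<^sup>2)) \<le> - s" using s False by (simp add: a_def)
    hence "exp (ln (B2 * (1 + T'\<^sup>2))) \<le> exp (- s)" by simp
    hence "B2 * (1 + T'\<^sup>2) \<le> exp (- s)" using 2(2) T'(2) by simp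
    moreover have "B2 * (1 + t\<^sup>2) \<le> B2 * (1 + T'\<^sup>2)" using 2(2) t2 by (intro mult_left_mono) auto
    ultimately have "B2 \<le> Im w" unfolding imw using t2p by (simp add: field_simps)
    from 2(3)[OF this] have "cmod (line t s) \<le> C2 * (1 + \<bar>Re w\<bar> / Im w) ^ (k + 1) / Im w"
      unfolding act by (simp only: line_def)
    also have "\<bar>Re w\<bar> / Im w = \<bar>t\<bar>" unfolding w by (simp add: abs_mult)
    also have "C2 * (1 + \<bar>t\<bar>) ^ (k + 1) / Im w = C2 * (1 + \<bar>t\<bar>) ^ (k + 1) * (1 + t\<^sup>2) * exp (- \<bar>s\<bar>)"
      unfolding imw using False by (simp add: exp_minus field_simps)
    also have "\<dots> \<le> C2 * (1 + T') ^ (k + 1) * (1 + T'\<^sup>2) * exp (- \<bar>s\<bar>)"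
      using 2(1) tT t2 t2p T' by (intro mult_right_mono mult_mono mult_left_mono power_mono) auto
    also have "\<dots> \<le> C * exp (- \<bar>s\<bar>)" using C by (intro mult_right_mono) auto
    finally show ?thesis .
  qed
  moreover have "a \<ge> 0" by (simp add: a_def)
  ultimately show ?thesis using C by blast
qed

lemma integrable_line: "integrable lborel (line t)"
proof -
  obtain C a where C: "C \<ge> 0" "a \<ge> 0" "\<And>s. \<bar>s\<bar> \<ge> a \<Longrightarrow> cmod (line t s) \<le> C * exp (- \<bar>s\<bar>)"
    using line_tails[of "\<bar>t\<bar>"] by blast
  obtain P where P: "\<And>z. z \<in> upper_half_plane \<Longrightarrow> (P has_field_derivative G z * QX N X z ^ k) (at z)"
    using exists_primitive by blast
  have 1: "integrable lborel (\<lambda>s. indicator {- a..a} s *\<^sub>R line t s)"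
    using line_integral(1)[OF P, of "- a" a t] C(2) by (simp add: set_integrable_def)
  have 2: "integrable lborel (\<lambda>s. indicator (- {- a..a}) s *\<^sub>R line t s)"
  proof (rule Bochner_Integration.integrable_bound[OF integrable_mult_right[OF integrable_exp_abs, of C]])
    show "AE s in lborel. norm (indicator (- {- a..a}) s *\<^sub>R line t s) \<le> norm (C * exp (- \<bar>s\<bar>))"
    proof (rule AE_I2)
      fix s :: real
      show "norm (indicator (- {- a..a}) s *\<^sub>R line t s) \<le> norm (C * exp (- \<bar>s\<bar>))"
        using C(1) C(3)[of s] by (cases "\<bar>s\<bar> \<ge> a") (auto simp: indicator_def)
    qed
  qed measurable
  have "integrable lborel (\<lambda>s. indicator {- a..a} s *\<^sub>R line t s + indicator (- {- a..a}) s *\<^sub>R line t s)"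
    by (rule Bochner_Integration.integrable_add[OF 1 2])
  also have "(\<lambda>s. indicator {- a..a} s *\<^sub>R line t s + indicator (- {- a..a}) s *\<^sub>R line t s) = line t"
    by (rule ext) (simp add: indicator_def)
  finally show ?thesis .
qed

text \<open>At parameter s two rays are joined by a horizontal segment of length exp s |t|, on which
  the derivative of the primitive is O(exp(-|s|) / exp s). So the primitives on the two rays
  approach each other at both ends: Cauchy's theorem with vanishing short sides.\<close>

lemma line_integral_constant: "(LINT s|lborel. line t s) = (LINT s|lborel. line 0 s)"
proof -
  obtain P where P: "\<And>z. z \<in> upper_half_plane \<Longrightarrow> (P has_field_derivative G z * QX N X z ^ k) (at z)"
    using exists_primitive by blast
  define p where "p t s = P (moebius_act g (hpt s t))" for t s
  have lim: "(\<lambda>n. - 2 * of_real \<kappa> * (p t (real n) - p t (- real n))) \<longlonglongrightarrow> (LINT s|lborel. line t s)" for t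
  proof -
    have "(\<lambda>n. LINT s|lborel. indicator {- real n..real n} s *\<^sub>R line t s) \<longlonglongrightarrow> (LINT s|lborel. line t s)"
    proof (rule integral_dominated_convergence[where w = "\<lambda>s. norm (line t s)"])
      show "AE s in lborel. (\<lambda>n. indicator {- real n..real n} s *\<^sub>R line t s) \<longlonglongrightarrow> line t s"
      proof (rule AE_I2)
        fix s :: real
        obtain n0 :: nat where n0: "\<bar>s\<bar> \<le> real n0" using real_arch_simple by blast
        have "eventually (\<lambda>n. indicator {- real n..real n} s *\<^sub>R line t s = line t s) sequentially"
          by (rule eventually_mono[OF eventually_ge_at_top[of n0]]) (use n0 in \<open>auto simp: indicator_def\<close>)
        thus "(\<lambda>n. indicator {- real n..real n} s *\<^sub>R line t s) \<longlonglongrightarrow> line t s"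
          by (rule tendsto_eventually)
      qed
    qed (use integrable_line in \<open>auto simp: indicator_def\<close>)
    moreover have "(LINT s|lborel. indicator {- real n..real n} s *\<^sub>R line t s) = - 2 * of_real \<kappa> * (p t (real n) - p t (- real n))" for n
      using line_integral(2)[OF P, of "- real n" "real n" t] by (simp add: p_def set_lebesgue_integral_def)
    ultimately show ?thesis by simp
  qed
  obtain C a where C: "C \<ge> 0" "a \<ge> 0" "\<And>t' s. \<bar>t'\<bar> \<le> \<bar>t\<bar> \<Longrightarrow> \<bar>s\<bar> \<ge> a \<Longrightarrow> cmod (line t' s) \<le> C * exp (- \<bar>s\<bar>)"
    using line_tails[of "\<bar>t\<bar>"] by blast
  have diff: "cmod (p t s - p 0 s) \<le> (C / (2 * \<kappa>) * \<bar>t\<bar>) * exp (- \<bar>s\<bar>)" if s: "\<bar>s\<bar> \<ge> a" for s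
  proof -
    \<comment> \<open>A convex segment containing the points of both rays at height exp s; each of
      its points lies on a ray with |t'| <= |t|, so the uniform tail bound applies.\<close>
    define S where "S = {w. Im w = exp s \<and> \<bar>Re w\<bar> \<le> exp s * \<bar>t\<bar>}"
    have S: "S \<subseteq> upper_half_plane" by (auto simp: S_def upper_half_plane_def)
    have "S = {w. Im w = exp s} \<inter> ({w. Re w \<le> exp s * \<bar>t\<bar>} \<inter> {w. Re w \<ge> - (exp s * \<bar>t\<bar>)})" by (auto simp: S_def)
    moreover have "convex {w. Im w = exp s}" unfolding convex_def by (auto simp: distrib_right[symmetric])
    ultimately have cvx: "convex S" by (simp add: convex_Int convex_halfspace_Re_le convex_halfspace_Re_ge)
    have "cmod (P (moebius_act g (hpt s t)) - P (moebius_act g (hpt s 0))) \<le> (C * exp (- \<bar>s\<bar>) / (2 * \<kappa> * exp s)) * cmod (hpt s t - hpt s 0)"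
    proof (rule field_differentiable_bound[OF cvx])
      fix w assume w: "w \<in> S"
      hence wH: "w \<in> upper_half_plane" using S by blast
      show "((\<lambda>w. P (moebius_act g w)) has_field_derivative (G (moebius_act g w) * QX N X (moebius_act g w) ^ k) * (1 / (aut g w)\<^sup>2)) (at w within S)"
        by (rule DERIV_subset[OF DERIV_chain2[OF P[OF g_uhp[OF wH]] moebius_act_derivative[OF det_g wH]]]) simp
      have j: "aut g w \<noteq> 0" by (rule aut_nz[OF det_g wH])
      have w0: "w \<noteq> 0" using w by (auto simp: S_def)
      define t' where "t' = Re w / exp s"
      have wt: "w = hpt s t'" using w by (simp add: t'_def complex_eq_iff S_def)
      have t': "\<bar>t'\<bar> \<le> \<bar>t\<bar>" using w by (simp add: t'_def S_def field_simps)
      have "(G (moebius_act g w) * QX N X (moebius_act g w) ^ k) * (1 / (aut g w)\<^sup>2) = line t' s / (- 2 * of_real \<kappa> * w)"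
        unfolding line_def wt[symmetric] using j w0 kappa_pos by (simp add: QX_g[OF wH])
      hence "cmod ((G (moebius_act g w) * QX N X (moebius_act g w) ^ k) * (1 / (aut g w)\<^sup>2)) = cmod (line t' s) / (2 * \<kappa> * cmod w)"
        using kappa_pos by (simp add: norm_divide norm_mult)
      also have "\<dots> \<le> C * exp (- \<bar>s\<bar>) / (2 * \<kappa> * exp s)"
      proof (rule frac_le)
        show "cmod (line t' s) \<le> C * exp (- \<bar>s\<bar>)" by (rule C(3)[OF t' s])
        have "exp s \<le> cmod w" using abs_Im_le_cmod[of w] w by (simp add: S_def)
        thus "2 * \<kappa> * exp s \<le> 2 * \<kappa> * cmod w" using kappa_pos by simp
      qed (use C kappa_pos in auto)
      finally show "cmod ((G (moebius_act g w) * QX N X (moebius_act g w) ^ k) * (1 / (aut g w)\<^sup>2)) \<le> C * exp (- \<bar>s\<bar>) / (2 * \<kappa> * exp s)" .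
    qed (auto simp: S_def abs_mult)
    also have "hpt s t - hpt s 0 = of_real (exp s * t)" by (simp add: complex_eq_iff)
    also have "cmod (of_real (exp s * t)) = exp s * \<bar>t\<bar>" by (simp add: norm_mult abs_mult)
    finally show ?thesis by (simp add: p_def mult_ac)
  qed
  have dlim: "(\<lambda>n. p t (e * real n) - p 0 (e * real n)) \<longlonglongrightarrow> 0" if e: "e \<in> {1, - 1}" for e
  proof (rule Lim_null_comparison)
    obtain n0 :: nat where n0: "a \<le> real n0" using real_arch_simple by blast
    show "eventually (\<lambda>n. norm (p t (e * real n) - p 0 (e * real n)) \<le> (C / (2 * \<kappa>) * \<bar>t\<bar>) * exp (- 1) ^ n) sequentially"
    proof (rule eventually_mono[OF eventually_ge_at_top[of n0]])
      fix n assume "n0 \<le> n"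
      hence "\<bar>e * real n\<bar> \<ge> a" "\<bar>e * real n\<bar> = real n" using n0 e by auto
      moreover have "exp (- 1) ^ n = exp (- real n)" by (simp add: exp_of_nat_mult[symmetric])
      ultimately show "norm (p t (e * real n) - p 0 (e * real n)) \<le> (C / (2 * \<kappa>) * \<bar>t\<bar>) * exp (- 1) ^ n"
        using diff[of "e * real n"] by metis
    qed
    have "(\<lambda>n. exp (- 1 :: real) ^ n) \<longlonglongrightarrow> 0" by (rule LIMSEQ_power_zero) simp
    from tendsto_mult_left[OF this, of "C / (2 * \<kappa>) * \<bar>t\<bar>"]
    show "(\<lambda>n. (C / (2 * \<kappa>) * \<bar>t\<bar>) * exp (- 1) ^ n) \<longlonglongrightarrow> 0" by simp
  qed
  have "(\<lambda>n. - 2 * of_real \<kappa> * ((p t (1 * real n) - p 0 (1 * real n)) - (p t (- 1 * real n) - p 0 (- 1 * real n)))) \<longlonglongrightarrow> - 2 * of_real \<kappa> * (0 - 0)"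
    by (intro tendsto_mult tendsto_const tendsto_diff dlim) auto
  hence "(\<lambda>n. - 2 * of_real \<kappa> * (p t (real n) - p t (- real n)) - - 2 * of_real \<kappa> * (p 0 (real n) - p 0 (- real n))) \<longlonglongrightarrow> 0"
    by (simp add: algebra_simps)
  moreover have "(\<lambda>n. - 2 * of_real \<kappa> * (p t (real n) - p t (- real n)) - - 2 * of_real \<kappa> * (p 0 (real n) - p 0 (- real n))) \<longlonglongrightarrow>
     (LINT s|lborel. line t s) - (LINT s|lborel. line 0 s)"
    by (intro tendsto_diff lim)
  ultimately have "(LINT s|lborel. line t s) - (LINT s|lborel. line 0 s) = 0" using LIMSEQ_unique by blast
  thus ?thesis by simp
qed

text \<open>The stabilizer fixes a cusp, so the powers of a multiplier \<open>a\<close> of the cusp have bounded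
  denominators; as the same holds for \<open>a\<^sup>-\<^sup>1\<close>, necessarily \<open>a = \<plusminus>1\<close>.\<close>

lemma stabilizer_trivial:
  assumes d: "\<delta> \<in> \<Gamma>" "conj_act \<delta> X = X"
  shows "\<delta> = mat 1 \<or> \<delta> = - mat 1"
proof -
  have detd: "det \<delta> = 1" using d det1 by blast
  obtain \<sigma> where s: "\<sigma> \<in> SL2Z" "conj_act (matrix_inv \<sigma>) X $ 1 $ 1 = root"
    "conj_act (matrix_inv \<sigma>) X $ 2 $ 1 = 0" "conj_act (matrix_inv \<sigma>) X $ 2 $ 2 = - root"
    using cusp_at_infinity by blast
  have dets: "det \<sigma> = 1" using s det1_SL2Z by blast
  define T b where "T = conj_act (matrix_inv \<sigma>) X" "b = T $ 1 $ 2"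
  have T: "T = M2 root b 0 (- root)" using s by (simp add: T_b_def mat2_eq_iff)
  define c where "c \<gamma> = conj_act (matrix_inv \<sigma>) \<gamma>" for \<gamma>
  define e where "e = c \<delta>"
  have dete: "det e = 1" using detd dets by (simp add: e_def c_def det_matrix_inv)
  have "conj_act e T = T" unfolding e_def c_def T_b_def(1)
    by (subst conj_act_conj_act) (simp_all add: dets det_matrix_inv detd d)
  hence com: "e ** T = T ** e" using conj_act_eq_iff_commute[OF dete] by blast
  hence ent: "(e ** T) $ i $ j = (T ** e) $ i $ j" for i j by simp
  have e21: "e $ 2 $ 1 = 0" using ent[of 2 1] root_pos by (simp add: mat2_mult_nth T)
  define p q where "p = e $ 1 $ 1" "q = e $ 2 $ 2"
  have pq: "p * q = 1" using dete e21 by (simp add: det_2 p_q_def)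
  have den: "denominator_bounded D (c \<gamma>)" if "\<gamma> \<in> \<Gamma>" for \<gamma>
    unfolding c_def conj_act_matrix_inv[OF dets]
    by (intro denominator_bounded_mult_SL2Z denominator that SL2Z.inv_mem s)
  have pow: "\<exists>\<gamma>\<in>\<Gamma>. c \<gamma> $ 2 $ 1 = 0 \<and> c \<gamma> $ 1 $ 1 = p ^ n \<and> c \<gamma> $ 2 $ 2 = q ^ n" for n
  proof (induction n)
    case 0
    have "c (mat 1) = mat 1" by (simp add: c_def det_matrix_inv dets)
    thus ?case using one_mem by (intro bexI[of _ "mat 1"]) auto
  next
    case (Suc n)
    then obtain \<gamma> where g: "\<gamma> \<in> \<Gamma>" "c \<gamma> $ 2 $ 1 = 0" "c \<gamma> $ 1 $ 1 = p ^ n" "c \<gamma> $ 2 $ 2 = q ^ n" by blast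
    have "c (\<gamma> ** \<delta>) = c \<gamma> ** e" unfolding c_def e_def by (rule conj_act_hom[OF det_matrix_inv[OF dets]])
    hence "c (\<gamma> ** \<delta>) $ 2 $ 1 = 0 \<and> c (\<gamma> ** \<delta>) $ 1 $ 1 = p ^ Suc n \<and> c (\<gamma> ** \<delta>) $ 2 $ 2 = q ^ Suc n"
      using g e21 by (simp add: mat2_mult_nth p_q_def[symmetric])
    thus ?case using mult_mem[OF g(1) d(1)] by blast
  qed
  have ints: "real D * p ^ n \<in> \<int>" "real D * q ^ n \<in> \<int>" for n
    using pow[of n] den by (auto simp: denominator_bounded_def) metis+
  \<comment> \<open>Nonzero integers have absolute value at least 1, whereas D |x|^n tends to
    0.\<close>
  have small: False if x: "\<And>n. real D * x ^ n \<in> \<int>" "\<bar>x\<bar> < 1" "x \<noteq> 0" for x :: real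
  proof -
    have "(\<lambda>n. real D * \<bar>x\<bar> ^ n) \<longlonglongrightarrow> real D * 0"
      using x(2) by (intro tendsto_mult tendsto_const LIMSEQ_power_zero) auto
    hence "eventually (\<lambda>n. real D * \<bar>x\<bar> ^ n < 1) sequentially" by (intro order_tendstoD(2)) auto
    then obtain n where n: "real D * \<bar>x\<bar> ^ n < 1" by (auto simp: eventually_sequentially)
    have "real D * x ^ n \<noteq> 0" using D_pos x(3) by simp
    hence "1 \<le> \<bar>real D * x ^ n\<bar>" using Ints_nonzero_abs_ge1[OF x(1)] by blast
    thus False using n by (simp add: abs_mult power_abs)
  qed
  have nz: "p \<noteq> 0" "q \<noteq> 0" using pq by auto
  have abs: "\<bar>p\<bar> * \<bar>q\<bar> = 1" using pq by (metis abs_mult abs_one)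
  have "\<not> \<bar>p\<bar> < 1" using small[of p] ints nz by blast
  moreover have "\<not> \<bar>q\<bar> < 1" using small[of q] ints nz by blast
  ultimately have "\<bar>p\<bar> = 1" using abs mult_left_mono[of 1 "\<bar>q\<bar>" "\<bar>p\<bar>"] by linarith
  hence p: "p = 1 \<or> p = - 1" by (auto simp: abs_if split: if_splits)
  hence qp: "q = p" using pq by auto
  \<comment> \<open>With equal diagonal entries of e, commuting with T, whose eigenvalues differ,
    kills the off-diagonal entry.\<close>
  have "p * b + e $ 1 $ 2 * (- root) = root * e $ 1 $ 2 + b * q" using ent[of 1 2] by (simp add: mat2_mult_nth T p_q_def)
  hence "e $ 1 $ 2 = 0" using qp root_pos by simp
  hence "e = mat 1 \<or> e = - mat 1" using p qp e21 by (auto simp: mat2_eq_iff p_q_def)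
  moreover have "\<delta> = conj_act \<sigma> e" by (simp add: e_def c_def conj_act_inv dets)
  ultimately show ?thesis by (auto simp: conj_act_uminus_right dets)
qed

text \<open>The stabilizer acts trivially, so the tube is the whole half-plane and its multiplicity
  is the order of the centre.\<close>

lemma orbit_sum_open:
  assumes F: "fundamental_domain \<Gamma> F"
  shows "\<exists>S. ((\<lambda>Y. LINT z:F|hyp. phi Y z) has_sum S) ((\<lambda>\<gamma>. conj_act \<gamma> X) ` \<Gamma>) \<and>
    coef X * S = - of_real (sqrt N) * (LINT y:{0<..}|lborel. G (geodesic_path g y) * QX N X (geodesic_path g y) ^ k * vector_derivative (geodesic_path g) (at y))
      * exp (2 * of_real pi * \<i> * of_real m * \<tau>)"
proof -
  define C where "C = (LINT y:{0<..}|lborel. G (geodesic_path g y) * QX N X (geodesic_path g y) ^ k * vector_derivative (geodesic_path g) (at y))"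
  have "C = (LINT s:{s. exp s \<in> {0<..}}|lborel. line 0 s) / (- 2 * of_real \<kappa>)"
    unfolding C_def by (rule cycle_line_integral) auto
  hence C: "(LINT s|lborel. line 0 s) = - 2 * of_real \<kappa> * C"
    using kappa_pos by (simp add: set_lebesgue_integral_def)
  have J: "(LINT s:UNIV|lborel. line t s) = - 2 * of_real \<kappa> * C" for t
    using line_integral_constant[of t] C by (simp add: set_lebesgue_integral_def)
  have stab: "{\<delta> \<in> \<Gamma>. conj_act \<delta> X = X \<and> moebius_act \<delta> z \<in> {z \<in> upper_half_plane. ln (Im (moebius_act (matrix_inv g) z)) \<in> UNIV}} = \<Gamma> \<inter> {mat 1, - mat 1}"
    if z: "z \<in> upper_half_plane" for z
    using stabilizer_trivial moebius_upper_half_plane[OF det1 z] z by auto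
  have fin: "finite {\<delta> \<in> \<Gamma>. conj_act \<delta> X = X \<and> moebius_act \<delta> z \<in> {z \<in> upper_half_plane. ln (Im (moebius_act (matrix_inv g) z)) \<in> UNIV}}"
    and card: "card {\<delta> \<in> \<Gamma>. conj_act \<delta> X = X \<and> moebius_act \<delta> z \<in> {z \<in> upper_half_plane. ln (Im (moebius_act (matrix_inv g) z)) \<in> UNIV}} = center_order"
    if "z \<in> upper_half_plane" for z
    unfolding stab[OF that] by (simp_all add: center_order_def)
  show ?thesis unfolding C_def[symmetric]
    by (rule orbit_sum_from_tube[OF F _ fin card J]; (assumption | simp))
qed

end

section \<open>Pell units and the stabilizer of a closed geodesic\<close>

context hyperbolic_vector
begin

lemma X_entries:
  "(X$1$1)\<^sup>2 + X$1$2 * X$2$1 = root\<^sup>2"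
proof -
  have "det X = det (M2 root 0 0 (- root))" by (subst X_conj) (rule det_conj_act[OF det_g])
  moreover have "X$2$2 = - X$1$1" using trace_X by (simp add: trace_mat2 add_eq_0_iff)
  ultimately show ?thesis by (simp add: det_2 power2_eq_square)
qed

text \<open>A solution of Pell's equation for the discriminant of \<open>X\<close> gives a hyperbolic element of the
  principal congruence subgroup that commutes with \<open>X\<close>.\<close>

lemma hyperbolic_stabilizer_element:
  assumes irr: "root \<notin> \<rat>"
  shows "\<exists>a. a \<noteq> 0 \<and> conj_act g (diag2 (exp a) (exp (- a))) \<in> \<Gamma>"
proof -
  have "real denom * X $ i $ j \<in> \<int>" for i j
    using h_denominator[OF X_mem] by (auto simp: denominator_bounded_def)
  then obtain b1 b2 b3 where b: "real denom * X$1$2 = of_int b1" "real denom * X$1$1 = of_int b2" "real denom * X$2$1 = of_int b3"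
    by (metis Ints_cases)
  have X22: "X$2$2 = - X$1$1" using trace_X by (simp add: trace_mat2 add_eq_0_iff)
  \<comment> \<open>Up to sign the determinant of the integral matrix \<open>denom\<close> times X;
    irrationality of \<open>root\<close> means that it is not a square.\<close>
  define \<Delta> where "\<Delta> = b2\<^sup>2 + b1 * b3"
  have "real_of_int \<Delta> = (real denom)\<^sup>2 * ((X$1$1)\<^sup>2 + X$1$2 * X$2$1)"
    by (simp add: \<Delta>_def b[symmetric] power2_eq_square algebra_simps)
  hence \<Delta>r: "real_of_int \<Delta> = (real denom * root)\<^sup>2" by (simp add: X_entries power_mult_distrib)
  have "real denom * root > 0" using denom_pos root_pos by simp
  hence \<Delta>pos: "\<Delta> > 0" using \<Delta>r by (metis of_int_0_less_iff zero_less_power)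
  define n where "n = int conductor"
  have n: "n \<ge> 1" using conductor by (simp add: n_def)
  define D' where "D' = nat (\<Delta> * n\<^sup>2)"
  have D': "int D' = \<Delta> * n\<^sup>2" using \<Delta>pos by (simp add: D'_def)
  have "\<nexists>r::nat. D' = r\<^sup>2"
  proof
    assume "\<exists>r::nat. D' = r\<^sup>2"
    then obtain r :: nat where r: "D' = r\<^sup>2" by blast
    have "(real denom * root * of_int n)\<^sup>2 = real_of_int (int D')" by (simp only: D' power_mult_distrib of_int_mult of_int_power \<Delta>r)
    also have "\<dots> = (real r)\<^sup>2" by (simp add: r)
    finally have "real denom * root * of_int n = real r"
      using denom_pos root_pos n by (subst (asm) power2_eq_iff_nonneg) auto
    hence "root = real r / (real denom * of_int n)" using denom_pos n by (simp add: field_simps)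
    also have "\<dots> \<in> \<rat>" by (intro Rats_divide Rats_mult) auto
    finally show False using irr by blast
  qed
  from pell_solution[OF this] obtain x y where xy: "y \<noteq> 0" "x\<^sup>2 - int D' * y\<^sup>2 = 1" by blast
  have pell: "x\<^sup>2 = 1 + \<Delta> * n\<^sup>2 * y\<^sup>2" using xy(2) D' by simp
  have x2: "x\<^sup>2 \<ge> 1" using pell \<Delta>pos by simp
  \<comment> \<open>\<alpha> + \<beta> sqrt \<Delta> is the square of the Pell unit x + y n sqrt
    \<Delta>. Squaring makes \<alpha> congruent to 1 modulo n, and \<beta> is divisible by
    n.\<close>
  define \<alpha> \<beta> where "\<alpha> = 2 * x\<^sup>2 - 1" "\<beta> = 2 * x * y * n"
  have unit: "\<alpha>\<^sup>2 - \<beta>\<^sup>2 * \<Delta> = 1"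
  proof -
    have "\<beta>\<^sup>2 * \<Delta> = 4 * x\<^sup>2 * (\<Delta> * n\<^sup>2 * y\<^sup>2)" by (simp add: \<alpha>_\<beta>_def power_mult_distrib algebra_simps)
    also have "\<Delta> * n\<^sup>2 * y\<^sup>2 = x\<^sup>2 - 1" using pell by simp
    finally show ?thesis by (simp add: \<alpha>_\<beta>_def power2_eq_square algebra_simps)
  qed
  have \<alpha>: "\<alpha> \<ge> 1" using x2 by (simp add: \<alpha>_\<beta>_def)
  have \<beta>: "\<beta> \<noteq> 0" using x2 xy n by (auto simp: \<alpha>_\<beta>_def)
  define s where "s = real denom * root"
  have s: "s > 0" using denom_pos root_pos by (simp add: s_def)
  \<comment> \<open>The eigenvalues of the matrix \<alpha> + \<beta> \<open>denom\<close> X; both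
    are positive, as their product is 1 and their sum 2 \<alpha>.\<close>
  define \<mu> \<nu> where "\<mu> = of_int \<alpha> + of_int \<beta> * s" "\<nu> = of_int \<alpha> - of_int \<beta> * s"
  have \<mu>\<nu>: "\<mu> * \<nu> = 1"
  proof -
    have "\<mu> * \<nu> = of_int (\<alpha>\<^sup>2 - \<beta>\<^sup>2 * \<Delta>)"
      by (simp add: \<mu>_\<nu>_def \<Delta>r s_def power2_eq_square algebra_simps)
    thus ?thesis by (simp only: unit of_int_1)
  qed
  have "\<mu> + \<nu> > 0" using \<alpha> by (simp add: \<mu>_\<nu>_def)
  hence \<mu>: "\<mu> > 0" using \<mu>\<nu> by (smt (verit) mult_nonneg_nonpos mult_nonpos_nonneg)
  define a where "a = ln \<mu>"
  have ea: "exp a = \<mu>" "exp (- a) = \<nu>" using \<mu> \<mu>\<nu> by (simp_all add: a_def exp_minus inverse_unique)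
  have "a \<noteq> 0"
  proof
    assume "a = 0"
    hence "\<mu> = 1" "\<nu> = 1" using ea by simp_all
    hence "of_int \<beta> * s = 0" unfolding \<mu>_\<nu>_def by linarith
    thus False using \<beta> s by simp
  qed
  \<comment> \<open>Entrywise this is \<alpha> + \<beta> \<open>denom\<close> X, which commutes with
    X by construction.\<close>
  define \<delta> where "\<delta> = M2 (of_int (\<alpha> + \<beta> * b2)) (of_int (\<beta> * b1)) (of_int (\<beta> * b3)) (of_int (\<alpha> - \<beta> * b2))"
  have "conj_act g (diag2 (exp a) (exp (- a))) = \<delta>"
  proof -
    have dg: "g$1$1 * g$2$2 - g$1$2 * g$2$1 = 1" using det_g by (simp add: det_2)
    have xe: "X$1$1 = root * (g$1$1 * g$2$2 + g$1$2 * g$2$1)" "X$1$2 = - 2 * root * g$1$1 * g$1$2" "X$2$1 = 2 * root * g$2$1 * g$2$2"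
      using diagonalizes_entries[OF diag] m_pos by (simp_all add: Q_X root_def)
    have id1: "a * (x + y * z) * d - b * (x - y * z) * c = x + y * (z * (a * d + b * c))"
      and id2: "d * (x - y * z) * a - c * (x + y * z) * b = x - y * (z * (a * d + b * c))"
      if "a * d - b * c = 1" for a b c d x y z :: real
      using that by algebra+
    have be: "of_int b2 = s * (g$1$1 * g$2$2 + g$1$2 * g$2$1)" "of_int b1 = - 2 * s * g$1$1 * g$1$2" "of_int b3 = 2 * s * g$2$1 * g$2$2"
      unfolding b[symmetric] xe s_def by simp_all
    show ?thesis
      unfolding mat2_eq_iff conj_act_nth[OF det_g] ea \<delta>_def M2_nth of_int_add of_int_diff of_int_mult be \<mu>_\<nu>_def
      using id1[OF dg, of "of_int \<alpha>" "of_int \<beta>" s] id2[OF dg, of "of_int \<alpha>" "of_int \<beta>" s]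
      by (simp add: diag2_def algebra_simps)
  qed
  moreover have "\<delta> \<in> principal_congruence conductor"
  proof -
    have "det \<delta> = of_int (\<alpha>\<^sup>2 - \<beta>\<^sup>2 * \<Delta>)" by (simp add: \<delta>_def \<Delta>_def power2_eq_square algebra_simps)
    hence "\<delta> \<in> SL2Z" using unit by (auto simp: SL2Z_def forall_2 \<delta>_def)
    have al: "\<alpha> = 1 + n * (2 * \<Delta> * n * y\<^sup>2)" using pell by (simp add: \<alpha>_\<beta>_def power2_eq_square)
    have "\<delta> $ 1 $ 1 = 1 + of_int (n * (2 * \<Delta> * n * y\<^sup>2 + 2 * x * y * b2))" "\<delta> $ 1 $ 2 = 0 + of_int (n * (2 * x * y * b1))"
      "\<delta> $ 2 $ 1 = 0 + of_int (n * (2 * x * y * b3))" "\<delta> $ 2 $ 2 = 1 + of_int (n * (2 * \<Delta> * n * y\<^sup>2 - 2 * x * y * b2))"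
      unfolding \<delta>_def M2_nth al \<alpha>_\<beta>_def(2) by (simp_all add: algebra_simps)
    hence "\<exists>a::int. \<delta> $ i $ j = mat 1 $ i $ j + of_int (n * a)" for i j
      using exhaust_2[of i] exhaust_2[of j] by (metis mat2_one_nth)
    thus ?thesis using \<open>\<delta> \<in> SL2Z\<close> by (auto simp: principal_congruence_def n_def)
  qed
  ultimately show ?thesis using conductor(2) \<open>a \<noteq> 0\<close> by blast
qed

text \<open>Matrices commuting with a diagonal matrix of distinct eigenvalues are diagonal, so up to
  sign the stabilizer lies in the group of diag(exp a, exp(-a)). It is discrete and, by the Pell
  element, nontrivial; hence it is infinite cyclic, with \<epsilon> = exp \<omega>.\<close>

lemma stabilizer_generator_exists:
  assumes irr: "root \<notin> \<rat>"
  shows "\<exists>\<epsilon>. stabilizer_generator \<Gamma> X g \<epsilon>"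
proof -
  define U where "U = \<Gamma> \<union> uminus ` \<Gamma>"
  interpret U: fuchsian U D unfolding U_def by (rule pm_fuchsian)
  have U_minus: "- d \<in> U" if "d \<in> U" for d using that by (auto simp: U_def image_iff)
  define m' where "m' a = conj_act g (diag2 (exp a) (exp (- a)))" for a
  have d2: "diag2 p q = M2 p 0 0 q" for p q by (simp add: diag2_def M2_def)
  have detd: "det (diag2 (exp a) (exp (- a))) = 1" for a by (simp add: d2 exp_add[symmetric])
  have inj: "inj m'"
  proof (rule injI)
    fix a b assume "m' a = m' b"
    hence "diag2 (exp a) (exp (- a)) = diag2 (exp b) (exp (- b))" unfolding m'_def using conj_act_inv(1)[OF det_g] by metis
    thus "a = b" by (simp add: d2 mat2_eq_iff)
  qed
  have "\<exists>\<omega>>0. {a. m' a \<in> U} = {of_int n * \<omega> | n. True}"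
  proof (rule U.one_parameter_cyclic[OF inj])
    have "diag2 1 1 = mat 1" by (simp add: d2 mat2_eq_iff)
    thus "m' 0 = mat 1" by (simp add: m'_def det_g)
    show "m' (a + b) = m' a ** m' b" for a b
      unfolding m'_def conj_act_hom[OF det_g, symmetric] by (simp add: d2 M2_mult exp_add[symmetric] exp_diff)
    show "\<exists>C. \<forall>a i j. \<bar>a\<bar> \<le> B \<longrightarrow> \<bar>m' a $ i $ j\<bar> \<le> C" for B
    proof (intro exI allI impI)
      fix a i j assume a: "\<bar>a\<bar> \<le> B"
      have "\<bar>diag2 (exp a) (exp (- a)) $ i $ j\<bar> \<le> exp B" for i j
        using exhaust_2[of i] exhaust_2[of j] a by (auto simp: d2)
      thus "\<bar>m' a $ i $ j\<bar> \<le> 2 * exp B * (\<bar>g$1$1\<bar> + \<bar>g$1$2\<bar> + \<bar>g$2$1\<bar> + \<bar>g$2$2\<bar>)\<^sup>2"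
        unfolding m'_def by (rule abs_conj_act_le[OF det_g])
    qed
    show "\<exists>a. a \<noteq> 0 \<and> m' a \<in> U" using hyperbolic_stabilizer_element[OF irr] by (auto simp: m'_def U_def)
  qed
  then obtain \<omega> where \<omega>: "\<omega> > 0" "{a. m' a \<in> U} = {of_int n * \<omega> | n. True}" by blast
  define \<epsilon> where "\<epsilon> = exp \<omega>"
  have powi: "\<epsilon> powi n = exp (of_int n * \<omega>)" for n by (simp add: \<epsilon>_def exp_power_int)
  have u: "conj_act g (diag2 (\<epsilon> powi n) (\<epsilon> powi (- n))) = m' (of_int n * \<omega>)" for n
    unfolding powi m'_def by simp
  define Y where "Y = M2 root 0 0 (- root)"
  have inv: "conj_act (matrix_inv g) d = e \<longleftrightarrow> d = conj_act g e" for d e by (rule conj_act_inv_eq_iff[OF det_g])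
  have fixY: "conj_act (s *\<^sub>R diag2 (exp a) (exp (- a))) Y = Y" if "s = 1 \<or> s = - 1" for s a
  proof -
    have "det (s *\<^sub>R diag2 (exp a) (exp (- a))) = 1" using that by (auto simp: d2 det_2 exp_add[symmetric])
    thus ?thesis by (subst conj_act_eq_iff_commute) (auto simp: d2 Y_def mat2_eq_iff mat2_mult_nth)
  qed
  have "{d \<in> conj_act (matrix_inv g) ` U. conj_act d Y = Y} = {s *\<^sub>R diag2 (\<epsilon> powi n) (\<epsilon> powi (- n)) | s n. s \<in> {1, -1}}"
  proof (intro equalityI subsetI)
    fix d assume "d \<in> {d \<in> conj_act (matrix_inv g) ` U. conj_act d Y = Y}"
    then obtain \<gamma> where \<gamma>: "\<gamma> \<in> U" "d = conj_act (matrix_inv g) \<gamma>" and dY: "conj_act d Y = Y" by blast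
    have det: "det d = 1" using \<gamma> U.det1 by (simp add: det_matrix_inv det_g)
    have g_d: "\<gamma> = conj_act g d" using \<gamma>(2) by (simp add: conj_act_inv[OF det_g])
    have "d ** Y = Y ** d" using dY conj_act_eq_iff_commute[OF det] by blast
    hence e: "(d ** Y) $ i $ j = (Y ** d) $ i $ j" for i j by simp
    have off: "d $ 1 $ 2 = 0" "d $ 2 $ 1 = 0"
      using e[of 1 2] e[of 2 1] root_pos by (simp_all add: mat2_mult_nth Y_def)
    have dd: "d$1$1 * d$2$2 = 1" using det off by (simp add: det_2)
    have nz: "d$1$1 \<noteq> 0" using dd by auto
    have d22: "d$2$2 = 1 / d$1$1" using dd nz by (simp add: field_simps)
    define a where "a = ln \<bar>d$1$1\<bar>"
    have ea: "exp a = \<bar>d$1$1\<bar>" "exp (- a) = 1 / \<bar>d$1$1\<bar>" using nz by (simp_all add: a_def exp_minus divide_inverse)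
    define s :: real where "s = sgn (d$1$1)"
    have s: "s = 1 \<or> s = - 1" using nz by (auto simp: s_def sgn_if)
    have d: "d = s *\<^sub>R diag2 (exp a) (exp (- a))"
      using off d22 nz by (simp add: mat2_eq_iff d2 ea s_def) (auto simp: sgn_if abs_if)
    have "\<gamma> = m' a \<or> \<gamma> = - m' a" unfolding g_d using s by (auto simp: d m'_def conj_act_uminus_right)
    hence "m' a \<in> U" using \<gamma>(1) U_minus[of "- m' a"] by auto
    then obtain n where "a = of_int n * \<omega>" using \<omega>(2) by auto
    hence "d = s *\<^sub>R diag2 (\<epsilon> powi n) (\<epsilon> powi (- n))" unfolding d powi by simp
    thus "d \<in> {s *\<^sub>R diag2 (\<epsilon> powi n) (\<epsilon> powi (- n)) | s n. s \<in> {1, -1}}" using s by blast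
  next
    fix d assume "d \<in> {s *\<^sub>R diag2 (\<epsilon> powi n) (\<epsilon> powi (- n)) | s n. s \<in> {1, -1}}"
    then obtain s n where d: "d = s *\<^sub>R diag2 (\<epsilon> powi n) (\<epsilon> powi (- n))" "s = 1 \<or> s = - 1" by blast
    have "m' (of_int n * \<omega>) \<in> U" using \<omega>(2) by auto
    moreover have "conj_act g d = m' (of_int n * \<omega>) \<or> conj_act g d = - m' (of_int n * \<omega>)"
      using d u[of n] by (auto simp: conj_act_uminus_right)
    ultimately have "conj_act g d \<in> U" using U_minus by auto
    hence "d \<in> conj_act (matrix_inv g) ` U" using inv[of "conj_act g d" d] by (intro image_eqI[of _ _ "conj_act g d"]) auto
    moreover have "conj_act d Y = Y" using fixY[OF d(2), of "of_int n * \<omega>"] unfolding d(1) powi by simp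
    ultimately show "d \<in> {d \<in> conj_act (matrix_inv g) ` U. conj_act d Y = Y}" by blast
  qed
  moreover have "\<epsilon> > 1" using \<omega>(1) by (simp add: \<epsilon>_def)
  ultimately have "stabilizer_generator \<Gamma> X g \<epsilon>"
    unfolding stabilizer_generator_def conj_act_matrix_inv[OF det_g, symmetric] conj_X Y_def U_def by blast
  thus ?thesis by blast
qed

end

context shintani_data
begin

text \<open>The unfolding uses the very g that \<open>cycle_integral\<close> chooses, and
  rationality of \<open>root\<close> matches the case distinction in
  \<open>cycle_interval\<close>.\<close>

lemma orbit_sum_negative:
  assumes F: "fundamental_domain \<Gamma> F" and X: "X \<in> h" and m: "Q N X = - m" "m > 0"
  shows "\<exists>S. ((\<lambda>Y. LINT z:F|hyp. phi Y z) has_sum S) ((\<lambda>\<gamma>. conj_act \<gamma> X) ` \<Gamma>) \<and>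
    coef X * S = - of_real (sqrt N) * cycle_integral N \<Gamma> k G X * exp (2 * of_real pi * \<i> * of_real m * \<tau>)"
proof -
  define g where "g = (SOME g. diagonalizes N X g)"
  have "diagonalizes N X g" unfolding g_def
    by (rule someI_ex[OF diagonalizes_exists]) (use N_pos h_trace X m in auto)
  then interpret hyperbolic_vector \<Gamma> D N k G \<tau> h conductor denom X g m
    by unfold_locales (use X m in auto)
  have root2: "\<bar>Q N X\<bar> / N = root\<^sup>2" using m N_pos by (simp add: root_def)
  have sq: "(\<exists>r\<in>\<rat>. \<bar>Q N X\<bar> / N = r\<^sup>2) \<longleftrightarrow> root \<in> \<rat>"
  proof
    assume "\<exists>r\<in>\<rat>. \<bar>Q N X\<bar> / N = r\<^sup>2"
    then obtain r where r: "r \<in> \<rat>" "root\<^sup>2 = r\<^sup>2" using root2 by auto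
    hence "root = r \<or> root = - r" by (simp add: power2_eq_iff)
    thus "root \<in> \<rat>" using r(1) by auto
  qed (use root2 in auto)
  show ?thesis
  proof (cases "root \<in> \<rat>")
    case True
    interpret open_geodesic \<Gamma> D N k G \<tau> h conductor denom X g m by unfold_locales (rule True)
    have "cycle_interval N \<Gamma> X g = {0<..}" using True sq by (simp add: cycle_interval_def)
    thus ?thesis using orbit_sum_open[OF F] unfolding cycle_integral_def Let_def g_def[symmetric] by simp
  next
    case False
    define \<epsilon> where "\<epsilon> = (SOME \<epsilon>. stabilizer_generator \<Gamma> X g \<epsilon>)"
    have "stabilizer_generator \<Gamma> X g \<epsilon>" unfolding \<epsilon>_def by (rule someI_ex[OF stabilizer_generator_exists[OF False]])
    then interpret closed_geodesic \<Gamma> D N k G \<tau> h conductor denom X g m \<epsilon> by unfold_locales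
    have "cycle_interval N \<Gamma> X g = {1<..<\<epsilon>\<^sup>2}" using False sq by (simp add: cycle_interval_def \<epsilon>_def)
    thus ?thesis using orbit_sum_closed[OF F] unfolding cycle_integral_def Let_def g_def[symmetric] by simp
  qed
qed

end


section \<open>Finiteness of the trace and the expansion\<close>

lemma denominator_bounded_conj_SL2Z:
  assumes "denominator_bounded D X" "g \<in> SL2Z"
  shows "denominator_bounded D (conj_act g X)"
  unfolding conj_act_def
  by (intro denominator_bounded_mult_SL2Z assms SL2Z.inv_mem)

text \<open>Reduction of binary quadratic forms: in each \<open>SL\<^sub>2(\<int>)\<close>-class choose a representative whose
  lower left entry has minimal absolute value.\<close>

lemma SL2Z_reduction_indefinite:
  assumes D: "D > 0" and X: "trace X = 0" "denominator_bounded D X" "det X = - c" and c: "c > 0"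
  shows "\<exists>g\<in>SL2Z. \<forall>i j. \<bar>conj_act g X $ i $ j\<bar> \<le> (real D + 1) * (c + (2 * c + 1)\<^sup>2) + 2 * (c + 1)"
proof -
  define B where "B = (real D + 1) * (c + (2 * c + 1)\<^sup>2) + 2 * (c + 1)"
  have sq_le: "\<bar>t\<bar> \<le> M + 1" if "t\<^sup>2 \<le> M" for t M :: real
  proof -
    have "(\<bar>t\<bar> - 1/2)\<^sup>2 = t\<^sup>2 - \<bar>t\<bar> + 1/4" by (simp add: power2_eq_square algebra_simps)
    thus ?thesis using that zero_le_power2[of "\<bar>t\<bar> - 1/2"] by linarith
  qed
  \<comment> \<open>On the SL2(Z)-orbit, D times the absolute lower left entry is a natural number,
    so a minimum exists.\<close>
  define f where "f g = nat \<lfloor>real D * \<bar>conj_act g X $ 2 $ 1\<bar>\<rfloor>" for g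
  obtain g0 where g0: "g0 \<in> SL2Z" "\<And>g. g \<in> SL2Z \<Longrightarrow> f g0 \<le> f g"
    using ex_has_least_nat[of "\<lambda>g. g \<in> SL2Z" "mat 1" f] SL2Z.one_mem by blast
  have den: "real D * conj_act g X $ i $ j \<in> \<int>" if "g \<in> SL2Z" for g i j
    using denominator_bounded_conj_SL2Z[OF X(2) that] by (simp add: denominator_bounded_def)
  have f_eq: "real (f g) = real D * \<bar>conj_act g X $ 2 $ 1\<bar>" if g: "g \<in> SL2Z" for g
  proof -
    obtain n where n: "real D * conj_act g X $ 2 $ 1 = of_int n" using den[OF g, of 2 1] by (auto elim: Ints_cases)
    have "real D * \<bar>conj_act g X $ 2 $ 1\<bar> = \<bar>real D * conj_act g X $ 2 $ 1\<bar>" by (simp add: abs_mult)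
    also have "\<dots> = of_int \<bar>n\<bar>" by (simp add: n)
    finally have e: "real D * \<bar>conj_act g X $ 2 $ 1\<bar> = of_int \<bar>n\<bar>" .
    show ?thesis unfolding f_def e by simp
  qed
  have min: "\<bar>conj_act g0 X $ 2 $ 1\<bar> \<le> \<bar>conj_act g X $ 2 $ 1\<bar>" if "g \<in> SL2Z" for g
  proof -
    have "real (f g0) \<le> real (f g)" using g0(2)[OF that] by simp
    thus ?thesis unfolding f_eq[OF that] f_eq[OF g0(1)] using D by simp
  qed
  define Y where "Y = conj_act g0 X"
  define y1 y2 y3 where "y1 = Y$1$2" "y2 = Y$1$1" "y3 = Y$2$1"
  note yd = this
  have det0: "det g0 = 1" using g0(1) det1_SL2Z by blast
  have y22: "Y$2$2 = - y2" using X(1) trace_conj_act[OF det0, of X] by (simp add: Y_def yd trace_mat2 add_eq_0_iff)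
  have cy: "y2\<^sup>2 + y1 * y3 = c"
    using X(3) det_conj_act[OF det0, of X] by (simp add: Y_def[symmetric] det_2 y22 yd[symmetric] power2_eq_square)
  define u where "u n = M2 1 (of_int n) 0 1" for n :: int
  have uZ: "u n \<in> SL2Z" for n by (auto simp: SL2Z_def forall_2 u_def)
  have detu: "det (u n) = 1" for n by (simp add: u_def)
  have uY: "conj_act (u n) Y $ 2 $ 1 = y3" "conj_act (u n) Y $ 1 $ 1 = y2 + of_int n * y3"
    "conj_act (u n) Y $ 2 $ 2 = - (y2 + of_int n * y3)"
    "conj_act (u n) Y $ 1 $ 2 = y1 - 2 * of_int n * y2 - (of_int n)\<^sup>2 * y3" for n
    unfolding conj_act_nth[OF detu] by (simp_all add: u_def y22 yd[symmetric] power2_eq_square algebra_simps)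
  have uX: "conj_act (u n ** g0) X = conj_act (u n) Y" for n by (simp add: Y_def conj_act_mult detu det0)
  have ug: "u n ** g0 \<in> SL2Z" for n by (intro SL2Z.mult_mem uZ g0(1))
  have B1: "2 * (c + 1) \<le> B" using c by (simp add: B_def add_nonneg_nonneg)
  show ?thesis unfolding B_def[symmetric]
  proof (cases "y3 = 0")
    case True
    have y2: "y2\<^sup>2 = c" using cy True by simp
    hence y2b: "\<bar>y2\<bar> \<le> c + 1" using sq_le[of y2 c] by simp
    have y2nz: "y2 \<noteq> 0" using y2 c by auto
    \<comment> \<open>For y3 = 0, translation by n changes the upper right entry by -2 n y2;
      rounding brings it to at most |y2|.\<close>
    define n where "n = round (y1 / (2 * y2))"
    have "\<bar>of_int n - y1 / (2 * y2)\<bar> \<le> 1/2" unfolding n_def by (rule of_int_round_abs_le)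
    hence "\<bar>2 * y2\<bar> * \<bar>of_int n - y1 / (2 * y2)\<bar> \<le> \<bar>2 * y2\<bar> * (1/2)" by (intro mult_left_mono) auto
    moreover have "\<bar>2 * y2\<bar> * \<bar>of_int n - y1 / (2 * y2)\<bar> = \<bar>2 * y2 * of_int n - y1\<bar>"
      using y2nz by (simp add: abs_mult[symmetric] right_diff_distrib)
    moreover have "\<bar>2 * y2\<bar> = 2 * \<bar>y2\<bar>" by (simp add: abs_mult)
    ultimately have "\<bar>2 * y2 * of_int n - y1\<bar> \<le> \<bar>y2\<bar>" by linarith
    hence y1b: "\<bar>y1 - 2 * of_int n * y2\<bar> \<le> c + 1" using y2b by (simp add: mult_ac abs_minus_commute)
    have "\<bar>conj_act (u n) Y $ i $ j\<bar> \<le> B" for i j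
      using exhaust_2[of i] exhaust_2[of j] uY[of n] y1b y2b B1 c True by auto
    thus "\<exists>g\<in>SL2Z. \<forall>i j. \<bar>conj_act g X $ i $ j\<bar> \<le> B" using ug[of n] uX[of n] by metis
  next
    case False
    \<comment> \<open>Translation by this n brings the diagonal entry to at most |y3| / 2.\<close>
    define n where "n = round (- y2 / y3)"
    define z2 z1 where "z2 = y2 + of_int n * y3" "z1 = y1 - 2 * of_int n * y2 - (of_int n)\<^sup>2 * y3"
    have cz: "z2\<^sup>2 + z1 * y3 = c" unfolding z2_z1_def cy[symmetric] by (simp add: power2_eq_square algebra_simps)
    have "\<bar>of_int n - (- y2 / y3)\<bar> \<le> 1/2" unfolding n_def by (rule of_int_round_abs_le)
    hence "\<bar>y3\<bar> * \<bar>of_int n - (- y2 / y3)\<bar> \<le> \<bar>y3\<bar> * (1/2)" by (intro mult_left_mono) auto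
    hence z2: "\<bar>z2\<bar> \<le> \<bar>y3\<bar> / 2" using False by (simp add: abs_mult[symmetric] distrib_left z2_z1_def algebra_simps)
    \<comment> \<open>Inversion exchanges the off-diagonal entries up to sign, so minimality gives
      |y3| <= |z1|; together with z2^2 + z1 y3 = c this bounds y3.\<close>
    define S where "S = M2 0 (- 1) 1 0"
    have SZ: "S \<in> SL2Z" by (auto simp: SL2Z_def forall_2 S_def)
    have detS: "det S = 1" by (simp add: S_def)
    have "conj_act (S ** (u n ** g0)) X = conj_act S (conj_act (u n) Y)"
      by (subst conj_act_mult) (simp_all add: detS detu det0 det_mul uX)
    moreover have "conj_act S (conj_act (u n) Y) $ 2 $ 1 = - z1"
      unfolding conj_act_nth[OF detS] by (simp add: S_def uY z2_z1_def)
    ultimately have "\<bar>y3\<bar> \<le> \<bar>z1\<bar>"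
      using min[OF SL2Z.mult_mem[OF SZ ug[of n]]] by (simp add: Y_def[symmetric] yd)
    hence "\<bar>y3\<bar> * \<bar>y3\<bar> \<le> \<bar>z1\<bar> * \<bar>y3\<bar>" by (intro mult_right_mono) auto
    also have "\<dots> = \<bar>c - z2\<^sup>2\<bar>" using cz by (simp add: abs_mult[symmetric] algebra_simps)
    also have "\<dots> \<le> c + z2\<^sup>2" using c by (simp add: abs_le_iff)
    also have "z2\<^sup>2 \<le> (\<bar>y3\<bar> / 2)\<^sup>2" using z2 by (metis abs_ge_zero power2_abs power_mono)
    finally have "y3\<^sup>2 \<le> c + y3\<^sup>2 / 4" by (simp add: power2_eq_square power_divide)
    hence y3s: "y3\<^sup>2 \<le> 2 * c" using c by linarith
    hence y3: "\<bar>y3\<bar> \<le> 2 * c + 1" by (rule sq_le)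
    have z2': "\<bar>z2\<bar> \<le> 2 * c + 1" using z2 y3 by linarith
    \<comment> \<open>A nonzero entry is at least 1 / D in absolute value, so |z1| <= D |z1 y3| = D
      |c - z2^2|.\<close>
    have "1 \<le> real D * \<bar>y3\<bar>"
    proof -
      have "real D * y3 \<in> \<int>" using den[OF g0(1), of 2 1] by (simp add: yd Y_def)
      hence "1 \<le> \<bar>real D * y3\<bar>" using False D by (intro Ints_nonzero_abs_ge1) auto
      thus ?thesis by (simp add: abs_mult)
    qed
    hence "\<bar>z1\<bar> * 1 \<le> \<bar>z1\<bar> * (real D * \<bar>y3\<bar>)" by (intro mult_left_mono) auto
    also have "\<bar>z1\<bar> * (real D * \<bar>y3\<bar>) = real D * \<bar>c - z2\<^sup>2\<bar>"
    proof -
      have "c - z2\<^sup>2 = z1 * y3" using cz by simp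
      thus ?thesis by (simp add: abs_mult)
    qed
    also have "\<dots> \<le> real D * (c + (2 * c + 1)\<^sup>2)"
    proof (rule mult_left_mono)
      have "z2\<^sup>2 \<le> (2 * c + 1)\<^sup>2" using z2' by (metis abs_ge_zero power2_abs power_mono)
      thus "\<bar>c - z2\<^sup>2\<bar> \<le> c + (2 * c + 1)\<^sup>2" using c by (simp add: abs_le_iff)
    qed simp
    finally have z1: "\<bar>z1\<bar> \<le> real D * (c + (2 * c + 1)\<^sup>2)" by simp
    have "c + (2 * c + 1)\<^sup>2 \<ge> 0" using c by simp
    hence B2: "real D * (c + (2 * c + 1)\<^sup>2) \<le> B" "2 * c + 1 \<le> B" using c B1 by (auto simp: B_def distrib_right)
    have "\<bar>conj_act (u n) Y $ i $ j\<bar> \<le> B" for i j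
      using exhaust_2[of i] exhaust_2[of j] uY[of n] z1 z2' y3 B2 unfolding z2_z1_def[symmetric] by auto
    thus "\<exists>g\<in>SL2Z. \<forall>i j. \<bar>conj_act g X $ i $ j\<bar> \<le> B" using ug[of n] uX[of n] by metis
  qed
qed

context fuchsian
begin

definition orbit :: "mat2 \<Rightarrow> mat2 set" where
  "orbit X = (\<lambda>\<gamma>. conj_act \<gamma> X) ` \<Gamma>"

lemma orbit_self: "X \<in> orbit X"
  using one_mem by (auto simp: orbit_def intro!: image_eqI[of _ _ "mat 1"])

lemma orbit_conj_act:
  assumes "\<gamma> \<in> \<Gamma>" shows "orbit (conj_act \<gamma> X) = orbit X"
proof (intro equalityI subsetI)
  fix Y assume "Y \<in> orbit (conj_act \<gamma> X)"
  then obtain \<delta> where "\<delta> \<in> \<Gamma>" "Y = conj_act \<delta> (conj_act \<gamma> X)" by (auto simp: orbit_def)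
  hence "Y = conj_act (\<delta> ** \<gamma>) X" "\<delta> ** \<gamma> \<in> \<Gamma>" using assms mult_mem det1 by (auto simp: conj_act_mult)
  thus "Y \<in> orbit X" by (auto simp: orbit_def)
next
  fix Y assume "Y \<in> orbit X"
  then obtain \<delta> where d: "\<delta> \<in> \<Gamma>" "Y = conj_act \<delta> X" by (auto simp: orbit_def)
  have "conj_act (\<delta> ** matrix_inv \<gamma>) (conj_act \<gamma> X) = Y"
    using d assms det1 by (simp add: conj_act_mult det_matrix_inv conj_act_inv)
  moreover have "\<delta> ** matrix_inv \<gamma> \<in> \<Gamma>" using d assms mult_mem inv_mem by blast
  ultimately show "Y \<in> orbit (conj_act \<gamma> X)" unfolding orbit_def by (metis imageI)
qed

lemma orbit_eq:
  assumes "Y \<in> orbit X" shows "orbit Y = orbit X"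
proof -
  obtain \<gamma> where "\<gamma> \<in> \<Gamma>" "Y = conj_act \<gamma> X" using assms by (auto simp: orbit_def)
  thus ?thesis using orbit_conj_act by simp
qed

end

section \<open>Assembly of the expansion\<close>

context shintani_data
begin

text \<open>Every vector of norm q is SL2(Z)-equivalent to one of finitely many reduced matrices,
  and SL2(Z) splits into finitely many cosets of Gamma(n). Thus the sum in
  \<open>cycle_trace\<close> is a genuine finite sum and not the default 0 of an infinite
  one.\<close>

lemma finite_orbits:
  assumes q: "q < 0"
  shows "finite (orbit ` {X \<in> h. Q N X = q})"
proof -
  define c where "c = - q / N"
  have c: "c > 0" using q N_pos by (simp add: c_def divide_neg_pos)
  define B where "B = (real denom + 1) * (c + (2 * c + 1)\<^sup>2) + 2 * (c + 1)"
  define Rs where "Rs = {X. denominator_bounded denom X \<and> (\<forall>i j. \<bar>X $ i $ j\<bar> \<le> B)}"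
  have Rs: "finite Rs" unfolding Rs_def by (rule finite_denominator_bounded[OF denom_pos])
  obtain T where T: "finite T" "T \<subseteq> SL2Z" "\<forall>g\<in>SL2Z. \<exists>\<sigma>\<in>T. \<exists>\<gamma>\<in>principal_congruence conductor. g = \<gamma> ** \<sigma>"
    using SL2Z_finite_cosets[OF conductor(1)] by blast
  have "orbit ` {X \<in> h. Q N X = q} \<subseteq> (\<lambda>(\<sigma>, Y). orbit (conj_act \<sigma> Y)) ` (T \<times> Rs)"
  proof
    fix o' assume "o' \<in> orbit ` {X \<in> h. Q N X = q}"
    then obtain X where X: "X \<in> h" "Q N X = q" "o' = orbit X" by blast
    have "det X = - c" using X(2) N_pos by (simp add: Q_def c_def field_simps)
    from SL2Z_reduction_indefinite[OF denom_pos h_trace[OF X(1)] h_denominator[OF X(1)] this c]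
    obtain g where g: "g \<in> SL2Z" "\<And>i j. \<bar>conj_act g X $ i $ j\<bar> \<le> B" by (auto simp: B_def)
    have Y: "conj_act g X \<in> Rs"
      using g denominator_bounded_conj_SL2Z[OF h_denominator[OF X(1)] g(1)] by (simp add: Rs_def)
    obtain \<sigma> \<gamma> where s: "\<sigma> \<in> T" "\<gamma> \<in> \<Gamma>" "matrix_inv g = \<gamma> ** \<sigma>"
      using T(3) SL2Z.inv_mem[OF g(1)] conductor(2) by blast
    have det: "det \<sigma> = 1" "det \<gamma> = 1" "det g = 1" using s T(2) g det1 det1_SL2Z by auto
    have "X = conj_act (matrix_inv g) (conj_act g X)" by (simp add: conj_act_inv det)
    also have "\<dots> = conj_act \<gamma> (conj_act \<sigma> (conj_act g X))" unfolding s(3) by (rule conj_act_mult[OF det(2,1)])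
    finally have "orbit X = orbit (conj_act \<sigma> (conj_act g X))" using orbit_conj_act[OF s(2)] by metis
    thus "o' \<in> (\<lambda>(\<sigma>, Y). orbit (conj_act \<sigma> Y)) ` (T \<times> Rs)" using X(3) s(1) Y by auto
  qed
  thus ?thesis by (rule finite_subset) (use T Rs in auto)
qed

lemma Q_rational: "X \<in> h \<Longrightarrow> Q N X \<in> \<rat>"
  using h_rational[of X] N_rat by (auto simp: Q_def det_2 rational_mat_def)

text \<open>Fubini for the counting measure on \<open>h\<close> against \<open>hyp\<close>,
  justified by \<open>theta_absolutely_convergent\<close>.\<close>

lemma Shintani_lift_has_sum:
  defines "F \<equiv> SOME F. fundamental_domain \<Gamma> F"
  shows "((\<lambda>X. coef X * (LINT z:F|hyp. phi X z)) has_sum Shintani_lift N \<Gamma> k G \<tau> h) h"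
proof -
  have F: "fundamental_domain \<Gamma> F" unfolding F_def by (rule someI_ex[OF fundamental_domain_exists])
  hence F_uhp: "F \<subseteq> upper_half_plane" and [measurable]: "F \<in> sets borel" by (auto simp: fundamental_domain_def)
  define f where "f X z = indicator F z *\<^sub>R (coef X * phi X z)" for X z
  have [measurable]: "f X \<in> borel_measurable borel" for X unfolding f_def by measurable
  interpret C: sigma_finite_measure "count_space h" by (rule sigma_finite_measure_count_space_countable[OF h_countable])
  interpret P: pair_sigma_finite "count_space h" hyp by (simp add: pair_sigma_finite_def C.sigma_finite_measure_axioms sigma_finite_hyp)
  have fm: "case_prod f \<in> borel_measurable (count_space h \<Otimes>\<^sub>M hyp)"
    by (rule measurable_pair_measure_countable1[OF h_countable]) simp
  have "(\<integral>\<^sup>+p. ennreal (norm (case_prod f p)) \<partial>(count_space h \<Otimes>\<^sub>M hyp)) = (\<integral>\<^sup>+X. \<integral>\<^sup>+z. ennreal (norm (f X z)) \<partial>hyp \<partial>count_space h)"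
    by (subst hyp.nn_integral_fst[symmetric]) (use fm in auto)
  also have "\<dots> = (\<integral>\<^sup>+X. \<integral>\<^sup>+z. ennreal (cmod (coef X * phi X z)) * indicator F z \<partial>hyp \<partial>count_space h)"
    by (intro nn_integral_cong) (auto simp: f_def indicator_def)
  also have "\<dots> < \<infinity>" by (rule theta_absolutely_convergent[OF F])
  finally have int: "integrable (count_space h \<Otimes>\<^sub>M hyp) (case_prod f)"
    by (rule integrableI_bounded[OF fm])
  have inner: "(LINT z|hyp. f X z) = coef X * (LINT z:F|hyp. phi X z)" for X
    by (simp add: f_def set_lebesgue_integral_def mult_scaleR_right[symmetric] del: mult_scaleR_right)
  have sumi: "Infinite_Set_Sum.abs_summable_on (\<lambda>X. LINT z|hyp. f X z) h"
    using P.integrable_fst[OF int] by (simp add: abs_summable_on_def)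
  \<comment> \<open>For complex families the Bochner integral over the counting measure and
    \<open>infsum\<close> always agree: summability is absolute, and both are 0 by default without
    it. So the theta series can be replaced by an integral at every z.\<close>
  have infset: "(LINT X|count_space h. u X) = infsum u h" for u :: "mat2 \<Rightarrow> complex"
  proof (cases "Infinite_Set_Sum.abs_summable_on u h")
    case True
    thus ?thesis using infsetsum_infsum[OF True] by (simp add: infsetsum_def)
  next
    case False
    hence "\<not> u summable_on h" using summable_on_iff_abs_summable_on_complex abs_summable_equivalent by blast
    thus ?thesis using False by (simp add: infsum_not_exists abs_summable_on_def not_integrable_integral_eq)
  qed
  define \<Phi> where "\<Phi> z = (LINT X|count_space h. f X z)" for z
  have [measurable]: "\<Phi> \<in> borel_measurable hyp"
    unfolding \<Phi>_def using P.integrable_snd[OF int] by (rule borel_measurable_integrable)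
  have pointwise: "indicator F z *\<^sub>R (G z * cnj (Theta_Sh N k \<tau> z h) * of_real (Im z ^ (2 * k + 2)) / of_real ((Im z)\<^sup>2)) =
     (indicator upper_half_plane z / (Im z)\<^sup>2) *\<^sub>R \<Phi> z" for z
  proof (cases "z \<in> F")
    case True
    hence z: "z \<in> upper_half_plane" using F_uhp by blast
    hence y: "Im z > 0" by (simp add: upper_half_plane_def)
    define t where "t X = of_real (sqrt (Im \<tau>)) / of_real (Im z ^ (2 * k + 2)) * QX N X (cnj z) ^ (k + 1) *
        exp (of_real (- 2 * pi * Im \<tau> * R N X z)) * exp (2 * of_real pi * \<i> * of_real (Q N X) * \<tau>)" for X
    have cQ: "cnj (QX N X (cnj z)) = QX N X z" for X by (simp add: QX_def)
    have term_eq: "f X z = (G z * of_real (Im z ^ (2 * k + 2))) * cnj (t X)" for X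
    proof -
      have "cnj (t X) = of_real (sqrt (Im \<tau>)) / of_real (Im z ^ (2 * k + 2)) * QX N X z ^ (k + 1) *
        of_real (exp (- 2 * pi * Im \<tau> * R N X z)) * cnj (exp (2 * of_real pi * \<i> * of_real (Q N X) * \<tau>))"
        unfolding t_def exp_of_real by (simp only: complex_cnj_mult complex_cnj_divide complex_cnj_power complex_cnj_complex_of_real cQ)
      thus ?thesis using True z y by (simp add: f_def phi_def coef_def G0_def mult_ac)
    qed
    have "\<Phi> z = infsum (\<lambda>X. f X z) h" unfolding \<Phi>_def by (rule infset)
    also have "\<dots> = (G z * of_real (Im z ^ (2 * k + 2))) * infsum (\<lambda>X. cnj (t X)) h"
      unfolding term_eq by (rule infsum_cmult_right')
    also have "infsum (\<lambda>X. cnj (t X)) h = cnj (Theta_Sh N k \<tau> z h)"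
      by (simp only: infsum_cnj Theta_Sh_def t_def)
    finally show ?thesis using True z by (simp add: scaleR_conv_of_real mult_ac)
  next
    case False
    thus ?thesis by (simp add: \<Phi>_def f_def)
  qed
  have "Shintani_lift N \<Gamma> k G \<tau> h = (LINT z|lborel. (indicator upper_half_plane z / (Im z)\<^sup>2) *\<^sub>R \<Phi> z)"
    unfolding Shintani_lift_def quotient_integral_def F_def[symmetric] set_lebesgue_integral_def pointwise ..
  also have "\<dots> = (LINT z|hyp. \<Phi> z)"
    unfolding hyp_def by (rule integral_density[symmetric]) (use \<open>\<Phi> \<in> borel_measurable hyp\<close> in \<open>auto simp: indicator_def\<close>)
  also have "\<dots> = (LINT X|count_space h. LINT z|hyp. f X z)"
    unfolding \<Phi>_def by (rule P.Fubini_integral[OF int])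
  also have "\<dots> = infsum (\<lambda>X. LINT z|hyp. f X z) h" by (rule infset)
  finally have "Shintani_lift N \<Gamma> k G \<tau> h = infsum (\<lambda>X. coef X * (LINT z:F|hyp. phi X z)) h" by (simp only: inner)
  moreover have "(\<lambda>X. coef X * (LINT z:F|hyp. phi X z)) summable_on h"
    using sumi abs_summable_equivalent abs_summable_summable unfolding inner by blast
  ultimately show ?thesis by simp
qed

lemma orbit_has_sum_coef:
  assumes "((\<lambda>Y. LINT z:F|hyp. phi Y z) has_sum S) (orbit X)"
  shows "((\<lambda>Y. coef Y * (LINT z:F|hyp. phi Y z)) has_sum (coef X * S)) (orbit X)"
proof -
  have "((\<lambda>Y. coef X * (LINT z:F|hyp. phi Y z)) has_sum (coef X * S)) (orbit X)"
    by (rule has_sum_cmult_right[OF assms])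
  thus ?thesis by (rule has_sum_cong[THEN iffD1, rotated]) (auto simp: orbit_def det1)
qed

text \<open>Orbits partition \<open>A\<close>, so an unconditional sum over \<open>A\<close> can be
  regrouped by orbits.\<close>

lemma has_sum_disjoint_orbits:
  assumes A: "(a has_sum s) A" and closed: "\<And>X. X \<in> A \<Longrightarrow> orbit X \<subseteq> A"
    and orb: "\<And>X. X \<in> A \<Longrightarrow> (a has_sum b (orbit X)) (orbit X)"
  shows "(b has_sum (s :: complex)) (orbit ` A)"
proof -
  have "bij_betw snd (Sigma (orbit ` A) (\<lambda>o'. o')) A"
  proof (rule bij_betwI')
    fix p p' assume "p \<in> Sigma (orbit ` A) (\<lambda>o'. o')" "p' \<in> Sigma (orbit ` A) (\<lambda>o'. o')"
    then obtain X Y X' Y' where "p = (orbit X, Y)" "Y \<in> orbit X" "p' = (orbit X', Y')" "Y' \<in> orbit X'" by auto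
    moreover from this have "Y = Y' \<Longrightarrow> orbit X = orbit X'" using orbit_eq by metis
    ultimately show "(snd p = snd p') = (p = p')" by auto
  next
    fix p assume "p \<in> Sigma (orbit ` A) (\<lambda>o'. o')"
    thus "snd p \<in> A" by (auto dest: closed[THEN subsetD])
  next
    fix X assume "X \<in> A"
    thus "\<exists>p\<in>Sigma (orbit ` A) (\<lambda>o'. o'). X = snd p" using orbit_self by (intro bexI[of _ "(orbit X, X)"]) auto
  qed
  from has_sum_reindex_bij_betw[OF this, of a s] A
  have "((\<lambda>p. a (snd p)) has_sum s) (Sigma (orbit ` A) (\<lambda>o'. o'))" by simp
  thus ?thesis by (rule has_sum_SigmaD) (use orb in auto)
qed

text \<open>The sum over \<open>h\<close> is grouped by the rational value of Q and, within a level,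
  by orbits. Levels q >= 0 vanish orbit by orbit, whatever the number of orbits; on levels q < 0
  that number is finite.\<close>

lemma Shintani_lift_expansion:
  "((\<lambda>m. - of_real (sqrt N) * (cycle_trace N \<Gamma> k G (- m) h * exp (2 * of_real pi * \<i> * of_real m * \<tau>)))
     has_sum Shintani_lift N \<Gamma> k G \<tau> h) {m \<in> \<rat>. m > 0}"
proof -
  define F where "F = (SOME F. fundamental_domain \<Gamma> F)"
  have F: "fundamental_domain \<Gamma> F" unfolding F_def by (rule someI_ex[OF fundamental_domain_exists])
  define a where "a X = coef X * (LINT z:F|hyp. phi X z)" for X
  define lvl where "lvl q = {X \<in> h. Q N X = q}" for q
  define t where "t m = - of_real (sqrt N) * (cycle_trace N \<Gamma> k G (- m) h * exp (2 * of_real pi * \<i> * of_real m * \<tau>))" for m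
  define g where "g q = (if q < 0 then t (- q) else 0)" for q
  have a_sum: "(a has_sum Shintani_lift N \<Gamma> k G \<tau> h) h"
    unfolding a_def[abs_def] F_def by (rule Shintani_lift_has_sum)
  have lvl_closed: "orbit X \<subseteq> lvl q" if "X \<in> lvl q" for X q
    using that h_invariant det1 by (auto simp: lvl_def orbit_def)
  have lvl_sum: "(a has_sum g q) (lvl q)" for q
  proof -
    \<comment> \<open>Summability only provides the existence of the partial sum s; its value is
      computed through the orbits.\<close>
    have "a summable_on lvl q"
      by (rule summable_on_subset_banach[OF has_sum_imp_summable[OF a_sum]]) (auto simp: lvl_def)
    then obtain s where s: "(a has_sum s) (lvl q)" by (auto simp: summable_on_def)
    show ?thesis
    proof (cases "q < 0")
      case False
      have "(a has_sum 0) (orbit X)" if X: "X \<in> lvl q" for X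
      proof -
        have Xh: "X \<in> h" "Q N X = q" using X by (auto simp: lvl_def)
        have "((\<lambda>Y. LINT z:F|hyp. phi Y z) has_sum 0) (orbit X)"
        proof (cases "q = 0")
          case True
          thus ?thesis using orbit_sum_parabolic[OF F Xh(1)] orbit_sum_zero Xh unfolding orbit_def by (cases "X = 0") auto
        next
          case False
          thus ?thesis using orbit_sum_definite[OF F Xh(1)] Xh \<open>\<not> q < 0\<close> unfolding orbit_def by simp
        qed
        from orbit_has_sum_coef[OF this] show ?thesis by (simp add: a_def[abs_def])
      qed
      from has_sum_disjoint_orbits[OF s lvl_closed, of "\<lambda>_. 0"] this
      have "((\<lambda>_. 0) has_sum s) (orbit ` lvl q)" by blast
      hence "s = 0" using has_sum_unique has_sum_0_simp by blast
      thus ?thesis using s False by (simp add: g_def)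
    next
      case True
      define m where "m = - q"
      define e where "e = exp (2 * of_real pi * \<i> * of_real m * \<tau>)"
      define b where "b o' = - of_real (sqrt N) * cycle_integral N \<Gamma> k G (SOME X. X \<in> o') * e" for o'
      have "(a has_sum b (orbit X)) (orbit X)" if X: "X \<in> lvl q" for X
      proof -
        \<comment> \<open>The orbit is unfolded from the representative that
          \<open>cycle_trace\<close> chooses, so the cycle integrals agree literally.\<close>
        define Y where "Y = (SOME Y. Y \<in> orbit X)"
        have Y: "Y \<in> orbit X" unfolding Y_def using orbit_self by (rule someI)
        have oY: "orbit Y = orbit X" by (rule orbit_eq[OF Y])
        have Yh: "Y \<in> h" "Q N Y = - m" using Y lvl_closed[OF X] by (auto simp: lvl_def m_def)
        have "m > 0" using True by (simp add: m_def)
        from orbit_sum_negative[OF F Yh this]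
        obtain S where S: "((\<lambda>Y. LINT z:F|hyp. phi Y z) has_sum S) (orbit Y)"
          "coef Y * S = - of_real (sqrt N) * cycle_integral N \<Gamma> k G Y * e" unfolding orbit_def e_def by blast
        have "b (orbit X) = coef Y * S" using S(2) by (simp add: b_def Y_def)
        thus ?thesis using orbit_has_sum_coef[OF S(1)] by (simp add: oY a_def[abs_def])
      qed
      from has_sum_disjoint_orbits[OF s lvl_closed this]
      have "(b has_sum s) (orbit ` lvl q)" by blast
      moreover have fin: "finite (orbit ` lvl q)" unfolding lvl_def by (rule finite_orbits[OF True])
      ultimately have "s = sum b (orbit ` lvl q)" using has_sum_unique has_sum_finite by blast
      also have "\<dots> = - of_real (sqrt N) * (cycle_trace N \<Gamma> k G (- m) h * e)"
        unfolding b_def cycle_trace_def lattice_level_def lvl_def m_def orbit_def[abs_def]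
        by (simp add: sum_distrib_left sum_distrib_right mult.assoc)
      also have "\<dots> = g q" using True by (simp add: g_def t_def m_def e_def)
      finally show ?thesis using s by simp
    qed
  qed
  have "bij_betw snd (Sigma \<rat> lvl) h"
    by (rule bij_betw_byWitness[where f' = "\<lambda>X. (Q N X, X)"]) (auto simp: lvl_def Q_rational)
  from has_sum_reindex_bij_betw[OF this, of a "Shintani_lift N \<Gamma> k G \<tau> h"] a_sum
  have "((\<lambda>p. a (snd p)) has_sum Shintani_lift N \<Gamma> k G \<tau> h) (Sigma \<rat> lvl)" by simp
  hence "(g has_sum Shintani_lift N \<Gamma> k G \<tau> h) \<rat>"
    by (rule has_sum_SigmaD) (use lvl_sum in auto)
  also have "(g has_sum Shintani_lift N \<Gamma> k G \<tau> h) \<rat> \<longleftrightarrow> (g has_sum Shintani_lift N \<Gamma> k G \<tau> h) {q \<in> \<rat>. q < 0}"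
    by (rule has_sum_cong_neutral) (auto simp: g_def)
  also have "\<dots> \<longleftrightarrow> (t has_sum Shintani_lift N \<Gamma> k G \<tau> h) {m \<in> \<rat>. m > 0}"
    by (rule has_sum_reindex_bij_witness[where i = uminus and j = uminus]) (auto simp: g_def)
  finally show ?thesis unfolding t_def .
qed

end

text \<open>The finitely many basis vectors and Y have a common denominator, which integral
  combinations keep.\<close>

lemma full_lattice_coset:
  assumes "full_lattice L" "Y \<in> V"
  shows "\<exists>D>0. \<forall>X\<in>(\<lambda>X. Y + X) ` L. trace X = 0 \<and> denominator_bounded D X"
    and "\<And>X X'. X \<in> L \<Longrightarrow> X' \<in> L \<Longrightarrow> X + X' \<in> L"
proof -
  obtain B where B: "B \<subseteq> V" "finite B" and L: "L = {\<Sum>b\<in>B. of_int (c b) *\<^sub>R b | c :: mat2 \<Rightarrow> int. True}"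
    using assms(1) by (auto simp: full_lattice_def)
  show "X + X' \<in> L" if X: "X \<in> L" "X' \<in> L" for X X'
  proof -
    obtain c :: "mat2 \<Rightarrow> int" where "X = (\<Sum>b\<in>B. of_int (c b) *\<^sub>R b)" using X(1) unfolding L by auto
    moreover obtain c' :: "mat2 \<Rightarrow> int" where "X' = (\<Sum>b\<in>B. of_int (c' b) *\<^sub>R b)" using X(2) unfolding L by auto
    ultimately have "X + X' = (\<Sum>b\<in>B. of_int (c b + c' b) *\<^sub>R b)" by (simp add: sum.distrib scaleR_left_distrib)
    thus ?thesis unfolding L by (intro CollectI exI[of _ "\<lambda>b. c b + c' b"] conjI TrueI)
  qed
  have "\<And>X. X \<in> insert Y B \<Longrightarrow> rational_mat X" using B assms(2) by (auto simp: V_def)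
  then obtain D :: nat where D: "D > 0" "\<forall>X\<in>insert Y B. denominator_bounded D X"
    using rational_mat_common_denominator[of "insert Y B"] B(2) by blast
  have "trace X = 0 \<and> denominator_bounded D X" if X: "X \<in> (\<lambda>X. Y + X) ` L" for X
  proof -
    obtain c :: "mat2 \<Rightarrow> int" where c: "X = Y + (\<Sum>b\<in>B. of_int (c b) *\<^sub>R b)" using X unfolding L by blast
    have nth: "X $ i $ j = Y $ i $ j + (\<Sum>b\<in>B. of_int (c b) * b $ i $ j)" for i j
      unfolding c by simp
    have "real D * X $ i $ j \<in> \<int>" for i j
      unfolding nth distrib_left sum_distrib_left mult.left_commute[of "real D"]
      using D by (intro Ints_add Ints_sum Ints_mult[OF Ints_of_int]) (auto simp: denominator_bounded_def)
    moreover have "trace X = 0"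
    proof -
      have "Y $ 1 $ 1 + Y $ 2 $ 2 = 0" using assms(2) by (simp add: V_def trace_mat2)
      moreover have "(\<Sum>b\<in>B. of_int (c b) * b $ 1 $ 1) + (\<Sum>b\<in>B. of_int (c b) * b $ 2 $ 2) = 0"
      proof -
        have "(\<Sum>b\<in>B. of_int (c b) * (b $ 1 $ 1 + b $ 2 $ 2)) = (0::real)"
          using B(1) by (intro sum.neutral ballI) (auto simp: V_def trace_mat2)
        thus ?thesis by (simp add: distrib_left sum.distrib)
      qed
      ultimately show ?thesis by (simp add: trace_mat2 nth)
    qed
    ultimately show ?thesis by (simp add: denominator_bounded_def)
  qed
  thus "\<exists>D>0. \<forall>X\<in>(\<lambda>X. Y + X) ` L. trace X = 0 \<and> denominator_bounded D X" using D(1) by blast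
qed

text \<open>Norms on a coset are rational but in general not integral, whence the sum over all
  positive rationals; levels without vectors contribute empty traces. Summability is part of the
  claim because \<open>infsum\<close> is 0 by default.\<close>

theorem theorem5p2:
  fixes N :: real and L \<Gamma> h :: "mat2 set" and k :: nat and G :: "complex \<Rightarrow> complex" and \<tau> :: complex
  assumes "N \<in> \<rat>" and "N > 0"
    and "even_lattice N L"
    and "congruence_subgroup \<Gamma>"
    and "\<forall>\<gamma>\<in>\<Gamma>. conj_act \<gamma> ` L = L"
    and "\<forall>\<gamma>\<in>\<Gamma>. \<forall>X\<in>dual_lattice N L. conj_act \<gamma> X - X \<in> L"
    and "G \<in> cusp_forms \<Gamma> (2 * k + 2)"
    and "h \<in> discriminant_group N L"
    and "\<tau> \<in> upper_half_plane"
  shows "(\<lambda>m. cycle_trace N \<Gamma> k G (- m) h * exp (2 * of_real pi * \<i> * of_real m * \<tau>))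
           summable_on {m \<in> \<rat>. m > 0} \<and>
         Shintani_lift N \<Gamma> k G \<tau> h =
           - of_real (sqrt N) *
             (\<Sum>\<^sub>\<infinity>m\<in>{m \<in> \<rat>. m > 0}.
                cycle_trace N \<Gamma> k G (- m) h * exp (2 * of_real pi * \<i> * of_real m * \<tau>))"
proof -
  obtain D where "fuchsian \<Gamma> D" using congruence_subgroup_fuchsian[OF assms(4)] by blast
  then interpret fuchsian \<Gamma> D .
  obtain n where n: "n \<ge> 1" "principal_congruence n \<subseteq> \<Gamma>" using assms(4) by (auto simp: congruence_subgroup_def)
  obtain Y where Y: "Y \<in> dual_lattice N L" "h = (\<lambda>X. Y + X) ` L" using assms(8) by (auto simp: discriminant_group_def)
  have L: "full_lattice L" using assms(3) by (simp add: even_lattice_def)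
  have YV: "Y \<in> V" using Y(1) by (simp add: dual_lattice_def)
  obtain denom where denom: "denom > 0" "\<And>X. X \<in> h \<Longrightarrow> trace X = 0" "\<And>X. X \<in> h \<Longrightarrow> denominator_bounded denom X"
    using full_lattice_coset(1)[OF L YV] Y(2) by metis
  have h_inv: "conj_act \<gamma> X \<in> h" if g: "\<gamma> \<in> \<Gamma>" and X: "X \<in> h" for \<gamma> X
  proof -
    obtain l where l: "l \<in> L" "X = Y + l" using X Y(2) by blast
    have "conj_act \<gamma> X = conj_act \<gamma> Y + conj_act \<gamma> l"
      by (simp add: l conj_act_def mat2_eq_iff mat2_mult_nth algebra_simps)
    \<comment> \<open>The group moves Y only within Y + L, because it acts trivially on L'/L, and it
      preserves L.\<close>
    also have "\<dots> = Y + ((conj_act \<gamma> Y - Y) + conj_act \<gamma> l)" by simp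
    finally have e: "conj_act \<gamma> X = Y + ((conj_act \<gamma> Y - Y) + conj_act \<gamma> l)" .
    have "conj_act \<gamma> Y - Y \<in> L" "conj_act \<gamma> l \<in> L" using assms(5,6) g Y(1) l(1) by auto
    hence "(conj_act \<gamma> Y - Y) + conj_act \<gamma> l \<in> L" by (rule full_lattice_coset(2)[OF L YV])
    thus ?thesis unfolding e Y(2) by blast
  qed
  interpret shintani_data \<Gamma> D N k G \<tau> h n denom
    by unfold_locales (use assms(1,2,7,9) n denom h_inv in auto)
  define f where "f m = cycle_trace N \<Gamma> k G (- m) h * exp (2 * of_real pi * \<i> * of_real m * \<tau>)" for m
  define c where "c = - complex_of_real (sqrt N)"
  have c: "c \<noteq> 0" using assms(2) by (simp add: c_def)
  have "((\<lambda>m. c * f m) has_sum Shintani_lift N \<Gamma> k G \<tau> h) {m \<in> \<rat>. m > 0}"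
    unfolding c_def f_def by (rule Shintani_lift_expansion)
  from has_sum_cmult_right[OF this, of "1 / c"]
  have "(f has_sum (Shintani_lift N \<Gamma> k G \<tau> h / c)) {m \<in> \<rat>. m > 0}" using c by simp
  hence "f summable_on {m \<in> \<rat>. m > 0}" "infsum f {m \<in> \<rat>. m > 0} = Shintani_lift N \<Gamma> k G \<tau> h / c"
    by (auto intro: has_sum_imp_summable infsumI)
  thus ?thesis using c unfolding f_def[abs_def] c_def by simp
qed

end
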